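(* Let $n\ge2$ and $d\ge n+2$. A $d$-web by hypersurfaces $W$ on a domain $U$ of $\mathbb C^n$ is linearizable if and only if the projective connections $\Pi_{W'}$ of all the $(n+2)$-subwebs $W'$ of $W$ coincide and are flat.
   Context: Everything is holomorphic (complex analytic). "Domain" means connected and simply connected open subset. Webs. A $d$-web by hypersurfaces (of codimension 1) on $U$ is an ordered $d$-tuple $W=(\mathcal F_1,\dots,\mathcal F_d)$ of regular holomorphic foliations of codimension 1 on $U$ whose tangent spaces are in general position at every point: if $\mathcal F_i$ is defined by the nowhere vanishing integrable 1-form $\omega_i$, then at every point any $\min(n,d)$ of the $\omega_i$ are linearly independent. An $(n+2)$-subweb is a web formed by $n+2$ of the foliations $\mathcal F_i$. $W$ is linear if all leaves of its foliations are (open pieces of) affine hyperplanes of $\mathbb C^n$. $W$ is linearizable if there are a point $m\in U$ and a germ of biholomorphism $\varphi:(U,m)\to(\mathbb C^n,\varphi(m))$ such that $\varphi_*(W)$ is a germ of linear web. Projective connections. A geodesic curve of a holomorphic affine connection $\nabla$ on $T_U$ is a curve admitting locally a parametrization $c(t)$ with $\nabla_{dc/dt}(dc/dt)=0$. Two affine connections are projectively equivalent if they have the same geodesic curves; a projective connection $\Pi$ on $U$ is a projective equivalence class $[\nabla]$ of affine connections on $U$. A submanifold $V\subset U$ is totally geodesic for $\Pi=[\nabla]$ if for every $v\in V$ and every tangent direction $L\in\mathbb P T_{V,v}$ the germ at $v$ of the geodesic curve of $\nabla$ tangent to $L$ is contained in $V$. $\Pi$ is compatible with a web if all leaves of all its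 foliations are totally geodesic for $\Pi$. For every $(n+2)$-web $W'$ of codimension 1 on $U$ there is a unique projective connection on $U$ compatible with $W'$; it is denoted $\Pi_{W'}$ and called the projective connection of $W'$. $\Pi$ is flat (integrable) if locally it is equivalent, by a biholomorphism, to the projective connection on $\mathbb C^n$ represented by the affine connection with zero Christoffel symbols. *)

theory Defs
  imports "HOL-Complex_Analysis.Complex_Analysis"
begin

section \<open>Holomorphic maps between open subsets of complex coordinate spaces\<close>

definition cn_domain :: "(complex^'n) set \<Rightarrow> bool" where
  "cn_domain U \<longleftrightarrow> open U \<and> connected U \<and> simply_connected U \<and> U \<noteq> {}"

definition holo_map :: "(complex^'n) set \<Rightarrow> (complex^'n \<Rightarrow> complex^'m) \<Rightarrow> bool" where
  "holo_map U f \<longleftrightarrow>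
     (\<forall>x\<in>U. \<exists>f'. (f has_derivative f') (at x) \<and> Vector_Spaces.linear (*s) (*s) f')"

definition biholo :: "(complex^'n) set \<Rightarrow> (complex^'n \<Rightarrow> complex^'n) \<Rightarrow> bool" where
  "biholo V \<phi> \<longleftrightarrow> open V \<and> open (\<phi> ` V) \<and> holo_map V \<phi> \<and>
     (\<exists>\<psi>. holo_map (\<phi> ` V) \<psi> \<and> (\<forall>x\<in>V. \<psi> (\<phi> x) = x))"

abbreviation Dmap :: "(complex^'n \<Rightarrow> complex^'m) \<Rightarrow> complex^'n \<Rightarrow> complex^'n \<Rightarrow> complex^'m" where
  "Dmap f x \<equiv> frechet_derivative f (at x)"


section \<open>Foliations and webs of codimension 1\<close>

text \<open>A 1-form \<open>\<Sum>\<^sub>i a\<^sub>i dx\<^sub>i\<close> is given by its coefficient vector \<open>a\<close>; the pairing is complex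
  bilinear (no conjugation).\<close>

definition pair :: "complex^'n \<Rightarrow> complex^'n \<Rightarrow> complex" where
  "pair a v = (\<Sum>i\<in>UNIV. a $ i * v $ i)"

definition ext_deriv ::
    "(complex^'n \<Rightarrow> complex^'n) \<Rightarrow> complex^'n \<Rightarrow> complex^'n \<Rightarrow> complex^'n \<Rightarrow> complex" where
  "ext_deriv \<omega> x u v = pair (Dmap \<omega> x u) v - pair (Dmap \<omega> x v) u"

text \<open>The Frobenius condition \<open>\<omega> \<and> d\<omega> = 0\<close>, evaluated on triples of vectors.\<close>

definition integrable_form :: "(complex^'n) set \<Rightarrow> (complex^'n \<Rightarrow> complex^'n) \<Rightarrow> bool" where
  "integrable_form V \<omega> \<longleftrightarrow> (\<forall>x\<in>V. \<forall>u v w.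
     pair (\<omega> x) u * ext_deriv \<omega> x v w + pair (\<omega> x) v * ext_deriv \<omega> x w u
       + pair (\<omega> x) w * ext_deriv \<omega> x u v = 0)"

text \<open>A foliation is encoded by its field of tangent hyperplanes \<open>x \<mapsto> F x\<close>; values outside the
  open set under consideration are irrelevant. Defining 1-forms are only required locally, since
  a global one need not exist on a general domain.\<close>

type_synonym 'n hfield = "complex^'n \<Rightarrow> (complex^'n) set"

definition foliation :: "(complex^'n) set \<Rightarrow> 'n hfield \<Rightarrow> bool" where
  "foliation U F \<longleftrightarrow> (\<forall>x\<in>U. \<exists>V \<omega>. open V \<and> x \<in> V \<and> V \<subseteq> U \<and> holo_map V \<omega> \<and>
     integrable_form V \<omega> \<and> (\<forall>y\<in>V. \<omega> y \<noteq> 0 \<and> F y = {v. pair (\<omega> y) v = 0}))"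

text \<open>The leaf through \<open>p\<close>, i.e. the maximal connected integral manifold through \<open>p\<close>: the points
  of \<open>U\<close> that can be joined to \<open>p\<close> by a piecewise continuously differentiable path in \<open>U\<close> tangent
  to the foliation. Leaves are only immersed in general.\<close>

definition leaf :: "(complex^'n) set \<Rightarrow> 'n hfield \<Rightarrow> complex^'n \<Rightarrow> (complex^'n) set" where
  "leaf U F p = {q. \<exists>g S. valid_path g \<and> path_image g \<subseteq> U \<and> pathstart g = p \<and> pathfinish g = q \<and>
     finite S \<and> (\<forall>t\<in>{0..1} - S. \<exists>v\<in>F (g t). (g has_vector_derivative v) (at t))}"

text \<open>A web is a family of foliations with a finite index set \<open>I\<close>; a \<open>d\<close>-web has index set
  \<open>{..<d}\<close>, and its subwebs are obtained by shrinking the index set.\<close>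

definition general_position :: "nat set \<Rightarrow> (nat \<Rightarrow> 'n hfield) \<Rightarrow> complex^'n \<Rightarrow> bool" where
  "general_position I W x \<longleftrightarrow>
     (\<forall>J\<subseteq>I. card J = min CARD('n) (card I) \<longrightarrow>
        (\<forall>\<omega>. (\<forall>j\<in>J. \<omega> j \<noteq> 0 \<and> W j x = {v. pair (\<omega> j) v = 0}) \<longrightarrow>
          (\<forall>c :: nat \<Rightarrow> complex. (\<Sum>j\<in>J. c j *s \<omega> j) = 0 \<longrightarrow> (\<forall>j\<in>J. c j = 0))))"

definition web :: "(complex^'n) set \<Rightarrow> nat set \<Rightarrow> (nat \<Rightarrow> 'n hfield) \<Rightarrow> bool" where
  "web U I W \<longleftrightarrow> finite I \<and> (\<forall>i\<in>I. foliation U (W i)) \<and> (\<forall>x\<in>U. general_position I W x)"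

definition affine_hyperplane :: "(complex^'n) set \<Rightarrow> bool" where
  "affine_hyperplane H \<longleftrightarrow> (\<exists>a b. a \<noteq> 0 \<and> H = {z. pair a z = b})"

definition linear_web :: "(complex^'n) set \<Rightarrow> nat set \<Rightarrow> (nat \<Rightarrow> 'n hfield) \<Rightarrow> bool" where
  "linear_web U I W \<longleftrightarrow> (\<forall>i\<in>I. \<forall>p\<in>U. \<exists>H. affine_hyperplane H \<and>
     openin (top_of_set H) (leaf U (W i) p))"

definition push_hfield ::
    "(complex^'n) set \<Rightarrow> (complex^'n \<Rightarrow> complex^'n) \<Rightarrow> 'n hfield \<Rightarrow> 'n hfield" where
  "push_hfield V \<phi> F y = (\<Union>x\<in>{x\<in>V. \<phi> x = y}. Dmap \<phi> x ` F x)"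

definition linearizable :: "(complex^'n) set \<Rightarrow> nat set \<Rightarrow> (nat \<Rightarrow> 'n hfield) \<Rightarrow> bool" where
  "linearizable U I W \<longleftrightarrow> (\<exists>m\<in>U. \<exists>V \<phi>. m \<in> V \<and> V \<subseteq> U \<and> biholo V \<phi> \<and>
     linear_web (\<phi> ` V) I (\<lambda>i. push_hfield V \<phi> (W i)))"


section \<open>Affine and projective connections\<close>

text \<open>A holomorphic affine connection on \<open>U\<close> is \<open>\<nabla>\<^sub>X Y = dY(X) + \<Gamma>(X, Y)\<close>, where
  \<open>\<Gamma> x v w = \<Sum>\<^sub>k (\<Sum>\<^sub>i\<^sub>j \<Gamma>\<^sup>k\<^sub>i\<^sub>j(x) v\<^sub>i w\<^sub>j) e\<^sub>k\<close> collects the Christoffel symbols. No condition is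
  put on the torsion.\<close>

type_synonym 'n conn = "complex^'n \<Rightarrow> complex^'n \<Rightarrow> complex^'n \<Rightarrow> complex^'n"

definition affine_connection :: "(complex^'n) set \<Rightarrow> 'n conn \<Rightarrow> bool" where
  "affine_connection U \<Gamma> \<longleftrightarrow>
     (\<forall>x\<in>U. (\<forall>v. Vector_Spaces.linear (*s) (*s) (\<Gamma> x v)) \<and>
            (\<forall>w. Vector_Spaces.linear (*s) (*s) (\<lambda>v. \<Gamma> x v w))) \<and>
     (\<forall>v w. holo_map U (\<lambda>x. \<Gamma> x v w))"

definition velocity :: "(complex \<Rightarrow> complex^'n) \<Rightarrow> complex \<Rightarrow> complex^'n" where
  "velocity c t = (\<chi> k. deriv (\<lambda>s. c s $ k) t)"

text \<open>Immersed holomorphic parametrizations with \<open>\<nabla>\<^bsub>c'\<^esub> c' = c'' + \<Gamma>(c', c') = 0\<close>.\<close>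

definition geodesic_param ::
    "(complex^'n) set \<Rightarrow> 'n conn \<Rightarrow> complex set \<Rightarrow> (complex \<Rightarrow> complex^'n) \<Rightarrow> bool" where
  "geodesic_param U \<Gamma> D c \<longleftrightarrow> open D \<and> c ` D \<subseteq> U \<and> (\<forall>k. (\<lambda>t. c t $ k) holomorphic_on D) \<and>
     (\<forall>t\<in>D. velocity c t \<noteq> 0 \<and>
        velocity (velocity c) t + \<Gamma> (c t) (velocity c t) (velocity c t) = 0)"

definition geodesic_curve :: "(complex^'n) set \<Rightarrow> 'n conn \<Rightarrow> (complex^'n) set \<Rightarrow> bool" where
  "geodesic_curve U \<Gamma> C \<longleftrightarrow> C \<subseteq> U \<and>
     (\<forall>p\<in>C. \<exists>V D c g. open V \<and> p \<in> V \<and> geodesic_param U \<Gamma> D c \<and> homeomorphism D (C \<inter> V) c g)"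

definition proj_equiv :: "(complex^'n) set \<Rightarrow> 'n conn \<Rightarrow> 'n conn \<Rightarrow> bool" where
  "proj_equiv U \<Gamma> \<Gamma>' \<longleftrightarrow> (\<forall>C. geodesic_curve U \<Gamma> C \<longleftrightarrow> geodesic_curve U \<Gamma>' C)"

definition proj_class :: "(complex^'n) set \<Rightarrow> 'n conn \<Rightarrow> 'n conn set" where
  "proj_class U \<Gamma> = {\<Gamma>'. affine_connection U \<Gamma>' \<and> proj_equiv U \<Gamma> \<Gamma>'}"

definition proj_connection :: "(complex^'n) set \<Rightarrow> 'n conn set \<Rightarrow> bool" where
  "proj_connection U P \<longleftrightarrow> (\<exists>\<Gamma>. affine_connection U \<Gamma> \<and> P = proj_class U \<Gamma>)"

text \<open>\<open>S\<close> is an immersed submanifold of \<open>U\<close> and \<open>T v\<close> its tangent space at \<open>v \<in> S\<close>.\<close>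

definition totally_geodesic ::
    "(complex^'n) set \<Rightarrow> 'n conn set \<Rightarrow> (complex^'n) set \<Rightarrow> 'n hfield \<Rightarrow> bool" where
  "totally_geodesic U P S T \<longleftrightarrow>
     (\<forall>\<Gamma>\<in>P. \<forall>v\<in>S. \<forall>D c t0.
        geodesic_param U \<Gamma> D c \<and> t0 \<in> D \<and> c t0 = v \<and> velocity c t0 \<in> T v \<longrightarrow>
        (\<forall>\<^sub>F t in nhds t0. c t \<in> S))"

definition compatible :: "(complex^'n) set \<Rightarrow> 'n conn set \<Rightarrow> nat set \<Rightarrow> (nat \<Rightarrow> 'n hfield) \<Rightarrow> bool" where
  "compatible U P I W \<longleftrightarrow> (\<forall>i\<in>I. \<forall>p\<in>U. totally_geodesic U P (leaf U (W i) p) (W i))"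

text \<open>Meaningful for webs of \<open>n + 2\<close> foliations, for which the compatible projective connection
  exists and is unique.\<close>

definition web_connection :: "(complex^'n) set \<Rightarrow> nat set \<Rightarrow> (nat \<Rightarrow> 'n hfield) \<Rightarrow> 'n conn set" where
  "web_connection U I W = (THE P. proj_connection U P \<and> compatible U P I W)"

definition proj_restrict :: "(complex^'n) set \<Rightarrow> 'n conn set \<Rightarrow> 'n conn set" where
  "proj_restrict V P = (\<Union>\<Gamma>\<in>P. proj_class V \<Gamma>)"

text \<open>\<open>\<phi>\<^sub>*\<Gamma> = \<Gamma>'\<close>, i.e. \<open>d\<phi>(\<nabla>\<^sub>X Y) = \<nabla>'\<^bsub>\<phi>\<^sub>*X\<^esub> \<phi>\<^sub>*Y\<close>, tested on constant fields \<open>X = v\<close>, \<open>Y = w\<close>.\<close>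

definition carries_conn ::
    "(complex^'n) set \<Rightarrow> (complex^'n \<Rightarrow> complex^'n) \<Rightarrow> 'n conn \<Rightarrow> 'n conn \<Rightarrow> bool" where
  "carries_conn V \<phi> \<Gamma> \<Gamma>' \<longleftrightarrow> (\<forall>x\<in>V. \<forall>v w.
     Dmap \<phi> x (\<Gamma> x v w) =
       Dmap (\<lambda>y. Dmap \<phi> y w) x v + \<Gamma>' (\<phi> x) (Dmap \<phi> x v) (Dmap \<phi> x w))"

definition proj_pullback ::
    "(complex^'n) set \<Rightarrow> (complex^'n \<Rightarrow> complex^'n) \<Rightarrow> 'n conn set \<Rightarrow> 'n conn set" where
  "proj_pullback V \<phi> P' = {\<Gamma>. affine_connection V \<Gamma> \<and> (\<exists>\<Gamma>'\<in>P'. carries_conn V \<phi> \<Gamma> \<Gamma>')}"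

definition proj_flat :: "(complex^'n) set \<Rightarrow> 'n conn set \<Rightarrow> bool" where
  "proj_flat U P \<longleftrightarrow> (\<forall>m\<in>U. \<exists>V \<phi>. m \<in> V \<and> V \<subseteq> U \<and> biholo V \<phi> \<and>
     proj_restrict V P = proj_pullback V \<phi> (proj_class (\<phi> ` V) (\<lambda>x v w. 0)))"

end

theory Submission
  imports Defs
begin

text \<open>
Two dictionaries turn the theorem into a statement about holomorphic functions. A leaf of a foliation with local first
integral \<open>f\<close> is totally geodesic for \<open>\<Gamma>\<close> if and only if \<open>d\<^sup>2f(v, v) = df(\<Gamma>(v, v))\<close> for all \<open>v\<close> in the
kernel of \<open>df\<close> (\<open>compatible_iff\<close>); two connections have the same geodesic curves if and only if
\<open>\<Gamma>(v, v) - \<Gamma>'(v, v)\<close> is always proportional to \<open>v\<close> (\<open>proj_equiv_iff_par\<close>). Every projective class has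
exactly one representative that is torsion-free and trace-free (\<open>normal_exists\<close>, \<open>normal_unique\<close>), and for an
\<open>(n + 2)\<close>-web compatibility is a system of linear equations that determines the class
(\<open>local_web_connection\<close>, \<open>compat_unique_point\<close>). Thus the connection of an \<open>(n + 2)\<close>-web exists globally and is
encoded by holomorphic functions on \<open>U\<close> (\<open>web_connection_char\<close>).

Suppose that the web is linear in a chart \<open>\<phi>\<close> on \<open>V\<close>. Leaves contained in hyperplanes are totally geodesic for the standard
connection (\<open>linear_leaf_tgcond\<close>), so the pull-back of the standard connection is compatible with every subweb on \<open>V\<close>, and by
uniqueness all the web connections coincide and are flat there. Coincidence extends to the connected set \<open>U\<close> by the identity theorem
for the normal representatives. Flatness extends because it amounts to the vanishing of the
projective curvature tensors, again an identity between holomorphic functions: it is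
necessary (\<open>flat_imp_integrable\<close>), and it is sufficient (\<open>integrable_imp_proj_flat\<close>) since it is the Frobenius condition
for a linear second order system whose solutions, near any point, yield flat homogeneous coordinates.

Conversely, let the connections coincide and be flat. Every foliation of the web lies in some \<open>(n + 2)\<close>-subweb, so in a flat
chart all leaves are totally geodesic for the standard connection. Then the tangent hyperplane
is parallel along straight segments in the leaf, by a homogeneous linear differential equation, and the leaf is an open piece of an affine
hyperplane (\<open>linear_leaf\<close>).

The analytic tools are the holomorphic Frobenius theorem (\<open>frobenius\<close>), which also supplies geodesics and
first integrals, and the fact that a leaf meets a transversal in a countable
set (\<open>leaf_countable\<close>): a leaf need not be embedded, and this is what makes a geodesic contained in it tangent to it.
\<close>

no_notation fps_nth (infixl \<open>$\<close> 75)

section \<open>Holomorphic functions of several complex variables\<close>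

text \<open>The scalar counterpart of \<open>holo_map\<close>. Working with one component at a time makes the usual
algebra of differentiable functions available.\<close>

definition chol :: "(complex^'n) set \<Rightarrow> (complex^'n \<Rightarrow> complex) \<Rightarrow> bool" where
  "chol U f \<longleftrightarrow> (\<forall>x\<in>U. \<exists>f'. (f has_derivative f') (at x) \<and> (\<forall>c v. f' (c *s v) = c * f' v))"

definition dd :: "(complex^'n \<Rightarrow> complex) \<Rightarrow> complex^'n \<Rightarrow> complex^'n \<Rightarrow> complex" where
  "dd f x v = frechet_derivative f (at x) v"

lemma dd_eq: "(f has_derivative f') (at x) \<Longrightarrow> dd f x = f'"
  unfolding dd_def by (rule ext) (metis frechet_derivative_at)

lemma chol_has_derivative:
  assumes "chol U f" "x \<in> U" shows "(f has_derivative dd f x) (at x)"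
  using assms dd_eq unfolding chol_def by blast

lemma chol_dd_scale:
  assumes "chol U f" "x \<in> U" shows "dd f x (c *s v) = c * dd f x v"
  using assms dd_eq unfolding chol_def by metis

lemma chol_dd_linear:
  assumes "chol U f" "x \<in> U"
  shows "dd f x (v + w) = dd f x v + dd f x w" "dd f x (v - w) = dd f x v - dd f x w"
    "dd f x 0 = 0" "dd f x (- v) = - dd f x v" "dd f x (sum g A) = (\<Sum>i\<in>A. dd f x (g i))"
    "dd f x (r *\<^sub>R v) = r *\<^sub>R dd f x v"
proof -
  have "linear (dd f x)" using chol_has_derivative[OF assms] has_derivative_linear by blast
  then show "dd f x (v + w) = dd f x v + dd f x w" "dd f x (v - w) = dd f x v - dd f x w"
    "dd f x 0 = 0" "dd f x (- v) = - dd f x v" "dd f x (sum g A) = (\<Sum>i\<in>A. dd f x (g i))"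
    "dd f x (r *\<^sub>R v) = r *\<^sub>R dd f x v"
    by (auto simp: linear_add linear_diff linear_0 linear_neg linear_sum linear_scale)
qed

lemma cholI:
  assumes "\<And>x. x \<in> U \<Longrightarrow> (f has_derivative f' x) (at x)" "\<And>x c v. x \<in> U \<Longrightarrow> f' x (c *s v) = c * f' x v"
  shows "chol U f"
  using assms unfolding chol_def by blast

lemma chol_subset: "chol U f \<Longrightarrow> V \<subseteq> U \<Longrightarrow> chol V f"
  by (auto simp: chol_def)

lemma chol_cong:
  assumes "chol U f" "open U" "\<And>x. x \<in> U \<Longrightarrow> g x = f x" shows "chol U g"
  using assms unfolding chol_def by (metis has_derivative_transform_within_open)

lemma dd_cong:
  assumes "open U" "x \<in> U" "\<And>y. y \<in> U \<Longrightarrow> g y = f y" 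
  shows "dd g x = dd f x"
proof -
  have "(f has_derivative f') (at x) \<longleftrightarrow> (g has_derivative f') (at x)" for f'
    using assms has_derivative_transform_within_open by (metis (mono_tags, lifting))
  then show ?thesis unfolding dd_def frechet_derivative_def by simp
qed

lemma chol_continuous_on: "chol U f \<Longrightarrow> continuous_on U f"
  by (meson chol_has_derivative continuous_at_imp_continuous_on has_derivative_continuous)

lemma vec_scale_norm: "norm (c *s v) = norm c * norm (v :: complex^'n)"
proof -
  have "norm (c *s v) = L2_set (\<lambda>i. norm c * norm (v $ i)) UNIV"
    by (simp add: norm_vec_def norm_mult)
  also have "\<dots> = norm c * norm v" by (simp add: norm_vec_def L2_set_right_distrib)
  finally show ?thesis .
qed

lemma scaleR_eq_scale: "r *\<^sub>R (v :: complex^'n) = complex_of_real r *s v"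
  by (simp add: vec_eq_iff scaleR_conv_of_real[where 'a = complex])

lemma bounded_linear_scale_left: "bounded_linear (\<lambda>\<zeta>. \<zeta> *s (v :: complex^'n))"
  by (rule bounded_linear_intro[where K = "norm v"])
     (auto simp: vec_scale_norm vec_eq_iff algebra_simps)

lemma bounded_linear_scale_right: "bounded_linear (\<lambda>v. \<zeta> *s (v :: complex^'n))"
  by (rule bounded_linear_intro[where K = "norm \<zeta>"])
     (auto simp: vec_scale_norm vec_eq_iff algebra_simps)

lemma has_derivative_line: "((\<lambda>\<zeta>. x + \<zeta> *s (v :: complex^'n)) has_derivative (\<lambda>h. h *s v)) (at \<zeta>0)"
  using has_derivative_add[OF has_derivative_const bounded_linear.has_derivative[OF bounded_linear_scale_left has_derivative_ident]]
  by auto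

lemma chol_line_deriv:
  assumes "chol U f" "x + \<zeta> *s v \<in> U"
  shows "((\<lambda>\<zeta>. f (x + \<zeta> *s v)) has_field_derivative dd f (x + \<zeta> *s v) v) (at \<zeta>)"
proof -
  have "((\<lambda>\<zeta>. f (x + \<zeta> *s v)) has_derivative (\<lambda>h. dd f (x + \<zeta> *s v) (h *s v))) (at \<zeta>)"
    using has_derivative_compose[OF has_derivative_line chol_has_derivative[OF assms]] .
  moreover have "(\<lambda>h. dd f (x + \<zeta> *s v) (h *s v)) = (*) (dd f (x + \<zeta> *s v) v)"
    by (simp add: fun_eq_iff chol_dd_scale[OF assms] mult.commute)
  ultimately show ?thesis by (simp add: has_field_derivative_def)
qed

lemma open_line: "open U \<Longrightarrow> open {\<zeta>. x + \<zeta> *s (v :: complex^'n) \<in> U}"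
  using open_vimage[of U "\<lambda>\<zeta>. x + \<zeta> *s v"]
  by (simp add: vimage_def continuous_on_add bounded_linear.continuous_on[OF bounded_linear_scale_left] continuous_on_id)

lemma chol_line_holomorphic:
  assumes "chol U f" shows "(\<lambda>\<zeta>. f (x + \<zeta> *s v)) holomorphic_on {\<zeta>. x + \<zeta> *s v \<in> U}"
  unfolding holomorphic_on_def field_differentiable_def
  using chol_line_deriv[OF assms] has_field_derivative_at_within by blast

lemma in_ball_line:
  fixes v :: "complex^'n"
  assumes "norm \<zeta> * norm v < r" shows "x + \<zeta> *s v \<in> ball x r"
  using assms by (simp add: dist_norm vec_scale_norm)

text \<open>Cauchy's inequality for the restriction of \<open>f\<close> to the complex line through \<open>x\<close> in direction \<open>v\<close>.\<close>

lemma chol_Cauchy_estimate: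
  assumes f: "chol (ball x r) f" and r: "0 < r" and B: "\<And>y. y \<in> ball x r \<Longrightarrow> norm (f y) \<le> B"
  shows "norm (dd f x v) \<le> 2 * B / r * norm v"
proof (cases "v = 0")
  case True
  then show ?thesis using chol_dd_linear(3)[OF f] r by simp
next
  case False
  define s where "s = r / (2 * norm v)"
  have s: "s > 0" "s * norm v < r" using r False by (auto simp: s_def)
  define g where "g \<zeta> = f (x + \<zeta> *s v)" for \<zeta>
  have sub: "cball 0 s \<subseteq> {\<zeta>. x + \<zeta> *s v \<in> ball x r}"
    using s False by (auto intro!: in_ball_line simp del: mem_ball) (smt (verit) mult_right_mono norm_ge_zero)
  have hol: "g holomorphic_on cball 0 s"
    unfolding g_def by (rule holomorphic_on_subset[OF chol_line_holomorphic[OF f] sub])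
  have "norm ((deriv ^^ 1) g 0) \<le> fact 1 * B / s ^ 1"
  proof (rule Cauchy_inequality)
    show "g holomorphic_on ball 0 s" using hol by (rule holomorphic_on_subset) auto
    show "continuous_on (cball 0 s) g" using hol by (rule holomorphic_on_imp_continuous_on)
    show "norm (g z) \<le> B" if "norm (0 - z) = s" for z
      using sub that B unfolding g_def by (auto simp: subset_iff simp del: mem_ball)
  qed (use s in auto)
  moreover have "deriv g 0 = dd f x v"
    unfolding g_def using chol_line_deriv[OF f, of x 0 v] r by (auto intro!: DERIV_imp_deriv)
  ultimately show ?thesis by (simp add: s_def field_simps)
qed

lemma dd_diff:
  assumes "chol U f" "chol U g" "x \<in> U"
  shows "dd (\<lambda>x. f x - g x) x v = dd f x v - dd g x v"
  using dd_eq[OF has_derivative_diff[OF chol_has_derivative[OF assms(1,3)] chol_has_derivative[OF assms(2,3)]]]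
  by simp

lemma chol_diff: assumes "chol U f" "chol U g" shows "chol U (\<lambda>x. f x - g x)"
  by (rule cholI[OF has_derivative_diff[OF chol_has_derivative[OF assms(1)] chol_has_derivative[OF assms(2)]]])
     (auto simp: chol_dd_scale[OF assms(1)] chol_dd_scale[OF assms(2)] algebra_simps)

lemma dd_add:
  assumes "chol U f" "chol U g" "x \<in> U"
  shows "dd (\<lambda>x. f x + g x) x v = dd f x v + dd g x v"
  using dd_eq[OF has_derivative_add[OF chol_has_derivative[OF assms(1,3)] chol_has_derivative[OF assms(2,3)]]]
  by simp

lemma chol_add: assumes "chol U f" "chol U g" shows "chol U (\<lambda>x. f x + g x)"
  by (rule cholI[OF has_derivative_add[OF chol_has_derivative[OF assms(1)] chol_has_derivative[OF assms(2)]]])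
     (auto simp: chol_dd_scale[OF assms(1)] chol_dd_scale[OF assms(2)] algebra_simps)

lemma dd_mult:
  assumes "chol U f" "chol U g" "x \<in> U"
  shows "dd (\<lambda>x. f x * g x) x v = f x * dd g x v + dd f x v * g x"
  using dd_eq[OF has_derivative_mult[OF chol_has_derivative[OF assms(1,3)] chol_has_derivative[OF assms(2,3)]]]
  by simp

lemma chol_mult: assumes "chol U f" "chol U g" shows "chol U (\<lambda>x. f x * g x)"
  by (rule cholI[OF has_derivative_mult[OF chol_has_derivative[OF assms(1)] chol_has_derivative[OF assms(2)]]])
     (auto simp: chol_dd_scale[OF assms(1)] chol_dd_scale[OF assms(2)] algebra_simps)

lemma chol_const: "chol U (\<lambda>x. c)" by (rule cholI[of _ _ "\<lambda>x v. 0"]) auto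

lemma dd_const: "dd (\<lambda>x. c) x v = 0" by (simp add: dd_def)

lemma dd_nth: "dd (\<lambda>x. x $ k) x v = v $ k"
  using dd_eq[OF bounded_linear.has_derivative[OF bounded_linear_vec_nth has_derivative_ident, of k]] by simp

lemma chol_nth: "chol U (\<lambda>x. x $ k)"
  by (rule cholI[OF bounded_linear.has_derivative[OF bounded_linear_vec_nth has_derivative_ident]]) auto

lemma chol_uminus: "chol U f \<Longrightarrow> chol U (\<lambda>x. - f x)"
  using chol_diff[OF chol_const[of U 0]] by simp

lemma chol_sum:
  assumes "\<And>i. i \<in> A \<Longrightarrow> chol U (f i)" shows "chol U (\<lambda>x. \<Sum>i\<in>A. f i x)"
  using assms by (induction A rule: infinite_finite_induct) (auto intro: chol_add chol_const)

lemma dd_sum: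
  assumes "\<And>i. i \<in> A \<Longrightarrow> chol U (f i)" "x \<in> U"
  shows "dd (\<lambda>x. \<Sum>i\<in>A. f i x) x v = (\<Sum>i\<in>A. dd (f i) x v)"
  using assms by (induction A rule: infinite_finite_induct) (auto simp: dd_const dd_add[OF _ chol_sum, of U])

lemma chol_prod:
  assumes "\<And>i. i \<in> A \<Longrightarrow> chol U (f i)" shows "chol U (\<lambda>x. \<Prod>i\<in>A. f i x)"
  using assms by (induction A rule: infinite_finite_induct) (auto intro: chol_mult chol_const)

lemma has_derivative_chol_comp:
  assumes f: "chol U f" and x: "x \<in> U" and g: "(g has_field_derivative g') (at (f x))"
  shows "((\<lambda>x. g (f x)) has_derivative (\<lambda>v. g' * dd f x v)) (at x)"
  using has_derivative_compose[OF chol_has_derivative[OF f x] g[unfolded has_field_derivative_def]] .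

lemma chol_comp:
  assumes f: "chol U f" and g: "\<And>x. x \<in> U \<Longrightarrow> g field_differentiable (at (f x))"
  shows "chol U (\<lambda>x. g (f x))"
proof (rule cholI)
  show "((\<lambda>x. g (f x)) has_derivative (\<lambda>v. deriv g (f x) * dd f x v)) (at x)" if "x \<in> U" for x
    by (rule has_derivative_chol_comp[OF f that]) (use g[OF that] field_differentiable_derivI in blast)
qed (use chol_dd_scale[OF f] in auto)

lemma chol_inverse: "chol U f \<Longrightarrow> (\<And>x. x \<in> U \<Longrightarrow> f x \<noteq> 0) \<Longrightarrow> chol U (\<lambda>x. inverse (f x))"
  by (rule chol_comp[of U f inverse]) (auto simp: field_differentiable_def intro: DERIV_inverse)

lemma chol_divide: "chol U f \<Longrightarrow> chol U g \<Longrightarrow> (\<And>x. x \<in> U \<Longrightarrow> g x \<noteq> 0) \<Longrightarrow> chol U (\<lambda>x. f x / g x)"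
  unfolding divide_inverse by (intro chol_mult chol_inverse) auto

subsection \<open>Limits\<close>

text \<open>By the Cauchy estimate the derivatives converge locally uniformly as well. This is what produces
holomorphic limits of iteration schemes, and of difference quotients in the next lemma.\<close>

lemma chol_limit:
  assumes U: "open U" and f: "\<And>n. chol U (f n)"
    and lim: "\<And>x. x \<in> U \<Longrightarrow> \<exists>r>0. ball x r \<subseteq> U \<and> uniform_limit (ball x r) f g sequentially"
  shows "chol U g" "\<And>x v. x \<in> U \<Longrightarrow> (\<lambda>n. dd (f n) x v) \<longlonglongrightarrow> dd g x v"
proof -
  have main: "(g has_derivative (\<lambda>v. lim (\<lambda>n. dd (f n) x v))) (at x) \<and>
       (\<forall>v. (\<lambda>n. dd (f n) x v) \<longlonglongrightarrow> lim (\<lambda>n. dd (f n) x v))" if x: "x \<in> U" for x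
  proof -
    obtain r where r: "r > 0" "ball x r \<subseteq> U" "uniform_limit (ball x r) f g sequentially" using lim x by blast
    define S where "S = ball x (r/2)"
    have S: "ball y (r/2) \<subseteq> ball x r" if "y \<in> S" for y
      using that unfolding S_def by (metis field_sum_of_halves mem_ball dist_commute subset_ball subsetI dist_triangle_half_r mem_ball)
    have xS: "x \<in> S" using r by (simp add: S_def)
    have SU: "S \<subseteq> U" using r(1,2) subset_ball[of "r/2" r x] unfolding S_def by auto
    have est: "norm (dd (f m) y v - dd (f n) y v) \<le> e * norm v"
      if e: "e > 0" and mn: "\<And>y. y \<in> ball x r \<Longrightarrow> norm (f m y - f n y) \<le> e * r / 4" and y: "y \<in> S" for m n e y v
    proof -
      have yU: "y \<in> U" using y SU by blast
      have "norm (dd (\<lambda>y. f m y - f n y) y v) \<le> 2 * (e * r / 4) / (r/2) * norm v"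
      proof (rule chol_Cauchy_estimate)
        show "chol (ball y (r/2)) (\<lambda>y. f m y - f n y)"
          by (rule chol_subset[OF chol_diff[OF f f]]) (use S[OF y] r in auto)
      qed (use S[OF y] r mn in auto)
      then show ?thesis using r by (simp add: dd_diff[OF f f yU])
    qed
    have cau: "\<exists>N. \<forall>m\<ge>N. \<forall>n\<ge>N. \<forall>y\<in>S. \<forall>v. norm (dd (f m) y v - dd (f n) y v) \<le> e * norm v" if e: "e > 0" for e
    proof -
      have "uniformly_Cauchy_on (ball x r) f" using r(3) by (metis uniformly_convergent_Cauchy uniformly_convergent_on_def)
      then obtain N where N: "\<And>y m n. y \<in> ball x r \<Longrightarrow> m \<ge> N \<Longrightarrow> n \<ge> N \<Longrightarrow> dist (f m y) (f n y) < e * r / 4"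
        using e r(1) unfolding uniformly_Cauchy_on_def by (metis mult_pos_pos zero_less_divide_iff zero_less_numeral)
      show ?thesis
        by (rule exI[of _ N]) (use N est[OF e] in \<open>auto simp: dist_norm less_imp_le\<close>)
    qed
    have conv: "(\<lambda>n. dd (f n) y v) \<longlonglongrightarrow> lim (\<lambda>n. dd (f n) y v)" if y: "y \<in> S" for y v
    proof -
      have "Cauchy (\<lambda>n. dd (f n) y v)"
      proof (rule metric_CauchyI)
        fix e :: real assume e: "e > 0"
        have e': "e / (norm v + 1) > 0" using e by (simp add: add_nonneg_pos)
        obtain N where N: "\<forall>m\<ge>N. \<forall>n\<ge>N. \<forall>y\<in>S. \<forall>w. norm (dd (f m) y w - dd (f n) y w) \<le> e / (norm v + 1) * norm w" 
          using cau[OF e'] by blast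
        have "e / (norm v + 1) * norm v < e / (norm v + 1) * (norm v + 1)" 
          by (rule mult_strict_left_mono[OF _ e']) simp
        also have "\<dots> = e" using norm_ge_zero[of v] by (simp del: norm_ge_zero)
        finally have "e / (norm v + 1) * norm v < e" .
        then show "\<exists>M. \<forall>m\<ge>M. \<forall>n\<ge>M. dist (dd (f m) y v) (dd (f n) y v) < e"
          using N y unfolding dist_norm by (meson le_less_trans)
      qed
      then show ?thesis by (simp add: Cauchy_convergent_iff convergent_LIMSEQ_iff)
    qed
    have "\<exists>h. \<forall>y\<in>S. (\<lambda>n. f n y) \<longlonglongrightarrow> h y \<and> (h has_derivative (\<lambda>v. lim (\<lambda>n. dd (f n) y v))) (at y within S)"
    proof (rule has_derivative_sequence)
      show "convex S" by (simp add: S_def)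
      show "(f n has_derivative dd (f n) y) (at y within S)" if "y \<in> S" for n y
        using chol_has_derivative[OF f] SU that has_derivative_at_withinI by blast
      show "x \<in> S" by (fact xS)
      show "(\<lambda>n. f n x) \<longlonglongrightarrow> g x" using tendsto_uniform_limitI[OF r(3)] r(1) by simp
      show "\<forall>\<^sub>F n in sequentially. \<forall>y\<in>S. \<forall>h. norm (dd (f n) y h - lim (\<lambda>n. dd (f n) y h)) \<le> e * norm h" if e: "e > 0" for e
      proof -
        obtain N where N: "\<forall>m\<ge>N. \<forall>n\<ge>N. \<forall>y\<in>S. \<forall>v. norm (dd (f m) y v - dd (f n) y v) \<le> e * norm v" 
          using cau[OF e] by blast
        have "norm (dd (f n) y h - lim (\<lambda>n. dd (f n) y h)) \<le> e * norm h" if "n \<ge> N" "y \<in> S" for n y h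
        proof (rule tendsto_upperbound)
          show "(\<lambda>m. norm (dd (f n) y h - dd (f m) y h)) \<longlonglongrightarrow> norm (dd (f n) y h - lim (\<lambda>n. dd (f n) y h))"
            by (intro tendsto_intros conv that)
          show "\<forall>\<^sub>F m in sequentially. norm (dd (f n) y h - dd (f m) y h) \<le> e * norm h"
            unfolding eventually_sequentially using N that by blast
        qed auto
        then show ?thesis by (auto simp: eventually_sequentially)
      qed
    qed
    then obtain h where h: "\<And>y. y \<in> S \<Longrightarrow> (\<lambda>n. f n y) \<longlonglongrightarrow> h y"
      "\<And>y. y \<in> S \<Longrightarrow> (h has_derivative (\<lambda>v. lim (\<lambda>n. dd (f n) y v))) (at y within S)" by metis
    have "h y = g y" if "y \<in> S" for y
    proof -
      have "y \<in> ball x r" using that r(1) by (simp add: S_def)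
      then have "(\<lambda>n. f n y) \<longlonglongrightarrow> g y" using tendsto_uniform_limitI[OF r(3)] by blast
      then show ?thesis using LIMSEQ_unique h(1)[OF that] by blast
    qed
    moreover have "(h has_derivative (\<lambda>v. lim (\<lambda>n. dd (f n) x v))) (at x)"
      using h(2)[OF xS] at_within_open[OF xS] open_ball[of x "r/2"] unfolding S_def by metis
    ultimately have "(g has_derivative (\<lambda>v. lim (\<lambda>n. dd (f n) x v))) (at x)"
      using has_derivative_transform_within_open[OF _ _ xS] open_ball[of x "r/2"] unfolding S_def[symmetric] by blast
    then show ?thesis using conv[OF xS] by blast
  qed
  show "chol U g"
  proof (rule cholI)
    show "(g has_derivative (\<lambda>v. lim (\<lambda>n. dd (f n) x v))) (at x)" if "x \<in> U" for x using main that by blast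
    show "lim (\<lambda>n. dd (f n) x (c *s v)) = c * lim (\<lambda>n. dd (f n) x v)" if x: "x \<in> U" for x c v
    proof -
      have "(\<lambda>n. c * dd (f n) x v) \<longlonglongrightarrow> c * lim (\<lambda>n. dd (f n) x v)"
        using main[OF x] by (intro tendsto_intros) auto
      then show ?thesis by (simp add: chol_dd_scale[OF f x] limI)
    qed
  qed
  show "(\<lambda>n. dd (f n) x v) \<longlonglongrightarrow> dd g x v" if "x \<in> U" for x v
    using main[OF that] dd_eq by metis
qed

lemma quotient_bound:
  assumes g: "g holomorphic_on ball 0 r" and r: "r > 0" and B: "\<And>z. z \<in> ball 0 r \<Longrightarrow> norm (g z) \<le> B"
    and h: "norm h \<le> r / 4" "h \<noteq> 0"
  shows "norm ((g h - g 0) / h - deriv g 0) \<le> 32 * B / r\<^sup>2 * norm h"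
proof -
  have b2: "norm ((deriv ^^ 2) g z) \<le> 32 * B / r\<^sup>2" if z: "z \<in> cball 0 (r/4)" for z
  proof -
    have sub: "cball z (r/4) \<subseteq> ball 0 r" 
    proof
      fix w assume "w \<in> cball z (r/4)"
      then have "dist z w \<le> r/4" "dist 0 z \<le> r/4" using z by auto
      then show "w \<in> ball 0 r" using dist_triangle[of 0 w z] r by simp
    qed
    have "norm ((deriv ^^ 2) g z) \<le> fact 2 * B / (r/4) ^ 2"
    proof (rule Cauchy_inequality)
      show "g holomorphic_on ball z (r/4)" using g sub ball_subset_cball holomorphic_on_subset by blast
      show "continuous_on (cball z (r/4)) g" using g sub holomorphic_on_imp_continuous_on continuous_on_subset by blast
      show "norm (g w) \<le> B" if "norm (z - w) = r/4" for w
        using B sub that by (auto simp: subset_iff dist_norm)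
    qed (use r in auto)
    then show ?thesis by (simp add: power2_eq_square)
  qed
  have hd: "((deriv ^^ i) g has_field_derivative (deriv ^^ Suc i) g z) (at z within cball 0 (r/4))" if "z \<in> cball 0 (r/4)" for i z
  proof -
    have "(deriv ^^ i) g holomorphic_on ball 0 r" by (rule holomorphic_higher_deriv[OF g]) auto
    moreover have "z \<in> ball 0 r" using that r by auto
    ultimately show ?thesis using holomorphic_derivI[of _ "ball 0 r" z] by (auto intro: has_field_derivative_at_within)
  qed
  have "norm ((deriv ^^ 0) g h - (\<Sum>i\<le>1. (deriv ^^ i) g 0 * (h - 0) ^ i / (fact i))) \<le> 32 * B / r\<^sup>2 * norm (h - 0) ^ Suc 1 / fact 1"
  proof (rule complex_Taylor[of "cball 0 (r/4)" 1 "\<lambda>i. (deriv ^^ i) g"])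
    show "norm ((deriv ^^ Suc 1) g x) \<le> 32 * B / r\<^sup>2" if "x \<in> cball 0 (r/4)" for x
      using b2[OF that] by (simp add: numeral_2_eq_2)
  qed (use hd h r in auto)
  then have t: "norm (g h - (g 0 + deriv g 0 * h)) \<le> 32 * B / r\<^sup>2 * norm h ^ 2" 
    by (simp add: power2_eq_square)
  have "norm ((g h - g 0) / h - deriv g 0) = norm (g h - (g 0 + deriv g 0 * h)) / norm h"
    using h by (simp add: norm_divide[symmetric] field_simps)
  also have "\<dots> \<le> (32 * B / r\<^sup>2 * norm h ^ 2) / norm h" using t by (intro divide_right_mono) auto
  also have "\<dots> = 32 * B / r\<^sup>2 * norm h" using h by (simp add: power2_eq_square)
  finally show ?thesis .
qed

lemma dd_shift: 
  assumes "chol U f" "x + c \<in> U"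
  shows "((\<lambda>x. f (x + c)) has_derivative dd f (x + c)) (at x)"
  using has_derivative_compose[of "\<lambda>x. x + c" "\<lambda>v. v" x UNIV f, OF _ chol_has_derivative[OF assms]]
  by (simp add: has_derivative_add_const)

text \<open>A complex derivative is again holomorphic. Holomorphy in one variable bounds the error of
the difference quotients of \<open>f\<close> along \<open>v\<close>, uniformly in the base point, so that the derivative
is a locally uniform limit of holomorphic functions; differentiating the quotients in another direction
before passing to the limit yields the symmetry of second derivatives in the same stroke.\<close>

lemma dd_chol_and_symmetric:
  assumes U: "open U" and f: "chol U f"
  shows "chol U (\<lambda>x. dd f x v)"
    and "x \<in> U \<Longrightarrow> dd (\<lambda>x. dd f x v) x w = dd (\<lambda>x. dd f x w) x v"
proof -
  \<comment> \<open>locally the derivative is a uniform limit of difference quotients\<close>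
  have main: "\<exists>r>0. \<exists>h. ball x r \<subseteq> U \<and> chol (ball x r) (\<lambda>x. dd f x v) \<and> (\<forall>n::nat. h n \<noteq> 0) \<and> h \<longlonglongrightarrow> 0 \<and>
     (\<forall>w. (\<lambda>n. (dd f (x + h n *s v) w - dd f x w) / h n) \<longlonglongrightarrow> dd (\<lambda>x. dd f x v) x w)" if x: "x \<in> U" and v: "v \<noteq> 0" for x v
  proof -
    obtain R where R: "R > 0" "cball x R \<subseteq> U" using U x open_contains_cball by blast
    define r where "r = R / 2"
    have r: "r > 0" using R by (simp add: r_def)
    have "compact (f ` cball x R)" using chol_continuous_on[OF f] R
      by (meson compact_cball compact_continuous_image continuous_on_subset)
    then obtain B where B: "\<And>y. y \<in> cball x R \<Longrightarrow> norm (f y) \<le> B"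
      by (meson bounded_iff compact_imp_bounded imageI)
    define s where "s = r / norm v"
    have s: "s > 0" "s * norm v = r" using r v by (auto simp: s_def)
    define h where "h n = complex_of_real (s / 4 * inverse (real (Suc n)))" for n
    have h0: "h n \<noteq> 0" for n using s unfolding h_def of_real_eq_0_iff by simp
    have hs: "norm (h n) \<le> s / 4" for n
    proof -
      have "norm (h n) = s / 4 * inverse (real (Suc n))" unfolding h_def norm_of_real using s by simp
      also have "\<dots> \<le> s / 4 * 1" using s by (intro mult_left_mono) (auto simp: field_simps)
      finally show ?thesis by simp
    qed
    have hlim: "h \<longlonglongrightarrow> 0"
    proof -
      have "(\<lambda>n. s / 4 * inverse (real (Suc n))) \<longlonglongrightarrow> s / 4 * 0"
        by (intro tendsto_intros LIMSEQ_inverse_real_of_nat)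
      then have "(\<lambda>n. complex_of_real (s / 4 * inverse (real (Suc n)))) \<longlonglongrightarrow> of_real 0"
        by (intro tendsto_of_real) simp
      then show ?thesis by (simp only: h_def[abs_def] of_real_0)
    qed
    have inb: "y + \<zeta> *s v \<in> ball x R" if "y \<in> ball x r" "norm \<zeta> < s" for y \<zeta>
    proof -
      have "norm \<zeta> * norm v < r" using that s v by (metis mult_strict_right_mono zero_less_norm_iff)
      then have "dist y (y + \<zeta> *s v) < r" by (simp add: dist_norm vec_scale_norm)
      then show ?thesis using that(1) dist_triangle[of x "y + \<zeta> *s v" y] by (simp add: r_def)
    qed
    have hin: "y + h n *s v \<in> ball x R" if "y \<in> ball x r" for y n
      using inb[OF that, of "h n"] hs[of n] s by linarith
    define q where "q n y = (f (y + h n *s v) - f y) / h n" for n y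
    have BU: "ball x R \<subseteq> U" using R by auto
    have subU: "ball x r \<subseteq> U" using BU R by (auto simp: r_def)
    have hd: "(q n has_derivative (\<lambda>w. (dd f (y + h n *s v) w - dd f y w) / h n)) (at y)" if y: "y \<in> ball x r" for n y
    proof -
      have "((\<lambda>y. f (y + h n *s v)) has_derivative dd f (y + h n *s v)) (at y)"
        by (rule dd_shift[OF f]) (use hin[OF y] BU in blast)
      from bounded_linear.has_derivative[OF bounded_linear_divide has_derivative_diff[OF this chol_has_derivative[OF f, of y]], of "h n"]
      show ?thesis unfolding q_def using y subU by auto
    qed
    have qc: "chol (ball x r) (q n)" for n
    proof (rule cholI[OF hd])
      fix y c w assume y: "y \<in> ball x r"
      have "y + h n *s v \<in> U" "y \<in> U" using hin[OF y] BU y subU by auto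
      then show "(dd f (y + h n *s v) (c *s w) - dd f y (c *s w)) / h n = c * ((dd f (y + h n *s v) w - dd f y w) / h n)"
        by (simp add: chol_dd_scale[OF f] algebra_simps diff_divide_distrib)
    qed
    have B0: "B \<ge> 0" using order_trans[OF norm_ge_zero B[of x]] R by simp
    have bound: "norm (q n y - dd f y v) \<le> 32 * B / s\<^sup>2 * norm (h n)" if y: "y \<in> ball x r" for n y
    proof -
      define g where "g \<zeta> = f (y + \<zeta> *s v)" for \<zeta>
      have "g holomorphic_on ball 0 s" unfolding g_def
        by (rule holomorphic_on_subset[OF chol_line_holomorphic[OF f]]) (use inb[OF y] BU in auto)
      moreover have "norm (g z) \<le> B" if "z \<in> ball 0 s" for z
      proof -
        have "y + z *s v \<in> cball x R" using inb[OF y, of z] that ball_subset_cball by auto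
        then show ?thesis unfolding g_def by (rule B)
      qed
      ultimately have "norm ((g (h n) - g 0) / h n - deriv g 0) \<le> 32 * B / s\<^sup>2 * norm (h n)"
        by (rule quotient_bound[OF _ s(1)]) (use hs h0 in auto)
      moreover have "deriv g 0 = dd f y v"
        unfolding g_def using chol_line_deriv[OF f, of y 0 v] y subU by (auto intro!: DERIV_imp_deriv)
      ultimately show ?thesis by (simp add: g_def q_def)
    qed
    have ul: "uniform_limit (ball x r) q (\<lambda>y. dd f y v) sequentially"
    proof (rule uniform_limitI)
      fix e :: real assume e: "e > 0"
      have "(\<lambda>n. 32 * B / s\<^sup>2 * norm (h n)) \<longlonglongrightarrow> 32 * B / s\<^sup>2 * norm (0::complex)"
        by (intro tendsto_intros hlim)
      then have "\<forall>\<^sub>F n in sequentially. 32 * B / s\<^sup>2 * norm (h n) < e"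
        using e by (auto simp: order_tendsto_iff)
      then show "\<forall>\<^sub>F n in sequentially. \<forall>y\<in>ball x r. dist (q n y) (dd f y v) < e"
        by eventually_elim (use bound in \<open>auto simp: dist_norm simp del: mem_ball intro: le_less_trans\<close>)
    qed
    have lim: "\<exists>r'>0. ball y r' \<subseteq> ball x r \<and> uniform_limit (ball y r') q (\<lambda>y. dd f y v) sequentially" if y: "y \<in> ball x r" for y
      using openE[OF open_ball y] ul uniform_limit_on_subset by metis
    have c1: "chol (ball x r) (\<lambda>y. dd f y v)" and c2: "\<And>w. (\<lambda>n. dd (q n) x w) \<longlonglongrightarrow> dd (\<lambda>y. dd f y v) x w"
      using chol_limit[OF open_ball qc lim] r by auto
    have "dd (q n) x = (\<lambda>w. (dd f (x + h n *s v) w - dd f x w) / h n)" for n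
      by (rule dd_eq[OF hd]) (use r in auto)
    with c2 have "(\<lambda>n. (dd f (x + h n *s v) w - dd f x w) / h n) \<longlonglongrightarrow> dd (\<lambda>x. dd f x v) x w" for w by simp
    then show ?thesis using r c1 h0 hlim subU by blast
  qed
  show c: "chol U (\<lambda>x. dd f x v)" for v
  proof (cases "v = 0")
    case True
    then show ?thesis
      by (intro chol_cong[OF chol_const[of U 0] U]) (simp add: chol_dd_linear(3)[OF f])
  next
    case False
    show ?thesis unfolding chol_def
    proof
      fix x assume "x \<in> U"
      from main[OF this False] obtain r where "r > 0" "chol (ball x r) (\<lambda>x. dd f x v)" by blast
      then show "\<exists>f'. ((\<lambda>x. dd f x v) has_derivative f') (at x) \<and> (\<forall>c v. f' (c *s v) = c * f' v)"
        unfolding chol_def by (meson centre_in_ball)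
    qed
  qed
  show "dd (\<lambda>x. dd f x v) x w = dd (\<lambda>x. dd f x w) x v" if x: "x \<in> U"
  proof (cases "v = 0")
    case True
    have "dd (\<lambda>x. dd f x 0) x w = dd (\<lambda>x. 0) x w"
      using dd_cong[OF U x, of "\<lambda>x. dd f x 0" "\<lambda>x. 0"] chol_dd_linear(3)[OF f] by auto
    then show ?thesis using True chol_dd_linear(3)[OF c x] by (simp add: dd_const)
  next
    case False
    from main[OF x False] obtain h :: "nat \<Rightarrow> complex" where h: "\<And>n. h n \<noteq> 0" "h \<longlonglongrightarrow> 0"
      "(\<lambda>n. (dd f (x + h n *s v) w - dd f x w) / h n) \<longlonglongrightarrow> dd (\<lambda>x. dd f x v) x w" by blast
    have "((\<lambda>\<zeta>. dd f (x + \<zeta> *s v) w) has_field_derivative dd (\<lambda>x. dd f x w) x v) (at 0)"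
      using chol_line_deriv[OF c, of x 0 v w] x by simp
    then have "((\<lambda>\<zeta>. (dd f (x + \<zeta> *s v) w - dd f x w) / \<zeta>) \<longlongrightarrow> dd (\<lambda>x. dd f x w) x v) (at 0)"
      by (simp add: has_field_derivative_iff)
    moreover have "filterlim h (at 0) sequentially"
      using h by (auto simp: filterlim_at)
    ultimately have "(\<lambda>n. (dd f (x + h n *s v) w - dd f x w) / h n) \<longlonglongrightarrow> dd (\<lambda>x. dd f x w) x v"
      by (rule filterlim_compose)
    then show ?thesis using h(3) LIMSEQ_unique by blast
  qed
qed

lemma dd_expand:
  assumes "chol U f" "x \<in> U"
  shows "dd f x v = (\<Sum>k\<in>UNIV. v $ k * dd f x (axis k 1))"
proof -
  have "dd f x v = dd f x (\<Sum>k\<in>UNIV. v $ k *s axis k 1)" by (simp add: basis_expansion)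
  also have "\<dots> = (\<Sum>k\<in>UNIV. v $ k * dd f x (axis k 1))"
    by (simp only: chol_dd_linear(5)[OF assms] chol_dd_scale[OF assms])
  finally show ?thesis .
qed

lemma dd_continuous_on:
  assumes U: "open U" and f: "chol U f" and g: "continuous_on S g" "g ` S \<subseteq> U" and h: "continuous_on S h"
  shows "continuous_on S (\<lambda>s. dd f (g s) (h s))"
proof -
  have "continuous_on S (\<lambda>s. \<Sum>k\<in>UNIV. h s $ k * dd f (g s) (axis k 1))"
    by (intro continuous_intros h continuous_on_compose2[OF chol_continuous_on[OF dd_chol_and_symmetric(1)[OF U f]] g(1) g(2)]
        bounded_linear.continuous_on[OF bounded_linear_vec_nth h])
  then show ?thesis
    by (rule continuous_on_cong[THEN iffD1, rotated -1]) (use g in \<open>auto simp: image_subset_iff intro!: dd_expand[OF f, symmetric]\<close>)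
qed

text \<open>The set of points near which \<open>f\<close> vanishes is open. At a limit point \<open>x\<close> of it, some ball around \<open>x\<close> in \<open>U\<close>
contains such a point \<open>y\<close>, and the one-variable identity theorem on the complex lines through \<open>y\<close> shows that
\<open>f\<close> vanishes on that ball.\<close>

lemma chol_identity:
  assumes U: "open U" "connected U" and f: "chol U f" and V: "open V" "V \<noteq> {}" "V \<subseteq> U" "\<And>x. x \<in> V \<Longrightarrow> f x = 0"
    and x: "x \<in> U"
  shows "f x = 0"
proof -
  define Z where "Z = {x\<in>U. \<exists>r>0. \<forall>y\<in>ball x r. y \<in> U \<longrightarrow> f y = 0}"
  have "openin (top_of_set U) Z"
  proof (subst openin_open_eq[OF U(1)], intro conjI)
    show "open Z" unfolding open_contains_ball
    proof
      fix x assume "x \<in> Z"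
      then obtain r where r: "x \<in> U" "r > 0" "\<forall>y\<in>ball x r. y \<in> U \<longrightarrow> f y = 0" by (auto simp: Z_def)
      obtain s where s: "s > 0" "ball x s \<subseteq> U" using U r open_contains_ball by blast
      have "ball x (min r s) \<subseteq> Z"
      proof
        fix y assume y: "y \<in> ball x (min r s)"
        obtain e where e: "e > 0" "ball y e \<subseteq> ball x (min r s)" using openE[OF open_ball y] by blast
        have "f z = 0" if "z \<in> ball y e" "z \<in> U" for z using e r that by auto
        then show "y \<in> Z" using e s y unfolding Z_def by auto
      qed
      then show "\<exists>e>0. ball x e \<subseteq> Z" using r s by (metis min_less_iff_conj)
    qed
  qed (auto simp: Z_def)
  moreover have "closedin (top_of_set U) Z"
    unfolding closedin_limpt
  proof (intro conjI allI impI)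
    fix x assume x: "x islimpt Z \<and> x \<in> U"
    obtain s where s: "s > 0" "ball x s \<subseteq> U" using U x open_contains_ball by blast
    obtain y where y: "y \<in> Z" "y \<in> ball x s" using x s unfolding islimpt_approachable by (metis dist_commute mem_ball)
    obtain r where r: "r > 0" "\<forall>z\<in>ball y r. z \<in> U \<longrightarrow> f z = 0" using y by (auto simp: Z_def)
    have "f z = 0" if z: "z \<in> ball x s" for z
    proof -
      define T where "T = {\<zeta>. y + \<zeta> *s (z - y) \<in> ball x s}"
      define g where "g \<zeta> = f (y + \<zeta> *s (z - y))" for \<zeta>
      have oT: "open T" unfolding T_def by (rule open_line) auto
      have cT: "convex T"
      proof (rule convexI)
        fix a b :: complex and u v :: real assume a: "a \<in> T" "b \<in> T" "0 \<le> u" "0 \<le> v" "u + v = 1"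
        then have "u *\<^sub>R (y + a *s (z - y)) + v *\<^sub>R (y + b *s (z - y)) \<in> ball x s"
          unfolding T_def using convexD[OF convex_ball] by (metis mem_Collect_eq)
        moreover have "u *\<^sub>R (y + a *s (z - y)) + v *\<^sub>R (y + b *s (z - y)) = y + (u *\<^sub>R a + v *\<^sub>R b) *s (z - y)"
        proof -
          have u: "u = 1 - v" using a(5) by simp
          show ?thesis unfolding u
            by (simp add: vec_eq_iff scaleR_conv_of_real[where 'a = complex] algebra_simps)
        qed
        ultimately show "u *\<^sub>R a + v *\<^sub>R b \<in> T" unfolding T_def by simp
      qed
      have hol: "g holomorphic_on T" unfolding g_def T_def
        by (rule chol_line_holomorphic[OF chol_subset[OF f s(2)]])
      have o1: "1 \<in> T" and o0: "0 \<in> T" using z y by (auto simp: T_def)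
      have oN: "open {\<zeta>. y + \<zeta> *s (z - y) \<in> ball x s \<inter> ball y r}" by (rule open_line) auto
      have "g 1 = 0"
      proof (rule analytic_continuation_open[where f = g and g = "\<lambda>_. 0" and s = "{\<zeta>. y + \<zeta> *s (z - y) \<in> ball x s \<inter> ball y r}" and s' = T])
        show "{\<zeta>. y + \<zeta> *s (z - y) \<in> ball x s \<inter> ball y r} \<noteq> {}" using y r by (auto intro!: exI[of _ 0])
        show "g w = 0" if "w \<in> {\<zeta>. y + \<zeta> *s (z - y) \<in> ball x s \<inter> ball y r}" for w
          using that r s unfolding g_def by blast
      qed (use oN oT hol cT o1 in \<open>auto simp: T_def convex_connected\<close>)
      then show ?thesis by (simp add: g_def)
    qed
    then show "x \<in> Z" using s x unfolding Z_def by auto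
  qed (auto simp: Z_def)
  moreover have "Z \<noteq> {}"
  proof -
    obtain v where v: "v \<in> V" using V by blast
    obtain r where "r > 0" "ball v r \<subseteq> V" using V v open_contains_ball by blast
    then have "v \<in> Z" using V v by (auto simp: Z_def subset_iff)
    then show ?thesis by blast
  qed
  ultimately have "Z = U" using U(2) unfolding connected_clopen by blast
  then have "x \<in> Z" using x by simp
  then obtain r where "r > 0" "\<forall>y\<in>ball x r. y \<in> U \<longrightarrow> f y = 0" by (auto simp: Z_def)
  then show ?thesis using x centre_in_ball by blast
qed

subsection \<open>Holomorphic maps\<close>

lemma clinear_iff:
  "Vector_Spaces.linear (*s) (*s) (f :: complex^'n \<Rightarrow> complex^'m) \<longleftrightarrow>
     (\<forall>x y. f (x + y) = f x + f y) \<and> (\<forall>c x. f (c *s x) = c *s f x)"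
  by (auto simp: Vector_Spaces.linear_iff intro: vec.vector_space_axioms)

lemma bounded_linear_axis_c: "bounded_linear (axis k :: complex \<Rightarrow> complex^'m)"
  unfolding linear_conv_bounded_linear[symmetric] by (rule linearI) (auto simp: axis_def vec_eq_iff)

lemma has_derivative_vecI:
  fixes f :: "'a::real_normed_vector \<Rightarrow> complex^'m"
  assumes "\<And>k. ((\<lambda>x. f x $ k) has_derivative f' k) F"
  shows "(f has_derivative (\<lambda>v. \<chi> k. f' k v)) F"
proof -
  have e: "(\<Sum>k\<in>UNIV. axis k (y $ k)) = y" for y :: "complex^'m"
    by (simp add: vec_eq_iff axis_def if_distrib cong: if_cong)
  have "((\<lambda>x. \<Sum>k\<in>UNIV. axis k (f x $ k)) has_derivative (\<lambda>v. \<Sum>k\<in>UNIV. axis k (f' k v))) F"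
    by (intro has_derivative_sum bounded_linear.has_derivative[OF bounded_linear_axis_c] assms)
  moreover have "(\<Sum>k\<in>UNIV. axis k (f' k v)) = (\<chi> k. f' k v)" for v using e[of "\<chi> k. f' k v"] by simp
  ultimately show ?thesis by (simp add: e)
qed

lemma holo_map_iff_chol:
  fixes f :: "complex^'n \<Rightarrow> complex^'m"
  shows "holo_map U f \<longleftrightarrow> (\<forall>k. chol U (\<lambda>x. f x $ k))"
proof (intro iffI allI)
  fix k assume f: "holo_map U f"
  show "chol U (\<lambda>x. f x $ k)" unfolding chol_def
  proof
    fix x assume "x \<in> U"
    then obtain f' where f': "(f has_derivative f') (at x)" "Vector_Spaces.linear (*s) (*s) f'" using f holo_map_def by blast
    then show "\<exists>f'. ((\<lambda>x. f x $ k) has_derivative f') (at x) \<and> (\<forall>c v. f' (c *s v) = c * f' v)"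
      by (intro exI[of _ "\<lambda>v. f' v $ k"]) (auto simp: clinear_iff intro: bounded_linear.has_derivative[OF bounded_linear_vec_nth])
  qed
next
  assume f: "\<forall>k. chol U (\<lambda>x. f x $ k)"
  show "holo_map U f" unfolding holo_map_def
  proof
    fix x assume x: "x \<in> U"
    have "(f has_derivative (\<lambda>v. \<chi> k. dd (\<lambda>x. f x $ k) x v)) (at x)"
      by (rule has_derivative_vecI) (use f x chol_has_derivative in blast)
    moreover have "Vector_Spaces.linear (*s) (*s) (\<lambda>v. \<chi> k. dd (\<lambda>x. f x $ k) x v)"
      using f x by (auto simp: clinear_iff vec_eq_iff chol_dd_linear(1)[OF _ x] chol_dd_scale[OF _ x])
    ultimately show "\<exists>f'. (f has_derivative f') (at x) \<and> Vector_Spaces.linear (*s) (*s) f'" by blast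
  qed
qed

lemma holo_map_chol: "holo_map U f \<Longrightarrow> chol U (\<lambda>x. f x $ k)"
  by (simp add: holo_map_iff_chol)

lemma Dmap_eq: "(f has_derivative f') (at x) \<Longrightarrow> Dmap f x = f'"
  by (metis frechet_derivative_at)

lemma holo_map_has_derivative:
  assumes "holo_map U f" "x \<in> U" shows "(f has_derivative Dmap f x) (at x)"
  using assms Dmap_eq unfolding holo_map_def by metis

lemma Dmap_clinear:
  assumes "holo_map U f" "x \<in> U" shows "Vector_Spaces.linear (*s) (*s) (Dmap f x)"
  using assms Dmap_eq unfolding holo_map_def by metis

lemma Dmap_scale: "holo_map U f \<Longrightarrow> x \<in> U \<Longrightarrow> Dmap f x (c *s v) = c *s Dmap f x v"
  using Dmap_clinear clinear_iff by metis

lemma Dmap_linear: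
  assumes "holo_map U f" "x \<in> U"
  shows "Dmap f x (v + w) = Dmap f x v + Dmap f x w" "Dmap f x (v - w) = Dmap f x v - Dmap f x w"
    "Dmap f x 0 = 0" "Dmap f x (- v) = - Dmap f x v" "Dmap f x (sum g A) = (\<Sum>i\<in>A. Dmap f x (g i))"
proof -
  have "linear (Dmap f x)" using holo_map_has_derivative[OF assms] has_derivative_linear by blast
  then show "Dmap f x (v + w) = Dmap f x v + Dmap f x w" "Dmap f x (v - w) = Dmap f x v - Dmap f x w"
    "Dmap f x 0 = 0" "Dmap f x (- v) = - Dmap f x v" "Dmap f x (sum g A) = (\<Sum>i\<in>A. Dmap f x (g i))"
    by (auto simp: linear_add linear_diff linear_0 linear_neg linear_sum)
qed

lemma Dmap_nth:
  assumes "holo_map U f" "x \<in> U" shows "Dmap f x v $ k = dd (\<lambda>x. f x $ k) x v"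
  using dd_eq[OF bounded_linear.has_derivative[OF bounded_linear_vec_nth holo_map_has_derivative[OF assms]], of k] by simp

lemma holo_map_subset: "holo_map U f \<Longrightarrow> V \<subseteq> U \<Longrightarrow> holo_map V f"
  by (auto simp: holo_map_def)

lemma holo_map_cong:
  assumes "holo_map U f" "open U" "\<And>x. x \<in> U \<Longrightarrow> g x = f x" shows "holo_map U g"
  using assms by (auto simp: holo_map_iff_chol intro: chol_cong)

lemma Dmap_cong:
  assumes "open U" "x \<in> U" "\<And>y. y \<in> U \<Longrightarrow> g y = f y" 
  shows "Dmap g x = Dmap f x"
proof -
  have "(f has_derivative f') (at x) \<longleftrightarrow> (g has_derivative f') (at x)" for f'
    using assms has_derivative_transform_within_open by (metis (mono_tags, lifting))
  then show ?thesis unfolding frechet_derivative_def by simp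
qed

lemma holo_map_continuous_on: "holo_map U f \<Longrightarrow> continuous_on U f"
  by (meson holo_map_has_derivative continuous_at_imp_continuous_on has_derivative_continuous)

lemma holo_map_id: "holo_map U (\<lambda>x. x)" by (simp add: holo_map_iff_chol chol_nth)
lemma holo_map_const: "holo_map U (\<lambda>x. c)" by (simp add: holo_map_iff_chol chol_const)

lemma chol_compose:
  assumes f: "chol V f" and g: "holo_map U g" "g ` U \<subseteq> V"
  shows "chol U (\<lambda>x. f (g x))"
    and "x \<in> U \<Longrightarrow> dd (\<lambda>x. f (g x)) x v = dd f (g x) (Dmap g x v)"
proof -
  have d: "((\<lambda>x. f (g x)) has_derivative (\<lambda>v. dd f (g x) (Dmap g x v))) (at x)" if x: "x \<in> U" for x
    by (rule has_derivative_compose[OF holo_map_has_derivative[OF g(1) x] chol_has_derivative[OF f]])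
       (use g x in blast)
  show "chol U (\<lambda>x. f (g x))"
    by (rule cholI[OF d]) (use g in \<open>auto simp: Dmap_scale[OF g(1)] chol_dd_scale[OF f] image_subset_iff\<close>)
  show "dd (\<lambda>x. f (g x)) x v = dd f (g x) (Dmap g x v)" if "x \<in> U"
    using dd_eq[OF d[OF that]] by simp
qed

lemma holo_map_compose:
  assumes f: "holo_map V f" and g: "holo_map U g" "g ` U \<subseteq> V"
  shows "holo_map U (\<lambda>x. f (g x))"
    and "x \<in> U \<Longrightarrow> Dmap (\<lambda>x. f (g x)) x v = Dmap f (g x) (Dmap g x v)"
proof -
  show h: "holo_map U (\<lambda>x. f (g x))"
    using chol_compose(1)[OF _ g] f by (auto simp: holo_map_iff_chol)
  show "Dmap (\<lambda>x. f (g x)) x v = Dmap f (g x) (Dmap g x v)" if x: "x \<in> U"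
  proof -
    have "g x \<in> V" using g x by blast
    then show ?thesis 
      by (simp add: vec_eq_iff Dmap_nth[OF h x] Dmap_nth[OF f] chol_compose(2)[OF holo_map_chol[OF f] g x])
  qed
qed

lemma holo_map_Dmap:
  fixes f :: "complex^'n \<Rightarrow> complex^'m" and v w x :: "complex^'n"
  assumes U: "open U" and f: "holo_map U f"
  shows "holo_map U (\<lambda>x. Dmap f x v)"
    and "x \<in> U \<Longrightarrow> Dmap (\<lambda>x. Dmap f x v) x w $ k = dd (\<lambda>x. dd (\<lambda>x. f x $ k) x v) x w"
    and "x \<in> U \<Longrightarrow> Dmap (\<lambda>x. Dmap f x v) x w = Dmap (\<lambda>x. Dmap f x w) x v"
proof -
  have c: "chol U (\<lambda>x. Dmap f x v $ k)" for v k
    by (rule chol_cong[OF dd_chol_and_symmetric(1)[OF U holo_map_chol[OF f]] U]) (rule Dmap_nth[OF f])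
  then show h: "holo_map U (\<lambda>x. Dmap f x v)" for v by (simp add: holo_map_iff_chol)
  have e: "Dmap (\<lambda>x. Dmap f x v) x w $ k = dd (\<lambda>x. dd (\<lambda>x. f x $ k) x v) x w" if x: "x \<in> U" for v w k
    by (subst Dmap_nth[OF h x], subst dd_cong[OF U x, of "\<lambda>x. Dmap f x v $ k" "\<lambda>x. dd (\<lambda>x. f x $ k) x v"])
       (auto simp: Dmap_nth[OF f])
  then show "x \<in> U \<Longrightarrow> Dmap (\<lambda>x. Dmap f x v) x w $ k = dd (\<lambda>x. dd (\<lambda>x. f x $ k) x v) x w" .
  show "Dmap (\<lambda>x. Dmap f x v) x w = Dmap (\<lambda>x. Dmap f x w) x v" if x: "x \<in> U"
    by (simp add: vec_eq_iff e[OF x] dd_chol_and_symmetric(2)[OF U holo_map_chol[OF f] x, where v = v])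
qed

lemma Dmap_continuous_on:
  assumes U: "open U" and f: "holo_map U f" and g: "continuous_on S g" "g ` S \<subseteq> U" and h: "continuous_on S h"
  shows "continuous_on S (\<lambda>s. Dmap f (g s) (h s))"
proof -
  have "continuous_on S (\<lambda>s. \<chi> k. dd (\<lambda>x. f x $ k) (g s) (h s))"
    by (intro continuous_on_vec_lambda dd_continuous_on[OF U holo_map_chol[OF f] g h])
  then show ?thesis
    by (rule continuous_on_cong[THEN iffD1, rotated -1])
       (use g in \<open>auto simp: image_subset_iff vec_eq_iff Dmap_nth[OF f]\<close>)
qed

subsection \<open>Second derivatives and gradients\<close>

definition d2 :: "(complex^'n \<Rightarrow> complex) \<Rightarrow> complex^'n \<Rightarrow> complex^'n \<Rightarrow> complex^'n \<Rightarrow> complex" where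
  "d2 f x v w = dd (\<lambda>y. dd f y v) x w"

lemma d2_sym: "open U \<Longrightarrow> chol U f \<Longrightarrow> x \<in> U \<Longrightarrow> d2 f x v w = d2 f x w v"
  unfolding d2_def by (rule dd_chol_and_symmetric(2))

lemma d2_chol: assumes "open U" "chol U f" shows "chol U (\<lambda>x. d2 f x v w)"
  unfolding d2_def by (intro dd_chol_and_symmetric(1) assms)

lemma d2_bilinear:
  assumes U: "open U" "chol U f" "x \<in> U"
  shows "d2 f x v (w + w') = d2 f x v w + d2 f x v w'" "d2 f x (v + v') w = d2 f x v w + d2 f x v' w"
    "d2 f x v (c *s w) = c * d2 f x v w" "d2 f x (c *s v) w = c * d2 f x v w"
    "d2 f x v (\<Sum>i\<in>A. g i) = (\<Sum>i\<in>A. d2 f x v (g i))" "d2 f x (\<Sum>i\<in>A. g i) w = (\<Sum>i\<in>A. d2 f x (g i) w)"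
proof -
  note c = dd_chol_and_symmetric(1)[OF U(1,2)]
  show "d2 f x v (w + w') = d2 f x v w + d2 f x v w'" "d2 f x v (c *s w) = c * d2 f x v w"
    "d2 f x v (\<Sum>i\<in>A. g i) = (\<Sum>i\<in>A. d2 f x v (g i))" for v w w' c
    by (simp_all add: d2_def chol_dd_linear[OF c U(3)] chol_dd_scale[OF c U(3)])
  then show "d2 f x (v + v') w = d2 f x v w + d2 f x v' w" "d2 f x (c *s v) w = c * d2 f x v w"
     "d2 f x (\<Sum>i\<in>A. g i) w = (\<Sum>i\<in>A. d2 f x (g i) w)"
    by (metis d2_sym[OF U], metis d2_sym[OF U], simp add: d2_sym[OF U, of _ w])
qed

lemma dd_varying:
  assumes U: "open U" and f: "chol U f" and g: "holo_map U g"
  shows "chol U (\<lambda>x. dd f x (g x))"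
    and "x \<in> U \<Longrightarrow> dd (\<lambda>x. dd f x (g x)) x w = d2 f x (g x) w + dd f x (Dmap g x w)"
proof -
  have e: "dd f x (g x) = (\<Sum>k\<in>UNIV. g x $ k * dd f x (axis k 1))" if "x \<in> U" for x
    by (rule dd_expand[OF f that])
  have c: "chol U (\<lambda>x. \<Sum>k\<in>UNIV. g x $ k * dd f x (axis k 1))"
    by (intro chol_sum chol_mult holo_map_chol[OF g] dd_chol_and_symmetric(1)[OF U f])
  show "chol U (\<lambda>x. dd f x (g x))" by (rule chol_cong[OF c U]) (rule e)
  show "dd (\<lambda>x. dd f x (g x)) x w = d2 f x (g x) w + dd f x (Dmap g x w)" if x: "x \<in> U"
  proof -
    have "dd (\<lambda>x. dd f x (g x)) x w = dd (\<lambda>x. \<Sum>k\<in>UNIV. g x $ k * dd f x (axis k 1)) x w"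
      by (subst dd_cong[OF U x, OF e]) auto
    also have "\<dots> = (\<Sum>k\<in>UNIV. g x $ k * d2 f x (axis k 1) w + Dmap g x w $ k * dd f x (axis k 1))"
      unfolding d2_def
      by (subst dd_sum[of UNIV U])
         (auto intro!: chol_mult holo_map_chol[OF g] dd_chol_and_symmetric(1)[OF U f] sum.cong x
           simp: dd_mult[OF holo_map_chol[OF g] dd_chol_and_symmetric(1)[OF U f] x] Dmap_nth[OF g x])
    also have "\<dots> = (\<Sum>k\<in>UNIV. d2 f x (g x $ k *s axis k 1) w) + dd f x (Dmap g x w)"
      by (simp add: sum.distrib dd_expand[OF f x, of "Dmap g x w"] d2_bilinear[OF U f x])
    also have "(\<Sum>k\<in>UNIV. d2 f x (g x $ k *s axis k 1) w) = d2 f x (g x) w"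
      by (simp add: d2_bilinear(6)[OF U f x, symmetric] basis_expansion)
    finally show ?thesis .
  qed
qed

definition grad :: "(complex^'n \<Rightarrow> complex) \<Rightarrow> complex^'n \<Rightarrow> complex^'n" where
  "grad f x = (\<chi> k. dd f x (axis k 1))"

lemma pair_grad: "chol U f \<Longrightarrow> x \<in> U \<Longrightarrow> pair (grad f x) v = dd f x v"
  by (simp add: pair_def grad_def dd_expand[of U f x v] mult.commute)

lemma grad_holo: "open U \<Longrightarrow> chol U f \<Longrightarrow> holo_map U (grad f)"
  by (simp add: holo_map_iff_chol grad_def dd_chol_and_symmetric(1))

lemma pair_linear:
  "pair a (v + w) = pair a v + pair a w" "pair a (c *s v) = c * pair a v" "pair a (v - w) = pair a v - pair a w"
  "pair a (- v) = - pair a v" "pair a 0 = 0" "pair (a + b) v = pair a v + pair b v" "pair (c *s a) v = c * pair a v"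
  "pair (a - b) v = pair a v - pair b v" "pair 0 v = 0" "pair a (\<Sum>i\<in>A. g i) = (\<Sum>i\<in>A. pair a (g i))"
  "pair (\<Sum>i\<in>A. g i) v = (\<Sum>i\<in>A. pair (g i) v)"
proof -
  show "pair a (\<Sum>i\<in>A. g i) = (\<Sum>i\<in>A. pair a (g i))"
    unfolding pair_def sum_component sum_distrib_left by (rule sum.swap)
  show "pair (\<Sum>i\<in>A. g i) v = (\<Sum>i\<in>A. pair (g i) v)"
    unfolding pair_def sum_component sum_distrib_right by (rule sum.swap)
qed (simp_all add: pair_def algebra_simps sum.distrib sum_subtractf sum_negf sum_distrib_left)

lemma pair_axis: "pair a (axis k c) = a $ k * c" "pair (axis k c) v = c * v $ k"
  by (simp_all add: pair_def axis_def if_distrib if_distribR cong: if_cong)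

lemma pair_eq_0: "(\<And>v. pair a v = 0) \<Longrightarrow> a = 0"
  by (metis mult.right_neutral pair_axis(1) vec_eq_iff zero_index)

lemma chol_pair:
  assumes "holo_map U a" "holo_map U b"
  shows "chol U (\<lambda>x. pair (a x) (b x))"
  unfolding pair_def using assms by (intro chol_sum chol_mult) (auto intro: holo_map_chol)

lemma dd_pair:
  assumes a: "holo_map U a" and b: "holo_map U b" and x: "x \<in> U"
  shows "dd (\<lambda>x. pair (a x) (b x)) x v = pair (a x) (Dmap b x v) + pair (Dmap a x v) (b x)"
  unfolding pair_def
  by (subst dd_sum[OF _ x])
     (auto intro: chol_mult holo_map_chol[OF a] holo_map_chol[OF b]
       simp: dd_mult[OF holo_map_chol[OF a] holo_map_chol[OF b] x] Dmap_nth[OF a x] Dmap_nth[OF b x] sum.distrib)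

lemma holo_map_add: "holo_map U f \<Longrightarrow> holo_map U g \<Longrightarrow> holo_map U (\<lambda>x. f x + g x)"
  by (simp add: holo_map_iff_chol chol_add)
lemma holo_map_diff: "holo_map U f \<Longrightarrow> holo_map U g \<Longrightarrow> holo_map U (\<lambda>x. f x - g x)"
  by (simp add: holo_map_iff_chol chol_diff)
lemma holo_map_scale: "chol U c \<Longrightarrow> holo_map U g \<Longrightarrow> holo_map U (\<lambda>x. c x *s g x)"
  by (simp add: holo_map_iff_chol chol_mult)
lemma holo_map_sum: "(\<And>i. i \<in> A \<Longrightarrow> holo_map U (f i)) \<Longrightarrow> holo_map U (\<lambda>x. \<Sum>i\<in>A. f i x)"
  by (simp add: holo_map_iff_chol chol_sum)
lemma Dmap_add: "holo_map U f \<Longrightarrow> holo_map U g \<Longrightarrow> x \<in> U \<Longrightarrow> Dmap (\<lambda>x. f x + g x) x v = Dmap f x v + Dmap g x v"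
  by (simp add: vec_eq_iff Dmap_nth[of U] holo_map_add dd_add[of U] holo_map_chol)
lemma Dmap_scale_fun: "chol U c \<Longrightarrow> holo_map U g \<Longrightarrow> x \<in> U \<Longrightarrow> Dmap (\<lambda>x. c x *s g x) x v = c x *s Dmap g x v + dd c x v *s g x"
  by (simp add: vec_eq_iff Dmap_nth[of U] holo_map_scale dd_mult[of U] holo_map_chol)

subsection \<open>The inverse function theorem\<close>

lemma biholo_subset:
  assumes b: "biholo V f" and V': "V' \<subseteq> V" "open V'"
  shows "biholo V' f"
proof -
  obtain g where g: "open V" "open (f ` V)" "holo_map V f" "holo_map (f ` V) g" "\<forall>x\<in>V. g (f x) = x"
    using b unfolding biholo_def by blast
  have "f ` V' = f ` V \<inter> g -` V'" using g V' by force
  then have "open (f ` V')"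
    using continuous_open_preimage[OF holo_map_continuous_on[OF g(4)] g(2) V'(2)] by simp
  then show ?thesis unfolding biholo_def using g V' by (meson holo_map_subset image_mono subsetD)
qed

text \<open>The real inverse function theorem gives a differentiable inverse; its derivative is the inverse of
a complex linear map, hence complex linear.\<close>

lemma holo_inverse_function:
  fixes f :: "complex^'n \<Rightarrow> complex^'n"
  assumes U: "open U" and f: "holo_map U f" and x0: "x0 \<in> U" and inj: "\<And>v. Dmap f x0 v = 0 \<Longrightarrow> v = 0"
  obtains V where "V \<subseteq> U" "x0 \<in> V" "biholo V f"
proof -
  define f' where "f' x = Blinfun (Dmap f x)" for x
  have bl: "bounded_linear (Dmap f x)" if "x \<in> U" for x
    using holo_map_has_derivative[OF f that] has_derivative_bounded_linear by blast
  have ap: "blinfun_apply (f' x) = Dmap f x" if "x \<in> U" for x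
    unfolding f'_def using bounded_linear_Blinfun_apply[OF bl[OF that]] .
  have derf: "(f has_derivative blinfun_apply (f' x)) (at x)" if "x \<in> U" for x
    using holo_map_has_derivative[OF f that] by (simp add: ap[OF that])
  have contf: "continuous_on U f'"
  proof (rule continuous_on_blinfun_componentwise)
    fix i :: "complex^'n"
    have "continuous_on U (\<lambda>x. Dmap f x i)"
      by (rule Dmap_continuous_on[OF U f]) (auto intro: continuous_intros)
    then show "continuous_on U (\<lambda>x. blinfun_apply (f' x) i)"
      by (rule continuous_on_cong[THEN iffD1, rotated -1]) (auto simp: ap)
  qed
  have lin: "linear (Dmap f x0)" using bl[OF x0] by (simp add: bounded_linear.linear)
  moreover have "inj (Dmap f x0)" using linear_injective_0[OF lin] inj by blast
  ultimately obtain g' where g': "linear g'" "g' \<circ> Dmap f x0 = id" using linear_injective_left_inverse by blast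
  have invf: "Blinfun g' o\<^sub>L f' x0 = id_blinfun"
    using g' by (intro blinfun_eqI)
      (auto simp: ap[OF x0] bounded_linear_Blinfun_apply linear_conv_bounded_linear o_def id_def fun_eq_iff)
  have "\<exists>U' V g. open U' \<and> U' \<subseteq> U \<and> x0 \<in> U' \<and> open V \<and> f x0 \<in> V \<and> homeomorphism U' V f g \<and>
     (\<forall>y\<in>V. (g has_derivative inv (blinfun_apply (f' (g y)))) (at y)) \<and> (\<forall>y\<in>V. bij (blinfun_apply (f' (g y))))"
  proof (rule inverse_function_theorem[OF U derf contf x0 invf], goal_cases)
    case (2 U' V g g')
    have "\<forall>y\<in>V. (g has_derivative inv (blinfun_apply (f' (g y)))) (at y)" using 2(7,8) by metis
    then show ?case using 2 by blast
  qed auto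
  then obtain U' V g where V: "open U'" "U' \<subseteq> U" "x0 \<in> U'" "open V" "f x0 \<in> V" "homeomorphism U' V f g"
    "\<And>y. y \<in> V \<Longrightarrow> (g has_derivative inv (blinfun_apply (f' (g y)))) (at y)"
    "\<And>y. y \<in> V \<Longrightarrow> bij (blinfun_apply (f' (g y)))" by blast
  have im: "f ` U' = V" and gf: "\<And>x. x \<in> U' \<Longrightarrow> g (f x) = x" and gV: "g ` V = U'"
    using V(6) by (auto simp: homeomorphism_def)
  have "holo_map V g" unfolding holo_map_def
  proof
    fix y assume y: "y \<in> V"
    then have gy: "g y \<in> U" using gV V by blast
    have bij: "bij (Dmap f (g y))" using V(8)[OF y] ap[OF gy] by simp
    define D where "D y = inv (blinfun_apply (f' (g y)))" for y
    have D: "D y = inv (Dmap f (g y))" using ap[OF gy] by (simp add: D_def)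
    have "D y (c *s v) = c *s D y v" for c v
    proof -
      have "Dmap f (g y) (c *s D y v) = c *s v"
        using bij by (simp add: D Dmap_scale[OF f gy] bij_is_surj surj_f_inv_f)
      then show ?thesis using bij unfolding D by (metis bij_inv_eq_iff)
    qed
    moreover have "linear (D y)" using V(7)[OF y] has_derivative_linear D_def by metis
    ultimately show "\<exists>f'. (g has_derivative f') (at y) \<and> Vector_Spaces.linear (*s) (*s) f'"
      using V(7)[OF y] D_def by (metis clinear_iff linear_add)
  qed
  then have "biholo U' f" unfolding biholo_def using V im gf holo_map_subset[OF f V(2)] by auto
  then show ?thesis using that V by blast
qed

lemma biholo_Dmap:
  assumes V: "open V" "open (f ` V)" "holo_map V f" "holo_map (f ` V) g" "\<forall>x\<in>V. g (f x) = x" and x: "x \<in> V"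
  shows "Dmap g (f x) (Dmap f x v) = v" "Dmap f x (Dmap g (f x) w) = w"
proof -
  have "Dmap (\<lambda>x. g (f x)) x v = v" 
    by (subst Dmap_cong[OF V(1) x, of _ "\<lambda>x. x"]) (use V in \<open>auto simp: Dmap_eq[OF has_derivative_ident]\<close>)
  then show "Dmap g (f x) (Dmap f x v) = v"
    using holo_map_compose(2)[OF V(4,3) order_refl x] by simp
  have fg: "f (g y) = y" if "y \<in> f ` V" for y using that V(5) by auto
  have y: "f x \<in> f ` V" using x by simp
  have "Dmap (\<lambda>y. f (g y)) (f x) w = w" 
    by (subst Dmap_cong[OF V(2) y, of _ "\<lambda>x. x"]) (use fg in \<open>auto simp: Dmap_eq[OF has_derivative_ident]\<close>)
  moreover have "g ` f ` V \<subseteq> V" using V(5) by auto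
  ultimately show "Dmap f x (Dmap g (f x) w) = w"
    using holo_map_compose(2)[OF V(3,4) _ y] V(5) x by simp
qed

section \<open>The holomorphic Frobenius theorem\<close>

text \<open>Uniqueness for linear differential equations, in the only form needed: \<open>|e|\<^sup>2 exp(-2Ct)\<close> is
nonincreasing and nonnegative, and it starts at \<open>0\<close>.\<close>

lemma gronwall_zero:
  fixes e :: "real \<Rightarrow> 'a::real_inner"
  assumes d: "\<And>t. t \<in> {0..1} \<Longrightarrow> (e has_vector_derivative e' t) (at t within {0..1})"
    and le: "\<And>t. t \<in> {0..1} \<Longrightarrow> norm (e' t) \<le> C * norm (e t)" and e0: "e 0 = 0" and t: "t \<in> {0..1}"
  shows "e t = 0"
proof -
  define \<phi> where "\<phi> t = (e t \<bullet> e t) * exp (- 2 * C * t)" for t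
  have ce: "continuous_on {0..1} e"
    using d has_vector_derivative_continuous continuous_on_eq_continuous_within by blast
  have "\<phi> t \<le> \<phi> 0"
  proof (rule DERIV_nonpos_imp_decreasing_open[of 0 t \<phi>])
    show "0 \<le> t" using t by simp
    show "continuous_on {0..t} \<phi>" unfolding \<phi>_def
      by (intro continuous_intros continuous_on_subset[OF ce]) (use t in auto)
    fix s assume s: "0 < s" "s < t"
    have "(e has_vector_derivative e' s) (at s within {0<..<1})"
      by (rule has_vector_derivative_within_subset[OF d]) (use s t in auto)
    then have ds: "(e has_vector_derivative e' s) (at s)"
      using s t by (simp add: at_within_open_NO_MATCH)
    have i: "((\<lambda>t. e t \<bullet> e t) has_vector_derivative (e s \<bullet> e' s + e' s \<bullet> e s)) (at s)"
      by (rule bounded_bilinear.has_vector_derivative[OF bounded_bilinear_inner ds ds])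
    have "(\<phi> has_field_derivative (e s \<bullet> e' s + e' s \<bullet> e s) * exp (- 2 * C * s) + exp (- 2 * C * s) * (- 2 * C) * (e s \<bullet> e s)) (at s)"
      unfolding \<phi>_def
      by (rule DERIV_mult[OF i[folded has_real_derivative_iff_has_vector_derivative]])
         (auto intro!: derivative_eq_intros)
    moreover have "(e s \<bullet> e' s + e' s \<bullet> e s) * exp (- 2 * C * s) + exp (- 2 * C * s) * (- 2 * C) * (e s \<bullet> e s)
       = 2 * exp (- 2 * C * s) * (e s \<bullet> e' s - C * (e s \<bullet> e s))"
      by (simp add: inner_commute algebra_simps)
    moreover have "e s \<bullet> e' s - C * (e s \<bullet> e s) \<le> 0"
    proof -
      have "e s \<bullet> e' s \<le> norm (e s) * norm (e' s)" by (rule norm_cauchy_schwarz)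
      also have "\<dots> \<le> norm (e s) * (C * norm (e s))" using le[of s] s t by (intro mult_left_mono) auto
      also have "\<dots> = C * (e s \<bullet> e s)" by (simp add: power2_norm_eq_inner[symmetric] power2_eq_square)
      finally show ?thesis by simp
    qed
    ultimately show "\<exists>y. (\<phi> has_field_derivative y) (at s) \<and> y \<le> 0"
      by (metis exp_ge_zero mult_nonneg_nonpos zero_le_numeral mult_nonneg_nonneg)
  qed
  then have "(e t \<bullet> e t) * exp (- 2 * C * t) \<le> 0" by (simp add: \<phi>_def e0)
  then have "e t \<bullet> e t \<le> 0" by (simp add: mult_le_0_iff)
  then show ?thesis using inner_ge_zero[of "e t"] inner_eq_zero_iff[of "e t"] by (metis antisym)
qed

lemma clinear_holo:
  assumes "Vector_Spaces.linear (*s) (*s) (P :: complex^'n \<Rightarrow> complex^'m)"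
  shows "holo_map U P" "Dmap P x = P" "bounded_linear P"
proof -
  have "linear P" using assms by (intro linearI) (auto simp: clinear_iff scaleR_eq_scale)
  then show b: "bounded_linear P" by (simp add: linear_conv_bounded_linear)
  have d: "(P has_derivative P) (at x)" for x using bounded_linear.has_derivative[OF b has_derivative_ident] .
  then show "holo_map U P" using assms unfolding holo_map_def by blast
  show "Dmap P x = P" by (rule Dmap_eq[OF d])
qed

lemma clinear_basis:
  assumes "Vector_Spaces.linear (*s) (*s) (A :: complex^'n \<Rightarrow> complex^'m)"
  shows "A v = (\<Sum>k\<in>UNIV. v $ k *s A (axis k 1))"
proof -
  have "linear A" by (rule bounded_linear.linear[OF clinear_holo(3)[OF assms]])
  then have "A (\<Sum>k\<in>UNIV. v $ k *s axis k 1) = (\<Sum>k\<in>UNIV. A (v $ k *s axis k 1))" by (rule linear_sum)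
  then show ?thesis using assms by (simp add: basis_expansion clinear_iff)
qed

lemma clinear_chol_basis:
  assumes "\<And>c v. A (c *s v) = c * A v" "\<And>v w. A (v + w) = A v + A w"
  shows "A (v :: complex^'n) = (\<Sum>k\<in>UNIV. v $ k * (A (axis k 1) :: complex))"
proof -
  have "linear A" using assms by (intro linearI) (auto simp: scaleR_eq_scale scaleR_conv_of_real)
  then have "A (\<Sum>k\<in>UNIV. v $ k *s axis k 1) = (\<Sum>k\<in>UNIV. A (v $ k *s axis k 1))" by (rule linear_sum)
  then show ?thesis using assms by (simp add: basis_expansion)
qed

lemma Dmap_sum:
  assumes "\<And>k. holo_map U (f k)" "x \<in> U" "finite A"
  shows "Dmap (\<lambda>x. \<Sum>k\<in>A. f k x) x w = (\<Sum>k\<in>A. Dmap (f k) x w)"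
  using assms(3)
  by (induction A) (auto simp: Dmap_add[OF assms(1) holo_map_sum[OF assms(1)] assms(2)] Dmap_eq[OF has_derivative_const])

lemma Dmap_family:
  fixes X :: "complex^'k \<Rightarrow> complex^'n \<Rightarrow> complex^'m"
  assumes Xl: "\<And>z. z \<in> Q \<Longrightarrow> Vector_Spaces.linear (*s) (*s) (X z)" and Xh: "\<And>v. holo_map Q (\<lambda>z. X z v)"
    and Q: "open Q" and z: "z \<in> Q"
  shows "Dmap (\<lambda>y. X y v) z u = (\<Sum>k\<in>UNIV. v $ k *s Dmap (\<lambda>y. X y (axis k 1)) z u)"
proof -
  have hk: "holo_map Q (\<lambda>y. v $ k *s X y (axis k 1))" for k by (intro holo_map_scale chol_const Xh)
  have "Dmap (\<lambda>y. X y v) z u = Dmap (\<lambda>y. \<Sum>k\<in>UNIV. v $ k *s X y (axis k 1)) z u"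
    by (subst Dmap_cong[OF Q z, of _ "\<lambda>y. \<Sum>k\<in>UNIV. v $ k *s X y (axis k 1)"]) (auto intro: clinear_basis[OF Xl])
  also have "\<dots> = (\<Sum>k\<in>UNIV. Dmap (\<lambda>y. v $ k *s X y (axis k 1)) z u)"
    by (rule Dmap_sum[OF hk z finite])
  also have "\<dots> = (\<Sum>k\<in>UNIV. v $ k *s Dmap (\<lambda>y. X y (axis k 1)) z u)"
    by (intro sum.cong refl) (simp add: Dmap_scale_fun[OF chol_const Xh z] dd_const)
  finally show ?thesis .
qed

text \<open>Product rule for \<open>X (a x) (b x)\<close> when \<open>X z\<close> is linear: expand the second argument in the standard basis.\<close>

lemma holo_family:
  fixes X :: "complex^'k \<Rightarrow> complex^'n \<Rightarrow> complex^'m" and a :: "complex^'l \<Rightarrow> complex^'k"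
  assumes Xl: "\<And>z. z \<in> Q \<Longrightarrow> Vector_Spaces.linear (*s) (*s) (X z)" and Xh: "\<And>v. holo_map Q (\<lambda>z. X z v)"
    and Q: "open Q" and U: "open U" and a: "holo_map U a" "a ` U \<subseteq> Q" and b: "holo_map U b"
  shows "holo_map U (\<lambda>x. X (a x) (b x))"
    and "x \<in> U \<Longrightarrow> Dmap (\<lambda>x. X (a x) (b x)) x w = Dmap (\<lambda>y. X y (b x)) (a x) (Dmap a x w) + X (a x) (Dmap b x w)"
proof -
  have e: "X z v = (\<Sum>k\<in>UNIV. v $ k *s X z (axis k 1))" if "z \<in> Q" for z v by (rule clinear_basis[OF Xl[OF that]])
  have aQ: "a x \<in> Q" if "x \<in> U" for x using a that by blast
  have hk: "holo_map U (\<lambda>x. b x $ k *s X (a x) (axis k 1))" for k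
    by (intro holo_map_scale holo_map_chol[OF b] holo_map_compose(1)[OF Xh a])
  show h: "holo_map U (\<lambda>x. X (a x) (b x))"
    by (rule holo_map_cong[OF holo_map_sum[OF hk] U]) (rule e[OF aQ])
  show "Dmap (\<lambda>x. X (a x) (b x)) x w = Dmap (\<lambda>y. X y (b x)) (a x) (Dmap a x w) + X (a x) (Dmap b x w)" if x: "x \<in> U"
  proof -
    have "Dmap (\<lambda>x. X (a x) (b x)) x w = Dmap (\<lambda>x. \<Sum>k\<in>UNIV. b x $ k *s X (a x) (axis k 1)) x w"
      by (subst Dmap_cong[OF U x, OF e[OF aQ]]) auto
    also have "\<dots> = (\<Sum>k\<in>UNIV. Dmap (\<lambda>x. b x $ k *s X (a x) (axis k 1)) x w)"
      by (rule Dmap_sum[OF hk x finite])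
    also have "\<dots> = (\<Sum>k\<in>UNIV. b x $ k *s Dmap (\<lambda>y. X y (axis k 1)) (a x) (Dmap a x w) + Dmap b x w $ k *s X (a x) (axis k 1))"
      by (intro sum.cong refl)
         (simp add: Dmap_scale_fun[OF holo_map_chol[OF b] holo_map_compose(1)[OF Xh a] x] holo_map_compose(2)[OF Xh a x] Dmap_nth[OF b x])
    also have "\<dots> = Dmap (\<lambda>y. X y (b x)) (a x) (Dmap a x w) + X (a x) (Dmap b x w)"
      by (simp add: sum.distrib Dmap_family[OF Xl Xh Q aQ[OF x], of "b x"] e[OF aQ[OF x], of "Dmap b x w"])
    finally show ?thesis .
  qed
qed

lemma Dmap_bound:
  fixes h :: "complex^'k \<Rightarrow> complex^'m"
  assumes O: "open Q" and h: "holo_map Q h" and c: "cball z0 \<rho> \<subseteq> Q"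
  shows "\<exists>L\<ge>0. \<forall>z\<in>cball z0 \<rho>. norm (h z) \<le> L \<and> (\<forall>w. norm (Dmap h z w) \<le> L * norm w)"
proof -
  have "compact ((\<lambda>s. Dmap h (fst s) (snd s)) ` (cball z0 \<rho> \<times> cball 0 1))"
    by (intro compact_continuous_image Dmap_continuous_on[OF O h] continuous_intros compact_Times compact_cball)
       (use c in auto)
  from bounded_iff[THEN iffD1, OF compact_imp_bounded[OF this]] obtain L where L0: "\<forall>y\<in>(\<lambda>s. Dmap h (fst s) (snd s)) ` (cball z0 \<rho> \<times> cball 0 1). norm y \<le> L"
    by (rule exE)
  have L: "norm (Dmap h z w) \<le> L" if "z \<in> cball z0 \<rho>" "w \<in> cball 0 1" for z w
    using L0 that by force
  have "compact (h ` cball z0 \<rho>)" 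
    by (intro compact_continuous_image continuous_on_subset[OF holo_map_continuous_on[OF h]] c) auto
  from bounded_iff[THEN iffD1, OF compact_imp_bounded[OF this]]
  obtain M where M: "\<And>z. z \<in> cball z0 \<rho> \<Longrightarrow> norm (h z) \<le> M" by blast
  have *: "norm (Dmap h z w) \<le> L * norm w" if z: "z \<in> cball z0 \<rho>" for z w
  proof (cases "w = 0")
    case True then show ?thesis using Dmap_linear(3)[OF h] z c by auto
  next
    case False
    define w' where "w' = (1 / complex_of_real (norm w)) *s w"
    have "w' \<in> cball 0 1" using False by (simp add: w'_def vec_scale_norm norm_divide)
    then have "norm (Dmap h z w') \<le> L" using L z by blast
    moreover have "Dmap h z w' = (1 / complex_of_real (norm w)) *s Dmap h z w"
      unfolding w'_def using Dmap_scale[OF h] z c by blast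
    ultimately show ?thesis using False by (simp add: vec_scale_norm norm_divide field_simps)
  qed
  then have "norm (h z) \<le> max 0 (max L M) \<and> (\<forall>w. norm (Dmap h z w) \<le> max 0 (max L M) * norm w)" if "z \<in> cball z0 \<rho>" for z
  proof (intro conjI allI)
    show "norm (h z) \<le> max 0 (max L M)" using M[OF that] by simp
    show "norm (Dmap h z w) \<le> max 0 (max L M) * norm w" for w
      by (rule order_trans[OF * [OF that] mult_right_mono]) auto
  qed
  then show ?thesis by (intro exI[of _ "max 0 (max L M)"]) auto
qed

text \<open>Bounds and Lipschitz constants on a compact ball; the Lipschitz estimate is the mean value
theorem on that ball.\<close>

lemma holo_family_bound:
  fixes X :: "complex^'k \<Rightarrow> complex^'n \<Rightarrow> complex^'m"
  assumes Xl: "\<And>z. z \<in> Q \<Longrightarrow> Vector_Spaces.linear (*s) (*s) (X z)" and Xh: "\<And>v. holo_map Q (\<lambda>z. X z v)"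
    and Q: "open Q" and c: "cball z0 \<rho> \<subseteq> Q"
  shows "\<exists>L\<ge>0. \<forall>z\<in>cball z0 \<rho>. \<forall>v. norm (X z v) \<le> L * norm v \<and> (\<forall>w. norm (Dmap (\<lambda>z. X z v) z w) \<le> L * norm v * norm w)
     \<and> (\<forall>z'\<in>cball z0 \<rho>. norm (X z v - X z' v) \<le> L * norm v * norm (z - z'))"
proof -
  have "\<forall>k. \<exists>L\<ge>0. \<forall>z\<in>cball z0 \<rho>. norm (X z (axis k 1)) \<le> L \<and> (\<forall>w. norm (Dmap (\<lambda>z. X z (axis k 1)) z w) \<le> L * norm w)"
    using Dmap_bound[OF Q Xh c] by blast
  then obtain L where L: "\<And>k. L k \<ge> 0" "\<And>k z. z \<in> cball z0 \<rho> \<Longrightarrow> norm (X z (axis k 1)) \<le> L k"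
     "\<And>k z w. z \<in> cball z0 \<rho> \<Longrightarrow> norm (Dmap (\<lambda>z. X z (axis k 1)) z w) \<le> L k * norm w" by metis
  define B where "B = (\<Sum>k\<in>UNIV. L k)"
  have B0: "B \<ge> 0" unfolding B_def using L(1) by (simp add: sum_nonneg)
  have zQ: "z \<in> Q" if "z \<in> cball z0 \<rho>" for z using c that by blast
  have 1: "norm (X z v) \<le> B * norm v" if z: "z \<in> cball z0 \<rho>" for z v
  proof -
    have "norm (X z v) = norm (\<Sum>k\<in>UNIV. v $ k *s X z (axis k 1))" using clinear_basis[OF Xl[OF zQ[OF z]]] by metis
    also have "\<dots> \<le> (\<Sum>k\<in>UNIV. norm v * L k)"
      by (intro sum_norm_le) (auto simp: vec_scale_norm intro!: mult_mono L z Finite_Cartesian_Product.norm_nth_le)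
    also have "\<dots> = B * norm v" by (simp add: B_def sum_distrib_left mult.commute)
    finally show ?thesis .
  qed
  have 2: "norm (Dmap (\<lambda>z. X z v) z w) \<le> B * norm v * norm w" if z: "z \<in> cball z0 \<rho>" for z v w
  proof -
    have "norm (Dmap (\<lambda>z. X z v) z w) = norm (\<Sum>k\<in>UNIV. v $ k *s Dmap (\<lambda>y. X y (axis k 1)) z w)"
      by (subst Dmap_family[OF Xl Xh Q zQ[OF z], of v]) auto
    also have "\<dots> \<le> (\<Sum>k\<in>UNIV. norm v * (L k * norm w))"
      by (intro sum_norm_le) (auto simp: vec_scale_norm intro!: mult_mono L z Finite_Cartesian_Product.norm_nth_le)
    also have "\<dots> = B * norm v * norm w" by (simp add: B_def sum_distrib_left sum_distrib_right mult_ac)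
    finally show ?thesis .
  qed
  have 3: "norm (X z v - X z' v) \<le> B * norm v * norm (z - z')" if z: "z \<in> cball z0 \<rho>" "z' \<in> cball z0 \<rho>" for z z' v
  proof (rule differentiable_bound[of "cball z0 \<rho>" "\<lambda>z. X z v" "\<lambda>z. Dmap (\<lambda>z. X z v) z"])
    fix x assume x: "x \<in> cball z0 \<rho>"
    show "((\<lambda>z. X z v) has_derivative Dmap (\<lambda>z. X z v) x) (at x within cball z0 \<rho>)"
      using holo_map_has_derivative[OF Xh zQ[OF x]] has_derivative_at_withinI by blast
    show "onorm (Dmap (\<lambda>z. X z v) x) \<le> B * norm v" by (rule onorm_le) (rule 2[OF x])
  qed (use z in auto)
  show ?thesis using B0 1 2 3 by blast
qed

lemma Dmap_const: "Dmap (\<lambda>x. c) x w = 0"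
  by (subst Dmap_eq[OF has_derivative_const]) simp

lemma has_vector_derivative_chol:
  assumes "(\<gamma> has_vector_derivative \<gamma>') (at t within S)" "chol U f" "\<gamma> t \<in> U"
  shows "((\<lambda>t. f (\<gamma> t)) has_vector_derivative dd f (\<gamma> t) \<gamma>') (at t within S)"
  using has_derivative_compose[OF assms(1)[unfolded has_vector_derivative_def] chol_has_derivative[OF assms(2,3)]]
  by (simp add: has_vector_derivative_def chol_dd_linear(6)[OF assms(2,3)])

lemma has_vector_derivative_holo:
  assumes "(\<gamma> has_vector_derivative \<gamma>') (at t within S)" "holo_map U f" "\<gamma> t \<in> U"
  shows "((\<lambda>t. f (\<gamma> t)) has_vector_derivative Dmap f (\<gamma> t) \<gamma>') (at t within S)"
  using has_derivative_compose[OF assms(1)[unfolded has_vector_derivative_def] holo_map_has_derivative[OF assms(2,3)]]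
  by (simp add: has_vector_derivative_def linear_scale[OF has_derivative_linear[OF holo_map_has_derivative[OF assms(2,3)]]])

subsection \<open>The Frobenius theorem\<close>

text \<open>
The system \<open>du(v) = X (u, v)\<close> is imposed for \<open>v\<close> in the image of a projection \<open>P\<close>, with prescribed
values on the kernel of \<open>P\<close>. The case \<open>P = id\<close> solves total differential equations (and, in one
variable, ordinary ones); a projection along one coordinate straightens a codimension 1
foliation. The norm conditions on \<open>P\<close> keep balls around the origin stable under the rays
\<open>t \<mapsto> x - (1 - t) P x\<close>, along which the system is integrated.
\<close>

context
  fixes Q :: "(complex^'m) set" and X :: "complex^'m \<Rightarrow> complex^'n \<Rightarrow> complex^'m" and P :: "complex^'n \<Rightarrow> complex^'n"
  assumes Q: "open Q"
    and Xl: "\<And>z. z \<in> Q \<Longrightarrow> Vector_Spaces.linear (*s) (*s) (X z)" and Xh: "\<And>v. holo_map Q (\<lambda>z. X z v)"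
    and Pl: "Vector_Spaces.linear (*s) (*s) P" and PP: "\<And>v. P (P v) = P v"
    and Pn: "\<And>v. norm (P v) \<le> norm v" and Pc: "\<And>v. norm (v - P v) \<le> norm v"
begin

definition ray_point :: "real \<Rightarrow> complex^'n \<Rightarrow> complex^'n" where
  "ray_point t x = x - (1 - t) *\<^sub>R P x"

lemma P_linear: "P (v + w) = P v + P w" "P (c *s v) = c *s P v" "P (t *\<^sub>R v) = t *\<^sub>R P v" "P (v - w) = P v - P w"
proof -
  have "linear P" by (rule bounded_linear.linear[OF clinear_holo(3)[OF Pl]])
  then show "P (v + w) = P v + P w" "P (t *\<^sub>R v) = t *\<^sub>R P v" "P (v - w) = P v - P w"
    by (auto simp: linear_add linear_scale linear_diff)
  show "P (c *s v) = c *s P v" using Pl by (simp add: clinear_iff)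
qed

lemma ray_clinear: "Vector_Spaces.linear (*s) (*s) (ray_point t)"
  by (auto simp: clinear_iff ray_point_def P_linear algebra_simps vec_eq_iff)

lemma ray_holo: "holo_map U (ray_point t)" "Dmap (ray_point t) x = ray_point t"
  using clinear_holo[OF ray_clinear] by blast+

lemma P_holo: "holo_map U P" "Dmap P x = P" "continuous_on S P"
  using clinear_holo[OF Pl] by (auto intro: linear_continuous_on)

lemma ray_in_ball:
  assumes "x \<in> ball 0 r" "0 \<le> t" "t \<le> 1" shows "ray_point t x \<in> ball 0 r"
proof -
  have "ray_point t x = (1 - t) *\<^sub>R (x - P x) + t *\<^sub>R x" by (simp add: ray_point_def algebra_simps)
  moreover have "x - P x \<in> ball 0 r" using assms Pc[of x] by auto
  ultimately show ?thesis using convexD[OF convex_ball, of "x - P x" 0 r x "1 - t" t] assms by auto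
qed

lemma ray_simps: "P (ray_point t x) = t *\<^sub>R P x" "ray_point s (ray_point t x) = ray_point (s * t) x"
  "ray_point t x - P (ray_point t x) = x - P x" "ray_point 1 x = x" "P v = v \<Longrightarrow> ray_point t v = t *\<^sub>R v"
  "ray_point 0 x = x - P x"
  by (auto simp: ray_point_def P_linear PP algebra_simps)

lemma ray_continuous: "continuous_on S (\<lambda>s. ray_point (t s) (x s))" if "continuous_on S t" "continuous_on S x"
  unfolding ray_point_def by (intro continuous_intros that continuous_on_compose2[OF P_holo(3)[of UNIV]]) auto

lemma family_scale:
  assumes z: "z \<in> Q" shows "Dmap (\<lambda>y. X y (c *s v)) z w = c *s Dmap (\<lambda>y. X y v) z w"
proof -
  have "Dmap (\<lambda>y. X y (c *s v)) z w = Dmap (\<lambda>y. c *s X y v) z w"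
    using Dmap_cong[OF Q z, of "\<lambda>y. X y (c *s v)" "\<lambda>y. c *s X y v"] Xl by (simp add: clinear_iff)
  also have "\<dots> = c *s Dmap (\<lambda>y. X y v) z w"
    using Dmap_scale_fun[OF chol_const Xh z] by (simp add: dd_const)
  finally show ?thesis .
qed

text \<open>Differentiation under the integral sign: the integrand is holomorphic in \<open>x\<close> with a derivative that
is jointly continuous in \<open>x\<close> and \<open>t\<close>.\<close>

lemma ray_integral_holo:
  assumes u: "holo_map (ball 0 r) u" "u ` ball 0 r \<subseteq> Q"
  shows "holo_map (ball 0 r) (\<lambda>x. integral {0..1} (\<lambda>t. X (u (ray_point t x)) (P x)))"
    and "x \<in> ball 0 r \<Longrightarrow> continuous_on {0..1} (\<lambda>t. X (u (ray_point t x)) (P x))"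
proof -
  define q where "q t x = X (u (ray_point t x)) (P x)" for t x
  define h where "h k z = X z (axis k 1)" for k z
  have hh: "holo_map Q (h k)" for k using Xh by (simp add: h_def[abs_def])
  have Xe: "X z v = (\<Sum>k\<in>UNIV. v $ k *s h k z)" if "z \<in> Q" for z v
    unfolding h_def by (rule clinear_basis[OF Xl[OF that]])
  have Df: "Dmap (\<lambda>y. X y w) z v = (\<Sum>k\<in>UNIV. w $ k *s Dmap (h k) z v)" if "z \<in> Q" for z w v
    unfolding h_def[abs_def] by (rule Dmap_family[OF Xl Xh Q that])
  have B: "open (ball (0::complex^'n) r)" by simp
  have ur: "holo_map (ball 0 r) (\<lambda>x. u (ray_point t x))" "(\<lambda>x. u (ray_point t x)) ` ball 0 r \<subseteq> Q"
      "x \<in> ball 0 r \<Longrightarrow> Dmap (\<lambda>x. u (ray_point t x)) x v = Dmap u (ray_point t x) (ray_point t v)"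
    if "t \<in> {0..1}" for t x v
  proof -
    have im: "ray_point t ` ball 0 r \<subseteq> ball 0 r" using ray_in_ball that by auto
    show "holo_map (ball 0 r) (\<lambda>x. u (ray_point t x))" by (rule holo_map_compose(1)[OF u(1) ray_holo(1) im])
    show "(\<lambda>x. u (ray_point t x)) ` ball 0 r \<subseteq> Q" using im u(2) by blast
    show "x \<in> ball 0 r \<Longrightarrow> Dmap (\<lambda>x. u (ray_point t x)) x v = Dmap u (ray_point t x) (ray_point t v)"
      using holo_map_compose(2)[OF u(1) ray_holo(1) im] by (simp add: ray_holo(2))
  qed
  define D where "D t x v = (\<Sum>k\<in>UNIV. P x $ k *s Dmap (h k) (u (ray_point t x)) (Dmap u (ray_point t x) (ray_point t v)))
       + (\<Sum>k\<in>UNIV. P v $ k *s h k (u (ray_point t x)))" for t x v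
  have qh: "holo_map (ball 0 r) (q t)" and qD: "x \<in> ball 0 r \<Longrightarrow> Dmap (q t) x v = D t x v" if t: "t \<in> {0..1}" for t x v
  proof -
    show "holo_map (ball 0 r) (q t)" unfolding q_def
      by (rule holo_family(1)[OF Xl Xh Q B ur(1,2)[OF t] P_holo(1)])
    show "Dmap (q t) x v = D t x v" if x: "x \<in> ball 0 r"
    proof -
      have uq: "u (ray_point t x) \<in> Q" using ur(2)[OF t] x by blast
      show ?thesis unfolding q_def D_def 
        by (subst holo_family(2)[OF Xl Xh Q B ur(1,2)[OF t] P_holo(1) x])
           (auto simp: ur(3)[OF t x] P_holo(2) Xe[OF uq] Df[OF uq])
    qed
  qed
  define fx where "fx x t = Blinfun (D t x)" for x t
  have bl: "bounded_linear (D t x)" if "t \<in> {0..1}" "x \<in> ball 0 r" for t x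
  proof -
    have "Dmap (q t) x = D t x" using qD[OF that] by (rule ext)
    then show ?thesis using has_derivative_bounded_linear[OF holo_map_has_derivative[OF qh[OF that(1)] that(2)]] by simp
  qed
  have ap: "blinfun_apply (fx x t) = D t x" if "t \<in> {0..1}" "x \<in> ball 0 r" for t x
    unfolding fx_def using bounded_linear_Blinfun_apply[OF bl[OF that]] .
  have cont_pt: "continuous_on (ball 0 r \<times> {0..1}) (\<lambda>s. u (ray_point (snd s) (fst s)))"
    by (rule continuous_on_compose2[OF holo_map_continuous_on[OF u(1)] ray_continuous])
       (auto intro!: continuous_intros ray_in_ball simp del: mem_ball)
  have imQ: "(\<lambda>s. u (ray_point (snd s) (fst s))) ` (ball 0 r \<times> {0..1}) \<subseteq> Q"
    using ur(2) by force
  have contD: "continuous_on (ball 0 r \<times> {0..1}) (\<lambda>s. D (snd s) (fst s) v)" for v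
  proof -
    have sc: "continuous_on S (\<lambda>s. c s *s w s)" if "continuous_on S c" "continuous_on S w"
      for S :: "((complex^'n) \<times> real) set" and c and w :: "_ \<Rightarrow> complex^'m"
      unfolding vector_scalar_mult_def by (intro continuous_on_vec_lambda continuous_intros that)
    have Pk: "continuous_on (ball 0 r \<times> {0..1::real}) (\<lambda>s. P (fst s) $ k)" for k
      by (intro continuous_intros continuous_on_compose2[OF P_holo(3)[of UNIV]]) auto
    have Du: "continuous_on (ball 0 r \<times> {0..1}) (\<lambda>s. Dmap u (ray_point (snd s) (fst s)) (ray_point (snd s) v))"
      by (rule Dmap_continuous_on[OF B u(1)])
         (auto intro!: continuous_intros ray_continuous ray_in_ball simp del: mem_ball)
    show ?thesis unfolding D_def
      by (intro continuous_intros sc Pk Dmap_continuous_on[OF Q hh cont_pt imQ Du]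
            continuous_on_compose2[OF holo_map_continuous_on[OF hh] cont_pt imQ])
  qed
  have contq: "continuous_on {0..1} (\<lambda>t. q t x)" if x: "x \<in> ball 0 r" for x
  proof -
    have c: "continuous_on {0..1} (\<lambda>t. u (ray_point t x))"
      by (rule continuous_on_compose2[OF cont_pt, of _ "\<lambda>t. (x, t)", simplified]) (use x in \<open>auto intro!: continuous_intros\<close>)
    have im: "(\<lambda>t. u (ray_point t x)) ` {0..1} \<subseteq> Q" using ur(2) x by blast
    have "continuous_on {0..1} (\<lambda>t. \<Sum>k\<in>UNIV. P x $ k *s h k (u (ray_point t x)))"
      by (intro continuous_intros bounded_linear.continuous_on[OF bounded_linear_scale_right] 
           continuous_on_compose2[OF holo_map_continuous_on[OF hh] c im])
    then show ?thesis
      by (rule continuous_on_cong[THEN iffD1, rotated -1]) (use im in \<open>auto simp: q_def intro!: Xe[symmetric]\<close>)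
  qed
  then show "x \<in> ball 0 r \<Longrightarrow> continuous_on {0..1} (\<lambda>t. X (u (ray_point t x)) (P x))" by (simp add: q_def)
  show "holo_map (ball 0 r) (\<lambda>x. integral {0..1} (\<lambda>t. X (u (ray_point t x)) (P x)))"
    unfolding holo_map_def
  proof
    fix x :: "complex^'n" assume x: "x \<in> ball 0 r"
    have contfx: "continuous_on (ball 0 r \<times> cbox 0 1) (\<lambda>(x, t). fx x t)"
    proof (rule continuous_on_blinfun_componentwise)
      fix i :: "complex^'n"
      show "continuous_on (ball 0 r \<times> cbox 0 1) (\<lambda>s. blinfun_apply (case s of (x, t) \<Rightarrow> fx x t) i)"
        by (rule continuous_on_cong[THEN iffD1, OF refl _ contD[of i, folded cbox_interval]]) (auto simp: ap simp del: mem_ball)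
    qed
    have "((\<lambda>x. integral (cbox 0 1) (\<lambda>t. q t x)) has_derivative blinfun_apply (integral (cbox 0 1) (fx x))) (at x within ball 0 r)"
    proof (rule leibniz_rule[OF _ _ contfx x convex_ball])
      show "((\<lambda>x. q t x) has_derivative blinfun_apply (fx x t)) (at x within ball 0 r)" if "x \<in> ball 0 r" "t \<in> cbox 0 1" for x t
      proof -
        have t: "t \<in> {0..1}" using that(2) by simp
        have "Dmap (q t) x = D t x" using qD[OF t that(1)] by (rule ext)
        then show ?thesis using holo_map_has_derivative[OF qh[OF t] that(1)] ap[OF t that(1)] by (simp add: has_derivative_at_withinI)
      qed
      show "(\<lambda>t. q t x) integrable_on cbox 0 1" if "x \<in> ball 0 r" for x
        using integrable_continuous_interval[OF contq[OF that]] by simp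
    qed
    then have d: "((\<lambda>x. integral {0..1} (\<lambda>t. q t x)) has_derivative blinfun_apply (integral {0..1} (fx x))) (at x)"
      using at_within_open[OF x open_ball] by simp
    have int: "fx x integrable_on {0..1}"
      by (rule integrable_continuous_interval, rule continuous_on_compose2[OF contfx, of _ "\<lambda>t. (x, t)", simplified])
         (use x in \<open>auto intro!: continuous_intros\<close>)
    have ev: "blinfun_apply (integral {0..1} (fx x)) v = integral {0..1} (\<lambda>t. D t x v)" for v
    proof -
      have "blinfun_apply (integral {0..1} (fx x)) v = integral {0..1} (\<lambda>t. blinfun_apply (fx x t) v)"
        using integral_linear[OF int blinfun.bounded_linear_left, of v] 
        by (simp add: o_def)
      also have "\<dots> = integral {0..1} (\<lambda>t. D t x v)"
        by (rule integral_cong) (use ap x in auto)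
      finally show ?thesis .
    qed
    have Dint: "(\<lambda>t. D t x v) integrable_on {0..1}" for v
      by (rule integrable_continuous_interval, rule continuous_on_compose2[OF contD[of v], of _ "\<lambda>t. (x, t)", simplified])
         (use x in \<open>auto intro!: continuous_intros\<close>)
    have sc: "blinfun_apply (integral {0..1} (fx x)) (c *s v) = c *s blinfun_apply (integral {0..1} (fx x)) v" for c v
    proof -
      have "integral {0..1} (\<lambda>t. D t x (c *s v)) = integral {0..1} (\<lambda>t. c *s D t x v)"
      proof (rule integral_cong)
        fix t :: real assume t: "t \<in> {0..1}"
        show "D t x (c *s v) = c *s D t x v"
          using Dmap_scale[OF qh[OF t] x, of c v] by (simp add: qD[OF t x])
      qed
      also have "\<dots> = c *s integral {0..1} (\<lambda>t. D t x v)"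
        using integral_linear[OF Dint[of v] bounded_linear_scale_right[of c]] by (simp add: o_def)
      finally show ?thesis by (simp add: ev)
    qed
    then have "Vector_Spaces.linear (*s) (*s) (blinfun_apply (integral {0..1} (fx x)))"
      by (auto simp: clinear_iff blinfun.add_right)
    then show "\<exists>f'. ((\<lambda>x. integral {0..1} (\<lambda>t. X (u (ray_point t x)) (P x))) has_derivative f') (at x) \<and> Vector_Spaces.linear (*s) (*s) f'"
      using d unfolding q_def by blast
  qed
qed

text \<open>Picard iteration for the integrated equation. On a small ball the right-hand side is a contraction
with factor \<open>1/2\<close>, so the iterates converge uniformly and the limit stays holomorphic. No
integrability condition enters here: any \<open>X\<close> can be integrated along rays.\<close>

lemma frobenius_fixpoint:
  assumes G: "open G" "0 \<in> G" and g: "holo_map G g" "g 0 \<in> Q"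
  obtains r \<rho> u where "r > 0" "ball 0 r \<subseteq> G" "cball (g 0) \<rho> \<subseteq> Q" "holo_map (ball 0 r) u" "u ` ball 0 r \<subseteq> cball (g 0) \<rho>"
    "\<And>x. x \<in> ball 0 r \<Longrightarrow> u x = g (x - P x) + integral {0..1} (\<lambda>t. X (u (ray_point t x)) (P x))"
proof -
  define z0 where "z0 = g 0"
  obtain \<rho> where \<rho>: "\<rho> > 0" "cball z0 \<rho> \<subseteq> Q" using Q g(2) open_contains_cball z0_def by blast
  obtain L where L: "L \<ge> 0" "\<And>z v. z \<in> cball z0 \<rho> \<Longrightarrow> norm (X z v) \<le> L * norm v"
     "\<And>z z' v. z \<in> cball z0 \<rho> \<Longrightarrow> z' \<in> cball z0 \<rho> \<Longrightarrow> norm (X z v - X z' v) \<le> L * norm v * norm (z - z')"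
    using holo_family_bound[OF Xl Xh Q \<rho>(2)] by blast
  obtain \<delta>1 where \<delta>1: "\<delta>1 > 0" "ball 0 \<delta>1 \<subseteq> G" using G open_contains_ball by blast
  have "isCont g 0" using holo_map_continuous_on[OF g(1)] G by (simp add: continuous_on_eq_continuous_at)
  then obtain \<delta>2 where \<delta>2: "\<delta>2 > 0" "\<And>x. dist x 0 < \<delta>2 \<Longrightarrow> dist (g x) (g 0) < \<rho> / 2"
    unfolding continuous_at_eps_delta using \<rho>(1) half_gt_zero by blast
  define r where "r = min (min \<delta>1 \<delta>2) (min (\<rho> / (2 * (L + 1))) (1 / (2 * (L + 1))))"
  have r: "r > 0" using \<delta>1 \<delta>2 \<rho> L by (simp add: r_def)
  have "L * r \<le> L * (\<rho> / (2 * (L + 1)))" using L(1) by (intro mult_left_mono) (simp add: r_def)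
  also have "\<dots> \<le> \<rho> / 2" using L(1) \<rho>(1) by (simp add: field_simps)
  finally have Lr1: "L * r \<le> \<rho> / 2" .
  have "L * r \<le> L * (1 / (2 * (L + 1)))" using L(1) by (intro mult_left_mono) (simp add: r_def)
  also have "\<dots> \<le> 1 / 2" using L(1) by (simp add: field_simps)
  finally have Lr2: "L * r \<le> 1 / 2" .
  define \<Omega> where "\<Omega> = ball (0 :: complex^'n) r"
  have \<Omega>G: "\<Omega> \<subseteq> G" using \<delta>1 by (auto simp: \<Omega>_def r_def)
  have o\<Omega>: "open \<Omega>" by (simp add: \<Omega>_def)
  have Pc\<Omega>: "x - P x \<in> \<Omega>" if "x \<in> \<Omega>" for x using that Pc[of x] by (auto simp: \<Omega>_def)
  have gz: "norm (g (x - P x) - z0) \<le> \<rho> / 2" if "x \<in> \<Omega>" for x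
  proof -
    have "norm (x - P x) < r" using that Pc[of x] by (auto simp: \<Omega>_def)
    then have "dist (x - P x) 0 < \<delta>2" by (simp add: r_def)
    then show ?thesis using \<delta>2(2) by (force simp: z0_def dist_norm)
  qed
  have LP: "L * norm (P x) \<le> L * r" if "x \<in> \<Omega>" for x
    using that Pn[of x] L(1) by (intro mult_left_mono) (auto simp: \<Omega>_def)
  define T where "T u x = g (x - P x) + integral {0..1} (\<lambda>t. X (u (ray_point t x)) (P x))" for u x
  define A where "A u \<longleftrightarrow> holo_map \<Omega> u \<and> u ` \<Omega> \<subseteq> cball z0 \<rho>" for u
  have AQ: "u ` \<Omega> \<subseteq> Q" if "A u" for u using that \<rho>(2) by (auto simp: A_def)
  have Ain: "u (ray_point t x) \<in> cball z0 \<rho>" if "A u" "x \<in> \<Omega>" "t \<in> {0..1}" for u t x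
    using that ray_in_ball[of x r t] by (auto simp: A_def \<Omega>_def simp del: mem_ball mem_cball)
  have Acont: "continuous_on {0..1} (\<lambda>t. X (u (ray_point t x)) (P x))" if "A u" "x \<in> \<Omega>" for u x
    using ray_integral_holo(2)[of r u x] that AQ[OF that(1)] by (simp add: A_def \<Omega>_def)
  have AT: "A (T u)" if u: "A u" for u
  proof -
    have "holo_map \<Omega> (T u)" unfolding T_def \<Omega>_def
      by (intro holo_map_add ray_integral_holo(1) holo_map_compose(1)[OF g(1)] holo_map_diff holo_map_id P_holo(1))
         (use u AQ[OF u] \<Omega>G Pc\<Omega> in \<open>auto simp: A_def \<Omega>_def simp del: mem_ball\<close>)
    moreover have "norm (T u x - z0) \<le> \<rho>" if x: "x \<in> \<Omega>" for x
    proof -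
      have "norm (integral {0..1} (\<lambda>t. X (u (ray_point t x)) (P x))) \<le> (L * r) * (1 - 0)"
        by (rule integral_bound[OF _ Acont[OF u x]]) (use L(2)[OF Ain[OF u x]] LP[OF x] in \<open>auto intro: order_trans\<close>)
      moreover have "norm (T u x - z0) \<le> norm (g (x - P x) - z0) + norm (integral {0..1} (\<lambda>t. X (u (ray_point t x)) (P x)))"
        unfolding T_def
        using norm_triangle_ineq[of "g (x - P x) - z0" "integral {0..1} (\<lambda>t. X (u (ray_point t x)) (P x))"]
        by (simp add: algebra_simps)
      ultimately show ?thesis using gz[OF x] Lr1 by simp
    qed
    ultimately show ?thesis unfolding A_def by (auto simp: dist_norm norm_minus_commute)
  qed
  have Tcontr: "norm (T u x - T w x) \<le> e / 2" 
    if u: "A u" and w: "A w" and x: "x \<in> \<Omega>" and e: "\<And>y. y \<in> \<Omega> \<Longrightarrow> norm (u y - w y) \<le> e" for u w x e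
  proof -
    have e0: "e \<ge> 0" using order_trans[OF norm_ge_zero e[OF x]] .
    have "T u x - T w x = integral {0..1} (\<lambda>t. X (u (ray_point t x)) (P x) - X (w (ray_point t x)) (P x))"
      unfolding T_def using Acont[OF u x] Acont[OF w x]
      by (simp add: integral_diff integrable_continuous_interval)
    also have "norm \<dots> \<le> (e / 2) * (1 - 0)"
    proof (rule integral_bound)
      show "continuous_on {0..1} (\<lambda>t. X (u (ray_point t x)) (P x) - X (w (ray_point t x)) (P x))"
        by (intro continuous_intros Acont u w x)
      fix t :: real assume t: "t \<in> {0..1}"
      have "norm (X (u (ray_point t x)) (P x) - X (w (ray_point t x)) (P x)) \<le> L * norm (P x) * norm (u (ray_point t x) - w (ray_point t x))"
        by (rule L(3)[OF Ain[OF u x t] Ain[OF w x t]])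
      also have "\<dots> \<le> (1 / 2) * e"
        using LP[OF x] Lr2 e[of "ray_point t x"] ray_in_ball[of x r t] x t L(1)
        by (intro mult_mono) (auto simp: \<Omega>_def simp del: mem_ball)
      finally show "norm (X (u (ray_point t x)) (P x) - X (w (ray_point t x)) (P x)) \<le> e / 2" by simp
    qed simp
    finally show ?thesis by simp
  qed
  define s where "s n = (T ^^ n) (\<lambda>_. z0)" for n
  have sA: "A (s n)" for n
    by (induction n) (use \<rho> AT in \<open>auto simp: s_def A_def holo_map_const\<close>)
  have sS: "s (Suc n) = T (s n)" for n by (simp add: s_def)
  have diff: "\<forall>x\<in>\<Omega>. norm (s (Suc n) x - s n x) \<le> 2 * \<rho> * (1 / 2) ^ n" for n
  proof (induction n)
    case 0
    have "norm (s 1 x - s 0 x) \<le> 2 * \<rho>" if "x \<in> \<Omega>" for x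
    proof -
      have "norm (s n x - z0) \<le> \<rho>" for n using sA[of n] that by (auto simp: A_def dist_norm norm_minus_commute)
      from this[of 0] this[of 1] show ?thesis using norm_triangle_ineq4[of "s 1 x - z0" "s 0 x - z0"] by simp
    qed
    then show ?case by simp
  next
    case (Suc n)
    then show ?case using Tcontr[OF sA sA, of _ "Suc n" n "2 * \<rho> * (1 / 2) ^ n"] unfolding sS by auto
  qed
  define d where "d = (\<lambda>x. suminf (\<lambda>i. s (Suc i) x - s i x))"
  define u where "u x = z0 + d x" for x
  have uls: "uniform_limit \<Omega> (\<lambda>n x. \<Sum>i<n. (s (Suc i) x - s i x)) d sequentially"
    unfolding d_def
  proof (rule Weierstrass_m_test)
    show "summable (\<lambda>n. 2 * \<rho> * (1 / 2) ^ n)" by (intro summable_mult summable_geometric) simp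
  qed (use diff in blast)
  have ul0: "uniform_limit \<Omega> (\<lambda>n x. s n x - z0) d sequentially"
  proof -
    have "(\<Sum>i<n. (s (Suc i) x - s i x)) = s n x - z0" for n x
      using sum_lessThan_telescope[of "\<lambda>i. s i x" n] by (simp add: s_def)
    then show ?thesis using uls by simp
  qed
  have ul: "uniform_limit \<Omega> s u sequentially"
  proof -
    have "uniform_limit \<Omega> (\<lambda>n x. z0 + (s n x - z0)) (\<lambda>x. z0 + d x) sequentially"
      by (intro uniform_limit_add ul0 uniform_limit_const)
    then show ?thesis by (simp add: u_def[abs_def])
  qed
  have pt: "(\<lambda>n. s n x) \<longlonglongrightarrow> u x" if "x \<in> \<Omega>" for x using tendsto_uniform_limitI[OF ul that] .
  have uA: "A u" unfolding A_def
  proof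
    show "u ` \<Omega> \<subseteq> cball z0 \<rho>"
    proof safe
      fix x assume x: "x \<in> \<Omega>"
      show "u x \<in> cball z0 \<rho>"
        by (rule Lim_in_closed_set[OF closed_cball _ _ pt[OF x]]) (use sA x in \<open>auto simp: A_def image_subset_iff intro!: always_eventually\<close>)
    qed
    show "holo_map \<Omega> u" unfolding holo_map_iff_chol
    proof
      fix k
      have ulk: "uniform_limit \<Omega> (\<lambda>n x. s n x $ k) (\<lambda>x. u x $ k) sequentially"
        by (rule bounded_linear.uniform_limit[OF bounded_linear_vec_nth ul])
      show "chol \<Omega> (\<lambda>x. u x $ k)"
      proof (rule chol_limit(1)[OF o\<Omega>])
        show "chol \<Omega> (\<lambda>x. s n x $ k)" for n using sA[of n] holo_map_chol by (auto simp: A_def)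
        show "\<exists>r>0. ball x r \<subseteq> \<Omega> \<and> uniform_limit (ball x r) (\<lambda>n x. s n x $ k) (\<lambda>x. u x $ k) sequentially" if "x \<in> \<Omega>" for x
          using openE[OF o\<Omega> that] uniform_limit_on_subset[OF ulk] by metis
      qed
    qed
  qed
  have fp: "u x = T u x" if x: "x \<in> \<Omega>" for x
  proof -
    have "(\<lambda>n. T (s n) x) \<longlonglongrightarrow> T u x"
    proof (rule tendstoI)
      fix e :: real assume e: "e > 0"
      show "\<forall>\<^sub>F n in sequentially. dist (T (s n) x) (T u x) < e"
        using uniform_limitD[OF ul e]
      proof eventually_elim
        case (elim n)
        have "norm (T (s n) x - T u x) \<le> e / 2"
          by (rule Tcontr[OF sA uA x]) (use elim in \<open>auto simp: dist_norm less_imp_le\<close>)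
        then show ?case using e by (simp add: dist_norm)
      qed
    qed
    moreover have "(\<lambda>n. T (s n) x) \<longlonglongrightarrow> u x" using LIMSEQ_Suc[OF pt[OF x]] by (simp add: sS)
    ultimately show ?thesis using LIMSEQ_unique by blast
  qed
  show ?thesis
    by (rule that[of r \<rho> u]) (use r \<Omega>G \<rho> uA fp in \<open>auto simp: A_def \<Omega>_def z0_def T_def simp del: mem_ball\<close>)
qed

text \<open>The ray solution satisfies the system in the radial direction by construction. For another direction \<open>v\<close>,
the defect \<open>e = du(v) - X (u, v)\<close> satisfies, thanks to the commutation condition, a homogeneous linear
differential equation along each ray after multiplication by the ray parameter; being zero at the start,
it vanishes.\<close>

theorem frobenius:
  assumes G: "open G" "0 \<in> G" and g: "holo_map G g" "g 0 \<in> Q"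
    and comm: "\<And>z v w. z \<in> Q \<Longrightarrow> P v = v \<Longrightarrow> P w = w \<Longrightarrow> Dmap (\<lambda>z. X z v) z (X z w) = Dmap (\<lambda>z. X z w) z (X z v)"
  obtains r u where "r > 0" "ball 0 r \<subseteq> G" "holo_map (ball 0 r) u" "u ` ball 0 r \<subseteq> Q"
    "\<And>x. x \<in> ball 0 r \<Longrightarrow> P x = 0 \<Longrightarrow> u x = g x"
    "\<And>x v. x \<in> ball 0 r \<Longrightarrow> P v = v \<Longrightarrow> Dmap u x v = X (u x) v"
proof -
  obtain r \<rho> u where r: "r > 0" "ball 0 r \<subseteq> G" and \<rho>: "cball (g 0) \<rho> \<subseteq> Q" and u: "holo_map (ball 0 r) u"
    and u\<rho>: "u ` ball 0 r \<subseteq> cball (g 0) \<rho>"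
    and fp: "\<And>x. x \<in> ball 0 r \<Longrightarrow> u x = g (x - P x) + integral {0..1} (\<lambda>t. X (u (ray_point t x)) (P x))"
    using frobenius_fixpoint[OF G g] by blast
  have uQ: "u ` ball 0 r \<subseteq> Q" using \<rho> u\<rho> by blast
  have B: "open (ball (0::complex^'n) r)" by simp
  have dray: "((\<lambda>t. ray_point t x) has_vector_derivative P x) (at t within S)" for t x S
    unfolding ray_point_def by (auto intro!: derivative_eq_intros)
  have Pray: "t *\<^sub>R P x = P (ray_point t x)" for t x by (simp add: ray_simps)
  have X0: "X z (t *\<^sub>R v) = t *\<^sub>R X z v" if "z \<in> Q" for z t v
    using clinear_holo(3)[OF Xl[OF that]] by (simp add: bounded_linear.linear linear_scale)
  \<comment> \<open>the equation in the radial direction\<close>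
  have radial: "Dmap u x (P x) = X (u x) (P x)" if x: "x \<in> ball 0 r" for x
  proof -
    define F where "F t = X (u (ray_point t x)) (P x)" for t
    have cF: "continuous_on {0..1} F" unfolding F_def by (rule ray_integral_holo(2)[OF u uQ x])
    define \<Phi> where "\<Phi> \<tau> = integral {0..\<tau>} F" for \<tau>
    have d\<Phi>: "(\<Phi> has_vector_derivative F \<tau>) (at \<tau> within {0..1})" if "\<tau> \<in> {0..1}" for \<tau>
      unfolding \<Phi>_def by (rule integral_has_vector_derivative[OF cF that])
    have eq: "u (ray_point \<tau> x) = g (x - P x) + \<Phi> \<tau>" if \<tau>: "\<tau> \<in> {0..1}" for \<tau>
    proof -
      have rx: "ray_point \<tau> x \<in> ball 0 r" using ray_in_ball[OF x] \<tau> by simp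
      have "((\<lambda>t. \<tau> *\<^sub>R F (\<tau> * t)) has_integral (\<Phi> (\<tau> * 1) - \<Phi> (\<tau> * 0))) {0..1}"
      proof (rule fundamental_theorem_of_calculus)
        fix t :: real assume t: "t \<in> {0..1}"
        have t1: "\<tau> * t \<in> {0..1}" using \<tau> t by (auto intro: mult_le_one)
        have im: "(\<lambda>t. \<tau> * t) ` {0..1} \<subseteq> {0..1}" using \<tau> by (auto intro: mult_le_one)
        have "((\<lambda>t. \<tau> * t) has_vector_derivative \<tau>) (at t within {0..1})" by (auto intro!: derivative_eq_intros)
        from vector_diff_chain_within[OF this has_vector_derivative_within_subset[OF d\<Phi>[OF t1] im]]
        show "((\<lambda>t. \<Phi> (\<tau> * t)) has_vector_derivative \<tau> *\<^sub>R F (\<tau> * t)) (at t within {0..1})" by (simp add: o_def)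
      qed simp
      then have "integral {0..1} (\<lambda>t. \<tau> *\<^sub>R F (\<tau> * t)) = \<Phi> \<tau>" by (auto simp: \<Phi>_def dest: integral_unique)
      moreover have "integral {0..1} (\<lambda>t. X (u (ray_point t (ray_point \<tau> x))) (P (ray_point \<tau> x))) = integral {0..1} (\<lambda>t. \<tau> *\<^sub>R F (\<tau> * t))"
      proof (rule integral_cong)
        fix t :: real assume t: "t \<in> {0..1}"
        have "u (ray_point (t * \<tau>) x) \<in> Q" using ray_in_ball[OF x, of "t * \<tau>"] uQ t \<tau> mult_le_one[of t \<tau>] by (simp add: image_subset_iff)
        then show "X (u (ray_point t (ray_point \<tau> x))) (P (ray_point \<tau> x)) = \<tau> *\<^sub>R F (\<tau> * t)"
          by (simp add: ray_simps F_def X0 mult.commute)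
      qed
      ultimately show ?thesis by (simp only: fp[OF rx] ray_simps(3))
    qed
    have 1: "((\<lambda>\<tau>. u (ray_point \<tau> x)) has_vector_derivative F 1) (at 1 within {0..1})"
      by (rule has_vector_derivative_transform[where f = "\<lambda>\<tau>. g (x - P x) + \<Phi> \<tau>"])
         (use eq d\<Phi>[of 1] in \<open>auto intro!: derivative_eq_intros\<close>)
    have "((\<lambda>\<tau>. u (ray_point \<tau> x)) has_vector_derivative Dmap u (ray_point 1 x) (P x)) (at 1 within {0..1})"
      by (rule has_vector_derivative_holo[OF dray u]) (use x ray_simps in simp)
    then have "Dmap u (ray_point 1 x) (P x) = F 1"
      using vector_derivative_unique_within_closed_interval[of 0 1 1] 1 by simp
    then show ?thesis by (simp add: F_def ray_simps)
  qed
  have main: "Dmap u x v = X (u x) v" if x: "x \<in> ball 0 r" and v: "P v = v" for x v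
  proof -
    define e where "e z = Dmap u z v - X (u z) v" for z
    have Xu: "holo_map (ball 0 r) (\<lambda>z. X (u z) v)" "holo_map (ball 0 r) (\<lambda>z. X (u z) (P z))"
      using holo_family(1)[OF Xl Xh Q B u uQ holo_map_const] holo_family(1)[OF Xl Xh Q B u uQ P_holo(1)] by auto
    have DuP: "holo_map (ball 0 r) (\<lambda>z. Dmap u z (P z))"
      "z \<in> ball 0 r \<Longrightarrow> Dmap (\<lambda>z. Dmap u z (P z)) z w = Dmap (\<lambda>z'. Dmap u z' (P z)) z w + Dmap u z (P w)" for z w
      using holo_family[OF Dmap_clinear[OF u] holo_map_Dmap(1)[OF B u] B B holo_map_id _ P_holo(1)]
      by (auto simp: Dmap_eq[OF has_derivative_ident] P_holo(2))
    have eh: "holo_map (ball 0 r) e" unfolding e_def by (intro holo_map_diff holo_map_Dmap(1)[OF B u] Xu)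
    have Dsub: "Dmap (\<lambda>z. a z - b z) z w = Dmap a z w - Dmap b z w" 
      if "holo_map (ball 0 r) a" "holo_map (ball 0 r) b" "z \<in> ball 0 r" for a b :: "complex^'n \<Rightarrow> complex^'m" and z w
      by (simp add: vec_eq_iff Dmap_nth[OF holo_map_diff[OF that(1,2)] that(3)] Dmap_nth[OF that(1,3)] Dmap_nth[OF that(2,3)]
            dd_diff[OF holo_map_chol[OF that(1)] holo_map_chol[OF that(2)] that(3)])
    \<comment> \<open>differentiate the radial equation along v; the commutation condition cancels all terms without the defect\<close>
    have key: "e z + Dmap e z (P z) = Dmap (\<lambda>y. X y (P z)) (u z) (e z)" if z: "z \<in> ball 0 r" for z
    proof -
      have uz: "u z \<in> Q" using uQ z by blast
      have "Dmap (\<lambda>z. Dmap u z (P z)) z v = Dmap (\<lambda>z. X (u z) (P z)) z v"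
        using Dmap_cong[OF B z radial] by simp
      then have star: "Dmap (\<lambda>z'. Dmap u z' (P z)) z v + Dmap u z v = Dmap (\<lambda>y. X y (P z)) (u z) (Dmap u z v) + X (u z) v"
        by (simp add: DuP(2)[OF z] holo_family(2)[OF Xl Xh Q B u uQ P_holo(1) z] P_holo(2) v)
      have De: "Dmap e z (P z) = Dmap (\<lambda>z'. Dmap u z' v) z (P z) - Dmap (\<lambda>y. X y v) (u z) (Dmap u z (P z))"
      proof -
        have "Dmap (\<lambda>z. X (u z) v) z (P z) = Dmap (\<lambda>y. X y v) (u z) (Dmap u z (P z))"
          by (rule holo_map_compose(2)[OF Xh u uQ z])
        then show ?thesis unfolding e_def by (subst Dsub[OF holo_map_Dmap(1)[OF B u] Xu(1) z]) simp
      qed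
      have lin: "Dmap (\<lambda>y. X y (P z)) (u z) (a - b) = Dmap (\<lambda>y. X y (P z)) (u z) a - Dmap (\<lambda>y. X y (P z)) (u z) b" for a b
        by (rule Dmap_linear(2)[OF Xh uz])
      show ?thesis
        using star De comm[OF uz v PP[of z]] holo_map_Dmap(3)[OF B u z, of v "P z"] radial[OF z]
        by (simp add: e_def lin algebra_simps)
    qed
    obtain L where L: "L \<ge> 0" "\<And>z v w. z \<in> cball (g 0) \<rho> \<Longrightarrow> norm (Dmap (\<lambda>z. X z v) z w) \<le> L * norm v * norm w"
      using holo_family_bound[OF Xl Xh Q \<rho>] by blast
    have rin: "ray_point t x \<in> ball 0 r" if "t \<in> {0..1}" for t using ray_in_ball[OF x] that by simp
    \<comment> \<open>the factor t turns the key equation into a linear one with bounded coefficients\<close>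
    define \<epsilon> where "\<epsilon> t = t *\<^sub>R e (ray_point t x)" for t
    define \<epsilon>' where "\<epsilon>' t = Dmap (\<lambda>y. X y (P x)) (u (ray_point t x)) (\<epsilon> t)" for t
    have "\<epsilon> 1 = 0"
    proof (rule gronwall_zero[of \<epsilon> \<epsilon>' "L * norm (P x)"])
      fix t :: real assume t: "t \<in> {0..1}"
      have z: "ray_point t x \<in> ball 0 r" by (rule rin[OF t])
      have uz: "u (ray_point t x) \<in> Q" using uQ z by blast
      have "((\<lambda>t. e (ray_point t x)) has_vector_derivative Dmap e (ray_point t x) (P x)) (at t within {0..1})"
        by (rule has_vector_derivative_holo[OF dray eh z])
      then have d: "(\<epsilon> has_vector_derivative (t *\<^sub>R Dmap e (ray_point t x) (P x) + e (ray_point t x))) (at t within {0..1})"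
        unfolding \<epsilon>_def by (auto intro!: derivative_eq_intros)
      have lin: "linear (Dmap e (ray_point t x))" using has_derivative_linear[OF holo_map_has_derivative[OF eh z]] .
      have lin2: "linear (Dmap (\<lambda>y. X y (P x)) (u (ray_point t x)))" using has_derivative_linear[OF holo_map_has_derivative[OF Xh uz]] .
      have "t *\<^sub>R Dmap e (ray_point t x) (P x) + e (ray_point t x) = e (ray_point t x) + Dmap e (ray_point t x) (P (ray_point t x))"
        by (simp add: ray_simps linear_scale[OF lin])
      also have "\<dots> = Dmap (\<lambda>y. X y (P (ray_point t x))) (u (ray_point t x)) (e (ray_point t x))" by (rule key[OF z])
      also have "\<dots> = t *\<^sub>R Dmap (\<lambda>y. X y (P x)) (u (ray_point t x)) (e (ray_point t x))"
        unfolding ray_simps(1) scaleR_eq_scale by (rule family_scale[OF uz])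
      also have "\<dots> = \<epsilon>' t" by (simp add: \<epsilon>'_def \<epsilon>_def linear_scale[OF lin2])
      finally show "(\<epsilon> has_vector_derivative \<epsilon>' t) (at t within {0..1})" using d by simp
      show "norm (\<epsilon>' t) \<le> L * norm (P x) * norm (\<epsilon> t)"
        unfolding \<epsilon>'_def by (rule L(2)) (use u\<rho> z in blast)
    qed (auto simp: \<epsilon>_def)
    then show ?thesis by (simp add: \<epsilon>_def ray_simps e_def)
  qed
  show ?thesis
  proof (rule that[OF r u uQ])
    fix x assume x: "x \<in> ball 0 r" "P x = 0"
    have "X (u (ray_point t x)) 0 = 0" if "t \<in> {0..1}" for t
      using X0[of "u (ray_point t x)" 0 0] uQ ray_in_ball[OF x(1), of t] that by (simp add: image_subset_iff)
    then have "integral {0..1} (\<lambda>t. X (u (ray_point t x)) (P x)) = 0"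
      using x(2) integral_cong[of "{0..1}" "\<lambda>t. X (u (ray_point t x)) (P x)" "\<lambda>t. 0"] by simp
    then show "u x = g x" using fp[OF x(1)] x(2) by simp
  qed (rule main)
qed

end

section \<open>Geodesics and first integrals\<close>

lemma affine_connectionD:
  assumes "affine_connection U \<Gamma>"
  shows "x \<in> U \<Longrightarrow> Vector_Spaces.linear (*s) (*s) (\<Gamma> x v)" "x \<in> U \<Longrightarrow> Vector_Spaces.linear (*s) (*s) (\<lambda>v. \<Gamma> x v w)"
    "holo_map U (\<lambda>x. \<Gamma> x v w)"
  using assms by (auto simp: affine_connection_def)

lemma conn_bilinear:
  assumes "affine_connection U \<Gamma>" "x \<in> U"
  shows "\<Gamma> x (v + v') w = \<Gamma> x v w + \<Gamma> x v' w" "\<Gamma> x v (w + w') = \<Gamma> x v w + \<Gamma> x v w'"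
    "\<Gamma> x (c *s v) w = c *s \<Gamma> x v w" "\<Gamma> x v (c *s w) = c *s \<Gamma> x v w"
    "\<Gamma> x 0 w = 0" "\<Gamma> x v 0 = 0"
proof -
  show 1: "\<Gamma> x (v + v') w = \<Gamma> x v w + \<Gamma> x v' w" "\<Gamma> x (c *s v) w = c *s \<Gamma> x v w" for c
    using affine_connectionD(2)[OF assms, of w] by (simp_all add: clinear_iff)
  show 2: "\<Gamma> x v (w + w') = \<Gamma> x v w + \<Gamma> x v w'" "\<Gamma> x v (c *s w) = c *s \<Gamma> x v w" for c
    using affine_connectionD(1)[OF assms, of v] by (simp_all add: clinear_iff)
  show "\<Gamma> x 0 w = 0" "\<Gamma> x v 0 = 0" 
    using affine_connectionD(2)[OF assms, of w] affine_connectionD(1)[OF assms, of v]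
    unfolding clinear_iff by (metis vector_smult_lzero)+
qed

lemma conn_holo:
  fixes a :: "complex^'l \<Rightarrow> complex^'n"
  assumes \<Gamma>: "affine_connection U \<Gamma>" and U: "open U" and V: "open V" and a: "holo_map V a" "a ` V \<subseteq> U"
    and b: "holo_map V b" and c: "holo_map V c"
  shows "holo_map V (\<lambda>x. \<Gamma> (a x) (b x) (c x))"
proof -
  have aU: "a x \<in> U" if "x \<in> V" for x using a that by blast
  have 1: "holo_map V (\<lambda>x. \<Gamma> (a x) v (c x))" for v
    by (rule holo_family(1)[OF affine_connectionD(1)[OF \<Gamma>] affine_connectionD(3)[OF \<Gamma>] U V a c])
  show ?thesis
    by (rule holo_family(1)[where X = "\<lambda>x v. \<Gamma> (a x) v (c x)", OF affine_connectionD(2)[OF \<Gamma> aU] 1 V V holo_map_id _ b]) auto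
qed

subsection \<open>Existence of geodesics\<close>

text \<open>The geodesic equation as a first order system on pairs (position, velocity) is a total differential
equation in one variable, for which the commutation condition is trivially true.\<close>

lemma geodesic_exists:
  fixes x0 v0 :: "complex^'n"
  assumes \<Gamma>: "affine_connection U \<Gamma>" and U: "open U" and x0: "x0 \<in> U" and v0: "v0 \<noteq> 0"
  shows "\<exists>r>0. \<exists>c. geodesic_param U \<Gamma> (ball 0 r) c \<and> c 0 = x0 \<and> velocity c 0 = v0"
proof -
  define lft :: "complex^('n + 'n) \<Rightarrow> complex^'n" where "lft z = (\<chi> i. z $ Inl i)" for z
  define rgt :: "complex^('n + 'n) \<Rightarrow> complex^'n" where "rgt z = (\<chi> i. z $ Inr i)" for z
  define mk :: "complex^'n \<Rightarrow> complex^'n \<Rightarrow> complex^('n + 'n)" where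
    "mk x w = (\<chi> i. case i of Inl j \<Rightarrow> x $ j | Inr j \<Rightarrow> w $ j)" for x w
  have [simp]: "lft (mk x w) = x" "rgt (mk x w) = w" for x w by (simp_all add: lft_def rgt_def mk_def)
  have hl: "holo_map S lft" "holo_map S rgt" for S by (simp_all add: holo_map_iff_chol lft_def rgt_def chol_nth)
  define Q where "Q = {z. lft z \<in> U}"
  have Q: "open Q"
    using open_vimage[OF U holo_map_continuous_on[OF hl(1)]] by (simp add: Q_def vimage_def)
  define Y where "Y z = mk (rgt z) (- \<Gamma> (lft z) (rgt z) (rgt z))" for z
  have Yh: "holo_map Q Y" unfolding holo_map_iff_chol
  proof
    fix k :: "'n + 'n"
    have g: "holo_map Q (\<lambda>z. \<Gamma> (lft z) (rgt z) (rgt z))"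
      by (rule conn_holo[OF \<Gamma> U Q hl(1) _ hl(2) hl(2)]) (auto simp: Q_def)
    show "chol Q (\<lambda>z. Y z $ k)"
      by (cases k) (simp_all add: Y_def mk_def rgt_def[symmetric] chol_uminus[OF holo_map_chol[OF g]] holo_map_chol[OF hl(2)])
  qed
  define X where "X z \<tau> = (\<tau> $ 1) *s Y z" for z and \<tau> :: "complex^1"
  have Xl: "Vector_Spaces.linear (*s) (*s) (X z)" for z
    by (auto simp: clinear_iff X_def vec.scale_left_distrib)
  have Xh: "holo_map Q (\<lambda>z. X z \<tau>)" for \<tau> unfolding X_def by (intro holo_map_scale chol_const Yh)
  have DX: "Dmap (\<lambda>z. X z \<tau>) z w = \<tau> $ 1 *s Dmap Y z w" if "z \<in> Q" for z \<tau> w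
    unfolding X_def by (simp add: Dmap_scale_fun[OF chol_const Yh that] dd_const)
  have idl: "Vector_Spaces.linear (*s) (*s) (\<lambda>x :: complex^1. x)" by (simp add: clinear_iff)
  have z0: "mk x0 v0 \<in> Q" using x0 by (simp add: Q_def)
  have comm: "Dmap (\<lambda>z. X z v) z (X z w) = Dmap (\<lambda>z. X z w) z (X z v)" if "z \<in> Q" for z v w
    unfolding DX[OF that] by (simp add: X_def Dmap_scale[OF Yh that] mult.commute)
  obtain r u where r: "r > 0" and u: "holo_map (ball (0 :: complex^1) r) u" "u ` ball 0 r \<subseteq> Q"
    and u0: "\<And>x. x \<in> ball 0 r \<Longrightarrow> x = 0 \<Longrightarrow> u x = mk x0 v0"
    and Du: "\<And>x v. x \<in> ball 0 r \<Longrightarrow> v = v \<Longrightarrow> Dmap u x v = X (u x) v"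
    by (rule frobenius[OF Q Xl Xh idl _ _ _ open_UNIV _ holo_map_const z0 comm]) auto
  define e where "e = (vec 1 :: complex^1)"
  have e1: "e $ 1 = 1" by (simp add: e_def)
  have ne: "norm e = 1" by (simp add: e_def norm_vec_def L2_set_def)
  have inb: "t *s e \<in> ball 0 r" if "t \<in> ball 0 r" for t using that by (simp add: vec_scale_norm ne)
  define c where "c t = lft (u (t *s e))" for t
  have dk: "((\<lambda>t. u (t *s e) $ k) has_field_derivative Y (u (t *s e)) $ k) (at t)" if "t \<in> ball 0 r" for t k
  proof -
    have "((\<lambda>t. u (0 + t *s e) $ k) has_field_derivative dd (\<lambda>x. u x $ k) (0 + t *s e) e) (at t)"
      by (rule chol_line_deriv[OF holo_map_chol[OF u(1)]]) (use inb[OF that] in simp)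
    moreover have "dd (\<lambda>x. u x $ k) (t *s e) e = Y (u (t *s e)) $ k"
      using Du[OF inb[OF that], of e] Dmap_nth[OF u(1) inb[OF that], of e k] by (simp add: X_def e1)
    ultimately show ?thesis by simp
  qed
  have vel: "velocity c t = rgt (u (t *s e))" if "t \<in> ball 0 r" for t
    unfolding velocity_def using DERIV_imp_deriv[OF dk[OF that]]
    by (simp add: vec_eq_iff c_def lft_def rgt_def Y_def mk_def)
  have "velocity (velocity c) t = - \<Gamma> (c t) (velocity c t) (velocity c t)" if t: "t \<in> ball 0 r" for t
  proof -
    have "deriv (\<lambda>s. velocity c s $ k) t = Y (u (t *s e)) $ Inr k" for k
    proof (rule DERIV_imp_deriv, rule has_field_derivative_transform_within_open[OF dk[OF t]])
      show "u (s *s e) $ Inr k = velocity c s $ k" if "s \<in> ball 0 r" for s by (simp add: vel[OF that] rgt_def)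
    qed (use t in auto)
    then show ?thesis unfolding velocity_def[of "velocity c"] 
      by (simp add: vec_eq_iff Y_def mk_def vel[OF t] c_def)
  qed
  moreover have "(\<lambda>t. c t $ k) holomorphic_on ball 0 r" for k
    unfolding holomorphic_on_def field_differentiable_def
    using dk[of _ "Inl k"] has_field_derivative_at_within by (force simp: c_def lft_def simp del: mem_ball)
  moreover have "c ` ball 0 r \<subseteq> U"
  proof safe
    fix t :: complex assume "t \<in> ball 0 r"
    then have "u (t *s e) \<in> Q" using u(2) inb by blast
    then show "c t \<in> U" by (simp add: c_def Q_def)
  qed
  moreover have c0: "c 0 = x0" "velocity c 0 = v0" using u0[of 0] vel[of 0] r by (simp_all add: c_def)
  moreover have "geodesic_param U \<Gamma> (ball 0 s) c \<and> s > 0" if "s > 0" "s \<le> r" "\<And>t. t \<in> ball 0 s \<Longrightarrow> velocity c t \<noteq> 0" for s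
  proof -
    have sub: "ball 0 s \<subseteq> ball (0::complex) r" using that by auto
    have hc: "(\<lambda>t. c t $ k) holomorphic_on ball 0 s" for k
      using calculation(2) holomorphic_on_subset[OF _ sub] by blast
    show ?thesis unfolding geodesic_param_def
      using that sub hc calculation(1,3) by (auto simp: subset_iff image_subset_iff)
  qed
  moreover have "\<exists>s>0. s \<le> r \<and> (\<forall>t\<in>ball 0 s. velocity c t \<noteq> 0)"
  proof -
    have "continuous_on (ball 0 r) (\<lambda>t. rgt (u (t *s e)))"
      by (rule continuous_on_compose2[OF holo_map_continuous_on[OF hl(2)[of UNIV]]],
          rule continuous_on_compose2[OF holo_map_continuous_on[OF u(1)] bounded_linear.continuous_on[OF bounded_linear_scale_left continuous_on_id]])
         (use inb in \<open>auto simp del: mem_ball\<close>)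
    then have "open (ball 0 r \<inter> (\<lambda>t. rgt (u (t *s e))) -` (- {0}))"
      by (rule continuous_open_preimage) auto
    moreover have "0 \<in> ball 0 r \<inter> (\<lambda>t. rgt (u (t *s e))) -` (- {0})"
      using v0 c0 vel[of 0] r by simp
    ultimately obtain s where s: "s > 0" "ball 0 s \<subseteq> ball 0 r \<inter> (\<lambda>t. rgt (u (t *s e))) -` (- {0})"
      by (meson openE)
    have "velocity c t \<noteq> 0" if "t \<in> ball 0 (min s r)" for t
      using s(2) that vel[of t] by auto
    then show ?thesis using s r by (intro exI[of _ "min s r"]) auto
  qed
  ultimately show ?thesis by blast
qed

subsection \<open>First integrals\<close>

text \<open>A first integral of \<open>F\<close> on \<open>B\<close>: a submersion to \<open>\<complex>\<close> whose level sets are tangent to \<open>F\<close>.\<close>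

definition first_int :: "(complex^'n) set \<Rightarrow> 'n hfield \<Rightarrow> (complex^'n \<Rightarrow> complex) \<Rightarrow> bool" where
  "first_int B F f \<longleftrightarrow> open B \<and> chol B f \<and> (\<forall>y\<in>B. (\<exists>v. dd f y v \<noteq> 0) \<and> F y = {v. dd f y v = 0})"

text \<open>Scale \<open>\<omega>\<close> to be \<open>1\<close> on a coordinate vector \<open>e\<close>. Lifting coordinate directions into the kernel of
\<open>\<omega>\<close> along \<open>e\<close> gives a system whose commutation condition is the condition \<open>\<omega> \<and> d\<omega> = 0\<close>. Its solution
with initial values on the line through \<open>x0\<close> in direction \<open>e\<close> is a chart in which \<open>F\<close> is the field of
coordinate hyperplanes, and the remaining coordinate is a first integral.\<close>

lemma first_int_exists:
  fixes \<omega> :: "complex^'n \<Rightarrow> complex^'n"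
  assumes V: "open V" "x0 \<in> V" and w: "holo_map V \<omega>" "integrable_form V \<omega>" "\<And>y. y \<in> V \<Longrightarrow> \<omega> y \<noteq> 0"
  shows "\<exists>r>0. \<exists>f. ball x0 r \<subseteq> V \<and> first_int (ball x0 r) (\<lambda>y. {v. pair (\<omega> y) v = 0}) f"
proof -
  obtain j where j: "\<omega> x0 $ j \<noteq> 0" using w(3)[OF V(2)] by (auto simp: vec_eq_iff)
  define Q where "Q = V \<inter> (\<lambda>y. \<omega> y $ j) -` (- {0})"
  have Q: "open Q" unfolding Q_def
    by (rule continuous_open_preimage[OF chol_continuous_on[OF holo_map_chol[OF w(1)]] V(1)]) auto
  have QV: "Q \<subseteq> V" and x0Q: "x0 \<in> Q" and wj: "\<And>y. y \<in> Q \<Longrightarrow> \<omega> y $ j \<noteq> 0" using j V by (auto simp: Q_def)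
  have wQ: "holo_map Q \<omega>" using holo_map_subset[OF w(1) QV] .
  define e :: "complex^'n" where "e = axis j 1"
  have ej: "e $ j = 1" "\<And>k. k \<noteq> j \<Longrightarrow> e $ k = 0" by (auto simp: e_def axis_def)
  define c where "c y = inverse (\<omega> y $ j)" for y
  have cQ: "chol Q c" unfolding c_def by (intro chol_inverse holo_map_chol[OF wQ] wj)
  have c0: "c y \<noteq> 0" if "y \<in> Q" for y using wj[OF that] by (simp add: c_def)
  define \<eta> where "\<eta> y = c y *s \<omega> y" for y
  have \<eta>h: "holo_map Q \<eta>" unfolding \<eta>_def by (intro holo_map_scale cQ wQ)
  have \<eta>e: "pair (\<eta> y) e = 1" if "y \<in> Q" for y
    using wj[OF that] by (simp add: \<eta>_def pair_linear e_def pair_axis c_def)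
  have D\<eta>: "Dmap \<eta> y v = c y *s Dmap \<omega> y v + dd c y v *s \<omega> y" if "y \<in> Q" for y v
    unfolding \<eta>_def by (rule Dmap_scale_fun[OF cQ wQ that])
  have D\<eta>e: "pair (Dmap \<eta> y v) e = 0" if "y \<in> Q" for y v
  proof -
    have "dd (\<lambda>x. pair (\<eta> x) e) y v = dd (\<lambda>x. 1) y v"
      using dd_cong[OF Q that, of "\<lambda>x. pair (\<eta> x) e" "\<lambda>x. 1"] \<eta>e by simp
    then show ?thesis by (simp add: dd_pair[OF \<eta>h holo_map_const that] dd_const Dmap_const pair_linear)
  qed
  define P where "P v = v - v $ j *s e" for v
  define X where "X y v = v - pair (\<eta> y) v *s e" for y v
  have Xl: "Vector_Spaces.linear (*s) (*s) (X y)" for y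
    by (auto simp: clinear_iff X_def pair_linear vec_eq_iff algebra_simps)
  have Xh: "holo_map Q (\<lambda>y. X y v)" for v
    unfolding X_def by (intro holo_map_diff holo_map_scale chol_pair holo_map_const \<eta>h)
  have DX: "Dmap (\<lambda>y. X y v) y u = - (pair (Dmap \<eta> y u) v *s e)" if "y \<in> Q" for y u v
  proof -
    have h: "holo_map Q (\<lambda>y. X y v)" by (rule Xh)
    have "Dmap (\<lambda>y. X y v) y u $ k = - (pair (Dmap \<eta> y u) v * e $ k)" for k
    proof -
      have "dd (\<lambda>y. v $ k - pair (\<eta> y) v * e $ k) y u = dd (\<lambda>y. v $ k) y u - (pair (\<eta> y) v * dd (\<lambda>y. e $ k) y u + dd (\<lambda>y. pair (\<eta> y) v) y u * e $ k)"
        by (subst dd_diff[OF chol_const _ that], intro chol_mult chol_pair \<eta>h holo_map_const chol_const,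
            subst dd_mult[OF _ chol_const that], intro chol_pair \<eta>h holo_map_const) simp
      then show ?thesis unfolding Dmap_nth[OF h that]
        by (simp add: X_def dd_const dd_pair[OF \<eta>h holo_map_const that] Dmap_const pair_linear)
    qed
    then show ?thesis by (simp add: vec_eq_iff)
  qed
  have wX: "pair (\<omega> y) (X y v) = 0" if "y \<in> Q" for y v
  proof -
    have "pair (\<eta> y) (X y v) = 0" using \<eta>e[OF that] by (simp add: X_def pair_linear)
    then show ?thesis using c0[OF that] by (simp add: \<eta>_def pair_linear)
  qed
  have sym: "pair (Dmap \<eta> y (X y v)) w = pair (Dmap \<eta> y (X y w)) v" if y: "y \<in> Q" for y v w
  proof -
    have "ext_deriv \<omega> y (X y v) (X y w) = 0"
    proof -
      have "pair (\<omega> y) e * ext_deriv \<omega> y (X y v) (X y w) = 0"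
        using w(2) y QV wX[OF y] unfolding integrable_form_def by (metis (no_types, lifting) add.right_neutral mult_zero_left subsetD)
      then show ?thesis using wj[OF y] by (simp add: e_def pair_axis)
    qed
    then have "pair (Dmap \<omega> y (X y v)) (X y w) = pair (Dmap \<omega> y (X y w)) (X y v)" by (simp add: ext_deriv_def)
    then have "pair (Dmap \<eta> y (X y v)) (X y w) = pair (Dmap \<eta> y (X y w)) (X y v)"
      by (simp add: D\<eta>[OF y] pair_linear wX[OF y])
    then show ?thesis by (simp add: X_def[of y w] X_def[of y v] pair_linear D\<eta>e[OF y])
  qed
  have Pl: "Vector_Spaces.linear (*s) (*s) P" by (auto simp: clinear_iff P_def vec_eq_iff algebra_simps)
  have Pk: "P v $ k = (if k = j then 0 else v $ k)" for v k using ej by (simp add: P_def)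
  have PP: "P (P v) = P v" for v by (simp add: vec_eq_iff Pk)
  have Pn: "norm (P v) \<le> norm v" for v by (rule norm_le_componentwise_cart) (simp add: Pk)
  have Pc: "norm (v - P v) \<le> norm v" for v by (rule norm_le_componentwise_cart) (simp add: Pk)
  have gx: "x0 + 0 \<in> Q" using x0Q by simp
  obtain r \<Psi> where r: "r > 0" and \<Psi>: "holo_map (ball 0 r) \<Psi>" "\<Psi> ` ball 0 r \<subseteq> Q"
    and \<Psi>0: "\<And>x. x \<in> ball 0 r \<Longrightarrow> P x = 0 \<Longrightarrow> \<Psi> x = x0 + x"
    and D\<Psi>: "\<And>x v. x \<in> ball 0 r \<Longrightarrow> P v = v \<Longrightarrow> Dmap \<Psi> x v = X (\<Psi> x) v"
  proof (rule frobenius[OF Q Xl Xh Pl PP Pn Pc open_UNIV UNIV_I holo_map_add[OF holo_map_const holo_map_id] gx])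
    fix z v w assume "z \<in> Q"
    then show "Dmap (\<lambda>z. X z v) z (X z w) = Dmap (\<lambda>z. X z w) z (X z v)" by (simp add: DX sym)
  qed auto
  have D0e: "Dmap \<Psi> 0 e = e"
  proof -
    have "((\<lambda>t. \<Psi> (t *\<^sub>R e)) has_vector_derivative Dmap \<Psi> (0 *\<^sub>R e) e) (at 0)"
      by (rule has_vector_derivative_holo[OF _ \<Psi>(1)]) (use r in \<open>auto intro!: derivative_eq_intros\<close>)
    moreover have "((\<lambda>t. \<Psi> (t *\<^sub>R e)) has_vector_derivative e) (at 0)"
    proof (rule has_vector_derivative_transform_within_open[where f = "\<lambda>t. x0 + t *\<^sub>R e" and S = "{t. t *\<^sub>R e \<in> ball 0 r}"])
      show "open {t. t *\<^sub>R e \<in> ball 0 r}"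
        using open_vimage[of "ball 0 r" "\<lambda>t. t *\<^sub>R e"] by (simp add: vimage_def continuous_intros)
      show "x0 + t *\<^sub>R e = \<Psi> (t *\<^sub>R e)" if "t \<in> {t. t *\<^sub>R e \<in> ball 0 r}" for t
        using \<Psi>0[of "t *\<^sub>R e"] that ej by (simp add: P_def vec_eq_iff scaleR_eq_scale)
    qed (use r in \<open>auto intro!: derivative_eq_intros\<close>)
    ultimately show ?thesis using vector_derivative_unique_at by fastforce
  qed
  have inj: "v = 0" if "Dmap \<Psi> 0 v = 0" for v
  proof -
    have z: "(0::complex^'n) \<in> ball 0 r" using r by simp
    have "v = P v + v $ j *s e" by (simp add: P_def)
    then have "Dmap \<Psi> 0 v = Dmap \<Psi> 0 (P v) + v $ j *s Dmap \<Psi> 0 e"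
      using Dmap_linear(1)[OF \<Psi>(1) z] Dmap_scale[OF \<Psi>(1) z] by metis
    then have eq: "X (\<Psi> 0) (P v) + v $ j *s e = 0" using that D\<Psi>[OF z PP] D0e by simp
    have "v $ k = 0" if "k \<noteq> j" for k
    proof -
      have "(X (\<Psi> 0) (P v) + v $ j *s e) $ k = 0" using eq by simp
      then show ?thesis using that ej by (simp add: X_def Pk)
    qed
    then have P0: "P v = 0" by (simp add: vec_eq_iff Pk)
    then have "v $ j *s e = 0" using eq by (simp add: X_def pair_linear)
    then have "v $ j = 0" using ej by (metis mult.right_neutral vector_smult_component zero_index)
    then show ?thesis using \<open>v = P v + v $ j *s e\<close> P0 by simp
  qed
  obtain V' where V': "V' \<subseteq> ball 0 r" "0 \<in> V'" "biholo V' \<Psi>"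
    by (rule holo_inverse_function[OF open_ball \<Psi>(1) _ inj]) (use r in auto)
  then obtain \<psi> where \<psi>: "open V'" "open (\<Psi> ` V')" "holo_map V' \<Psi>" "holo_map (\<Psi> ` V') \<psi>" "\<forall>x\<in>V'. \<psi> (\<Psi> x) = x"
    unfolding biholo_def by blast
  have "\<Psi> 0 = x0" using \<Psi>0[of 0] r by (simp add: P_def)
  then have "x0 \<in> \<Psi> ` V'" using V' by force
  then obtain s where s: "s > 0" "ball x0 s \<subseteq> \<Psi> ` V'" using \<psi>(2) open_contains_ball by blast
  define f where "f y = \<psi> y $ j" for y
  have fh: "chol (ball x0 s) f" unfolding f_def using chol_subset[OF holo_map_chol[OF \<psi>(4)] s(2)] .
  have sQ: "ball x0 s \<subseteq> Q" using s(2) V'(1) \<Psi>(2) by blast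
  have "first_int (ball x0 s) (\<lambda>y. {v. pair (\<omega> y) v = 0}) f"
    unfolding first_int_def
  proof (intro conjI ballI)
    fix y assume y: "y \<in> ball x0 s"
    then obtain x where x: "x \<in> V'" "y = \<Psi> x" using s by blast
    have xb: "x \<in> ball 0 r" using x V' by blast
    have yQ: "y \<in> Q" using y sQ by blast
    note inv = biholo_Dmap[OF \<psi> x(1)]
    have yi: "y \<in> \<Psi> ` V'" using x by simp
    have df: "dd f y v = Dmap \<psi> y v $ j" for v
      unfolding f_def using Dmap_nth[OF \<psi>(4) yi] by simp
    have ker: "dd f y (X y v) = 0" for v
    proof -
      have "X y e = 0" by (simp add: X_def \<eta>e[OF yQ])
      moreover have "v = P v + v $ j *s e" by (simp add: P_def)
      moreover have "X y (a + c *s b) = X y a + c *s X y b" for a b c using Xl[of y] by (simp add: clinear_iff)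
      ultimately have "X y v = X y (P v)" by (metis add.right_neutral vector_smult_rzero)
      also have "\<dots> = Dmap \<Psi> x (P v)" using D\<Psi>[OF xb PP] x by simp
      finally have "Dmap \<psi> y (X y v) = P v" using inv(1) x by simp
      then show ?thesis by (simp add: df Pk)
    qed
    have dfe: "dd f y v = pair (\<eta> y) v * dd f y e" for v
    proof -
      have "v = X y v + pair (\<eta> y) v *s e" by (simp add: X_def)
      then show ?thesis using ker chol_dd_linear(1)[OF fh y] chol_dd_scale[OF fh y] by (metis add_0)
    qed
    have nz: "dd f y (Dmap \<Psi> x e) = 1" using df[of "Dmap \<Psi> x e"] inv(1)[of e] ej(1) x(2) by metis
    then show "\<exists>v. dd f y v \<noteq> 0" by (metis zero_neq_one)
    have "dd f y e \<noteq> 0" using nz dfe by (metis mult_zero_right zero_neq_one)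
    then show "{v. pair (\<omega> y) v = 0} = {v. dd f y v = 0}"
      using c0[OF yQ] by (subst dfe) (auto simp: \<eta>_def pair_linear)
  qed (use fh in auto)
  moreover have "ball x0 s \<subseteq> V" using sQ QV by blast
  ultimately show ?thesis using s by blast
qed

lemma foliation_first_int:
  assumes F: "foliation U F" and x: "x \<in> U"
  obtains r f where "r > 0" "ball x r \<subseteq> U" "first_int (ball x r) F f"
proof -
  from bspec[OF F[unfolded foliation_def] x] obtain V \<omega> where V: "open V" "x \<in> V" "V \<subseteq> U" "holo_map V \<omega>" "integrable_form V \<omega>"
    and w: "\<forall>y\<in>V. \<omega> y \<noteq> 0 \<and> F y = {v. pair (\<omega> y) v = 0}" by (elim exE conjE)
  have "\<exists>r>0. \<exists>f. ball x r \<subseteq> V \<and> first_int (ball x r) (\<lambda>y. {v. pair (\<omega> y) v = 0}) f"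
    by (rule first_int_exists[OF V(1,2,4,5)]) (use w in simp)
  then obtain r f where r: "r > 0" "ball x r \<subseteq> V" "first_int (ball x r) (\<lambda>y. {v. pair (\<omega> y) v = 0}) f"
    by (elim exE conjE)
  have "F y = {v. pair (\<omega> y) v = 0}" if "y \<in> ball x r" for y
    using bspec[OF w subsetD[OF r(2) that]] by simp
  then have "first_int (ball x r) F f" using r(3) unfolding first_int_def by simp
  then show ?thesis by (rule that[OF r(1) subset_trans[OF r(2) V(3)]])
qed

section \<open>Leaves\<close>

lemma unit_interval_const:
  assumes "\<And>t. t \<in> {0..1} \<Longrightarrow> \<exists>\<delta>>0. \<forall>s\<in>{0..1}. \<bar>s - t\<bar> < \<delta> \<longrightarrow> A s = A t"
  shows "A (1::real) = A 0"
proof (rule connected_local_const[of "{0..1::real}" 1 0 A])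
  show "\<forall>a\<in>{0..1}. \<forall>\<^sub>F b in at a within {0..1}. A a = A b"
  proof
    fix a :: real assume "a \<in> {0..1}"
    from assms[OF this] obtain \<delta> where "\<delta> > 0" "\<forall>s\<in>{0..1}. \<bar>s - a\<bar> < \<delta> \<longrightarrow> A s = A a" by blast
    then show "\<forall>\<^sub>F b in at a within {0..1}. A a = A b"
      unfolding eventually_at by (intro exI[of _ \<delta>]) (simp add: dist_real_def)
  qed
qed auto

lemma path_near:
  fixes g :: "real \<Rightarrow> 'a::metric_space"
  assumes g: "continuous_on {0..1} g" and N: "open N" and t: "t \<in> {0..1}" "g t \<in> N"
  shows "\<exists>\<delta>>0. \<forall>s\<in>{0..1}. \<bar>s - t\<bar> < \<delta> \<longrightarrow> g ` {min s t..max s t} \<subseteq> N"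
proof -
  obtain e where e: "e > 0" "ball (g t) e \<subseteq> N" using N t(2) openE by blast
  obtain \<delta> where \<delta>: "\<delta> > 0" "\<forall>s\<in>{0..1}. dist s t < \<delta> \<longrightarrow> dist (g s) (g t) < e"
    using g t(1) e(1) unfolding continuous_on_iff by metis
  have "g u \<in> N" if "s \<in> {0..1}" "\<bar>s - t\<bar> < \<delta>" "u \<in> {min s t..max s t}" for s u
  proof -
    have "u \<in> {0..1}" "dist u t < \<delta>" using that t(1) by (auto simp: min_def max_def dist_real_def split: if_splits)
    then have "dist (g u) (g t) < e" using \<delta>(2) by blast
    then have "g u \<in> ball (g t) e" by (simp add: dist_commute)
    then show ?thesis using e(2) by blast
  qed
  then show ?thesis using \<delta>(1) by blast
qed

text \<open>The paths in the definition of a leaf.\<close>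

definition tpath :: "(complex^'n) set \<Rightarrow> 'n hfield \<Rightarrow> (real \<Rightarrow> complex^'n) \<Rightarrow> bool" where
  "tpath U F g \<longleftrightarrow> valid_path g \<and> path_image g \<subseteq> U \<and>
     (\<exists>S. finite S \<and> (\<forall>t\<in>{0..1} - S. \<exists>v\<in>F (g t). (g has_vector_derivative v) (at t)))"

lemma leaf_iff: "q \<in> leaf U F p \<longleftrightarrow> (\<exists>g. tpath U F g \<and> pathstart g = p \<and> pathfinish g = q)"
  unfolding leaf_def tpath_def by blast

lemma tpath_smooth:
  assumes "\<And>t. t \<in> {0..1} \<Longrightarrow> (\<gamma> has_vector_derivative D t) (at t)" "continuous_on {0..1} D"
    and "\<And>t. t \<in> {0..1} \<Longrightarrow> \<gamma> t \<in> U" "\<And>t. t \<in> {0..1} \<Longrightarrow> D t \<in> F (\<gamma> t)"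
  shows "tpath U F \<gamma>"
  unfolding tpath_def
proof (intro conjI exI[of _ "{}"] ballI)
  show "valid_path \<gamma>" unfolding valid_path_def
    by (rule C1_differentiable_imp_piecewise) (unfold C1_differentiable_on_def, rule exI[of _ D], use assms in auto)
qed (use assms in \<open>auto simp: path_image_def\<close>)

text \<open>Concatenation doubles the speed, which is harmless because tangency is invariant under scaling.\<close>

lemma tpath_join:
  assumes sc: "\<And>y v r. y \<in> U \<Longrightarrow> v \<in> F y \<Longrightarrow> r *\<^sub>R v \<in> F y"
    and g1: "tpath U F g1" and g2: "tpath U F g2" and e: "pathfinish g1 = pathstart g2"
  shows "tpath U F (g1 +++ g2)"
proof -
  obtain S1 where S1: "finite S1" "\<And>t. t \<in> {0..1} - S1 \<Longrightarrow> \<exists>v\<in>F (g1 t). (g1 has_vector_derivative v) (at t)"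
    using g1 unfolding tpath_def by blast
  obtain S2 where S2: "finite S2" "\<And>t. t \<in> {0..1} - S2 \<Longrightarrow> \<exists>v\<in>F (g2 t). (g2 has_vector_derivative v) (at t)"
    using g2 unfolding tpath_def by blast
  have im: "g1 t \<in> U" "g2 t \<in> U" if "t \<in> {0..1}" for t
    using g1 g2 that unfolding tpath_def path_image_def by blast+
  define S where "S = (\<lambda>t. t / 2) ` S1 \<union> (\<lambda>t. (t + 1) / 2) ` S2 \<union> {1 / 2}"
  have "\<exists>v\<in>F ((g1 +++ g2) t). ((g1 +++ g2) has_vector_derivative v) (at t)" if t: "t \<in> {0..1} - S" for t
  proof (cases "t < 1 / 2")
    case True
    have "2 * t \<notin> S1"
    proof
      assume "2 * t \<in> S1"
      then have "t \<in> (\<lambda>t. t / 2) ` S1" by (intro image_eqI[of _ _ "2 * t"]) auto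
      then show False using t by (auto simp: S_def)
    qed
    then have "2 * t \<in> {0..1} - S1" using t True by auto
    then obtain v where v: "v \<in> F (g1 (2 * t))" "(g1 has_vector_derivative v) (at (2 * t))" using S1 by blast
    have "((\<lambda>t. 2 * t) has_vector_derivative 2) (at t)" by (auto intro!: derivative_eq_intros)
    from vector_diff_chain_at[OF this v(2)] have "((\<lambda>t. g1 (2 * t)) has_vector_derivative 2 *\<^sub>R v) (at t)" by (simp add: o_def)
    then have "((g1 +++ g2) has_vector_derivative 2 *\<^sub>R v) (at t)"
      by (rule has_vector_derivative_transform_within_open[where S = "{..<1/2}"]) (use True in \<open>auto simp: joinpaths_def\<close>)
    moreover have "2 *\<^sub>R v \<in> F ((g1 +++ g2) t)" using sc[OF im(1) v(1), of 2] t True by (simp add: joinpaths_def)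
    ultimately show ?thesis by blast
  next
    case False
    then have t2: "t > 1 / 2" using t by (auto simp: S_def)
    have "2 * t - 1 \<notin> S2"
    proof
      assume "2 * t - 1 \<in> S2"
      then have "t \<in> (\<lambda>t. (t + 1) / 2) ` S2" by (intro image_eqI[of _ _ "2 * t - 1"]) auto
      then show False using t by (auto simp: S_def)
    qed
    then have "2 * t - 1 \<in> {0..1} - S2" using t t2 by auto
    then obtain v where v: "v \<in> F (g2 (2 * t - 1))" "(g2 has_vector_derivative v) (at (2 * t - 1))" using S2 by blast
    have "((\<lambda>t. 2 * t - 1) has_vector_derivative 2) (at t)" by (auto intro!: derivative_eq_intros)
    from vector_diff_chain_at[OF this v(2)] have "((\<lambda>t. g2 (2 * t - 1)) has_vector_derivative 2 *\<^sub>R v) (at t)" by (simp add: o_def)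
    then have "((g1 +++ g2) has_vector_derivative 2 *\<^sub>R v) (at t)"
      by (rule has_vector_derivative_transform_within_open[where S = "{1/2<..}"]) (use t2 in \<open>auto simp: joinpaths_def\<close>)
    moreover have "2 *\<^sub>R v \<in> F ((g1 +++ g2) t)" using sc[OF im(2) v(1), of 2] t t2 by (simp add: joinpaths_def)
    ultimately show ?thesis by blast
  qed
  moreover have "finite S" using S1 S2 by (simp add: S_def)
  moreover have "valid_path (g1 +++ g2)" using g1 g2 e valid_path_join unfolding tpath_def by blast
  moreover have "path_image (g1 +++ g2) \<subseteq> U" using g1 g2 path_image_join_subset unfolding tpath_def by blast
  ultimately show ?thesis unfolding tpath_def by blast
qed

lemma leaf_trans:
  assumes "\<And>y v r. y \<in> U \<Longrightarrow> v \<in> F y \<Longrightarrow> r *\<^sub>R v \<in> F y" "q \<in> leaf U F p" "q' \<in> leaf U F q"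
  shows "q' \<in> leaf U F p"
proof -
  obtain g1 where g1: "tpath U F g1" "pathstart g1 = p" "pathfinish g1 = q" using assms(2) unfolding leaf_iff by blast
  obtain g2 where g2: "tpath U F g2" "pathstart g2 = q" "pathfinish g2 = q'" using assms(3) unfolding leaf_iff by blast
  have "tpath U F (g1 +++ g2)" by (rule tpath_join[OF assms(1) g1(1) g2(1)]) (use g1 g2 in auto)
  then show ?thesis unfolding leaf_iff using g1 g2 by (intro exI[of _ "g1 +++ g2"]) simp
qed

lemma leaf_refl:
  assumes "p \<in> U" "0 \<in> F p" shows "p \<in> leaf U F p"
  unfolding leaf_iff
  by (rule exI[of _ "\<lambda>_. p"])
     (use assms in \<open>auto intro!: tpath_smooth[where D = "\<lambda>_. 0"] derivative_eq_intros simp: pathstart_def pathfinish_def\<close>)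

lemma leaf_subset: "leaf U F p \<subseteq> U"
  unfolding leaf_def by (auto simp: path_image_def pathfinish_def)

lemma leaf_mono: "V \<subseteq> U \<Longrightarrow> leaf V F p \<subseteq> leaf U F p"
  unfolding leaf_def by blast

lemma first_int_subset: "first_int B F f \<Longrightarrow> B' \<subseteq> B \<Longrightarrow> open B' \<Longrightarrow> first_int B' F f"
  unfolding first_int_def using chol_subset by blast

lemma first_intD:
  assumes "first_int B F f" 
  shows "open B" "chol B f" "y \<in> B \<Longrightarrow> v \<in> F y \<longleftrightarrow> dd f y v = 0" "y \<in> B \<Longrightarrow> \<exists>v. dd f y v \<noteq> 0"
  using assms unfolding first_int_def by auto

lemma first_int_scale: "first_int B F f \<Longrightarrow> y \<in> B \<Longrightarrow> v \<in> F y \<Longrightarrow> c *s v \<in> F y"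
  using first_intD chol_dd_scale by (metis mult_zero_right)

lemma first_int_zero: "first_int B F f \<Longrightarrow> y \<in> B \<Longrightarrow> 0 \<in> F y"
  using first_intD chol_dd_linear(3) by metis

lemma foliation_scale: "foliation U F \<Longrightarrow> y \<in> U \<Longrightarrow> v \<in> F y \<Longrightarrow> r *\<^sub>R v \<in> F y"
  unfolding scaleR_eq_scale by (meson centre_in_ball first_int_scale foliation_first_int)

lemma foliation_zero: "foliation U F \<Longrightarrow> y \<in> U \<Longrightarrow> 0 \<in> F y"
  by (meson centre_in_ball first_int_zero foliation_first_int)

lemma tpath_continuous: "tpath U F g \<Longrightarrow> continuous_on {0..1} g"
  unfolding tpath_def using valid_path_imp_path path_def by blast

lemma tpath_first_int:
  assumes g: "tpath U F g" and f: "first_int B F f" and ab: "0 \<le> a" "b \<le> 1" "g ` {a..b} \<subseteq> B" and t: "t \<in> {a..b}"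
  shows "f (g t) = f (g a)"
proof -
  obtain S where S: "finite S" "\<And>t. t \<in> {0..1} - S \<Longrightarrow> \<exists>v\<in>F (g t). (g has_vector_derivative v) (at t)"
    using g unfolding tpath_def by blast
  show ?thesis
  proof (rule has_derivative_zero_unique_strong_interval[OF S(1) _ refl _ t])
    show "continuous_on {a..b} (\<lambda>t. f (g t))"
      by (rule continuous_on_compose2[OF chol_continuous_on[OF first_intD(2)[OF f]] continuous_on_subset[OF tpath_continuous[OF g]] ab(3)])
         (use ab in auto)
    fix s assume s: "s \<in> {a..b} - S"
    then have "s \<in> {0..1} - S" using ab by auto
    from S(2)[OF this] obtain v where v: "v \<in> F (g s)" "(g has_vector_derivative v) (at s)" by blast
    have gs: "g s \<in> B" using s ab by blast
    have "((\<lambda>t. f (g t)) has_vector_derivative dd f (g s) v) (at s within {a..b})"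
      by (rule has_vector_derivative_chol[OF has_vector_derivative_at_within[OF v(2)] first_intD(2)[OF f] gs])
    then show "((\<lambda>t. f (g t)) has_derivative (\<lambda>y. 0)) (at s within {a..b})"
      using v(1) first_intD(3)[OF f gs] by (simp add: has_vector_derivative_def)
  qed
qed

subsection \<open>Straightening a foliation\<close>

text \<open>Replacing the component of \<open>y\<close> along a transversal vector \<open>e\<close> by the value of \<open>f\<close> is a local
biholomorphism, in which \<open>f\<close> becomes the linear form \<open>dd f x\<close>.\<close>

lemma straight_chart:
  fixes f :: "complex^'n \<Rightarrow> complex"
  assumes f: "first_int B F f" and x: "x \<in> B"
  obtains N \<kappa> \<psi> e \<rho> where "\<rho> > 0" "open N" "x \<in> N" "N \<subseteq> B" "holo_map N \<kappa>" "holo_map (ball (\<kappa> x) \<rho>) \<psi>"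
    "\<kappa> ` N = ball (\<kappa> x) \<rho>" "\<And>y. y \<in> N \<Longrightarrow> \<psi> (\<kappa> y) = y" "\<And>y. y \<in> N \<Longrightarrow> f y = dd f x (\<kappa> y)"
    "\<And>y. \<kappa> y = y + (f y - dd f x y) *s e" "dd f x e = 1"
proof -
  note B = first_intD(1)[OF f] and fh = first_intD(2)[OF f]
  obtain v0 where v0: "dd f x v0 \<noteq> 0" using first_intD(4)[OF f x] by blast
  define e where "e = (1 / dd f x v0) *s v0"
  have e: "dd f x e = 1" using v0 by (simp add: e_def chol_dd_scale[OF fh x])
  define \<kappa> where "\<kappa> y = y + (f y - dd f x y) *s e" for y
  have dx: "chol B (dd f x)" "dd (dd f x) y v = dd f x v" for y v
    using chol_pair[OF holo_map_const holo_map_id, of B "grad f x"] dd_pair[OF holo_map_const holo_map_id, of y UNIV "grad f x" v]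
    by (simp_all add: pair_grad[OF fh x] Dmap_const pair_linear Dmap_eq[OF has_derivative_ident])
  have \<kappa>h: "holo_map B \<kappa>" unfolding \<kappa>_def
    by (intro holo_map_add holo_map_scale chol_diff fh dx holo_map_const holo_map_id)
  have D: "Dmap \<kappa> x v = v" for v
  proof -
    have "Dmap \<kappa> x v = Dmap (\<lambda>y. y) x v + Dmap (\<lambda>y. (f y - dd f x y) *s e) x v"
      unfolding \<kappa>_def by (rule Dmap_add[OF holo_map_id _ x]) (intro holo_map_scale chol_diff fh dx holo_map_const)
    also have "Dmap (\<lambda>y. (f y - dd f x y) *s e) x v = (f x - dd f x x) *s Dmap (\<lambda>_. e) x v + dd (\<lambda>y. f y - dd f x y) x v *s e"
      by (rule Dmap_scale_fun[OF chol_diff[OF fh dx(1)] holo_map_const x])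
    also have "dd (\<lambda>y. f y - dd f x y) x v = 0" by (simp add: dd_diff[OF fh dx(1) x] dx(2))
    finally show ?thesis by (simp add: Dmap_const Dmap_eq[OF has_derivative_ident])
  qed
  obtain V where V: "V \<subseteq> B" "x \<in> V" "biholo V \<kappa>"
    by (rule holo_inverse_function[OF B \<kappa>h x]) (use D in auto)
  then obtain \<psi> where \<psi>: "open V" "open (\<kappa> ` V)" "holo_map V \<kappa>" "holo_map (\<kappa> ` V) \<psi>" "\<forall>x\<in>V. \<psi> (\<kappa> x) = x"
    unfolding biholo_def by blast
  have "\<kappa> x \<in> \<kappa> ` V" using V(2) by simp
  then obtain \<rho> where \<rho>: "\<rho> > 0" "ball (\<kappa> x) \<rho> \<subseteq> \<kappa> ` V" using \<psi>(2) open_contains_ball by blast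
  define N where "N = V \<inter> \<kappa> -` ball (\<kappa> x) \<rho>"
  have N: "open N" unfolding N_def
    by (rule continuous_open_preimage[OF holo_map_continuous_on[OF \<psi>(3)] \<psi>(1)]) auto
  show ?thesis
  proof (rule that[OF \<rho>(1) N, of \<kappa> \<psi> e])
    show "x \<in> N" using V(2) \<rho>(1) by (simp add: N_def)
    show "N \<subseteq> B" using V(1) by (auto simp: N_def)
    then show "holo_map N \<kappa>" using \<kappa>h holo_map_subset by blast
    show "holo_map (ball (\<kappa> x) \<rho>) \<psi>" using \<psi>(4) \<rho>(2) holo_map_subset by blast
    show "\<kappa> ` N = ball (\<kappa> x) \<rho>"
    proof
      show "ball (\<kappa> x) \<rho> \<subseteq> \<kappa> ` N"
      proof
        fix z assume z: "z \<in> ball (\<kappa> x) \<rho>"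
        then obtain y where "y \<in> V" "z = \<kappa> y" using \<rho>(2) by blast
        then show "z \<in> \<kappa> ` N" using z by (simp add: N_def)
      qed
    qed (auto simp: N_def)
    show "\<psi> (\<kappa> y) = y" if "y \<in> N" for y using \<psi>(5) that by (simp add: N_def)
    show "\<kappa> y = y + (f y - dd f x y) *s e" for y by (simp add: \<kappa>_def)
    show "dd f x e = 1" by (rule e)
    show "f y = dd f x (\<kappa> y)" for y
      by (simp add: \<kappa>_def chol_dd_linear[OF fh x] chol_dd_scale[OF fh x] e)
  qed
qed

text \<open>In the straightened chart the level sets of \<open>f\<close> are pieces of parallel hyperplanes in a ball,
where straight segments connect any two points and realize every tangent vector.\<close>

lemma plaque_connected:
  assumes f: "first_int B F f" and x: "x \<in> B"
  shows "\<exists>N. open N \<and> x \<in> N \<and> N \<subseteq> B \<and> (\<forall>y\<in>N. \<forall>y'\<in>N. f y = f y' \<longrightarrow> y' \<in> leaf N F y) \<and>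
    (\<forall>y\<in>N. \<forall>v\<in>F y. \<exists>\<gamma> \<delta>. \<delta> > 0 \<and> (\<forall>t\<in>{-\<delta><..<\<delta>}. \<gamma> t \<in> leaf N F y) \<and> \<gamma> 0 = y \<and> (\<gamma> has_vector_derivative v) (at (0::real)))"
proof -
  note B = first_intD(1)[OF f] and fh = first_intD(2)[OF f]
  obtain N \<kappa> \<psi> e \<rho> where N: "\<rho> > 0" "open N" "x \<in> N" "N \<subseteq> B" "holo_map N \<kappa>" "holo_map (ball (\<kappa> x) \<rho>) \<psi>"
    "\<kappa> ` N = ball (\<kappa> x) \<rho>" "\<And>y. y \<in> N \<Longrightarrow> \<psi> (\<kappa> y) = y" "\<And>y. y \<in> N \<Longrightarrow> f y = dd f x (\<kappa> y)"
    by (rule straight_chart[OF f x]) blast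
  define b where "b = ball (\<kappa> x) \<rho>"
  have b: "open b" "convex b" "\<kappa> ` N = b" "holo_map b \<psi>" using N by (simp_all add: b_def)
  have \<psi>N: "\<psi> z \<in> N" and \<kappa>\<psi>: "\<kappa> (\<psi> z) = z" if "z \<in> b" for z
    using that N(8) b(3) by force+
  have im: "\<psi> ` b \<subseteq> B" using \<psi>N N(4) by blast
  have f\<psi>: "f (\<psi> z) = dd f x z" if "z \<in> b" for z using N(9)[OF \<psi>N[OF that]] \<kappa>\<psi>[OF that] by simp
  have df: "dd f (\<psi> z) (Dmap \<psi> z w) = dd f x w" if z: "z \<in> b" for z w
  proof -
    have "dd f (\<psi> z) (Dmap \<psi> z w) = dd (\<lambda>z. f (\<psi> z)) z w" using chol_compose(2)[OF fh b(4) im z] by simp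
    also have "\<dots> = dd (dd f x) z w" using dd_cong[OF b(1) z f\<psi>] by simp
    also have "\<dots> = dd f x w"
      using dd_pair[OF holo_map_const holo_map_id, of z UNIV "grad f x" w]
      by (simp add: pair_grad[OF fh subsetD[OF N(4,3)]] Dmap_const pair_linear Dmap_eq[OF has_derivative_ident])
    finally show ?thesis .
  qed
  have path: "\<psi> (z + w) \<in> leaf N F (\<psi> z)" if z: "z \<in> b" "z + w \<in> b" and w: "dd f x w = 0" for z w
    unfolding leaf_iff
  proof (intro exI conjI)
    define \<gamma> where "\<gamma> t = z + t *\<^sub>R w" for t
    have \<gamma>b: "\<gamma> t \<in> b" if "t \<in> {0..1}" for t
      using convexD[OF b(2) z, of "1 - t" t] that by (simp add: \<gamma>_def algebra_simps)
    have d\<gamma>: "(\<gamma> has_vector_derivative w) (at t)" for t unfolding \<gamma>_def by (auto intro!: derivative_eq_intros)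
    show "tpath N F (\<lambda>t. \<psi> (\<gamma> t))"
    proof (rule tpath_smooth[where D = "\<lambda>t. Dmap \<psi> (\<gamma> t) w"])
      fix t :: real assume t: "t \<in> {0..1}"
      show "((\<lambda>t. \<psi> (\<gamma> t)) has_vector_derivative Dmap \<psi> (\<gamma> t) w) (at t)"
        by (rule has_vector_derivative_holo[OF d\<gamma> b(4) \<gamma>b[OF t]])
      show "\<psi> (\<gamma> t) \<in> N" using \<psi>N[OF \<gamma>b[OF t]] .
      then show "Dmap \<psi> (\<gamma> t) w \<in> F (\<psi> (\<gamma> t))"
        using first_intD(3)[OF f] N(4) df[OF \<gamma>b[OF t]] w by auto
    next
      show "continuous_on {0..1} (\<lambda>t. Dmap \<psi> (\<gamma> t) w)"
        by (rule Dmap_continuous_on[OF b(1,4)]) (auto simp: \<gamma>_def[symmetric] intro!: \<gamma>b continuous_intros, auto simp: \<gamma>_def intro!: continuous_intros)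
    qed
  qed (simp_all add: pathstart_def pathfinish_def)
  show ?thesis
  proof (intro exI[of _ N] conjI ballI impI N(2-4))
    fix y y' assume y: "y \<in> N" "y' \<in> N" "f y = f y'"
    have "dd f x (\<kappa> y' - \<kappa> y) = 0" using N(9)[OF y(1)] N(9)[OF y(2)] y(3) by (simp add: chol_dd_linear[OF fh x])
    then have "\<psi> (\<kappa> y + (\<kappa> y' - \<kappa> y)) \<in> leaf N F (\<psi> (\<kappa> y))" by (intro path) (use b(3) y in auto)
    then show "y' \<in> leaf N F y" using N(8) y by simp
  next
    fix y v assume y: "y \<in> N" and v: "v \<in> F y"
    define w where "w = Dmap \<kappa> y v"
    have yb: "\<kappa> y \<in> b" using y b(3) by blast
    have "Dmap \<psi> (\<kappa> y) w = v"
    proof -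
      have "Dmap (\<lambda>y. \<psi> (\<kappa> y)) y v = Dmap (\<lambda>y. y) y v" using Dmap_cong[OF N(2) y, of "\<lambda>y. \<psi> (\<kappa> y)" "\<lambda>y. y"] N(8) by simp
      then show ?thesis using holo_map_compose(2)[OF b(4) N(5) _ y, of v] b(3) 
        by (simp add: w_def Dmap_eq[OF has_derivative_ident])
    qed
    then have w: "Dmap \<psi> (\<kappa> y) w = v" "dd f x w = 0"
      using df[OF yb, of w] v first_intD(3)[OF f] y N(4,8) by auto
    obtain \<delta>0 where \<delta>0: "\<delta>0 > 0" "ball (\<kappa> y) \<delta>0 \<subseteq> b" using b(1) yb openE by blast
    define \<delta> where "\<delta> = \<delta>0 / (norm w + 1)"
    have \<delta>: "\<delta> > 0" using \<delta>0 by (simp add: \<delta>_def add_nonneg_pos)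
    define \<gamma> where "\<gamma> t = \<psi> (\<kappa> y + t *\<^sub>R w)" for t :: real
    have inb: "\<kappa> y + t *\<^sub>R w \<in> b" if "t \<in> {-\<delta><..<\<delta>}" for t
    proof -
      have np: "norm w + 1 > 0" using norm_ge_zero[of w] by linarith
      have "\<bar>t\<bar> * norm w \<le> \<bar>t\<bar> * (norm w + 1)" by (simp add: mult_left_mono)
      also have "\<dots> < \<delta> * (norm w + 1)" using that np by (intro mult_strict_right_mono) auto
      also have "\<dots> = \<delta>0" using np by (simp add: \<delta>_def)
      finally have "\<kappa> y + t *\<^sub>R w \<in> ball (\<kappa> y) \<delta>0" by (simp add: dist_norm)
      then show ?thesis using \<delta>0(2) by blast
    qed
    have "\<gamma> t \<in> leaf N F y" if t: "t \<in> {-\<delta><..<\<delta>}" for t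
    proof -
      have "dd f x (t *\<^sub>R w) = 0" using w(2) chol_dd_linear(6)[OF fh x] by simp
      from path[OF yb inb[OF t] this] show ?thesis using N(8)[OF y] by (simp add: \<gamma>_def)
    qed
    moreover have "(\<gamma> has_vector_derivative v) (at 0)"
    proof -
      have "((\<lambda>t. \<kappa> y + t *\<^sub>R w) has_vector_derivative w) (at 0)" by (auto intro!: derivative_eq_intros)
      from has_vector_derivative_holo[OF this b(4)] show ?thesis using yb w(1) by (simp add: \<gamma>_def[abs_def])
    qed
    moreover have "\<gamma> 0 = y" using N(8)[OF y] by (simp add: \<gamma>_def)
    ultimately show "\<exists>\<gamma> \<delta>. \<delta> > 0 \<and> (\<forall>t\<in>{-\<delta><..<\<delta>}. \<gamma> t \<in> leaf N F y) \<and> \<gamma> 0 = y \<and> (\<gamma> has_vector_derivative v) (at (0::real))"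
      using \<delta> by blast
  qed
qed

lemma leaf_first_int_const:
  assumes "first_int B F f" "N \<subseteq> B" "q \<in> leaf N F p" shows "f q = f p"
proof -
  obtain g where g: "tpath N F g" "pathstart g = p" "pathfinish g = q" using assms(3) leaf_iff by metis
  have "g ` {0..1} \<subseteq> B" using g(1) assms(2) unfolding tpath_def path_image_def by blast
  then have "f (g 1) = f (g 0)" using tpath_first_int[OF g(1) assms(1), of 0 1 1] by simp
  then show ?thesis using g by (simp add: pathstart_def pathfinish_def)
qed

lemma first_int_locally_const:
  assumes f1: "first_int B1 F f1" and f: "first_int B F f" and y: "y \<in> B1 \<inter> B"
  obtains W where "open W" "y \<in> W" "W \<subseteq> B1 \<inter> B" "\<And>y1 y2. y1 \<in> W \<Longrightarrow> y2 \<in> W \<Longrightarrow> f1 y1 = f1 y2 \<Longrightarrow> f y1 = f y2"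
proof -
  have "first_int (B1 \<inter> B) F f1" by (rule first_int_subset[OF f1]) (use first_intD(1) f1 f in auto)
  from plaque_connected[OF this y] 
  obtain W where W: "open W" "y \<in> W" "W \<subseteq> B1 \<inter> B" "\<forall>y\<in>W. \<forall>y'\<in>W. f1 y = f1 y' \<longrightarrow> y' \<in> leaf W F y"
    by (elim exE conjE)
  have "W \<subseteq> B" using W(3) by blast
  then show ?thesis using that[OF W(1-3)] leaf_first_int_const[OF f] W(4) by metis
qed

subsection \<open>A leaf meets a transversal in a countable set\<close>

text \<open>Two first integrals are locally functions of one another; a level set of the first is covered by
countably many open sets on which the second is constant along it.\<close>

lemma plaque_countable:
  assumes f1: "first_int B1 F f1" and f: "first_int B F f"
  shows "countable (f ` {y \<in> B1 \<inter> B. f1 y = s})"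
proof -
  have "\<forall>y\<in>B1 \<inter> B. \<exists>W. open W \<and> y \<in> W \<and> W \<subseteq> B1 \<inter> B \<and> (\<forall>y1\<in>W. \<forall>y2\<in>W. f1 y1 = f1 y2 \<longrightarrow> f y1 = f y2)"
    using first_int_locally_const[OF f1 f] by metis
  then obtain W where W: "\<And>y. y \<in> B1 \<inter> B \<Longrightarrow> open (W y) \<and> y \<in> W y \<and> W y \<subseteq> B1 \<inter> B \<and> (\<forall>y1\<in>W y. \<forall>y2\<in>W y. f1 y1 = f1 y2 \<longrightarrow> f y1 = f y2)"
    by metis
  obtain \<W> where \<W>: "\<W> \<subseteq> W ` (B1 \<inter> B)" "countable \<W>" "\<Union>\<W> = \<Union>(W ` (B1 \<inter> B))"
    using Lindelof[of "W ` (B1 \<inter> B)"] W by (metis (no_types, lifting) imageE)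
  have "f ` {y \<in> B1 \<inter> B. f1 y = s} \<subseteq> (\<Union>w\<in>\<W>. f ` {y \<in> w. f1 y = s})"
  proof safe
    fix y assume y: "y \<in> B1" "y \<in> B"
    then have "y \<in> \<Union>\<W>" using W \<W>(3) by blast
    then show "f y \<in> (\<Union>w\<in>\<W>. f ` {y' \<in> w. f1 y' = f1 y})" by blast
  qed
  moreover have "countable (f ` {y \<in> w. f1 y = s})" if w: "w \<in> \<W>" for w
  proof -
    obtain x where x: "x \<in> B1 \<inter> B" "w = W x" using w \<W>(1) by blast
    have eq: "f y1 = f y2" if "y1 \<in> w" "y2 \<in> w" "f1 y1 = s" "f1 y2 = s" for y1 y2
      using W[OF x(1)] that x(2) by metis
    have "\<exists>c. f ` {y \<in> w. f1 y = s} \<subseteq> {c}"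
    proof (cases "\<exists>y0\<in>w. f1 y0 = s")
      case True
      then obtain y0 where "y0 \<in> w" "f1 y0 = s" by blast
      then have "f ` {y \<in> w. f1 y = s} \<subseteq> {f y0}" using eq by blast
      then show ?thesis by blast
    qed auto
    then show ?thesis by (metis countable_empty countable_insert countable_subset)
  qed
  ultimately show ?thesis using \<W>(2) by (meson countable_UN countable_subset)
qed

text \<open>A path in a leaf runs through finitely many of countably many plaque neighbourhoods. Hence all
values of local first integrals on the leaf are obtained from one initial value by countably many
chains of transitions, each step of which offers countably many choices.\<close>

lemma leaf_countable:
  assumes U: "open U" and F: "foliation U F" and f: "first_int B F f"
  shows "countable (f ` (leaf U F p \<inter> B))"
proof -
  have "\<forall>x\<in>U. \<exists>r \<phi>. r > 0 \<and> ball x r \<subseteq> U \<and> first_int (ball x r) F \<phi>"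
    using foliation_first_int[OF F] by metis
  then obtain r \<phi> where r: "\<And>x. x \<in> U \<Longrightarrow> r x > 0 \<and> ball x (r x) \<subseteq> U \<and> first_int (ball x (r x)) F (\<phi> x)"
    by metis
  obtain \<B> where \<B>: "\<B> \<subseteq> (\<lambda>x. ball x (r x)) ` U" "countable \<B>" "\<Union>\<B> = \<Union>((\<lambda>x. ball x (r x)) ` U)"
    using Lindelof[of "(\<lambda>x. ball x (r x)) ` U"] by (metis (no_types, lifting) imageE open_ball)
  obtain K where K: "countable K" "K \<subseteq> U" "\<B> = (\<lambda>x. ball x (r x)) ` K" 
    using countable_subset_image[of \<B> "\<lambda>x. ball x (r x)" U] \<B>(1,2) by blast
  have cov: "\<exists>x\<in>K. y \<in> ball x (r x)" if "y \<in> U" for y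
  proof -
    have "y \<in> \<Union>\<B>" using \<B>(3) r[OF that] that by (metis UN_I centre_in_ball)
    then show ?thesis using K(3) by blast
  qed
  \<comment> \<open>the plaques (chart, level) that can be reached from the plaques in C by one change of chart\<close>
  define step where "step C = (\<Union>z\<in>C \<inter> (K \<times> UNIV). \<Union>x'\<in>K. 
     Pair x' ` \<phi> x' ` {y \<in> ball (fst z) (r (fst z)) \<inter> ball x' (r x'). \<phi> (fst z) y = snd z})" for C
  define Cn where "Cn k = (step ^^ k) ((\<lambda>x. (x, \<phi> x p)) ` K)" for k
  have Cn0: "Cn 0 = (\<lambda>x. (x, \<phi> x p)) ` K" and CnS: "Cn (Suc k) = step (Cn k)" for k by (simp_all add: Cn_def)
  have cC: "countable (Cn k)" for k
  proof (induction k)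
    case 0
    then show ?case using K(1) by (simp add: Cn0)
  next
    case (Suc k)
    have "countable (Pair x' ` \<phi> x' ` {y \<in> ball (fst z) (r (fst z)) \<inter> ball x' (r x'). \<phi> (fst z) y = snd z})"
      if "z \<in> Cn k \<inter> (K \<times> UNIV)" "x' \<in> K" for x' z
    proof -
      have "fst z \<in> U" "x' \<in> U" using that K(2) by auto
      then have "first_int (ball (fst z) (r (fst z))) F (\<phi> (fst z))" "first_int (ball x' (r x')) F (\<phi> x')"
        using r by blast+
      then show ?thesis by (intro countable_image[of _ "Pair x'"] plaque_countable)
    qed
    then show ?case unfolding CnS step_def using Suc K(1) by (intro countable_UN) auto
  qed
  define C where "C = (\<Union>k. Cn k)"
  have C0: "(x, \<phi> x p) \<in> C" if "x \<in> K" for x using that unfolding C_def by (intro UN_I[of 0]) (auto simp: Cn0)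
  have CS: "(x', \<phi> x' y) \<in> C" if "(x, \<phi> x y) \<in> C" "x \<in> K" "x' \<in> K" "y \<in> ball x (r x)" "y \<in> ball x' (r x')" for x x' y
  proof -
    from that(1) obtain k where "(x, \<phi> x y) \<in> Cn k" unfolding C_def by blast
    then have "(x', \<phi> x' y) \<in> Cn (Suc k)" unfolding CnS step_def
      using that by (intro UN_I[of "(x, \<phi> x y)"] UN_I[of x']) auto
    then show ?thesis unfolding C_def by blast
  qed
  have reach: "\<forall>x\<in>K. q \<in> ball x (r x) \<longrightarrow> (x, \<phi> x q) \<in> C" if q: "q \<in> leaf U F p" for q
  proof -
    obtain g where g: "tpath U F g" "pathstart g = p" "pathfinish g = q" using q leaf_iff by metis
    have gU: "g t \<in> U" if "t \<in> {0..1}" for t using g(1) that unfolding tpath_def path_image_def by blast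
    define A where "A t \<longleftrightarrow> (\<forall>x\<in>K. g t \<in> ball x (r x) \<longrightarrow> (x, \<phi> x (g t)) \<in> C)" for t
    have loc: "\<exists>\<delta>>0. \<forall>s\<in>{0..1}. \<bar>s - t\<bar> < \<delta> \<longrightarrow> A s = A t" if t: "t \<in> {0..1}" for t
    proof -
      obtain x where x: "x \<in> K" "g t \<in> ball x (r x)" using cov[OF gU[OF t]] by blast
      have xU: "x \<in> U" using x K by blast
      obtain \<delta> where \<delta>: "\<delta> > 0" "\<forall>s\<in>{0..1}. \<bar>s - t\<bar> < \<delta> \<longrightarrow> g ` {min s t..max s t} \<subseteq> ball x (r x)"
        using path_near[OF tpath_continuous[OF g(1)] open_ball t x(2)] by blast
      have "A s = A t" if s: "s \<in> {0..1}" "\<bar>s - t\<bar> < \<delta>" for s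
      proof -
        have sub: "g ` {min s t..max s t} \<subseteq> ball x (r x)" using \<delta>(2) s by blast
        have fi: "first_int (ball x (r x)) F (\<phi> x)" using r[OF xU] by blast
        have eq1: "\<phi> x (g u) = \<phi> x (g (min s t))" if "u \<in> {min s t..max s t}" for u
          by (rule tpath_first_int[OF g(1) fi _ _ sub that]) (use s t in auto)
        have eq: "\<phi> x (g s) = \<phi> x (g t)" using eq1[of s] eq1[of t] by simp
        have As: "A u \<longleftrightarrow> (x, \<phi> x (g u)) \<in> C" if "u = s \<or> u = t" for u
        proof -
          have "g u \<in> ball x (r x)" using that sub by (auto simp: image_subset_iff)
          then show ?thesis using x(1) CS unfolding A_def by blast
        qed
        show ?thesis using As[of s] As[of t] eq by simp
      qed
      then show ?thesis using \<delta>(1) by blast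
    qed
    have "A 0" using g(2) C0 by (auto simp: A_def pathstart_def)
    have "A 1 = A 0" by (rule unit_interval_const[OF loc])
    then show ?thesis using \<open>A 0\<close> g(3) by (simp add: A_def pathfinish_def)
  qed
  have "f ` (leaf U F p \<inter> B) \<subseteq> (\<Union>(x, s)\<in>C \<inter> (K \<times> UNIV). f ` {y \<in> ball x (r x) \<inter> B. \<phi> x y = s})"
  proof safe
    fix q assume q: "q \<in> leaf U F p" "q \<in> B"
    then obtain x where x: "x \<in> K" "q \<in> ball x (r x)" using cov leaf_subset by blast
    then have "(x, \<phi> x q) \<in> C" using reach[OF q(1)] by blast
    then show "f q \<in> (\<Union>(x, s)\<in>C \<inter> (K \<times> UNIV). f ` {y \<in> ball x (r x) \<inter> B. \<phi> x y = s})"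
      using x q(2) by (intro UN_I[of "(x, \<phi> x q)"]) auto
  qed
  moreover have "countable (f ` {y \<in> ball x (r x) \<inter> B. \<phi> x y = s})" if "x \<in> K" for x s
  proof -
    have "x \<in> U" using that K(2) by auto
    then have "first_int (ball x (r x)) F (\<phi> x)" using r by blast
    then show ?thesis by (rule plaque_countable[OF _ f])
  qed
  moreover have "countable C" unfolding C_def using cC by blast
  ultimately show ?thesis by (rule_tac countable_subset) (auto intro!: countable_UN)
qed

text \<open>A leaf may accumulate on itself, so that a curve contained in it could a priori jump between
plaques. Along the curve, however, \<open>f\<close> takes values in a connected and countable set.\<close>

lemma curve_in_leaf_tangent:
  fixes c :: "complex \<Rightarrow> complex^'n"
  assumes U: "open U" and F: "foliation U F" and f: "first_int B F f" 
    and c: "\<And>k. (\<lambda>t. c t $ k) holomorphic_on ball t0 \<epsilon>" "\<And>t. t \<in> ball t0 \<epsilon> \<Longrightarrow> c t \<in> leaf U F p \<inter> B" and t: "t \<in> ball t0 \<epsilon>"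
  shows "f (c t) = f (c t0)"
proof -
  have "continuous_on (ball t0 \<epsilon>) (\<lambda>t. vec_lambda (\<lambda>k. c t $ k))"
    by (intro continuous_on_vec_lambda holomorphic_on_imp_continuous_on c(1))
  then have cc: "continuous_on (ball t0 \<epsilon>) c" by simp
  define S where "S = (\<lambda>t. f (c t)) ` ball t0 \<epsilon>"
  have "connected S" unfolding S_def
    by (intro connected_continuous_image continuous_on_compose2[OF chol_continuous_on[OF first_intD(2)[OF f]] cc]) (use c(2) in auto)
  moreover have "countable S"
    by (rule countable_subset[OF _ leaf_countable[OF U F f, of p]]) (use c(2) in \<open>auto simp: S_def\<close>)
  moreover have "t0 \<in> ball t0 \<epsilon>" using t zero_le_dist[of t0 t] by (simp del: zero_le_dist)
  then have "f (c t) \<in> S" "f (c t0) \<in> S" using t unfolding S_def by blast+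
  ultimately show ?thesis using connected_uncountable by blast
qed

section \<open>The algebraic form of compatibility\<close>

lemma d2_expand:
  assumes U: "open U" "chol U f" "x \<in> U"
  shows "d2 f x v w = (\<Sum>i\<in>UNIV. \<Sum>j\<in>UNIV. v $ i * w $ j * d2 f x (axis i 1) (axis j 1))"
proof -
  have "d2 f x v w = d2 f x (\<Sum>i\<in>UNIV. v $ i *s axis i 1) (\<Sum>j\<in>UNIV. w $ j *s axis j 1)"
    by (simp only: basis_expansion)
  also have "\<dots> = (\<Sum>i\<in>UNIV. \<Sum>j\<in>UNIV. d2 f x (v $ i *s axis i 1) (w $ j *s axis j 1))"
    by (simp only: d2_bilinear(5,6)[OF U]) (rule sum.swap)
  finally show ?thesis by (simp add: d2_bilinear(3,4)[OF U] mult.assoc mult.left_commute)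
qed

lemma conn_expand:
  assumes G: "affine_connection U \<Gamma>" "x \<in> U"
  shows "\<Gamma> x v w = (\<Sum>i\<in>UNIV. \<Sum>j\<in>UNIV. (v $ i * w $ j) *s \<Gamma> x (axis i 1) (axis j 1))"
proof -
  have "\<Gamma> x v w = (\<Sum>i\<in>UNIV. v $ i *s \<Gamma> x (axis i 1) w)"
    by (rule clinear_basis[OF affine_connectionD(2)[OF G]])
  also have "\<dots> = (\<Sum>i\<in>UNIV. v $ i *s (\<Sum>j\<in>UNIV. w $ j *s \<Gamma> x (axis i 1) (axis j 1)))"
    by (subst clinear_basis[OF affine_connectionD(1)[OF G], of _ w]) (rule refl)
  finally show ?thesis by (simp add: vec.scale_sum_right)
qed

lemma d2_continuous:
  assumes U: "open U" "chol U f" and c: "continuous_on S a" "a ` S \<subseteq> U" "continuous_on S v" "continuous_on S w"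
  shows "continuous_on S (\<lambda>s. d2 f (a s) (v s) (w s))"
proof -
  have k: "continuous_on S (\<lambda>s. d2 f (a s) (axis i 1) (axis j 1))" for i j
    by (rule continuous_on_compose2[OF chol_continuous_on[OF d2_chol[OF U]] c(1,2)])
  have "continuous_on S (\<lambda>s. \<Sum>i\<in>UNIV. \<Sum>j\<in>UNIV. v s $ i * w s $ j * d2 f (a s) (axis i 1) (axis j 1))"
    by (intro continuous_intros k c)
  then show ?thesis
    by (rule continuous_on_cong[THEN iffD1, rotated -1]) (use c(2) d2_expand[OF U] in auto)
qed

lemma conn_continuous:
  assumes G: "affine_connection U \<Gamma>" and c: "continuous_on S a" "a ` S \<subseteq> U" "continuous_on S v" "continuous_on S w"
  shows "continuous_on S (\<lambda>s. \<Gamma> (a s) (v s) (w s))"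
proof -
  have k: "continuous_on S (\<lambda>s. \<Gamma> (a s) (axis i 1) (axis j 1) $ l)" for i j l
    by (rule continuous_on_compose2[OF chol_continuous_on[OF holo_map_chol[OF affine_connectionD(3)[OF G]]] c(1,2)])
  have "continuous_on S (\<lambda>s. vec_lambda (\<lambda>l. \<Sum>i\<in>UNIV. \<Sum>j\<in>UNIV. v s $ i * w s $ j * \<Gamma> (a s) (axis i 1) (axis j 1) $ l))"
    by (intro continuous_on_vec_lambda continuous_intros k c)
  moreover have "\<Gamma> (a s) (v s) (w s) = vec_lambda (\<lambda>l. \<Sum>i\<in>UNIV. \<Sum>j\<in>UNIV. v s $ i * w s $ j * \<Gamma> (a s) (axis i 1) (axis j 1) $ l)" if "s \<in> S" for s
    by (subst conn_expand[OF G]) (use c(2) that in \<open>auto simp: vec_eq_iff sum_component\<close>)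
  ultimately show ?thesis by (simp cong: continuous_on_cong)
qed

subsection \<open>Holomorphic curves\<close>

lemma curve_has_derivative:
  fixes c :: "complex \<Rightarrow> complex^'n"
  assumes "open D" "\<And>k. (\<lambda>t. c t $ k) holomorphic_on D" "t \<in> D"
  shows "(c has_derivative (\<lambda>h. h *s velocity c t)) (at t)"
proof -
  have "((\<lambda>s. c s $ k) has_derivative (\<lambda>h. velocity c t $ k * h)) (at t)" for k
    using holomorphic_derivI[OF assms(2,1,3), of k] by (simp add: velocity_def has_field_derivative_def)
  from has_derivative_vecI[OF this] show ?thesis
    by (rule has_derivative_eq_rhs) (auto simp: fun_eq_iff vec_eq_iff)
qed

lemma curve_chol:
  assumes c: "open D" "\<And>k. (\<lambda>t. c t $ k) holomorphic_on D" "t \<in> D" and f: "chol B f" "c t \<in> B"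
  shows "((\<lambda>s. f (c s)) has_field_derivative dd f (c t) (velocity c t)) (at t)"
proof -
  have "((\<lambda>s. f (c s)) has_derivative (\<lambda>h. dd f (c t) (h *s velocity c t))) (at t)"
    by (rule has_derivative_compose[OF curve_has_derivative[OF c] chol_has_derivative[OF f]])
  then show ?thesis unfolding has_field_derivative_def
    by (rule has_derivative_eq_rhs) (auto simp: fun_eq_iff chol_dd_scale[OF f])
qed

lemma velocity_holomorphic:
  assumes c: "open D" "\<And>k. (\<lambda>t. c t $ k) holomorphic_on D"
  shows "(\<lambda>t. velocity c t $ k) holomorphic_on D"
  using holomorphic_deriv[OF c(2,1)] by (simp add: velocity_def)

lemma curve_continuous:
  fixes c :: "complex \<Rightarrow> complex^'n"
  assumes "\<And>k. (\<lambda>t. c t $ k) holomorphic_on D" shows "continuous_on D c"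
proof -
  have "continuous_on D (\<lambda>t. vec_lambda (\<lambda>k. c t $ k))"
    by (intro continuous_on_vec_lambda holomorphic_on_imp_continuous_on assms)
  then show ?thesis by simp
qed

lemma curve_dd:
  assumes c: "open D" "\<And>k. (\<lambda>t. c t $ k) holomorphic_on D" "t \<in> D" and f: "open B" "chol B f" "c t \<in> B"
    and w: "\<And>k. (\<lambda>t. w t $ k) holomorphic_on D"
  shows "((\<lambda>s. dd f (c s) (w s)) has_field_derivative d2 f (c t) (w t) (velocity c t) + dd f (c t) (velocity w t)) (at t)"
proof -
  have "((\<lambda>s. \<Sum>k\<in>UNIV. w s $ k * dd f (c s) (axis k 1)) has_field_derivative
      (\<Sum>k\<in>UNIV. w t $ k * d2 f (c t) (axis k 1) (velocity c t) + velocity w t $ k * dd f (c t) (axis k 1))) (at t)"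
  proof (rule DERIV_sum)
    fix k
    have 1: "((\<lambda>s. dd f (c s) (axis k 1)) has_field_derivative d2 f (c t) (axis k 1) (velocity c t)) (at t)"
      unfolding d2_def by (rule curve_chol[OF c dd_chol_and_symmetric(1)[OF f(1,2)] f(3)])
    have 2: "((\<lambda>s. w s $ k) has_field_derivative velocity w t $ k) (at t)"
      using holomorphic_derivI[OF w c(1,3), of k] by (simp add: velocity_def)
    show "((\<lambda>s. w s $ k * dd f (c s) (axis k 1)) has_field_derivative w t $ k * d2 f (c t) (axis k 1) (velocity c t) + velocity w t $ k * dd f (c t) (axis k 1)) (at t)"
      using DERIV_mult[OF 2 1] by (simp add: algebra_simps)
  qed
  moreover have "(\<Sum>k\<in>UNIV. w t $ k * d2 f (c t) (axis k 1) (velocity c t) + velocity w t $ k * dd f (c t) (axis k 1))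
     = d2 f (c t) (w t) (velocity c t) + dd f (c t) (velocity w t)"
  proof -
    have "d2 f (c t) (w t) (velocity c t) = d2 f (c t) (\<Sum>k\<in>UNIV. w t $ k *s axis k 1) (velocity c t)" by (simp only: basis_expansion)
    also have "\<dots> = (\<Sum>k\<in>UNIV. w t $ k * d2 f (c t) (axis k 1) (velocity c t))"
      by (simp only: d2_bilinear[OF f])
    finally show ?thesis by (simp add: sum.distrib dd_expand[OF f(2,3), of "velocity w t"])
  qed
  ultimately have d: "((\<lambda>s. \<Sum>k\<in>UNIV. w s $ k * dd f (c s) (axis k 1)) has_field_derivative
     d2 f (c t) (w t) (velocity c t) + dd f (c t) (velocity w t)) (at t)" by simp
  have o: "open (D \<inter> c -` B)"
    by (rule continuous_open_preimage[OF curve_continuous[OF c(2)] c(1) f(1)])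
  show ?thesis
    by (rule has_field_derivative_transform_within_open[OF d o]) (use c(3) f(3) dd_expand[OF f(2)] in auto)
qed

text \<open>The second fundamental form at \<open>x\<close> of the level set of \<open>f\<close> through \<open>x\<close>, measured with \<open>\<Gamma>\<close>, vanishes.\<close>

definition tgcond :: "(complex^'n \<Rightarrow> complex) \<Rightarrow> 'n conn \<Rightarrow> complex^'n \<Rightarrow> bool" where
  "tgcond f \<Gamma> x \<longleftrightarrow> (\<forall>v. dd f x v = 0 \<longrightarrow> d2 f x v v = dd f x (\<Gamma> x v v))"

text \<open>Differentiate \<open>f\<close> twice along the geodesic issuing from \<open>x\<close> in direction \<open>v\<close>, on which \<open>f\<close> is constant.\<close>

lemma tot_geodesic_imp_tgcond:
  assumes U: "open U" and F: "foliation U F" and G: "affine_connection U \<Gamma>" "\<Gamma> \<in> P"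
    and tg: "totally_geodesic U P (leaf U F x) F" and f: "first_int B F f" and x: "x \<in> B" "x \<in> U"
  shows "tgcond f \<Gamma> x"
  unfolding tgcond_def
proof (intro allI impI)
  note B = first_intD(1)[OF f] and fh = first_intD(2)[OF f]
  fix v assume v: "dd f x v = 0"
  show "d2 f x v v = dd f x (\<Gamma> x v v)"
  proof (cases "v = 0")
    case True
    have "d2 f x (0 *s v) v = 0" by (simp only: d2_bilinear(4)[OF B fh x(1)]) simp
    then show ?thesis using True conn_bilinear(5)[OF G(1) x(2)] chol_dd_linear(3)[OF fh x(1)] by simp
  next
    case False
    obtain r c where r: "r > 0" and c: "geodesic_param U \<Gamma> (ball 0 r) c" "c 0 = x" "velocity c 0 = v"
      using geodesic_exists[OF G(1) U x(2) False] by blast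
    have ch: "(\<lambda>t. c t $ k) holomorphic_on ball 0 r" for k using c(1) by (simp add: geodesic_param_def)
    have xl: "x \<in> leaf U F x" by (rule leaf_refl[where U = U and F = F, OF x(2) foliation_zero[OF F x(2)]])
    have "velocity c 0 \<in> F x" using c(3) v first_intD(3)[OF f x(1)] by simp
    then have "\<forall>\<^sub>F t in nhds 0. c t \<in> leaf U F x"
      using tg[unfolded totally_geodesic_def, rule_format, OF G(2) xl, of "ball 0 r" c 0] c(1,2) r by simp
    then obtain S where S: "open S" "0 \<in> S" "\<forall>t\<in>S. c t \<in> leaf U F x" unfolding eventually_nhds by blast
    have o: "open (ball 0 r \<inter> c -` B)"
      by (rule continuous_open_preimage[OF curve_continuous[OF ch] open_ball B])
    have "open (S \<inter> (ball 0 r \<inter> c -` B))" "0 \<in> S \<inter> (ball 0 r \<inter> c -` B)" using S o r c(2) x(1) by auto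
    then obtain \<epsilon> where \<epsilon>: "\<epsilon> > 0" "ball 0 \<epsilon> \<subseteq> S \<inter> (ball 0 r \<inter> c -` B)" using openE by blast
    have ch': "(\<lambda>t. c t $ k) holomorphic_on ball 0 \<epsilon>" for k using holomorphic_on_subset[OF ch] \<epsilon>(2) by blast
    have cB: "c t \<in> B" if "t \<in> ball 0 \<epsilon>" for t using \<epsilon>(2) that by blast
    have const: "f (c t) = f (c 0)" if "t \<in> ball 0 \<epsilon>" for t
      by (rule curve_in_leaf_tangent[OF U F f ch' _ that, of x]) (use \<epsilon>(2) S(3) in blast)
    have tang: "dd f (c t) (velocity c t) = 0" if t: "t \<in> ball 0 \<epsilon>" for t
    proof -
      have 1: "((\<lambda>s. f (c s)) has_field_derivative dd f (c t) (velocity c t)) (at t)"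
        by (rule curve_chol[OF open_ball ch' t fh cB[OF t]])
      have "((\<lambda>s. f (c s)) has_field_derivative 0) (at t)"
        by (rule has_field_derivative_transform_within_open[OF DERIV_const open_ball t]) (simp only: const)
      then show ?thesis using 1 DERIV_unique by blast
    qed
    have z: "(0::complex) \<in> ball 0 \<epsilon>" using \<epsilon>(1) by simp
    have 1: "((\<lambda>s. dd f (c s) (velocity c s)) has_field_derivative d2 f (c 0) (velocity c 0) (velocity c 0) + dd f (c 0) (velocity (velocity c) 0)) (at 0)"
      by (rule curve_dd[OF open_ball ch' z B fh cB[OF z] velocity_holomorphic[OF open_ball ch']])
    have "((\<lambda>s. dd f (c s) (velocity c s)) has_field_derivative 0) (at 0)"
      by (rule has_field_derivative_transform_within_open[OF DERIV_const open_ball z]) (simp only: tang)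
    then have "d2 f x v v + dd f x (velocity (velocity c) 0) = 0" using 1 DERIV_unique c by blast
    moreover have "velocity (velocity c) 0 = - \<Gamma> x v v"
      using c r by (auto simp: geodesic_param_def eq_neg_iff_add_eq_0)
    ultimately show ?thesis by (simp add: chol_dd_linear[OF fh x(1)])
  qed
qed

text \<open>Along a geodesic \<open>c\<close> let \<open>k = dd f (c) (c')\<close> be the transversal speed. Decomposing \<open>c'\<close> into a tangential part and
a multiple \<open>k\<close> of a fixed transversal vector, the condition kills the purely tangential term of
\<open>k'\<close>; what remains is a linear equation \<open>k' = \<mu> k\<close>. So a geodesic tangent to the leaf at one
point stays tangent.\<close>

lemma tgcond_imp_leaf:
  assumes U: "open U" and F: "foliation U F" and G: "affine_connection U \<Gamma>"
    and H: "\<And>B f x. first_int B F f \<Longrightarrow> x \<in> B \<Longrightarrow> x \<in> U \<Longrightarrow> tgcond f \<Gamma> x"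
    and c: "geodesic_param U \<Gamma> D c" "t0 \<in> D" "c t0 \<in> leaf U F p" "velocity c t0 \<in> F (c t0)"
  shows "\<forall>\<^sub>F t in nhds t0. c t \<in> leaf U F p"
proof -
  have D: "open D" and ch: "\<And>k. (\<lambda>t. c t $ k) holomorphic_on D" and cU: "\<And>t. t \<in> D \<Longrightarrow> c t \<in> U"
    and geo: "\<And>t. t \<in> D \<Longrightarrow> velocity (velocity c) t = - \<Gamma> (c t) (velocity c t) (velocity c t)"
    using c(1) by (auto simp: geodesic_param_def eq_neg_iff_add_eq_0)
  define x where "x = c t0"
  have xU: "x \<in> U" using cU c(2) by (simp add: x_def)
  obtain r f where r: "r > 0" "ball x r \<subseteq> U" and f: "first_int (ball x r) F f"
    by (rule foliation_first_int[OF F xU])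
  note fh = first_intD(2)[OF f]
  have xb: "x \<in> ball x r" using r by simp
  obtain e where e: "dd f x e \<noteq> 0" using first_intD(4)[OF f xb] by blast
  have cc: "continuous_on D c" "continuous_on D (velocity c)"
    using curve_continuous[of c D] curve_continuous[of "velocity c" D] ch velocity_holomorphic[OF D ch] by auto
  have vh: "(\<lambda>t. velocity c t $ k) holomorphic_on D" for k by (rule velocity_holomorphic[OF D ch])
  define O1 where "O1 = D \<inter> c -` ball x r"
  have O1: "open O1" unfolding O1_def by (rule continuous_open_preimage[OF cc(1) D]) auto
  have im1: "c ` O1 \<subseteq> ball x r" by (auto simp: O1_def)
  have cc1: "continuous_on O1 c" "continuous_on O1 (velocity c)" using cc continuous_on_subset O1_def by blast+
  define O2 where "O2 = O1 \<inter> (\<lambda>t. dd f (c t) e) -` (- {0})"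
  have O2: "open O2" unfolding O2_def
    by (rule continuous_open_preimage[OF dd_continuous_on[OF open_ball fh cc1(1) im1 continuous_on_const] O1]) auto
  have "t0 \<in> O2" using c(2) e r by (simp add: O2_def O1_def x_def)
  then obtain \<epsilon> where \<epsilon>: "\<epsilon> > 0" "ball t0 \<epsilon> \<subseteq> O2" using openE[OF O2] by blast
  have main: "c t \<in> leaf U F (c t0)" if t: "t \<in> ball t0 \<epsilon>" for t
  proof -
    define \<sigma> where "\<sigma> s = t0 + complex_of_real s * (t - t0)" for s
    have \<sigma>b: "\<sigma> s \<in> ball t0 \<epsilon>" if "s \<in> {0..1}" for s
    proof -
      have "norm (complex_of_real s * (t - t0)) \<le> 1 * norm (t - t0)"
        unfolding norm_mult using that by (intro mult_right_mono) auto
      then show ?thesis using t by (simp add: \<sigma>_def dist_norm norm_minus_commute)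
    qed
    have \<sigma>O: "\<sigma> s \<in> O2" "\<sigma> s \<in> O1" "\<sigma> s \<in> D" "c (\<sigma> s) \<in> ball x r" "c (\<sigma> s) \<in> U" "dd f (c (\<sigma> s)) e \<noteq> 0" if "s \<in> {0..1}" for s
      using \<sigma>b[OF that] \<epsilon>(2) cU by (auto simp: O2_def O1_def subset_iff)
    have d\<sigma>: "(\<sigma> has_vector_derivative (t - t0)) (at s within S)" for s S
      unfolding \<sigma>_def by (auto intro!: derivative_eq_intros)
    have c\<sigma>: "continuous_on {0..1} \<sigma>" unfolding \<sigma>_def by (intro continuous_intros)
    have chain: "((\<lambda>s. h (\<sigma> s)) has_vector_derivative (t - t0) * h') (at s within S)"
      if "(h has_field_derivative h') (at (\<sigma> s))" for h h' s S
      using field_vector_diff_chain_within[OF d\<sigma> has_field_derivative_at_within[OF that], of S] by (simp add: o_def)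
    define S where "S s a b = d2 f (c (\<sigma> s)) a b - dd f (c (\<sigma> s)) (\<Gamma> (c (\<sigma> s)) a b)" for s a b
    define w where "w s = velocity c (\<sigma> s)" for s
    define k where "k s = dd f (c (\<sigma> s)) (w s)" for s
    define q where "q s = k s / dd f (c (\<sigma> s)) e" for s
    define v0 where "v0 s = w s - q s *s e" for s
    define \<mu> where "\<mu> s = (S s (v0 s) e + S s e (v0 s) + q s * S s e e) / dd f (c (\<sigma> s)) e" for s
    have Sk: "S s (w s) (w s) = \<mu> s * k s" if s: "s \<in> {0..1}" for s
    proof -
      note bl = d2_bilinear[OF open_ball fh \<sigma>O(4)[OF s]] conn_bilinear[OF G \<sigma>O(5)[OF s]]
        chol_dd_linear(1)[OF fh \<sigma>O(4)[OF s]] chol_dd_scale[OF fh \<sigma>O(4)[OF s]]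
      have add: "S s (a + b) d = S s a d + S s b d" "S s d (a + b) = S s d a + S s d b" for a b d
        by (simp_all add: S_def bl)
      have sc: "S s (z *s a) b = z * S s a b" "S s a (z *s b) = z * S s a b" for z a b
        by (simp_all add: S_def bl algebra_simps)
      have "dd f (c (\<sigma> s)) (v0 s) = 0"
        using \<sigma>O(6)[OF s] by (simp add: v0_def chol_dd_linear(2)[OF fh \<sigma>O(4)[OF s]] bl q_def k_def)
      then have 0: "S s (v0 s) (v0 s) = 0"
        using H[OF f \<sigma>O(4)[OF s] \<sigma>O(5)[OF s]] by (simp add: S_def tgcond_def)
      have "w s = v0 s + q s *s e" by (simp add: v0_def)
      then have "S s (w s) (w s) = q s * (S s (v0 s) e + S s e (v0 s) + q s * S s e e)"
        by (simp add: add sc 0 algebra_simps)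
      also have "\<dots> = \<mu> s * k s" by (simp add: \<mu>_def q_def)
      finally show ?thesis .
    qed
    have cw: "continuous_on {0..1} (\<lambda>s. c (\<sigma> s))" "continuous_on {0..1} w"
      unfolding w_def by (rule continuous_on_compose2[OF cc(1) c\<sigma>], use \<sigma>O in blast, rule continuous_on_compose2[OF cc(2) c\<sigma>], use \<sigma>O in blast)
    have imb: "(\<lambda>s. c (\<sigma> s)) ` {0..1} \<subseteq> ball x r" "(\<lambda>s. c (\<sigma> s)) ` {0..1} \<subseteq> U" using \<sigma>O by blast+
    have cdd: "continuous_on {0..1} (\<lambda>s. dd f (c (\<sigma> s)) (a s))" if "continuous_on {0..1} a" for a
      by (rule dd_continuous_on[OF open_ball fh cw(1) imb(1) that])
    have cS: "continuous_on {0..1} (\<lambda>s. S s (a s) (b s))" if "continuous_on {0..1} a" "continuous_on {0..1} b" for a b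
      unfolding S_def by (intro continuous_intros cdd d2_continuous[OF open_ball fh cw(1) imb(1)] conn_continuous[OF G cw(1) imb(2)] that)
    have cq: "continuous_on {0..1} q" unfolding q_def k_def
      by (intro continuous_intros cdd cw(2)) (use \<sigma>O(6) in auto)
    have cv0: "continuous_on {0..1} v0" unfolding v0_def 
      by (intro continuous_intros cw(2)) (simp add: vector_scalar_mult_def, intro continuous_on_vec_lambda continuous_intros cq)
    have "continuous_on {0..1} \<mu>" unfolding \<mu>_def
      by (intro continuous_intros cS cdd cv0 cq) (use \<sigma>O(6) in auto)
    then have "compact (\<mu> ` {0..1})" by (intro compact_continuous_image) auto
    from bounded_iff[THEN iffD1, OF compact_imp_bounded[OF this]]
    obtain M where M: "\<And>s. s \<in> {0..1} \<Longrightarrow> norm (\<mu> s) \<le> M" by blast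
    have k0: "k s = 0" if "s \<in> {0..1}" for s
    proof (rule gronwall_zero[OF _ _ _ that])
      fix s :: real assume s: "s \<in> {0..1}"
      have "((\<lambda>t. dd f (c t) (velocity c t)) has_field_derivative d2 f (c (\<sigma> s)) (w s) (w s) + dd f (c (\<sigma> s)) (velocity (velocity c) (\<sigma> s))) (at (\<sigma> s))"
        unfolding w_def by (rule curve_dd[OF D ch \<sigma>O(3)[OF s] open_ball fh \<sigma>O(4)[OF s] vh])
      moreover have "d2 f (c (\<sigma> s)) (w s) (w s) + dd f (c (\<sigma> s)) (velocity (velocity c) (\<sigma> s)) = \<mu> s * k s"
        unfolding Sk[OF s, symmetric] S_def geo[OF \<sigma>O(3)[OF s]] by (simp add: chol_dd_linear[OF fh \<sigma>O(4)[OF s]] w_def)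
      ultimately show "(k has_vector_derivative (t - t0) * (\<mu> s * k s)) (at s within {0..1})"
        using chain unfolding k_def w_def by simp
      show "norm ((t - t0) * (\<mu> s * k s)) \<le> norm (t - t0) * M * norm (k s)"
        unfolding norm_mult mult.assoc by (intro mult_left_mono mult_right_mono M s) auto
    next
      show "k 0 = 0" using c(4) first_intD(3)[OF f xb] by (simp add: k_def w_def \<sigma>_def x_def)
    qed
    show ?thesis unfolding leaf_iff
    proof (intro exI conjI)
      show "tpath U F (\<lambda>s. c (\<sigma> s))"
      proof (rule tpath_smooth[where D = "\<lambda>s. (t - t0) *s w s"])
        fix s :: real assume s: "s \<in> {0..1}"
        show "c (\<sigma> s) \<in> U" by (rule \<sigma>O(5)[OF s])
        show "(t - t0) *s w s \<in> F (c (\<sigma> s))"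
          unfolding first_intD(3)[OF f \<sigma>O(4)[OF s]] chol_dd_scale[OF fh \<sigma>O(4)[OF s]]
          using k0[OF s] by (simp add: k_def)
        have "((\<lambda>s. c (\<sigma> s)) has_derivative (\<lambda>h. (h *\<^sub>R (t - t0)) *s velocity c (\<sigma> s))) (at s)"
          using has_derivative_compose[OF d\<sigma>[of s UNIV, unfolded has_vector_derivative_def] curve_has_derivative[OF D ch \<sigma>O(3)[OF s]]] .
        then show "((\<lambda>s. c (\<sigma> s)) has_vector_derivative (t - t0) *s w s) (at s)"
          unfolding has_vector_derivative_def
          by (rule has_derivative_eq_rhs) (auto simp: fun_eq_iff vec_eq_iff w_def scaleR_conv_of_real[where 'a = complex] algebra_simps)
      next
        show "continuous_on {0..1} (\<lambda>s. (t - t0) *s w s)"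
          by (rule bounded_linear.continuous_on[OF bounded_linear_scale_right cw(2)])
      qed
    qed (simp_all add: pathstart_def pathfinish_def \<sigma>_def)
  qed
  have "c t \<in> leaf U F p" if "t \<in> ball t0 \<epsilon>" for t
    by (rule leaf_trans[OF foliation_scale[OF F] c(3) main[OF that]])
  then show ?thesis unfolding eventually_nhds using \<epsilon>(1) by (intro exI[of _ "ball t0 \<epsilon>"]) auto
qed

text \<open>Compatibility as a pointwise algebraic condition. It is imposed for all local first integrals, although
one at each point suffices (see \<open>tgcond_change\<close>).\<close>

definition alg_compat :: "(complex^'n) set \<Rightarrow> nat set \<Rightarrow> (nat \<Rightarrow> 'n hfield) \<Rightarrow> 'n conn \<Rightarrow> bool" where
  "alg_compat U I W \<Gamma> \<longleftrightarrow> (\<forall>i\<in>I. \<forall>B f x. first_int B (W i) f \<and> x \<in> B \<and> x \<in> U \<longrightarrow> tgcond f \<Gamma> x)"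

lemma compatible_iff:
  assumes U: "open U" and W: "\<And>i. i \<in> I \<Longrightarrow> foliation U (W i)" and P: "\<And>\<Gamma>. \<Gamma> \<in> P \<Longrightarrow> affine_connection U \<Gamma>"
  shows "compatible U P I W \<longleftrightarrow> (\<forall>\<Gamma>\<in>P. alg_compat U I W \<Gamma>)"
proof
  assume c: "compatible U P I W"
  show "\<forall>\<Gamma>\<in>P. alg_compat U I W \<Gamma>" unfolding alg_compat_def
  proof (intro ballI allI impI, elim conjE)
    fix \<Gamma> i B f x assume a: "\<Gamma> \<in> P" "i \<in> I" "first_int B (W i) f" "x \<in> B" "x \<in> U"
    show "tgcond f \<Gamma> x"
      by (rule tot_geodesic_imp_tgcond[OF U W[OF a(2)] P[OF a(1)] a(1) _ a(3-5)]) (use c a in \<open>auto simp: compatible_def\<close>)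
  qed
next
  assume a: "\<forall>\<Gamma>\<in>P. alg_compat U I W \<Gamma>"
  show "compatible U P I W" unfolding compatible_def totally_geodesic_def
  proof (intro ballI allI impI, elim conjE)
    fix i p \<Gamma> v D c t0
    assume b: "i \<in> I" "p \<in> U" "\<Gamma> \<in> P" "v \<in> leaf U (W i) p" "geodesic_param U \<Gamma> D c" "t0 \<in> D" "c t0 = v" "velocity c t0 \<in> W i v"
    show "\<forall>\<^sub>F t in nhds t0. c t \<in> leaf U (W i) p"
      by (rule tgcond_imp_leaf[OF U W[OF b(1)] P[OF b(3)] _ b(5,6)]) (use a b in \<open>auto simp: alg_compat_def\<close>)
  qed
qed

section \<open>The algebraic form of projective equivalence\<close>

text \<open>The two connections have the same geodesics up to parametrization; polarizing, the symmetric
part of their difference is \<open>\<theta>(v) w + \<theta>(w) v\<close> for a 1-form \<open>\<theta>\<close>.\<close>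

definition par :: "(complex^'n) set \<Rightarrow> 'n conn \<Rightarrow> 'n conn \<Rightarrow> bool" where
  "par U \<Gamma> \<Gamma>' \<longleftrightarrow> (\<forall>x\<in>U. \<forall>v. \<exists>l. \<Gamma> x v v - \<Gamma>' x v v = l *s v)"

lemma par_sym: "par U \<Gamma> \<Gamma>' \<Longrightarrow> par U \<Gamma>' \<Gamma>"
  unfolding par_def by (metis minus_diff_eq vector_smult_lneg)

lemma par_trans: "par U \<Gamma> \<Gamma>' \<Longrightarrow> par U \<Gamma>' \<Gamma>'' \<Longrightarrow> par U \<Gamma> \<Gamma>''"
  unfolding par_def
proof (intro ballI allI)
  fix x v assume a: "\<forall>x\<in>U. \<forall>v. \<exists>l. \<Gamma> x v v - \<Gamma>' x v v = l *s v" "\<forall>x\<in>U. \<forall>v. \<exists>l. \<Gamma>' x v v - \<Gamma>'' x v v = l *s v" "x \<in> U"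
  then obtain l l' where "\<Gamma> x v v - \<Gamma>' x v v = l *s v" "\<Gamma>' x v v - \<Gamma>'' x v v = l' *s v" by meson
  then have "\<Gamma> x v v - \<Gamma>'' x v v = (l + l') *s v" by (simp add: vec.scale_left_distrib flip: \<open>_ = l *s v\<close> \<open>_ = l' *s v\<close>)
  then show "\<exists>l. \<Gamma> x v v - \<Gamma>'' x v v = l *s v" by blast
qed

lemma reparam:
  assumes c: "open D" "\<And>k. (\<lambda>t. c t $ k) holomorphic_on D" and \<eta>: "open E" "\<eta> holomorphic_on E" "\<eta> ` E \<subseteq> D"
    and c': "\<And>t. t \<in> E \<Longrightarrow> c' t = c (\<eta> t)" and t: "t \<in> E"
  shows "velocity c' t = deriv \<eta> t *s velocity c (\<eta> t)"
    and "velocity (velocity c') t = deriv (deriv \<eta>) t *s velocity c (\<eta> t) + (deriv \<eta> t)\<^sup>2 *s velocity (velocity c) (\<eta> t)"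
proof -
  have d\<eta>: "(\<eta> has_field_derivative deriv \<eta> s) (at s)" if "s \<in> E" for s
    by (rule holomorphic_derivI[OF \<eta>(2,1) that])
  have comp: "((\<lambda>s. h (\<eta> s)) has_field_derivative deriv h (\<eta> s) * deriv \<eta> s) (at s)" if "s \<in> E" "h holomorphic_on D" for h s
    using DERIV_chain2[OF holomorphic_derivI[OF that(2) c(1)] d\<eta>[OF that(1)]] \<eta>(3) that(1) by blast
  have 1: "velocity c' s = deriv \<eta> s *s velocity c (\<eta> s)" if s: "s \<in> E" for s
  proof -
    have "((\<lambda>s. c' s $ k) has_field_derivative deriv (\<lambda>t. c t $ k) (\<eta> s) * deriv \<eta> s) (at s)" for k
      by (rule has_field_derivative_transform_within_open[OF comp[OF s c(2)] \<eta>(1) s]) (simp add: c')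
    then show ?thesis by (simp add: velocity_def vec_eq_iff DERIV_imp_deriv mult.commute)
  qed
  then show "velocity c' t = deriv \<eta> t *s velocity c (\<eta> t)" using t .
  have "((\<lambda>s. velocity c' s $ k) has_field_derivative deriv \<eta> t * (velocity (velocity c) (\<eta> t) $ k * deriv \<eta> t) + deriv (deriv \<eta>) t * velocity c (\<eta> t) $ k) (at t)" for k
  proof -
    have a: "((\<lambda>s. velocity c (\<eta> s) $ k) has_field_derivative velocity (velocity c) (\<eta> t) $ k * deriv \<eta> t) (at t)"
      using comp[OF t velocity_holomorphic[OF c, of k]] by (simp add: velocity_def[of "velocity c"])
    have b: "(deriv \<eta> has_field_derivative deriv (deriv \<eta>) t) (at t)"
      by (rule holomorphic_derivI[OF holomorphic_deriv[OF \<eta>(2,1)] \<eta>(1) t])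
    show ?thesis
      by (rule has_field_derivative_transform_within_open[OF DERIV_mult'[OF b a] \<eta>(1) t]) (simp add: 1)
  qed
  then show "velocity (velocity c') t = deriv (deriv \<eta>) t *s velocity c (\<eta> t) + (deriv \<eta> t)\<^sup>2 *s velocity (velocity c) (\<eta> t)"
    unfolding velocity_def[of "velocity c'"] by (simp add: vec_eq_iff DERIV_imp_deriv power2_eq_square algebra_simps)
qed

lemma geodesic_param_subset:
  assumes "geodesic_param U \<Gamma> D c" "E \<subseteq> D" "open E" shows "geodesic_param U \<Gamma> E c"
  using assms holomorphic_on_subset unfolding geodesic_param_def by blast

lemma geodesic_paramD:
  assumes "geodesic_param U \<Gamma> D c"
  shows "open D" "(\<lambda>t. c t $ k) holomorphic_on D" "t \<in> D \<Longrightarrow> c t \<in> U" "t \<in> D \<Longrightarrow> velocity c t \<noteq> 0"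
    "t \<in> D \<Longrightarrow> velocity (velocity c) t = - \<Gamma> (c t) (velocity c t) (velocity c t)"
  using assms by (auto simp: geodesic_param_def eq_neg_iff_add_eq_0)

text \<open>A geodesic through \<open>x\<close> in direction \<open>v\<close> is, as a curve, also a geodesic for \<open>\<Gamma>'\<close>. Comparing the two
parametrizations to second order, the accelerations differ by a multiple of \<open>v\<close>.\<close>

lemma proj_equiv_imp_par:
  assumes U: "open U" and G: "affine_connection U \<Gamma>" and G': "affine_connection U \<Gamma>'" and pe: "proj_equiv U \<Gamma> \<Gamma>'"
  shows "par U \<Gamma> \<Gamma>'"
  unfolding par_def
proof (intro ballI allI)
  fix x v assume x: "x \<in> U"
  show "\<exists>l. \<Gamma> x v v - \<Gamma>' x v v = l *s v"
  proof (cases "v = 0")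
    case True
    then show ?thesis using conn_bilinear(5)[OF G x] conn_bilinear(5)[OF G' x] by simp
  next
    case False
    obtain r c where r: "r > 0" and c: "geodesic_param U \<Gamma> (ball 0 r) c" "c 0 = x" "velocity c 0 = v"
      using geodesic_exists[OF G U x False] by blast
    note cD = geodesic_paramD[OF c(1)]
    \<comment> \<open>the k-th coordinate serves as a parameter on the curve near x\<close>
    obtain k where k: "v $ k \<noteq> 0" using False by (auto simp: vec_eq_iff)
    define h where "h t = c t $ k" for t
    have hh: "h holomorphic_on ball 0 r" using cD(2) by (simp add: h_def[abs_def])
    have nz: "deriv h 0 \<noteq> 0" using c(3) k by (auto simp: velocity_def h_def[abs_def])
    have z: "(0::complex) \<in> ball 0 r" using r by simp
    obtain s where s: "s > 0" "ball (0::complex) s \<subseteq> ball 0 r" "inj_on h (ball 0 s)"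
        by (rule has_complex_derivative_locally_injective[OF hh z open_ball nz], rule that)
    have hs: "h holomorphic_on ball 0 s" using hh s(2) holomorphic_on_subset by blast
    obtain gk where gk: "gk holomorphic_on (h ` ball 0 s)" "\<And>z. z \<in> ball 0 s \<Longrightarrow> gk (h z) = z"
      using holomorphic_has_inverse[OF hs open_ball s(3)] by metis
    define C where "C = c ` ball 0 s"
    have gp: "geodesic_param U \<Gamma> (ball 0 s) c" by (rule geodesic_param_subset[OF c(1) s(2)]) simp
    have hom: "homeomorphism (ball 0 s) C c (\<lambda>y. gk (y $ k))"
    proof (rule homeomorphismI)
      show "continuous_on (ball 0 s) c" using curve_continuous[of c "ball 0 s"] geodesic_paramD(2)[OF gp] by blast
      show "continuous_on C (\<lambda>y. gk (y $ k))"
        by (rule continuous_on_compose2[OF holomorphic_on_imp_continuous_on[OF gk(1)]]) (auto intro!: continuous_intros simp: C_def h_def)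
    qed (auto simp: C_def gk(2)[unfolded h_def])
    have "geodesic_curve U \<Gamma> C" unfolding geodesic_curve_def
    proof (intro conjI ballI)
      show "C \<subseteq> U" using cD(3) s(2) by (auto simp: C_def simp del: mem_ball)
      show "\<exists>V D c g. open V \<and> p \<in> V \<and> geodesic_param U \<Gamma> D c \<and> homeomorphism D (C \<inter> V) c g" for p
        by (rule exI[of _ UNIV]) (use gp hom in auto)
    qed
    then have gc: "geodesic_curve U \<Gamma>' C" using pe by (simp add: proj_equiv_def)
    have xC: "x \<in> C" using c(2) s(1) by (force simp: C_def)
    then obtain V D' c' g' where V: "x \<in> V" "geodesic_param U \<Gamma>' D' c'" "homeomorphism D' (C \<inter> V) c' g'"
      using gc unfolding geodesic_curve_def by blast
    note c'D = geodesic_paramD[OF V(2)]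
    define t0 where "t0 = g' x"
    have t0: "t0 \<in> D'" "c' t0 = x" using V xC by (auto simp: t0_def homeomorphism_def)
    define \<eta> where "\<eta> t = gk (c' t $ k)" for t
    have c'C: "\<exists>s'\<in>ball 0 s. c' t = c s'" if "t \<in> D'" for t
      using V(3) that unfolding homeomorphism_def C_def by blast
    have \<eta>: "\<eta> t \<in> ball 0 s" "c' t = c (\<eta> t)" "c' t $ k \<in> h ` ball 0 s" if t: "t \<in> D'" for t
    proof -
      obtain s' where s': "s' \<in> ball 0 s" "c' t = c s'" using c'C[OF t] by blast
      have "\<eta> t = s'" unfolding \<eta>_def s'(2) using gk(2)[OF s'(1)] by (simp add: h_def)
      then show "\<eta> t \<in> ball 0 s" "c' t = c (\<eta> t)" "c' t $ k \<in> h ` ball 0 s" using s' by (auto simp: h_def)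
    qed
    have \<eta>h: "\<eta> holomorphic_on D'" unfolding \<eta>_def
      using holomorphic_on_compose_gen[OF c'D(2)[of k] gk(1)] \<eta>(3) by (auto simp: o_def)
    have im: "\<eta> ` D' \<subseteq> ball 0 s" using \<eta>(1) by blast
    have "\<eta> t0 = gk (h 0)" unfolding \<eta>_def t0(2) h_def c(2) ..
    then have \<eta>0: "\<eta> t0 = 0" using gk(2)[of 0] s(1) by simp
    note rp = reparam[OF open_ball geodesic_paramD(2)[OF gp] c'D(1) \<eta>h im \<eta>(2) t0(1)]
    define a where "a = deriv \<eta> t0"
    have v': "velocity c' t0 = a *s v" using rp(1) by (simp add: \<eta>0 c(3) a_def)
    then have a0: "a \<noteq> 0" using c'D(4)[OF t0(1)] by auto
    have "velocity (velocity c) 0 = - \<Gamma> x v v" using cD(5)[of 0] r c by simp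
    then have "velocity (velocity c') t0 = deriv (deriv \<eta>) t0 *s v - a\<^sup>2 *s \<Gamma> x v v"
      using rp(2) by (simp add: \<eta>0 c(3) a_def vec_eq_iff)
    moreover have "velocity (velocity c') t0 = - (a\<^sup>2 *s \<Gamma>' x v v)"
      using c'D(5)[OF t0(1)] conn_bilinear(3,4)[OF G' x] by (simp add: v' t0(2) power2_eq_square)
    ultimately have "a\<^sup>2 *s (\<Gamma> x v v - \<Gamma>' x v v) = deriv (deriv \<eta>) t0 *s v"
      by (simp add: vec_eq_iff algebra_simps)
    then have "\<Gamma> x v v - \<Gamma>' x v v = (deriv (deriv \<eta>) t0 / a\<^sup>2) *s v"
      using a0 by (simp add: vec_eq_iff field_simps)
    then show ?thesis by blast
  qed
qed

text \<open>Along a geodesic the factor of proportionality is a holomorphic function \<open>\<psi>\<close> of the parameter. A new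
parameter \<open>\<kappa>\<close> with \<open>\<kappa>''/\<kappa>' = -\<psi>\<close> absorbs it, and is found by two integrations.\<close>

lemma par_geodesic_curve:
  assumes U: "open U" and G: "affine_connection U \<Gamma>" and G': "affine_connection U \<Gamma>'" and par: "par U \<Gamma> \<Gamma>'"
    and C: "geodesic_curve U \<Gamma> C"
  shows "geodesic_curve U \<Gamma>' C"
  unfolding geodesic_curve_def
proof (intro conjI ballI)
  show "C \<subseteq> U" using C by (simp add: geodesic_curve_def)
  fix p assume p: "p \<in> C"
  obtain V D c g where V: "open V" "p \<in> V" "geodesic_param U \<Gamma> D c" "homeomorphism D (C \<inter> V) c g"
    using C p unfolding geodesic_curve_def by blast
  note cD = geodesic_paramD[OF V(3)]
  define t0 where "t0 = g p"
  have t0: "t0 \<in> D" "c t0 = p" using V p by (auto simp: t0_def homeomorphism_def)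
  obtain k where k: "velocity c t0 $ k \<noteq> 0" using cD(4)[OF t0(1)] by (auto simp: vec_eq_iff)
  note vh = velocity_holomorphic[OF cD(1,2)]
  have "open (D \<inter> (\<lambda>t. velocity c t $ k) -` (- {0}))"
    by (rule continuous_open_preimage[OF holomorphic_on_imp_continuous_on[OF vh] cD(1)]) auto
  then obtain \<epsilon> where \<epsilon>: "\<epsilon> > 0" "ball t0 \<epsilon> \<subseteq> D \<inter> (\<lambda>t. velocity c t $ k) -` (- {0})"
    using t0 k by (metis (no_types, lifting) ComplI IntI openE singletonD vimageI)
  define B where "B = ball t0 \<epsilon>"
  have B: "open B" "convex B" "B \<subseteq> D" "t0 \<in> B" and k0: "\<And>t. t \<in> B \<Longrightarrow> velocity c t $ k \<noteq> 0"
    using \<epsilon> by (auto simp: B_def)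
  have Gh: "(\<lambda>t. \<Delta> (c t) (velocity c t) (velocity c t) $ k) holomorphic_on B" if D: "affine_connection U \<Delta>" for \<Delta>
  proof -
    have e: "(\<lambda>t. \<Delta> (c t) (axis i 1) (axis j 1) $ k) holomorphic_on B" for i j
      unfolding holomorphic_on_def field_differentiable_def
      using curve_chol[OF cD(1,2) _ holo_map_chol[OF affine_connectionD(3)[OF D]] cD(3)] B(3) has_field_derivative_at_within by blast
    have "(\<lambda>t. \<Sum>i\<in>UNIV. \<Sum>j\<in>UNIV. velocity c t $ i * velocity c t $ j * \<Delta> (c t) (axis i 1) (axis j 1) $ k) holomorphic_on B"
      by (intro holomorphic_intros e holomorphic_on_subset[OF vh B(3)])
    moreover have "\<Delta> (c t) (velocity c t) (velocity c t) $ k = (\<Sum>i\<in>UNIV. \<Sum>j\<in>UNIV. velocity c t $ i * velocity c t $ j * \<Delta> (c t) (axis i 1) (axis j 1) $ k)" if "t \<in> B" for t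
      by (subst conn_expand[OF D cD(3)]) (use that B(3) in \<open>auto simp: sum_component\<close>)
    ultimately show ?thesis by (simp cong: holomorphic_cong)
  qed
  define \<psi> where "\<psi> t = (\<Gamma> (c t) (velocity c t) (velocity c t) $ k - \<Gamma>' (c t) (velocity c t) (velocity c t) $ k) / velocity c t $ k" for t
  have \<psi>h: "\<psi> holomorphic_on B" unfolding \<psi>_def
    by (intro holomorphic_intros Gh G G' holomorphic_on_subset[OF vh B(3)]) (use k0 in auto)
  have \<psi>: "\<Gamma> (c t) (velocity c t) (velocity c t) - \<Gamma>' (c t) (velocity c t) (velocity c t) = \<psi> t *s velocity c t" if t: "t \<in> B" for t
  proof -
    obtain l where l: "\<Gamma> (c t) (velocity c t) (velocity c t) - \<Gamma>' (c t) (velocity c t) (velocity c t) = l *s velocity c t"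
      using par cD(3) B(3) t unfolding par_def by blast
    then have "(\<Gamma> (c t) (velocity c t) (velocity c t) - \<Gamma>' (c t) (velocity c t) (velocity c t)) $ k = (l *s velocity c t) $ k" by simp
    then have "\<psi> t = l" using k0[OF t] by (simp add: \<psi>_def)
    then show ?thesis using l by simp
  qed
  obtain \<Psi> where \<Psi>: "\<And>t. t \<in> B \<Longrightarrow> (\<Psi> has_field_derivative \<psi> t) (at t within B)"
    by (rule holomorphic_convex_primitive'[OF B(2,1) \<psi>h]) blast
  have \<Psi>': "(\<Psi> has_field_derivative \<psi> t) (at t)" if "t \<in> B" for t using \<Psi>[OF that] at_within_open[OF that B(1)] by simp
  then have \<Psi>h: "\<Psi> holomorphic_on B" using B(1) holomorphic_on_open by blast
  have eh: "(\<lambda>t. exp (- \<Psi> t)) holomorphic_on B" by (intro holomorphic_intros \<Psi>h)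
  obtain \<kappa> where \<kappa>: "\<And>t. t \<in> B \<Longrightarrow> (\<kappa> has_field_derivative exp (- \<Psi> t)) (at t within B)"
    by (rule holomorphic_convex_primitive'[OF B(2,1) eh]) blast
  have \<kappa>': "(\<kappa> has_field_derivative exp (- \<Psi> t)) (at t)" if "t \<in> B" for t using \<kappa>[OF that] at_within_open[OF that B(1)] by simp
  then have \<kappa>h: "\<kappa> holomorphic_on B" using B(1) holomorphic_on_open by blast
  have nz: "deriv \<kappa> t0 \<noteq> 0" using DERIV_imp_deriv[OF \<kappa>'[OF B(4)]] by simp
  obtain s where s: "s > 0" "ball t0 s \<subseteq> B" "inj_on \<kappa> (ball t0 s)"
    by (rule has_complex_derivative_locally_injective[OF \<kappa>h B(4,1) nz], rule that)
  define S where "S = ball t0 s"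
  have S: "open S" "S \<subseteq> B" "inj_on \<kappa> S" "t0 \<in> S" using s by (auto simp: S_def)
  have \<kappa>S: "\<kappa> holomorphic_on S" using \<kappa>h S(2) holomorphic_on_subset by blast
  obtain \<eta> where \<eta>: "\<eta> holomorphic_on (\<kappa> ` S)" "\<And>z. z \<in> S \<Longrightarrow> \<eta> (\<kappa> z) = z"
    using holomorphic_has_inverse[OF \<kappa>S S(1,3)] by metis
  define E where "E = \<kappa> ` S"
  have E: "open E" unfolding E_def by (rule open_mapping_thm3[OF \<kappa>S S(1,3)])
  have \<eta>S: "\<eta> u \<in> S" "\<kappa> (\<eta> u) = u" if "u \<in> E" for u using that \<eta>(2) by (auto simp: E_def)
  have \<eta>h: "\<eta> holomorphic_on E" using \<eta>(1) by (simp add: E_def)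
  have d\<eta>: "deriv \<eta> u = exp (\<Psi> (\<eta> u))" if u: "u \<in> E" for u
  proof -
    have "(\<eta> has_field_derivative deriv \<eta> u) (at u)" by (rule holomorphic_derivI[OF \<eta>h E u])
    moreover have "\<eta> u \<in> B" using \<eta>S[OF u] S(2) by blast
    ultimately have "((\<lambda>u. \<kappa> (\<eta> u)) has_field_derivative exp (- \<Psi> (\<eta> u)) * deriv \<eta> u) (at u)"
      using DERIV_chain2[OF \<kappa>'] by blast
    moreover have "((\<lambda>u. \<kappa> (\<eta> u)) has_field_derivative 1) (at u)"
      by (rule has_field_derivative_transform_within_open[OF DERIV_ident E u]) (simp add: \<eta>S)
    ultimately have "exp (- \<Psi> (\<eta> u)) * deriv \<eta> u = 1" by (rule DERIV_unique)
    then show ?thesis by (simp add: exp_minus field_simps)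
  qed
  have dd\<eta>: "deriv (deriv \<eta>) u = \<psi> (\<eta> u) * (deriv \<eta> u)\<^sup>2" if u: "u \<in> E" for u
  proof -
    have uB: "\<eta> u \<in> B" using \<eta>S[OF u] S(2) by blast
    have "((\<lambda>u. exp (\<Psi> (\<eta> u))) has_field_derivative exp (\<Psi> (\<eta> u)) * (\<psi> (\<eta> u) * deriv \<eta> u)) (at u)"
      by (intro DERIV_fun_exp DERIV_chain2[where g = \<eta> and x = u, OF \<Psi>'[OF uB]] holomorphic_derivI[OF \<eta>h E u])
    then have "(deriv \<eta> has_field_derivative exp (\<Psi> (\<eta> u)) * (\<psi> (\<eta> u) * deriv \<eta> u)) (at u)"
      by (rule has_field_derivative_transform_within_open[OF _ E u]) (simp add: d\<eta>)
    then show ?thesis using DERIV_imp_deriv d\<eta>[OF u] by (fastforce simp: power2_eq_square)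
  qed
  have im: "\<eta> ` E \<subseteq> D" using \<eta>S S(2) B(3) by blast
  have gp: "geodesic_param U \<Gamma>' E (\<lambda>u. c (\<eta> u))"
    unfolding geodesic_param_def
  proof (intro conjI ballI allI E)
    show "(\<lambda>u. c (\<eta> u)) ` E \<subseteq> U" using im cD(3) by blast
    show "(\<lambda>u. c (\<eta> u) $ j) holomorphic_on E" for j
      using holomorphic_on_compose_gen[OF \<eta>h cD(2)[of j] im] by (simp add: o_def)
    fix u assume u: "u \<in> E"
    have uD: "\<eta> u \<in> D" and uB: "\<eta> u \<in> B" using im u \<eta>S[OF u] S(2) by blast+
    note rp = reparam[OF cD(1,2) E \<eta>h im refl u]
    have vel: "velocity (\<lambda>u. c (\<eta> u)) u = deriv \<eta> u *s velocity c (\<eta> u)" by (rule rp(1))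
    show "velocity (\<lambda>u. c (\<eta> u)) u \<noteq> 0" unfolding vel using cD(4)[OF uD] by (simp add: d\<eta>[OF u])
    have "velocity (velocity (\<lambda>u. c (\<eta> u))) u = (deriv \<eta> u)\<^sup>2 *s (\<psi> (\<eta> u) *s velocity c (\<eta> u) - \<Gamma> (c (\<eta> u)) (velocity c (\<eta> u)) (velocity c (\<eta> u)))"
      unfolding rp(2) dd\<eta>[OF u] cD(5)[OF uD] by (simp add: vec_eq_iff algebra_simps)
    also have "\<psi> (\<eta> u) *s velocity c (\<eta> u) - \<Gamma> (c (\<eta> u)) (velocity c (\<eta> u)) (velocity c (\<eta> u)) = - \<Gamma>' (c (\<eta> u)) (velocity c (\<eta> u)) (velocity c (\<eta> u))"
      using \<psi>[OF uB] by (simp add: algebra_simps)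
    finally show "velocity (velocity (\<lambda>u. c (\<eta> u))) u + \<Gamma>' (c (\<eta> u)) (velocity (\<lambda>u. c (\<eta> u)) u) (velocity (\<lambda>u. c (\<eta> u)) u) = 0"
      unfolding vel by (simp add: conn_bilinear(3,4)[OF G' cD(3)[OF uD]] power2_eq_square vec_eq_iff)
  qed
  have SD: "S \<subseteq> D" using S(2) B(3) by blast
  have "openin (top_of_set (C \<inter> V)) (c ` S)"
    by (rule homeomorphism_imp_open_map[OF V(4)]) (use S(1) SD in \<open>auto simp: openin_open\<close>)
  then obtain T where T: "open T" "c ` S = (C \<inter> V) \<inter> T" by (auto simp: openin_open)
  have h1: "homeomorphism S (c ` S) c g"
    by (rule homeomorphism_of_subsets[OF V(4) SD, of "c ` S"]) (use T(2) in auto)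
  have h2: "homeomorphism E S \<eta> \<kappa>"
    by (rule homeomorphismI) (use \<eta>S \<eta>(2) holomorphic_on_imp_continuous_on[OF \<eta>h] holomorphic_on_imp_continuous_on[OF \<kappa>S] in \<open>auto simp: E_def\<close>)
  have "homeomorphism E (C \<inter> (V \<inter> T)) (\<lambda>u. c (\<eta> u)) (\<kappa> \<circ> g)"
    using homeomorphism_compose[OF h2 h1] T(2) by (simp add: o_def Int_assoc)
  moreover have "p \<in> V \<inter> T" using T(2) t0(2) S(4) V(2) by blast
  ultimately show "\<exists>V D c g. open V \<and> p \<in> V \<and> geodesic_param U \<Gamma>' D c \<and> homeomorphism D (C \<inter> V) c g"
    using gp V(1) T(1) by blast
qed

theorem proj_equiv_iff_par:
  assumes "open U" "affine_connection U \<Gamma>" "affine_connection U \<Gamma>'"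
  shows "proj_equiv U \<Gamma> \<Gamma>' \<longleftrightarrow> par U \<Gamma> \<Gamma>'"
  using proj_equiv_imp_par[OF assms] par_geodesic_curve[OF assms] par_geodesic_curve[OF assms(1,3,2)] par_sym
  unfolding proj_equiv_def by blast

section \<open>The projective connection of an \<open>(n + 2)\<close>-web\<close>

text \<open>Two first integrals of the same foliation satisfy \<open>df' = h df\<close> with a holomorphic function \<open>h\<close>; the extra term of
the second derivative contains \<open>dd f x v\<close>.\<close>

lemma tgcond_change:
  assumes f: "first_int B F f" and f': "first_int B' F f'" and x: "x \<in> B" "x \<in> B'" and t: "tgcond f \<Gamma> x"
  shows "tgcond f' \<Gamma> x"
proof -
  note o = first_intD(1)[OF f] first_intD(1)[OF f'] and fh = first_intD(2)[OF f] and fh' = first_intD(2)[OF f']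
  obtain e where e: "dd f x e \<noteq> 0" using first_intD(4)[OF f x(1)] by blast
  define Q where "Q = (B \<inter> B') \<inter> (\<lambda>y. dd f y e) -` (- {0})"
  have de: "chol B (\<lambda>y. dd f y e)" "chol B' (\<lambda>y. dd f' y e)" by (rule dd_chol_and_symmetric(1)[OF o(1) fh], rule dd_chol_and_symmetric(1)[OF o(2) fh'])
  have Q: "open Q" unfolding Q_def
    by (rule continuous_open_preimage[OF continuous_on_subset[OF chol_continuous_on[OF de(1)]]]) (use o in auto)
  have xQ: "x \<in> Q" using e x by (simp add: Q_def)
  have Qsub: "y \<in> B" "y \<in> B'" "dd f y e \<noteq> 0" if "y \<in> Q" for y using that by (auto simp: Q_def)
  define h where "h y = dd f' y e / dd f y e" for y
  have hQ: "chol Q h" unfolding h_def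
    by (intro chol_divide chol_subset[OF de(1)] chol_subset[OF de(2)]) (use Qsub in auto)
  have eq: "dd f' y v = h y * dd f y v" if y: "y \<in> Q" for y v
  proof -
    note y' = Qsub[OF y]
    define w where "w = v - (dd f y v / dd f y e) *s e"
    have "dd f y w = 0" using y'(3) by (simp add: w_def chol_dd_linear[OF fh y'(1)] chol_dd_scale[OF fh y'(1)])
    then have "dd f' y w = 0" using first_intD(3)[OF f y'(1)] first_intD(3)[OF f' y'(2)] by blast
    then show ?thesis by (simp add: w_def h_def chol_dd_linear[OF fh' y'(2)] chol_dd_scale[OF fh' y'(2)])
  qed
  show ?thesis unfolding tgcond_def
  proof (intro allI impI)
    fix v assume v: "dd f' x v = 0"
    obtain e' where "dd f' x e' \<noteq> 0" using first_intD(4)[OF f' x(2)] by blast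
    then have hx: "h x \<noteq> 0" using eq[OF xQ] by auto
    then have v0: "dd f x v = 0" using eq[OF xQ, of v] v by simp
    have fQ: "chol Q (\<lambda>y. dd f y v)" by (rule chol_subset[OF dd_chol_and_symmetric(1)[OF o(1) fh]]) (use Qsub in blast)
    have "d2 f' x v v = dd (\<lambda>y. h y * dd f y v) x v"
      unfolding d2_def by (subst dd_cong[OF Q xQ, of "\<lambda>y. dd f' y v" "\<lambda>y. h y * dd f y v"]) (auto simp: eq)
    also have "\<dots> = h x * d2 f x v v" by (simp add: dd_mult[OF hQ fQ xQ] v0 d2_def)
    also have "d2 f x v v = dd f x (\<Gamma> x v v)" using t v0 by (simp add: tgcond_def)
    finally show "d2 f' x v v = dd f' x (\<Gamma> x v v)" using eq[OF xQ] by simp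
  qed
qed

lemma web_first_ints:
  assumes U: "open U" "x \<in> U" and W: "web U I W"
  obtains r f where "r > 0" "ball x r \<subseteq> U" "\<And>i. i \<in> I \<Longrightarrow> first_int (ball x r) (W i) (f i)"
proof -
  have "\<forall>i\<in>I. \<exists>r f. r > 0 \<and> first_int (ball x r) (W i) f"
    using W U(2) unfolding web_def by (metis foliation_first_int)
  then obtain \<rho> f where \<rho>: "\<And>i. i \<in> I \<Longrightarrow> \<rho> i > 0 \<and> first_int (ball x (\<rho> i)) (W i) (f i)" by metis
  obtain r0 where r0: "r0 > 0" "ball x r0 \<subseteq> U" using U open_contains_ball by blast
  define r where "r = Min (insert r0 (\<rho> ` I))"
  have fin: "finite I" using W by (simp add: web_def)
  have r: "r > 0" "r \<le> r0" "\<And>i. i \<in> I \<Longrightarrow> r \<le> \<rho> i" using \<rho> r0 fin by (auto simp: r_def)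
  have "first_int (ball x r) (W i) (f i)" if "i \<in> I" for i
    by (rule first_int_subset[of "ball x (\<rho> i)"]) (use \<rho>[OF that] r(3)[OF that] in auto)
  moreover have "ball x r \<subseteq> U" using r0(2) r(2) by auto
  ultimately show ?thesis using that[of r f] r(1) by blast
qed

lemma web_indep:
  fixes W :: "nat \<Rightarrow> complex^'n \<Rightarrow> (complex^'n) set"
  assumes gp: "general_position I W x" and f: "\<And>i. i \<in> I \<Longrightarrow> first_int B (W i) (f i)" and x: "x \<in> B"
    and J: "J \<subseteq> I" "card J = CARD('n)" "CARD('n) \<le> card I" and c: "\<And>v. (\<Sum>j\<in>J. c j * dd (f j) x v) = 0" and j: "j \<in> J"
  shows "c j = 0"
proof -
  have fi: "chol B (f j)" if "j \<in> J" for j using f J(1) that first_intD(2) by blast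
  define \<omega> where "\<omega> j = grad (f j) x" for j
  have pw: "pair (\<omega> j) v = dd (f j) x v" if "j \<in> J" for j v unfolding \<omega>_def by (rule pair_grad[OF fi[OF that] x])
  have "\<omega> j \<noteq> 0 \<and> W j x = {v. pair (\<omega> j) v = 0}" if "j \<in> J" for j
  proof -
    have F: "first_int B (W j) (f j)" using f J(1) that by blast
    obtain v where "dd (f j) x v \<noteq> 0" using first_intD(4)[OF F x] by blast
    then have "\<omega> j \<noteq> 0" using pw[OF that, of v] by (auto simp: pair_linear)
    then show ?thesis using first_intD(3)[OF F x] pw[OF that] by auto
  qed
  moreover have "(\<Sum>j\<in>J. c j *s \<omega> j) = 0"
    by (rule pair_eq_0) (simp add: pair_linear pw c)
  moreover have "card J = min CARD('n) (card I)" using J by simp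
  ultimately show ?thesis using gp J(1) j unfolding general_position_def by blast
qed

lemma chol_det:
  fixes M :: "complex^'l \<Rightarrow> complex^'n^'n"
  assumes "\<And>i j. chol U (\<lambda>x. M x $ i $ j)" shows "chol U (\<lambda>x. det (M x))"
  unfolding det_def by (intro chol_sum chol_mult chol_const chol_prod assms)

text \<open>The frame is obtained by Cramer's rule, so it is holomorphic.\<close>

lemma dual_frame:
  fixes g :: "'n \<Rightarrow> complex^'n \<Rightarrow> complex"
  assumes B: "open B" and g: "\<And>k. chol B (g k)"
    and ind: "\<And>x c. x \<in> B \<Longrightarrow> (\<And>v. (\<Sum>k\<in>UNIV. c k * dd (g k) x v) = 0) \<Longrightarrow> (\<forall>k. c k = 0)"
  obtains E where "\<And>j. holo_map B (E j)" "\<And>x k j. x \<in> B \<Longrightarrow> dd (g k) x (E j x) = (if k = j then 1 else 0)"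
    "\<And>x v. x \<in> B \<Longrightarrow> v = (\<Sum>k\<in>UNIV. dd (g k) x v *s E k x)"
proof -
  define A :: "complex^'n \<Rightarrow> complex^'n^'n" where "A x = (\<chi> i l. dd (g i) x (axis l 1))" for x
  have Av: "(A x *v v) $ i = dd (g i) x v" if "x \<in> B" for x v i
    by (simp add: A_def matrix_vector_mult_def dd_expand[OF g that, of i v] mult.commute)
  have Ac: "chol B (\<lambda>x. A x $ i $ l)" for i l by (simp add: A_def dd_chol_and_symmetric(1)[OF B g])
  have dn: "det (A x) \<noteq> 0" if x: "x \<in> B" for x
  proof -
    have "\<forall>i. c i = 0" if c: "(\<Sum>i\<in>UNIV. c i *s row i (A x)) = 0" for c
    proof (rule ind[OF x])
      fix v
      have "(\<Sum>k\<in>UNIV. c k * dd (g k) x v) = pair (\<Sum>i\<in>UNIV. c i *s row i (A x)) v"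
        unfolding pair_linear by (intro sum.cong refl) (simp add: pair_def row_def A_def dd_expand[OF g x, of _ v] mult.commute)
      then show "(\<Sum>k\<in>UNIV. c k * dd (g k) x v) = 0" by (simp add: c pair_linear)
    qed
    then show ?thesis
      unfolding invertible_det_nz[symmetric] invertible_right_inverse matrix_right_invertible_independent_rows by blast
  qed
  define E where "E j x = (\<chi> k. det (\<chi> i l. if l = k then axis j 1 $ i else A x $ i $ l) / det (A x))" for j :: 'n and x
  have Eh: "holo_map B (E j)" for j
    unfolding holo_map_iff_chol E_def
  proof
    fix k
    have "chol B (\<lambda>x. (\<chi> i l. if l = k then axis j 1 $ i else A x $ i $ l) $ i $ l)" for i l
      by (cases "l = k") (simp_all add: chol_const Ac)
    then show "chol B (\<lambda>x. (\<chi> k. det (\<chi> i l. if l = k then axis j 1 $ i else A x $ i $ l) / det (A x)) $ k)"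
      using chol_divide[OF chol_det chol_det[OF Ac] dn, of "\<lambda>x. \<chi> i l. if l = k then axis j 1 $ i else A x $ i $ l"] by simp
  qed
  have AE: "A x *v E j x = axis j 1" if "x \<in> B" for x j
    unfolding cramer[OF dn[OF that]] by (simp add: E_def)
  have dual: "dd (g k) x (E j x) = (if k = j then 1 else 0)" if "x \<in> B" for x k j
    using Av[OF that, of "E j x" k] AE[OF that, of j] by (simp add: axis_def)
  have "v = (\<Sum>k\<in>UNIV. dd (g k) x v *s E k x)" if x: "x \<in> B" for x v
  proof -
    have "A x *v (\<Sum>k\<in>UNIV. dd (g k) x v *s E k x) = A x *v v"
      by (simp add: vec_eq_iff Av[OF x] chol_dd_linear(5)[OF g x] chol_dd_scale[OF g x] dual[OF x] if_distrib cong: if_cong)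
    from cramer[OF dn[OF x], THEN iffD1, OF this] cramer[OF dn[OF x], THEN iffD1, OF refl[of "A x *v v"]]
    show ?thesis by (rule trans[rotated, OF sym])
  qed
  from that[OF Eh dual this] show ?thesis by assumption
qed

lemma chol_d2_varying:
  assumes B: "open B" "chol B f" and g: "holo_map B g" "holo_map B h"
  shows "chol B (\<lambda>x. d2 f x (g x) (h x))"
proof -
  have "chol B (\<lambda>x. \<Sum>i\<in>UNIV. \<Sum>j\<in>UNIV. g x $ i * h x $ j * d2 f x (axis i 1) (axis j 1))"
    by (intro chol_sum chol_mult holo_map_chol g d2_chol B)
  then show ?thesis by (rule chol_cong[OF _ B(1)]) (rule d2_expand[OF B])
qed

lemma quad_sym:
  fixes A :: "'n::finite \<Rightarrow> 'n \<Rightarrow> complex"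
  shows "(\<Sum>j\<in>UNIV. \<Sum>k\<in>UNIV. A j k * y j * y k) = (\<Sum>j\<in>UNIV. \<Sum>k\<in>UNIV. (A j k + A k j) / 2 * y j * y k)"
proof -
  have "(\<Sum>j\<in>UNIV. \<Sum>k\<in>UNIV. A k j * y j * y k) = (\<Sum>j\<in>UNIV. \<Sum>k\<in>UNIV. A j k * y j * y k)"
    by (subst sum.swap) (simp add: mult.assoc mult.commute[of "y _" "y _"])
  then show ?thesis by (simp add: add_divide_distrib algebra_simps sum.distrib sum_divide_distrib[symmetric])
qed

text \<open>For each pair \<open>{j, k}\<close> these are two linear equations for \<open>L j k\<close> and \<open>L k j\<close>, with
determinant \<open>a j * b k - a k * b j\<close>. On the diagonal both equations determine \<open>L j j\<close>; they agree
because the product of \<open>b\<close> with a suitable linear form \<open>m\<close> is added to the second quadratic form.\<close>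

lemma solve_pencil:
  fixes a b :: "'n \<Rightarrow> complex"
  assumes a: "\<And>k. a k \<noteq> 0" and b: "\<And>k. b k \<noteq> 0" and ab: "\<And>j k. j \<noteq> k \<Longrightarrow> a j * b k - a k * b j \<noteq> 0"
    and sym: "\<And>j k. \<alpha> j k = \<alpha> k j" "\<And>j k. \<beta> j k = \<beta> k j"
    and m: "\<And>j. m j = \<alpha> j j / a j - \<beta> j j / b j"
    and L: "\<And>j k. L j k = (if j = k then \<alpha> j j / a j 
         else (2 * \<alpha> j k * b k - (2 * \<beta> j k + b j * m k + b k * m j) * a k) / (a j * b k - a k * b j))"
  shows "a j * L j k + a k * L k j = 2 * \<alpha> j k" "b j * L j k + b k * L k j = 2 * \<beta> j k + b j * m k + b k * m j"
proof -
  have "a j * L j k + a k * L k j = 2 * \<alpha> j k \<and> b j * L j k + b k * L k j = 2 * \<beta> j k + b j * m k + b k * m j"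
  proof (cases "j = k")
    case True
    then show ?thesis using a[of k] b[of k] by (simp add: L m field_simps)
  next
    case False
    define D where "D = a j * b k - a k * b j"
    define c where "c = 2 * \<beta> j k + b j * m k + b k * m j"
    have D: "D \<noteq> 0" using ab[OF False] by (simp add: D_def)
    have 1: "L j k = (2 * \<alpha> j k * b k - c * a k) / D" using False by (simp add: L D_def c_def)
    have "L k j = (2 * \<alpha> j k * b j - c * a j) / (- D)"
      using False by (simp add: L D_def c_def sym(1)[of k j] sym(2)[of k j] add.commute add.left_commute)
    then have 2: "L k j = - (2 * \<alpha> j k * b j - c * a j) / D" by (metis minus_divide_left minus_divide_right)
    have "(a j * L j k + a k * L k j) * D = 2 * \<alpha> j k * D" "(b j * L j k + b k * L k j) * D = c * D"
      using D by (simp_all add: 1 2 distrib_right) (simp_all add: D_def algebra_simps)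
    then show ?thesis using D by (simp add: c_def)
  qed
  then show "a j * L j k + a k * L k j = 2 * \<alpha> j k" "b j * L j k + b k * L k j = 2 * \<beta> j k + b j * m k + b k * m j" by auto
qed

text \<open>Write \<open>y k\<close> for the differentials of the \<open>n\<close> functions \<open>g k\<close>. They are compatible with \<open>\<Gamma>\<close> exactly when
the \<open>k\<close>-th component of \<open>\<Gamma>(v, v)\<close> is \<open>d2 (g k) v v + y k(v) \<l> k(v)\<close> for some linear form \<open>\<l> k\<close>. Inserting this
into the conditions for \<open>fa\<close> and \<open>fb\<close> leaves the requirement that two quadratic forms be divisible by \<open>dfa\<close>
and \<open>dfb\<close>. The first can even be made zero, which fixes the projective gauge, and the second a
multiple of \<open>dfb\<close>; this is the linear system of \<open>solve_pencil\<close>.\<close>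

lemma local_web_connection:
  fixes g :: "'n \<Rightarrow> complex^'n \<Rightarrow> complex"
  assumes B: "open B" and g: "\<And>k. chol B (g k)" and fa: "chol B fa" and fb: "chol B fb"
    and E: "\<And>j. holo_map B (E j)" and dual: "\<And>x k j. x \<in> B \<Longrightarrow> dd (g k) x (E j x) = (if k = j then 1 else 0)"
    and span: "\<And>x v. x \<in> B \<Longrightarrow> v = (\<Sum>k\<in>UNIV. dd (g k) x v *s E k x)"
    and a0: "\<And>x k. x \<in> B \<Longrightarrow> dd fa x (E k x) \<noteq> 0" and b0: "\<And>x k. x \<in> B \<Longrightarrow> dd fb x (E k x) \<noteq> 0"
    and ab: "\<And>x j k. x \<in> B \<Longrightarrow> j \<noteq> k \<Longrightarrow> dd fa x (E j x) * dd fb x (E k x) - dd fa x (E k x) * dd fb x (E j x) \<noteq> 0"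
  shows "\<exists>\<Gamma>. affine_connection B \<Gamma> \<and> (\<forall>x\<in>B. (\<forall>k. tgcond (g k) \<Gamma> x) \<and> tgcond fa \<Gamma> x \<and> tgcond fb \<Gamma> x)"
proof -
  define a where "a k x = dd fa x (E k x)" for k x
  define b where "b k x = dd fb x (E k x)" for k x
  define R where "R f x j k = d2 f x (E j x) (E k x) - (\<Sum>l\<in>UNIV. dd f x (E l x) * d2 (g l) x (E j x) (E k x))" for f x j k
  define m where "m j x = R fa x j j / a j x - R fb x j j / b j x" for j x
  define L where "L j k x = (if j = k then R fa x j j / a j x 
         else (2 * R fa x j k * b k x - (2 * R fb x j k + b j x * m k x + b k x * m j x) * a k x) / (a j x * b k x - a k x * b j x))" for j k x
  define \<l> where "\<l> j x v = (\<Sum>k\<in>UNIV. L j k x * dd (g k) x v)" for j x v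
  define \<Gamma> where "\<Gamma> x v w = (\<Sum>k\<in>UNIV. (d2 (g k) x v w + (dd (g k) x v * \<l> k x w + dd (g k) x w * \<l> k x v) / 2) *s E k x)" for x v w
  have ac: "chol B (a k)" and bc: "chol B (b k)" for k
    unfolding a_def b_def by (intro dd_varying(1)[OF B] E fa fb)+
  have Rc: "chol B (\<lambda>x. R f x j k)" if "chol B f" for f j k
    unfolding R_def by (intro chol_diff chol_sum chol_mult chol_d2_varying B E g that dd_varying(1)[OF B])
  have mc: "chol B (m k)" for k unfolding m_def
    by (intro chol_diff chol_divide Rc fa fb ac bc) (use a0 b0 in \<open>auto simp: a_def b_def\<close>)
  have Lc: "chol B (L j k)" for j k
  proof (cases "j = k")
    case True then show ?thesis unfolding L_def by (simp, intro chol_divide Rc fa ac) (use a0 in \<open>auto simp: a_def\<close>)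
  next
    case False then show ?thesis unfolding L_def 
      by (simp, intro chol_divide chol_diff chol_add chol_mult Rc fa fb ac bc mc chol_const) (use ab in \<open>auto simp: a_def b_def\<close>)
  qed
  have lc: "chol B (\<lambda>x. \<l> j x v)" for j v unfolding \<l>_def
    by (intro chol_sum chol_mult Lc dd_chol_and_symmetric(1)[OF B g])
  have lin: "\<l> j x (v + w) = \<l> j x v + \<l> j x w" "\<l> j x (c *s v) = c * \<l> j x v" if "x \<in> B" for j x v w c
    by (simp_all add: \<l>_def chol_dd_linear(1)[OF g that] chol_dd_scale[OF g that] sum.distrib sum_distrib_left algebra_simps)
  have aff: "affine_connection B \<Gamma>" unfolding affine_connection_def
  proof (intro conjI ballI allI)
    fix v w show "holo_map B (\<lambda>x. \<Gamma> x v w)" unfolding \<Gamma>_def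
      by (intro holo_map_sum holo_map_scale chol_add chol_divide chol_mult d2_chol[OF B g] lc dd_chol_and_symmetric(1)[OF B g] chol_const E) simp
  next
    fix x v assume x: "x \<in> B"
    show "Vector_Spaces.linear (*s) (*s) (\<Gamma> x v)" unfolding clinear_iff \<Gamma>_def
      by (simp add: d2_bilinear[OF B g x] lin[OF x] chol_dd_linear(1)[OF g x] chol_dd_scale[OF g x] sum.distrib[symmetric] vec.scale_sum_right)
         (auto intro!: sum.cong simp: vec_eq_iff field_simps)
  next
    fix x w assume x: "x \<in> B"
    show "Vector_Spaces.linear (*s) (*s) (\<lambda>v. \<Gamma> x v w)" unfolding clinear_iff \<Gamma>_def
      by (simp add: d2_bilinear[OF B g x] lin[OF x] chol_dd_linear(1)[OF g x] chol_dd_scale[OF g x] sum.distrib[symmetric] vec.scale_sum_right)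
         (auto intro!: sum.cong simp: vec_eq_iff field_simps)
  qed
  have "(\<forall>k. tgcond (g k) \<Gamma> x) \<and> tgcond fa \<Gamma> x \<and> tgcond fb \<Gamma> x" if x: "x \<in> B" for x
  proof -
    define y where "y k v = dd (g k) x v" for k v
    have \<Gamma>y: "\<Gamma> x v v = (\<Sum>k\<in>UNIV. (d2 (g k) x v v + y k v * \<l> k x v) *s E k x)" for v by (simp add: \<Gamma>_def y_def mult.commute)
    have ddG: "dd f x (\<Gamma> x v v) = (\<Sum>k\<in>UNIV. (d2 (g k) x v v + y k v * \<l> k x v) * dd f x (E k x))" if "chol B f" for f v
      unfolding \<Gamma>y by (simp only: chol_dd_linear(5)[OF that x] chol_dd_scale[OF that x])
    have ddv: "dd f x v = (\<Sum>k\<in>UNIV. y k v * dd f x (E k x))" if "chol B f" for f v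
    proof -
      have "dd f x v = dd f x (\<Sum>k\<in>UNIV. y k v *s E k x)" using span[OF x, of v] by (simp add: y_def)
      then show ?thesis by (simp add: chol_dd_linear(5)[OF that x] chol_dd_scale[OF that x])
    qed
    have d2v: "d2 f x v v = (\<Sum>j\<in>UNIV. \<Sum>k\<in>UNIV. d2 f x (E j x) (E k x) * y j v * y k v)" if "chol B f" for f v
    proof -
      have "d2 f x v v = d2 f x (\<Sum>k\<in>UNIV. y k v *s E k x) (\<Sum>k\<in>UNIV. y k v *s E k x)" using span[OF x, of v] by (simp add: y_def)
      also have "\<dots> = (\<Sum>k\<in>UNIV. \<Sum>j\<in>UNIV. d2 f x (y j v *s E j x) (y k v *s E k x))"
        by (simp only: d2_bilinear(5,6)[OF B that x])
      also have "\<dots> = (\<Sum>j\<in>UNIV. \<Sum>k\<in>UNIV. d2 f x (y j v *s E j x) (y k v *s E k x))" by (rule sum.swap)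
      finally show ?thesis by (simp add: d2_bilinear(3,4)[OF B that x] mult_ac)
    qed
    have Rv: "(\<Sum>j\<in>UNIV. \<Sum>k\<in>UNIV. R f x j k * y j v * y k v) = d2 f x v v - (\<Sum>l\<in>UNIV. d2 (g l) x v v * dd f x (E l x))" if "chol B f" for f v
    proof -
      have "(\<Sum>l\<in>UNIV. d2 (g l) x v v * dd f x (E l x)) = (\<Sum>l\<in>UNIV. \<Sum>j\<in>UNIV. \<Sum>k\<in>UNIV. dd f x (E l x) * d2 (g l) x (E j x) (E k x) * y j v * y k v)"
        by (simp add: d2v[OF g] sum_distrib_right sum_distrib_left mult_ac)
      also have "\<dots> = (\<Sum>j\<in>UNIV. \<Sum>l\<in>UNIV. \<Sum>k\<in>UNIV. dd f x (E l x) * d2 (g l) x (E j x) (E k x) * y j v * y k v)" by (rule sum.swap)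
      also have "\<dots> = (\<Sum>j\<in>UNIV. \<Sum>k\<in>UNIV. \<Sum>l\<in>UNIV. dd f x (E l x) * d2 (g l) x (E j x) (E k x) * y j v * y k v)"
        by (intro sum.cong refl sum.swap)
      finally show ?thesis by (simp add: d2v[OF that] R_def left_diff_distrib sum_subtractf sum_distrib_right)
    qed
    have Rsym: "R f x j k = R f x k j" if "chol B f" for f j k
      unfolding R_def by (simp add: d2_sym[OF B that x, of "E j x"] d2_sym[OF B g x, of _ "E j x"])
    have ax: "a k x \<noteq> 0" "b k x \<noteq> 0" "j \<noteq> k \<Longrightarrow> a j x * b k x - a k x * b j x \<noteq> 0" for j k
      using a0[OF x] b0[OF x] ab[OF x] by (auto simp: a_def b_def)
    note P = solve_pencil[of "\<lambda>k. a k x" "\<lambda>k. b k x" "R fa x" "R fb x" "\<lambda>k. m k x" "\<lambda>j k. L j k x", OF ax Rsym[OF fa] Rsym[OF fb] m_def L_def]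
    have P2: "b j x * L j k x + b k x * L k j x = 2 * R fb x j k + b j x * m k x + b k x * m j x" for j k by (rule P(2))
    have Lq: "(\<Sum>k\<in>UNIV. y k v * \<l> k x v * c k) = (\<Sum>j\<in>UNIV. \<Sum>k\<in>UNIV. (c j * L j k x + c k * L k j x) / 2 * y j v * y k v)" for c v
      unfolding quad_sym[symmetric, of "\<lambda>j k. c j * L j k x"] 
      by (simp add: \<l>_def y_def sum_distrib_left sum_distrib_right mult_ac)
    have 1: "tgcond (g k) \<Gamma> x" for k unfolding tgcond_def
      by (auto simp: ddG[OF g] dual[OF x] y_def if_distrib cong: if_cong)
    have 2: "tgcond fa \<Gamma> x" unfolding tgcond_def
    proof (intro allI impI)
      fix v
      have "(\<Sum>k\<in>UNIV. y k v * \<l> k x v * a k x) = (\<Sum>j\<in>UNIV. \<Sum>k\<in>UNIV. R fa x j k * y j v * y k v)"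
        unfolding Lq using P(1) by simp
      then show "d2 fa x v v = dd fa x (\<Gamma> x v v)"
        unfolding Rv[OF fa] ddG[OF fa] by (simp add: distrib_right sum.distrib a_def)
    qed
    have 3: "tgcond fb \<Gamma> x" unfolding tgcond_def
    proof (intro allI impI)
      fix v assume v: "dd fb x v = 0"
      have "(\<Sum>k\<in>UNIV. y k v * \<l> k x v * b k x) = (\<Sum>j\<in>UNIV. \<Sum>k\<in>UNIV. (R fb x j k + b j x * m k x) * y j v * y k v)"
        unfolding Lq P2 quad_sym[of "\<lambda>j k. R fb x j k + b j x * m k x"]
        by (simp add: Rsym[OF fb] algebra_simps)
      also have "\<dots> = (\<Sum>j\<in>UNIV. \<Sum>k\<in>UNIV. R fb x j k * y j v * y k v) + (\<Sum>j\<in>UNIV. y j v * b j x) * (\<Sum>k\<in>UNIV. m k x * y k v)"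
        unfolding sum_product sum.distrib[symmetric] by (intro sum.cong refl) (simp add: algebra_simps)
      also have "(\<Sum>j\<in>UNIV. y j v * b j x) = 0" using ddv[OF fb, of v] v by (simp add: b_def)
      finally show "d2 fb x v v = dd fb x (\<Gamma> x v v)"
        unfolding Rv[OF fb] ddG[OF fb] by (simp add: distrib_right sum.distrib b_def)
    qed
    show ?thesis using 1 2 3 by blast
  qed
  then show ?thesis using aff by blast
qed

text \<open>\<open>S\<close> is the difference of two compatible connections. The condition for \<open>g k\<close> makes the \<open>k\<close>-th component
of \<open>S v v\<close> divisible by the \<open>k\<close>-th coordinate, with quotient a linear form \<open>l k\<close>. Testing the
other two conditions on the vectors \<open>E i / c i - E j / c j\<close>, where \<open>c\<close> is the differential in question,
gives two independent linear equations which force all the forms \<open>l k\<close> to agree.\<close>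

lemma compat_unique_point:
  fixes g :: "'n \<Rightarrow> complex^'n \<Rightarrow> complex" and S :: "complex^'n \<Rightarrow> complex^'n \<Rightarrow> complex^'n"
  assumes x: "x \<in> B" and g: "\<And>k. chol B (g k)" and fa: "chol B fa" and fb: "chol B fb"
    and dual: "\<And>k j. dd (g k) x (E j) = (if k = j then 1 else 0)" and span: "\<And>v. v = (\<Sum>k\<in>UNIV. dd (g k) x v *s E k)"
    and a0: "\<And>k. dd fa x (E k) \<noteq> 0" and b0: "\<And>k. dd fb x (E k) \<noteq> 0"
    and ab: "\<And>j k. j \<noteq> k \<Longrightarrow> dd fa x (E j) * dd fb x (E k) - dd fa x (E k) * dd fb x (E j) \<noteq> 0"
    and S: "\<And>u v w. S (u + v) w = S u w + S v w" "\<And>u v w. S w (u + v) = S w u + S w v"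
      "\<And>c v w. S (c *s v) w = c *s S v w" "\<And>c v w. S v (c *s w) = c *s S v w"
    and cg: "\<And>k v. dd (g k) x v = 0 \<Longrightarrow> dd (g k) x (S v v) = 0"
    and ca: "\<And>v. dd fa x v = 0 \<Longrightarrow> dd fa x (S v v) = 0" and cb: "\<And>v. dd fb x v = 0 \<Longrightarrow> dd fb x (S v v) = 0"
  shows "\<exists>l. S v v = l *s v"
proof -
  define y where "y k v = dd (g k) x v" for k v
  define K where "K k v w = dd (g k) x (S v w)" for k v w
  have yl: "y k (u + v) = y k u + y k v" "y k (c *s v) = c * y k v" for k u v c
    by (simp_all add: y_def chol_dd_linear[OF g x] chol_dd_scale[OF g x])
  have Kl: "K k (u + v) w = K k u w + K k v w" "K k w (u + v) = K k w u + K k w v"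
     "K k (c *s v) w = c * K k v w" "K k w (c *s v) = c * K k w v" for k u v w c
    by (simp_all add: K_def S chol_dd_linear[OF g x] chol_dd_scale[OF g x])
  have yE: "y k (E j) = (if k = j then 1 else 0)" for k j by (simp add: y_def dual)
  define l where "l k v = K k v (E k) + K k (E k) v - y k v * K k (E k) (E k)" for k v
  have ll: "l k (u + v) = l k u + l k v" "l k (c *s v) = c * l k v" for k u v c
    by (simp_all add: l_def Kl yl algebra_simps)
  have KK: "K k v v = y k v * l k v" for k v
  proof -
    define v' where "v' = v + (- y k v) *s E k"
    have "y k v' = 0" unfolding v'_def yl yE by simp
    then have "K k v' v' = 0" using cg by (simp add: y_def K_def)
    then show ?thesis unfolding v'_def Kl by (simp add: l_def algebra_simps)
  qed
  have expand: "h v = (\<Sum>k\<in>UNIV. y k v * h (E k))" if "\<And>u v. h (u + v) = h u + h v" "\<And>c v. h (c *s v) = c * h v" for h :: "complex^'n \<Rightarrow> complex" and v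
  proof -
    have h0: "h 0 = 0" using that(2)[of 0 0] by simp
    have "h (\<Sum>k\<in>A. y k v *s E k) = (\<Sum>k\<in>A. y k v * h (E k))" if "finite A" for A
      using that by (induction A) (simp_all add: h0 \<open>\<And>u v. h (u + v) = h u + h v\<close> \<open>\<And>c v. h (c *s v) = c * h v\<close>)
    from this[of UNIV] show ?thesis using span[of v] by (simp add: y_def)
  qed
  have step: "(l i (E i) - l j (E i)) * dd f x (E j) = (l i (E j) - l j (E j)) * dd f x (E i)"
    if ij: "i \<noteq> j" and f: "chol B f" and c0: "\<And>k. dd f x (E k) \<noteq> 0" and cf: "\<And>v. dd f x v = 0 \<Longrightarrow> dd f x (S v v) = 0" for i j f
  proof -
    define c where "c k = dd f x (E k)" for k
    have fl: "dd f x (u + v) = dd f x u + dd f x v" "dd f x (z *s v) = z * dd f x v" for u v z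
      by (simp_all add: chol_dd_linear[OF f x] chol_dd_scale[OF f x])
    define v where "v = (1 / c i) *s E i + (- 1 / c j) *s E j"
    have "dd f x v = 0" using c0[of i] c0[of j] unfolding v_def fl by (simp add: c_def)
    then have "0 = dd f x (S v v)" using cf by simp
    also have "\<dots> = (\<Sum>k\<in>UNIV. y k (S v v) * c k)" using expand[of "dd f x" "S v v"] fl by (simp add: c_def)
    also have "\<dots> = (\<Sum>k\<in>UNIV. y k v * l k v * c k)" using KK by (simp add: K_def y_def)
    also have "\<dots> = (\<Sum>k\<in>UNIV. (if k = i then l i v else 0) - (if k = j then l j v else 0))"
    proof (intro sum.cong refl)
      fix k
      have "y k v = (if k = i then 1 / c i else 0) - (if k = j then 1 / c j else 0)" unfolding v_def yl yE by simp
      then show "y k v * l k v * c k = (if k = i then l i v else 0) - (if k = j then l j v else 0)"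
        using ij c0[of i] c0[of j] by (auto simp: c_def)
    qed
    also have "\<dots> = l i v - l j v" by (simp add: sum_subtractf)
    finally have "l i v = l j v" by simp
    then have "(l i (E i) - l j (E i)) / c i = (l i (E j) - l j (E j)) / c j"
      unfolding v_def ll by (simp add: algebra_simps diff_divide_distrib)
    then show ?thesis using c0[of i] c0[of j] by (simp add: c_def field_simps)
  qed
  have same: "l j (E i) = l i (E i)" for i j
  proof (cases "i = j")
    case False
    define p where "p = l i (E i) - l j (E i)"
    define q where "q = l i (E j) - l j (E j)"
    have 1: "p * dd fa x (E j) = q * dd fa x (E i)" unfolding p_def q_def by (rule step[OF False fa a0 ca])
    have 2: "p * dd fb x (E j) = q * dd fb x (E i)" unfolding p_def q_def by (rule step[OF False fb b0 cb])
    have "p * (dd fa x (E i) * dd fb x (E j) - dd fa x (E j) * dd fb x (E i)) = 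
       dd fa x (E i) * (p * dd fb x (E j)) - dd fb x (E i) * (p * dd fa x (E j))" by (simp add: algebra_simps)
    also have "\<dots> = 0" unfolding 1 2 by (simp add: algebra_simps)
    finally have "p = 0" using ab[OF False] by simp
    then show ?thesis by (simp add: p_def)
  qed simp
  define lam where "lam = (\<Sum>i\<in>UNIV. y i v * l i (E i))"
  have lk: "l k v = lam" for k
    using expand[of "l k" v] ll by (simp add: lam_def same[of k])
  have "S v v = (\<Sum>k\<in>UNIV. K k v v *s E k)" using span[of "S v v"] by (simp add: K_def)
  also have "\<dots> = lam *s (\<Sum>k\<in>UNIV. y k v *s E k)" by (simp add: KK lk vec.scale_sum_right mult.commute)
  also have "(\<Sum>k\<in>UNIV. y k v *s E k) = v" using span[of v] by (simp add: y_def)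
  finally show ?thesis by blast
qed

text \<open>Local first integrals of an \<open>(n + 2)\<close>-web: \<open>n\<close> of them, with the frame dual to their differentials, and two
more. General position of the web says that the coefficients of the two remaining differentials
in this frame, and their \<open>2 \<times> 2\<close> minors, do not vanish.\<close>

lemma web_data:
  fixes W :: "nat \<Rightarrow> complex^'n \<Rightarrow> (complex^'n) set"
  assumes U: "open U" "x0 \<in> U" and W: "web U I W" and I: "card I = CARD('n) + 2"
  obtains r g fa fb E where "r > 0" "ball x0 r \<subseteq> U"
    "\<And>k::'n. chol (ball x0 r) (g k)" "chol (ball x0 r) fa" "chol (ball x0 r) fb"
    "\<And>k. \<exists>i\<in>I. first_int (ball x0 r) (W i) (g k)" "\<exists>i\<in>I. first_int (ball x0 r) (W i) fa" "\<exists>i\<in>I. first_int (ball x0 r) (W i) fb"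
    "\<And>i. i \<in> I \<Longrightarrow> first_int (ball x0 r) (W i) fa \<or> first_int (ball x0 r) (W i) fb \<or> (\<exists>k. first_int (ball x0 r) (W i) (g k))"
    "\<And>j. holo_map (ball x0 r) (E j)" "\<And>x k j. x \<in> ball x0 r \<Longrightarrow> dd (g k) x (E j x) = (if k = j then 1 else 0)"
    "\<And>x v. x \<in> ball x0 r \<Longrightarrow> v = (\<Sum>k\<in>UNIV. dd (g k) x v *s E k x)"
    "\<And>x k. x \<in> ball x0 r \<Longrightarrow> dd fa x (E k x) \<noteq> 0" "\<And>x k. x \<in> ball x0 r \<Longrightarrow> dd fb x (E k x) \<noteq> 0"
    "\<And>x j k. x \<in> ball x0 r \<Longrightarrow> j \<noteq> k \<Longrightarrow> dd fa x (E j x) * dd fb x (E k x) - dd fa x (E k x) * dd fb x (E j x) \<noteq> 0"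
proof -
  obtain r f where r: "r > 0" "ball x0 r \<subseteq> U" and f: "\<And>i. i \<in> I \<Longrightarrow> first_int (ball x0 r) (W i) (f i)"
    by (rule web_first_ints[OF U W]) blast
  have fin: "finite I" using W by (simp add: web_def)
  have gp: "general_position I W x" if "x \<in> ball x0 r" for x using W r that by (auto simp: web_def)
  obtain a where a: "a \<in> I" using I fin by fastforce
  have "card (I - {a}) = CARD('n) + 1" using a I fin by simp
  then obtain b where b: "b \<in> I" "b \<noteq> a" using fin by (metis Diff_iff One_nat_def add_is_0 card.empty ex_in_conv insertI1 old.nat.distinct(1))
  define J where "J = I - {a, b}"
  have "card J = CARD('n)" using a b I fin by (simp add: J_def card_Diff_subset)
  moreover have "finite J" using fin by (simp add: J_def)
  ultimately obtain \<iota> :: "'n \<Rightarrow> nat" where \<iota>: "bij_betw \<iota> UNIV J"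
    using finite_same_card_bij[of "UNIV :: 'n set" J] by auto
  have inj: "inj \<iota>" and \<iota>J: "\<And>k. \<iota> k \<in> J" and sur: "J = range \<iota>" using \<iota> by (auto simp: bij_betw_def)
  have JI: "J \<subseteq> I" by (auto simp: J_def)
  have \<iota>ab: "\<iota> k \<noteq> a" "\<iota> k \<noteq> b" "\<iota> k \<in> I" for k using \<iota>J[of k] by (auto simp: J_def)
  define B where "B = ball x0 r"
  have fc: "chol B (f i)" if "i \<in> I" for i using f[OF that] first_intD(2) by (auto simp: B_def)
  define g where "g k = f (\<iota> k)" for k
  have gc: "chol B (g k)" for k using fc \<iota>ab(3) by (simp add: g_def)
  have le: "CARD('n) \<le> card I" using I by simp
  have indep: "c j = 0" if "x \<in> B" "M \<subseteq> I" "card M = CARD('n)" "\<And>v. (\<Sum>j\<in>M. c j * dd (f j) x v) = 0" "j \<in> M" for x M c j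
    using web_indep[OF gp[OF that(1)[unfolded B_def]] f that(1)[unfolded B_def] that(2,3) le that(4,5)] .
  have ind: "\<forall>k. c k = 0" if x: "x \<in> B" and c: "\<And>v. (\<Sum>k\<in>UNIV. c k * dd (g k) x v) = 0" for x c
  proof
    fix k
    have se: "(\<Sum>j\<in>J. c (inv \<iota> j) * dd (f j) x v) = (\<Sum>k\<in>UNIV. c k * dd (g k) x v)" for v
      by (subst sum.reindex_bij_betw[OF \<iota>, symmetric]) (simp add: g_def inv_f_f[OF inj])
    have "c (inv \<iota> (\<iota> k)) = 0"
      by (rule indep[where c = "\<lambda>j. c (inv \<iota> j)", OF x JI \<open>card J = CARD('n)\<close> _ \<iota>J]) (simp only: se c)
    then show "c k = 0" by (simp add: inv_f_f[OF inj])
  qed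
  obtain E where E: "\<And>j. holo_map B (E j)" and dual: "\<And>x k j. x \<in> B \<Longrightarrow> dd (g k) x (E j x) = (if k = j then 1 else 0)"
    and span: "\<And>x v. x \<in> B \<Longrightarrow> v = (\<Sum>k\<in>UNIV. dd (g k) x v *s E k x)"
  proof (rule dual_frame[of B g])
    show "open B" by (simp add: B_def)
  qed (use gc ind in blast)+
  have ex: "dd h x v = (\<Sum>k\<in>UNIV. dd h x (E k x) * dd (g k) x v)" if "x \<in> B" "chol B h" for h x v
  proof -
    have "dd h x v = dd h x (\<Sum>k\<in>UNIV. dd (g k) x v *s E k x)" using span[OF that(1), of v] by simp
    then show ?thesis by (simp add: chol_dd_linear(5)[OF that(2,1)] chol_dd_scale[OF that(2,1)] mult.commute)
  qed
  have nz: "dd (f c) x (E k x) \<noteq> 0" if c: "c = a \<or> c = b" and x: "x \<in> B" for c x k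
  proof
    assume 0: "dd (f c) x (E k x) = 0"
    have cI: "c \<in> I" using c a b by auto
    have cn: "c \<notin> \<iota> ` (UNIV - {k})" using c \<iota>ab by auto
    define M where "M = insert c (\<iota> ` (UNIV - {k}))"
    have cM: "card M = CARD('n)" unfolding M_def
      using cn by (simp add: card_image[OF inj_on_subset[OF inj]] card_Diff_subset)
    define d where "d j = (if j = c then 1 else - dd (f c) x (E (inv \<iota> j) x))" for j
    have "(\<Sum>j\<in>M. d j * dd (f j) x v) = 0" for v
    proof -
      have "(\<Sum>j\<in>M. d j * dd (f j) x v) = dd (f c) x v + (\<Sum>j\<in>\<iota> ` (UNIV - {k}). d j * dd (f j) x v)"
        unfolding M_def using cn by (simp add: d_def)
      also have "(\<Sum>j\<in>\<iota> ` (UNIV - {k}). d j * dd (f j) x v) = (\<Sum>k'\<in>UNIV - {k}. - dd (f c) x (E k' x) * dd (g k') x v)"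
        by (subst sum.reindex[OF inj_on_subset[OF inj]]) (use c \<iota>ab in \<open>auto simp: d_def g_def inv_f_f[OF inj] intro!: sum.cong\<close>)
      also have "\<dots> = - (\<Sum>k'\<in>UNIV. dd (f c) x (E k' x) * dd (g k') x v)"
        by (subst (2) sum.remove[of _ k]) (simp_all add: 0 sum_negf)
      finally show ?thesis using ex[OF x fc[OF cI], of v] by simp
    qed
    then have "d c = 0" using indep[OF x _ cM, of d c] cI \<iota>ab(3) by (auto simp: M_def)
    then show False by (simp add: d_def)
  qed
  have cr: "dd (f a) x (E j x) * dd (f b) x (E k x) - dd (f a) x (E k x) * dd (f b) x (E j x) \<noteq> 0" if x: "x \<in> B" and jk: "j \<noteq> k" for x j k
  proof
    assume 0: "dd (f a) x (E j x) * dd (f b) x (E k x) - dd (f a) x (E k x) * dd (f b) x (E j x) = 0"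
    define R where "R = \<iota> ` (UNIV - {j, k})"
    define M where "M = insert a (insert b R)"
    have nR: "a \<notin> R" "b \<notin> R" "finite R" using \<iota>ab by (auto simp: R_def)
    have cR: "card R = CARD('n) - 2" unfolding R_def
      using jk by (simp add: card_image[OF inj_on_subset[OF inj]] card_Diff_subset)
    have "card {j, k} \<le> CARD('n)" by (rule card_mono) auto
    then have cM: "card M = CARD('n)" unfolding M_def using nR b(2) cR jk by simp
    define \<gamma> where "\<gamma> i = dd (f a) x (E j x) * dd (f b) x (E i x) - dd (f b) x (E j x) * dd (f a) x (E i x)" for i
    define d where "d i = (if i = a then - dd (f b) x (E j x) else if i = b then dd (f a) x (E j x) else - \<gamma> (inv \<iota> i))" for i
    have "(\<Sum>i\<in>M. d i * dd (f i) x v) = 0" for v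
    proof -
      have "(\<Sum>i\<in>M. d i * dd (f i) x v) = - dd (f b) x (E j x) * dd (f a) x v + dd (f a) x (E j x) * dd (f b) x v + (\<Sum>i\<in>R. d i * dd (f i) x v)"
        unfolding M_def using nR b(2) by (simp add: d_def)
      also have "(\<Sum>i\<in>R. d i * dd (f i) x v) = (\<Sum>i\<in>UNIV - {j, k}. - \<gamma> i * dd (g i) x v)"
        unfolding R_def by (subst sum.reindex[OF inj_on_subset[OF inj]]) (use \<iota>ab in \<open>auto simp: d_def g_def inv_f_f[OF inj] intro!: sum.cong\<close>)
      also have "\<dots> = - (\<Sum>i\<in>UNIV. \<gamma> i * dd (g i) x v)"
      proof -
        have "\<gamma> j = 0" "\<gamma> k = 0" using 0 by (simp_all add: \<gamma>_def algebra_simps)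
        then have "(\<Sum>i\<in>UNIV. \<gamma> i * dd (g i) x v) = (\<Sum>i\<in>UNIV - {j, k}. \<gamma> i * dd (g i) x v)"
          by (intro sum.mono_neutral_right) auto
        then show ?thesis by (simp add: sum_negf)
      qed
      also have "(\<Sum>i\<in>UNIV. \<gamma> i * dd (g i) x v) = dd (f a) x (E j x) * dd (f b) x v - dd (f b) x (E j x) * dd (f a) x v"
        unfolding ex[OF x fc[OF a], of v] ex[OF x fc[OF b(1)], of v]
        by (simp add: \<gamma>_def sum_distrib_left left_diff_distrib sum_subtractf mult.assoc)
      finally show ?thesis by simp
    qed
    then have "d b = 0" using indep[OF x _ cM, of d b] a b \<iota>ab(3) by (auto simp: M_def R_def)
    then show False using b(2) nz[of a x j] x by (simp add: d_def)
  qed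
  show ?thesis
  proof (rule that[of r g "f a" "f b" E])
    fix i assume i: "i \<in> I"
    show "first_int (ball x0 r) (W i) (f a) \<or> first_int (ball x0 r) (W i) (f b) \<or> (\<exists>k. first_int (ball x0 r) (W i) (g k))"
    proof (cases "i = a \<or> i = b")
      case False
      then have "i \<in> J" using i by (simp add: J_def)
      then obtain k where "i = \<iota> k" using sur by blast
      then show ?thesis using f[OF i] by (auto simp: g_def)
    qed (use f[OF i] in auto)
  next
    show "\<exists>i\<in>I. first_int (ball x0 r) (W i) (g k)" for k using f \<iota>ab(3) by (auto simp: g_def)
    show "v = (\<Sum>k\<in>UNIV. dd (g k) x v *s E k x)" if "x \<in> ball x0 r" for x v
      by (rule span) (use that in \<open>simp add: B_def\<close>)
  next
    show "\<exists>i\<in>I. first_int (ball x0 r) (W i) (f a)" "\<exists>i\<in>I. first_int (ball x0 r) (W i) (f b)" using f a b by auto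
    show "dd (g k) x (E j x) = (if k = j then 1 else 0)" if "x \<in> ball x0 r" for x k j
      by (rule dual) (use that in \<open>simp add: B_def\<close>)
  qed (use r gc fc a b E nz cr in \<open>simp_all add: B_def\<close>)
qed

subsection \<open>Thomas normalization\<close>

text \<open>Torsion-free and trace-free, the representative of a projective class singled out by T. Y. Thomas.
Its Christoffel symbols are holomorphic functions determined by the class, so that gluing and
analytic continuation apply to them.\<close>

definition normal :: "(complex^'n) set \<Rightarrow> 'n conn \<Rightarrow> bool" where
  "normal U \<Gamma> \<longleftrightarrow> (\<forall>x\<in>U. (\<forall>v w. \<Gamma> x v w = \<Gamma> x w v) \<and> (\<forall>v. (\<Sum>k\<in>UNIV. \<Gamma> x (axis k 1) v $ k) = 0))"

text \<open>Symmetrize, then subtract \<open>\<theta>(v) w + \<theta>(w) v\<close> with \<open>\<theta>\<close> the trace divided by \<open>n + 1\<close>.\<close>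

lemma normal_exists:
  fixes \<Gamma> :: "'n::finite conn"
  assumes G: "affine_connection U \<Gamma>"
  shows "\<exists>\<Gamma>'. affine_connection U \<Gamma>' \<and> normal U \<Gamma>' \<and> par U \<Gamma> \<Gamma>'"
proof -
  define N where "N = of_nat CARD('n) + (1::complex)"
  have N: "N \<noteq> 0" unfolding N_def using of_nat_neq_0[of "CARD('n)", where 'a = complex] by (simp add: add.commute)
  define \<tau> where "\<tau> x v = (\<Sum>k\<in>UNIV. \<Gamma> x (axis k 1) v $ k + \<Gamma> x v (axis k 1) $ k) / 2" for x v
  define \<Gamma>' where "\<Gamma>' x v w = (1/2) *s (\<Gamma> x v w + \<Gamma> x w v) - ((\<tau> x v / N) *s w + (\<tau> x w / N) *s v)" for x v w
  have tl: "\<tau> x (u + v) = \<tau> x u + \<tau> x v" "\<tau> x (c *s v) = c * \<tau> x v" if "x \<in> U" for x u v c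
    by (simp_all add: \<tau>_def conn_bilinear[OF G that] sum.distrib sum_distrib_left distrib_left add_divide_distrib)
  have th: "chol U (\<lambda>x. \<tau> x v)" for v unfolding \<tau>_def
    by (intro chol_divide chol_sum chol_add holo_map_chol affine_connectionD(3)[OF G] chol_const) simp
  have aff: "affine_connection U \<Gamma>'" unfolding affine_connection_def
  proof (intro conjI ballI allI)
    show "holo_map U (\<lambda>x. \<Gamma>' x v w)" for v w unfolding \<Gamma>'_def
      by (intro holo_map_diff holo_map_add holo_map_scale chol_const affine_connectionD(3)[OF G] holo_map_const chol_divide th) (rule N)+
    fix x v assume x: "x \<in> U"
    show "Vector_Spaces.linear (*s) (*s) (\<Gamma>' x v)" "Vector_Spaces.linear (*s) (*s) (\<lambda>w. \<Gamma>' x w v)"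
      unfolding clinear_iff \<Gamma>'_def by (simp_all add: conn_bilinear[OF G x] tl[OF x] vec_eq_iff field_simps add_divide_distrib)
  qed
  have "normal U \<Gamma>'" unfolding normal_def
  proof (intro ballI conjI allI)
    fix x v w assume x: "x \<in> U"
    show "\<Gamma>' x v w = \<Gamma>' x w v" by (simp add: \<Gamma>'_def add.commute)
    have te: "(\<Sum>k\<in>UNIV. \<tau> x (axis k 1) * v $ k) = \<tau> x v"
      using clinear_chol_basis[of "\<tau> x" v] tl[OF x] by (simp add: mult.commute)
    have 1: "(\<Sum>k\<in>UNIV. (\<Gamma> x (axis k 1) v $ k + \<Gamma> x v (axis k 1) $ k) / 2) = \<tau> x v"
      by (simp add: \<tau>_def sum_divide_distrib)
    have 2: "(\<Sum>k\<in>UNIV. \<tau> x (axis k 1) / N * v $ k) = \<tau> x v / N" unfolding te[symmetric] sum_divide_distrib by simp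
    have 3: "(\<Sum>k\<in>(UNIV::'n set). \<tau> x v / N) = of_nat CARD('n) * \<tau> x v / N" by simp
    have "(\<Sum>k\<in>UNIV. \<Gamma>' x (axis k 1) v $ k) = (\<Sum>k\<in>UNIV. (\<Gamma> x (axis k 1) v $ k + \<Gamma> x v (axis k 1) $ k) / 2 - \<tau> x (axis k 1) / N * v $ k - \<tau> x v / N)"
      by (intro sum.cong refl) (simp add: \<Gamma>'_def axis_def field_simps)
    also have "\<dots> = \<tau> x v - \<tau> x v / N - of_nat CARD('n) * \<tau> x v / N"
      unfolding sum_subtractf 1 2 3 ..
    also have "\<dots> = \<tau> x v - N * \<tau> x v / N" by (simp add: N_def algebra_simps add_divide_distrib)
    also have "\<dots> = 0" using N by simp
    finally show "(\<Sum>k\<in>UNIV. \<Gamma>' x (axis k 1) v $ k) = 0" .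
  qed
  moreover have "par U \<Gamma> \<Gamma>'" unfolding par_def
  proof (intro ballI allI)
    fix x v
    have "\<Gamma> x v v - \<Gamma>' x v v = (2 * \<tau> x v / N) *s v" by (simp add: \<Gamma>'_def vec_eq_iff)
    then show "\<exists>l. \<Gamma> x v v - \<Gamma>' x v v = l *s v" by blast
  qed
  ultimately show ?thesis using aff by blast
qed

text \<open>The symmetric difference \<open>S\<close> satisfies \<open>S v v = lam v *s v\<close>. Polarizing on pairs of coordinate vectors shows that
\<open>S\<close> comes from the linear form with values \<open>lam (e i)\<close>, whose trace is a nonzero multiple of it.\<close>

lemma normal_unique:
  fixes \<Gamma> \<Gamma>' :: "'n::finite conn"
  assumes G: "affine_connection U \<Gamma>" "normal U \<Gamma>" and G': "affine_connection U' \<Gamma>'" "normal U' \<Gamma>'"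
    and x: "x \<in> U" "x \<in> U'" and par: "\<And>v. \<exists>l. \<Gamma> x v v - \<Gamma>' x v v = l *s v"
  shows "\<Gamma> x v w = \<Gamma>' x v w"
proof -
  define S where "S v w = \<Gamma> x v w - \<Gamma>' x v w" for v w
  define e :: "'n \<Rightarrow> complex^'n" where "e k = axis k 1" for k
  have ek: "e k $ j = (if j = k then 1 else 0)" for k j by (simp add: e_def axis_def)
  have bl: "S (u + v) w = S u w + S v w" "S w (u + v) = S w u + S w v" "S (c *s v) w = c *s S v w" "S w (c *s v) = c *s S w v" for u v w c
    by (simp_all add: S_def conn_bilinear[OF G(1) x(1)] conn_bilinear[OF G'(1) x(2)] vec.scale_right_diff_distrib)
  have sym: "S v w = S w v" for v w using G(2) G'(2) x unfolding S_def normal_def by metis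
  have tr: "(\<Sum>k\<in>UNIV. S (e k) v $ k) = 0" for v
  proof -
    have "(\<Sum>k\<in>UNIV. \<Gamma> x (axis k 1) v $ k) = 0" "(\<Sum>k\<in>UNIV. \<Gamma>' x (axis k 1) v $ k) = 0"
      using G(2) G'(2) x unfolding normal_def by blast+
    then show ?thesis by (simp add: S_def sum_subtractf e_def)
  qed
  have "\<forall>v. \<exists>l. S v v = l *s v" using par by (simp add: S_def)
  then obtain lam where lam: "\<And>v. S v v = lam v *s v" by metis
  have off: "S (e k) (e i) $ k = lam (e i) / 2 \<and> 4 *s S (e k) (e i) = (2 * lam (e k)) *s e i + (2 * lam (e i)) *s e k" if ik: "i \<noteq> k" for i k
  proof -
    define a where "a = lam (e i + e k)"
    define b where "b = lam (e i + (-1) *s e k)"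
    define T where "T = S (e k) (e i)"
    have A: "lam (e i) *s e i + lam (e k) *s e k + 2 *s T = a *s (e i + e k)"
      using lam[of "e i + e k"] unfolding bl lam[of "e i"] lam[of "e k"] sym[of "e i" "e k"] T_def a_def by (simp add: vec_eq_iff algebra_simps)
    have B: "lam (e i) *s e i + lam (e k) *s e k - 2 *s T = b *s (e i - e k)"
      using lam[of "e i + (-1) *s e k"] unfolding bl lam[of "e i"] lam[of "e k"] sym[of "e i" "e k"] T_def b_def by (simp add: vec_eq_iff algebra_simps)
    have C: "lam (e i) * e i $ j + lam (e k) * e k $ j + 2 * T $ j = a * (e i $ j + e k $ j)"
        "lam (e i) * e i $ j + lam (e k) * e k $ j - 2 * T $ j = b * (e i $ j - e k $ j)" for j
      using arg_cong[OF A, of "\<lambda>v. v $ j"] arg_cong[OF B, of "\<lambda>v. v $ j"] by (simp_all add: algebra_simps)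
    have ci: "lam (e i) + 2 * T $ i = a" "lam (e i) - 2 * T $ i = b" using C[of i] ik by (simp_all add: ek)
    have ckk: "lam (e k) + 2 * T $ k = a" "lam (e k) - 2 * T $ k = - b" using C[of k] ik by (simp_all add: ek)
    have ab: "a + b = 2 * lam (e i)" "a - b = 2 * lam (e k)" "4 * T $ k = a + b"
    proof -
      have "(lam (e i) + 2 * T $ i) + (lam (e i) - 2 * T $ i) = a + b" by (simp only: ci)
      then show "a + b = 2 * lam (e i)" by simp
      have "(lam (e k) + 2 * T $ k) + (lam (e k) - 2 * T $ k) = a + (- b)" by (simp only: ckk)
      then show "a - b = 2 * lam (e k)" by simp
      have "(lam (e k) + 2 * T $ k) - (lam (e k) - 2 * T $ k) = a - (- b)" by (simp only: ckk)
      then show "4 * T $ k = a + b" by simp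
    qed
    have "4 * T $ j = 2 * lam (e k) * e i $ j + 2 * lam (e i) * e k $ j" for j
    proof -
      have "4 * T $ j = (lam (e i) * e i $ j + lam (e k) * e k $ j + 2 * T $ j) - (lam (e i) * e i $ j + lam (e k) * e k $ j - 2 * T $ j)" by simp
      also have "\<dots> = a * (e i $ j + e k $ j) - b * (e i $ j - e k $ j)" by (simp only: C)
      also have "\<dots> = (a - b) * e i $ j + (a + b) * e k $ j" by (simp add: algebra_simps)
      finally show ?thesis using ab by simp
    qed
    moreover have "2 * T $ k = lam (e i)" using ab by simp
    then have "T $ k = lam (e i) / 2" by (simp add: eq_divide_eq mult.commute)
    ultimately show ?thesis unfolding T_def by (simp add: vec_eq_iff)
  qed
  have l0: "lam (e i) = 0" for i
  proof -
    have "S (e i) (e i) $ i = lam (e i)" by (simp add: lam[of "e i"] ek)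
    then have "0 = lam (e i) + (\<Sum>k\<in>UNIV - {i}. S (e k) (e i) $ k)"
      using tr[of "e i"] by (simp add: sum.remove[of UNIV i])
    also have "(\<Sum>k\<in>UNIV - {i}. S (e k) (e i) $ k) = (\<Sum>k\<in>UNIV - {i}. lam (e i) / 2)"
      using off by (intro sum.cong refl) auto
    also have "\<dots> = of_nat (CARD('n) - 1) * (lam (e i) / 2)" by (simp add: card_Diff_singleton)
    finally have "lam (e i) * (of_nat (CARD('n) - 1) + 2) = 0" by (simp add: field_simps)
    moreover have "of_nat (CARD('n) - 1) + (2::complex) \<noteq> 0"
    proof -
      have "of_nat (CARD('n) - 1) + (2::complex) = of_nat (Suc (CARD('n) - 1 + 1))" by (simp only: of_nat_Suc of_nat_add of_nat_1) simp
      then show ?thesis by (simp only: of_nat_neq_0) simp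
    qed
    ultimately show ?thesis by simp
  qed
  have "S (e k) (e i) = 0" for k i
  proof (cases "i = k")
    case True then show ?thesis using lam[of "e i"] l0 by simp
  next
    case False
    then have "4 *s S (e k) (e i) = 0" using off l0 by simp
    then show ?thesis by simp
  qed
  then have "\<Gamma> x (axis k 1) (axis i 1) = \<Gamma>' x (axis k 1) (axis i 1)" for k i by (simp add: S_def e_def)
  then show ?thesis by (simp add: conn_expand[OF G(1) x(1), of v w] conn_expand[OF G'(1) x(2), of v w])
qed

subsection \<open>Existence and uniqueness\<close>

lemma alg_compat_unique:
  fixes W :: "nat \<Rightarrow> complex^'n \<Rightarrow> (complex^'n) set"
  assumes U: "open U" and W: "web U I W" and I: "card I = CARD('n) + 2" and V: "V \<subseteq> U"
    and G: "affine_connection V \<Gamma>" "alg_compat V I W \<Gamma>" and G': "affine_connection V \<Gamma>'" "alg_compat V I W \<Gamma>'"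
  shows "par V \<Gamma> \<Gamma>'"
  unfolding par_def
proof (intro ballI allI)
  fix x v assume x: "x \<in> V"
  then have xU: "x \<in> U" using V by blast
  show "\<exists>l. \<Gamma> x v v - \<Gamma>' x v v = l *s v"
  proof (rule web_data[OF U xU W I])
    fix r g fa fb E
    assume r: "r > 0" and g: "\<And>k::'n. chol (ball x r) (g k)" and fa: "chol (ball x r) fa" and fb: "chol (ball x r) fb"
      and fi: "\<And>k. \<exists>i\<in>I. first_int (ball x r) (W i) (g k)" "\<exists>i\<in>I. first_int (ball x r) (W i) fa" "\<exists>i\<in>I. first_int (ball x r) (W i) fb"
      and dual: "\<And>y k j. y \<in> ball x r \<Longrightarrow> dd (g k) y (E j y) = (if k = j then 1 else 0)"
      and span: "\<And>y v. y \<in> ball x r \<Longrightarrow> v = (\<Sum>k\<in>UNIV. dd (g k) y v *s E k y)"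
      and a0: "\<And>y k. y \<in> ball x r \<Longrightarrow> dd fa y (E k y) \<noteq> 0" and b0: "\<And>y k. y \<in> ball x r \<Longrightarrow> dd fb y (E k y) \<noteq> 0"
      and ab: "\<And>y j k. y \<in> ball x r \<Longrightarrow> j \<noteq> k \<Longrightarrow> dd fa y (E j y) * dd fb y (E k y) - dd fa y (E k y) * dd fb y (E j y) \<noteq> 0"
    have xb: "x \<in> ball x r" using r by simp
    have c: "dd f x (\<Gamma> x v v - \<Gamma>' x v v) = 0" if "\<exists>i\<in>I. first_int (ball x r) (W i) f" "dd f x v = 0" for f v
    proof -
      from that(1) obtain i where i: "i \<in> I" "first_int (ball x r) (W i) f" by blast
      then have "tgcond f \<Gamma> x" "tgcond f \<Gamma>' x" using G(2) G'(2) xb x unfolding alg_compat_def by blast+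
      then show ?thesis using that(2) chol_dd_linear(2)[OF first_intD(2)[OF i(2)] xb] by (simp add: tgcond_def)
    qed
    show ?thesis
      by (rule compat_unique_point[where S = "\<lambda>v w. \<Gamma> x v w - \<Gamma>' x v w" and E = "\<lambda>k. E k x", OF xb g fa fb dual[OF xb] span[OF xb] a0[OF xb] b0[OF xb] ab[OF xb] _ _ _ _ c[OF fi(1)] c[OF fi(2)] c[OF fi(3)]])
         (simp_all add: conn_bilinear[OF G(1) x] conn_bilinear[OF G'(1) x] vec.scale_right_diff_distrib)
  qed
qed

lemma alg_compat_par:
  assumes "par U \<Gamma> \<Gamma>'" "alg_compat U I W \<Gamma>" shows "alg_compat U I W \<Gamma>'"
  unfolding alg_compat_def tgcond_def
proof (intro ballI allI impI, elim conjE)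
  fix i B f x v assume a: "i \<in> I" "first_int B (W i) f" "x \<in> B" "x \<in> U" "dd f x v = 0"
  note fh = first_intD(2)[OF a(2)]
  obtain l where "\<Gamma> x v v - \<Gamma>' x v v = l *s v" using assms(1) a(4) unfolding par_def by blast
  then have "dd f x (\<Gamma> x v v) = dd f x (\<Gamma>' x v v + l *s v)" by (simp add: algebra_simps flip: \<open>_ = l *s v\<close>)
  then have "dd f x (\<Gamma> x v v) = dd f x (\<Gamma>' x v v)" by (simp add: chol_dd_linear[OF fh a(3)] chol_dd_scale[OF fh a(3)] a(5))
  then show "d2 f x v v = dd f x (\<Gamma>' x v v)" using assms(2) a unfolding alg_compat_def tgcond_def by metis
qed

lemma proj_class_eq:
  assumes "proj_equiv U \<Gamma> \<Gamma>'" shows "proj_class U \<Gamma> = proj_class U \<Gamma>'"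
  using assms by (auto simp: proj_class_def proj_equiv_def)

text \<open>The local connections of \<open>local_web_connection\<close> are replaced by their normal representatives. These agree
on overlaps, by uniqueness, and hence glue to a connection on \<open>U\<close>.\<close>

theorem web_connection_char:
  fixes W :: "nat \<Rightarrow> complex^'n \<Rightarrow> (complex^'n) set"
  assumes U: "open U" and W: "web U I W" and I: "card I = CARD('n) + 2"
  shows "\<exists>\<Gamma>. affine_connection U \<Gamma> \<and> normal U \<Gamma> \<and> alg_compat U I W \<Gamma> \<and> web_connection U I W = proj_class U \<Gamma>"
proof -
  have "\<exists>r \<Gamma>. r > 0 \<and> ball x r \<subseteq> U \<and> affine_connection (ball x r) \<Gamma> \<and> normal (ball x r) \<Gamma> \<and> alg_compat (ball x r) I W \<Gamma>" if x: "x \<in> U" for x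
  proof (rule web_data[OF U x W I])
    fix r g fa fb E
    assume r: "r > 0" "ball x r \<subseteq> U" and g: "\<And>k::'n. chol (ball x r) (g k)" and fa: "chol (ball x r) fa" and fb: "chol (ball x r) fb"
      and fi: "\<And>i. i \<in> I \<Longrightarrow> first_int (ball x r) (W i) fa \<or> first_int (ball x r) (W i) fb \<or> (\<exists>k. first_int (ball x r) (W i) (g k))"
      and E: "\<And>j. holo_map (ball x r) (E j)" and dual: "\<And>y k j. y \<in> ball x r \<Longrightarrow> dd (g k) y (E j y) = (if k = j then 1 else 0)"
      and span: "\<And>y v. y \<in> ball x r \<Longrightarrow> v = (\<Sum>k\<in>UNIV. dd (g k) y v *s E k y)"
      and a0: "\<And>y k. y \<in> ball x r \<Longrightarrow> dd fa y (E k y) \<noteq> 0" and b0: "\<And>y k. y \<in> ball x r \<Longrightarrow> dd fb y (E k y) \<noteq> 0"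
      and ab: "\<And>y j k. y \<in> ball x r \<Longrightarrow> j \<noteq> k \<Longrightarrow> dd fa y (E j y) * dd fb y (E k y) - dd fa y (E k y) * dd fb y (E j y) \<noteq> 0"
    obtain \<Gamma>0 where G0: "affine_connection (ball x r) \<Gamma>0"
      "\<forall>y\<in>ball x r. (\<forall>k. tgcond (g k) \<Gamma>0 y) \<and> tgcond fa \<Gamma>0 y \<and> tgcond fb \<Gamma>0 y"
      using local_web_connection[OF open_ball g fa fb E dual span a0 b0 ab] by blast
    have "alg_compat (ball x r) I W \<Gamma>0" unfolding alg_compat_def
    proof (intro ballI allI impI, elim conjE)
      fix i B f y assume a: "i \<in> I" "first_int B (W i) f" "y \<in> B" "y \<in> ball x r"
      from fi[OF a(1)] obtain f' where f': "first_int (ball x r) (W i) f'" "tgcond f' \<Gamma>0 y" using G0(2) a(4) by blast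
      show "tgcond f \<Gamma>0 y" by (rule tgcond_change[OF f'(1) a(2) a(4) a(3) f'(2)])
    qed
    moreover obtain \<Gamma> where "affine_connection (ball x r) \<Gamma>" "normal (ball x r) \<Gamma>" "par (ball x r) \<Gamma>0 \<Gamma>" using normal_exists[OF G0(1)] by blast
    ultimately show ?thesis using alg_compat_par r by blast
  qed
  then obtain r \<Delta> where \<Delta>: "\<And>x. x \<in> U \<Longrightarrow> r x > 0 \<and> ball x (r x) \<subseteq> U \<and> affine_connection (ball x (r x)) (\<Delta> x) \<and> normal (ball x (r x)) (\<Delta> x) \<and> alg_compat (ball x (r x)) I W (\<Delta> x)"
    by metis
  define \<Gamma> where "\<Gamma> x v w = \<Delta> x x v w" for x v w
  have eq: "\<Gamma> y v w = \<Delta> x y v w" if x: "x \<in> U" and y: "y \<in> ball x (r x)" for x y v w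
  proof -
    have yU: "y \<in> U" using \<Delta>[OF x] y by blast
    have yy: "y \<in> ball y (r y)" using \<Delta>[OF yU] by simp
    define V where "V = ball x (r x) \<inter> ball y (r y)"
    have sub: "affine_connection V D \<and> alg_compat V I W D" if "affine_connection T D" "alg_compat T I W D" "V \<subseteq> T" for D T
      using that unfolding affine_connection_def alg_compat_def by (meson holo_map_subset subsetD)
    have "par V (\<Delta> y) (\<Delta> x)"
      using alg_compat_unique[OF U W I, of V "\<Delta> y" "\<Delta> x"] sub[of "ball y (r y)" "\<Delta> y"] sub[of "ball x (r x)" "\<Delta> x"] \<Delta>[OF x] \<Delta>[OF yU]
      by (auto simp: V_def simp del: mem_ball)
    then have "\<exists>l. \<Delta> y y v v - \<Delta> x y v v = l *s v" for v using y yy unfolding par_def V_def by blast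
    then show ?thesis unfolding \<Gamma>_def 
      using normal_unique[of "ball y (r y)" "\<Delta> y" "ball x (r x)" "\<Delta> x" y v w] \<Delta>[OF x] \<Delta>[OF yU] y yy by blast
  qed
  have self: "x \<in> ball x (r x)" if "x \<in> U" for x using \<Delta>[OF that] by simp
  have aff: "affine_connection U \<Gamma>" unfolding affine_connection_def
  proof (intro conjI ballI allI)
    fix x v assume x: "x \<in> U"
    show "Vector_Spaces.linear (*s) (*s) (\<Gamma> x v)" "Vector_Spaces.linear (*s) (*s) (\<lambda>w. \<Gamma> x w v)"
      using affine_connectionD(1,2)[of "ball x (r x)" "\<Delta> x" x v] \<Delta>[OF x] self[OF x] by (simp_all add: \<Gamma>_def[abs_def])
  next
    fix v w
    have "holo_map (ball x (r x)) (\<lambda>y. \<Gamma> y v w)" if x: "x \<in> U" for x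
      by (rule holo_map_cong[OF affine_connectionD(3)[of "ball x (r x)" "\<Delta> x" v w] open_ball]) (use \<Delta>[OF x] eq[OF x] in auto)
    then show "holo_map U (\<lambda>x. \<Gamma> x v w)" unfolding holo_map_def using self by blast
  qed
  have nor: "normal U \<Gamma>" unfolding normal_def \<Gamma>_def
    using \<Delta> self unfolding normal_def by blast
  have alg: "alg_compat U I W \<Gamma>" unfolding alg_compat_def
  proof (intro ballI allI impI, elim conjE)
    fix i B f x assume a: "i \<in> I" "first_int B (W i) f" "x \<in> B" "x \<in> U"
    then have "tgcond f (\<Delta> x) x" using \<Delta>[OF a(4)] self[OF a(4)] unfolding alg_compat_def by blast
    then show "tgcond f \<Gamma> x" by (simp add: tgcond_def \<Gamma>_def)
  qed
  have Wf: "foliation U (W i)" if "i \<in> I" for i using W that by (simp add: web_def)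
  have "web_connection U I W = proj_class U \<Gamma>" unfolding web_connection_def
  proof (rule the_equality)
    have "alg_compat U I W \<Gamma>'" if "\<Gamma>' \<in> proj_class U \<Gamma>" for \<Gamma>'
      using that alg alg_compat_par proj_equiv_iff_par[OF U aff] unfolding proj_class_def by blast
    moreover have "compatible U (proj_class U \<Gamma>) I W \<longleftrightarrow> (\<forall>\<Gamma>'\<in>proj_class U \<Gamma>. alg_compat U I W \<Gamma>')"
      by (rule compatible_iff[OF U Wf]) (simp_all add: proj_class_def)
    ultimately have "compatible U (proj_class U \<Gamma>) I W" by simp
    then show "proj_connection U (proj_class U \<Gamma>) \<and> compatible U (proj_class U \<Gamma>) I W"
      using aff unfolding proj_connection_def by blast
  next
    fix P assume P: "proj_connection U P \<and> compatible U P I W"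
    then obtain \<Gamma>' where G': "affine_connection U \<Gamma>'" "P = proj_class U \<Gamma>'" unfolding proj_connection_def by blast
    have "\<Gamma>' \<in> P" using G' by (simp add: proj_class_def proj_equiv_def)
    moreover have "compatible U P I W \<longleftrightarrow> (\<forall>\<Gamma>'\<in>P. alg_compat U I W \<Gamma>')"
      by (rule compatible_iff[OF U Wf]) (simp_all add: G'(2) proj_class_def)
    ultimately have "alg_compat U I W \<Gamma>'" using P by simp
    then have "par U \<Gamma>' \<Gamma>" by (rule alg_compat_unique[OF U W I order_refl G'(1) _ aff alg])
    then show "P = proj_class U \<Gamma>" using proj_class_eq proj_equiv_iff_par[OF U G'(1) aff] G'(2) by blast
  qed
  then show ?thesis using aff nor alg by blast
qed

section \<open>Flat projective connections\<close>

subsection \<open>The integrability conditions\<close>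

text \<open>The derivative of the Christoffel symbols along \<open>z\<close>. The curvature operator is
\<open>Dconn \<Gamma> x z v w + \<Gamma> x z (\<Gamma> x v w)\<close>, antisymmetrized in \<open>z\<close> and \<open>v\<close>.\<close>

definition Dconn :: "'n::finite conn \<Rightarrow> complex^'n \<Rightarrow> complex^'n \<Rightarrow> complex^'n \<Rightarrow> complex^'n \<Rightarrow> complex^'n" where
  "Dconn \<Gamma> x z v w = Dmap (\<lambda>y. \<Gamma> y v w) x z"

text \<open>For a trace-free torsion-free connection this is the Ricci tensor, up to sign divided by \<open>n - 1\<close>.
It is the only tensor for which the first condition below can hold.\<close>

definition schouten :: "'n::finite conn \<Rightarrow> complex^'n \<Rightarrow> complex^'n \<Rightarrow> complex^'n \<Rightarrow> complex" where
  "schouten \<Gamma> x v w = ((\<Sum>k\<in>UNIV. \<Gamma> x v (\<Gamma> x (axis k 1) w) $ k) - (\<Sum>k\<in>UNIV. Dconn \<Gamma> x (axis k 1) v w $ k)) / (of_nat CARD('n) - 1)"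

text \<open>The compatibility conditions of the system \<open>d\<^sup>2u(w, v) = du(\<Gamma>(v, w)) + schouten(v, w) u\<close>: the
projective Weyl tensor and the projective Cotton tensor vanish, and the Schouten tensor is symmetric.\<close>

definition integrable_at :: "'n::finite conn \<Rightarrow> complex^'n \<Rightarrow> bool" where
  "integrable_at \<Gamma> x \<longleftrightarrow> (\<forall>z v w.
     Dconn \<Gamma> x z v w + \<Gamma> x z (\<Gamma> x v w) + schouten \<Gamma> x v w *s z = Dconn \<Gamma> x v z w + \<Gamma> x v (\<Gamma> x z w) + schouten \<Gamma> x z w *s v \<and>
     dd (\<lambda>y. schouten \<Gamma> y v w) x z + schouten \<Gamma> x z (\<Gamma> x v w) = dd (\<lambda>y. schouten \<Gamma> y z w) x v + schouten \<Gamma> x v (\<Gamma> x z w) \<and>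
     schouten \<Gamma> x v w = schouten \<Gamma> x w v)"

lemma Dconn_linear:
  assumes G: "affine_connection U \<Gamma>" and U: "open U" and x: "x \<in> U"
  shows "Dconn \<Gamma> x (z + z') v w = Dconn \<Gamma> x z v w + Dconn \<Gamma> x z' v w" "Dconn \<Gamma> x (c *s z) v w = c *s Dconn \<Gamma> x z v w"
    "Dconn \<Gamma> x z (v + v') w = Dconn \<Gamma> x z v w + Dconn \<Gamma> x z v' w" "Dconn \<Gamma> x z (c *s v) w = c *s Dconn \<Gamma> x z v w"
    "Dconn \<Gamma> x z v (w + w') = Dconn \<Gamma> x z v w + Dconn \<Gamma> x z v w'" "Dconn \<Gamma> x z v (c *s w) = c *s Dconn \<Gamma> x z v w"
proof -
  note h = affine_connectionD(3)[OF G]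
  show "Dconn \<Gamma> x (z + z') v w = Dconn \<Gamma> x z v w + Dconn \<Gamma> x z' v w" "Dconn \<Gamma> x (c *s z) v w = c *s Dconn \<Gamma> x z v w"
    by (simp_all add: Dconn_def Dmap_linear(1)[OF h x] Dmap_scale[OF h x])
  show "Dconn \<Gamma> x z (v + v') w = Dconn \<Gamma> x z v w + Dconn \<Gamma> x z v' w" "Dconn \<Gamma> x z v (w + w') = Dconn \<Gamma> x z v w + Dconn \<Gamma> x z v w'"
    unfolding Dconn_def
    by (simp_all add: Dmap_cong[OF U x, of "\<lambda>y. \<Gamma> y (v + v') w" "\<lambda>y. \<Gamma> y v w + \<Gamma> y v' w"]
        Dmap_cong[OF U x, of "\<lambda>y. \<Gamma> y v (w + w')" "\<lambda>y. \<Gamma> y v w + \<Gamma> y v w'"] conn_bilinear[OF G] Dmap_add[OF h h x])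
  show "Dconn \<Gamma> x z (c *s v) w = c *s Dconn \<Gamma> x z v w" "Dconn \<Gamma> x z v (c *s w) = c *s Dconn \<Gamma> x z v w"
    unfolding Dconn_def
    by (simp_all add: Dmap_cong[OF U x, of "\<lambda>y. \<Gamma> y (c *s v) w" "\<lambda>y. c *s \<Gamma> y v w"]
        Dmap_cong[OF U x, of "\<lambda>y. \<Gamma> y v (c *s w)" "\<lambda>y. c *s \<Gamma> y v w"] conn_bilinear[OF G] Dmap_scale_fun[OF chol_const h x] dd_const)
qed

lemma schouten_linear:
  assumes G: "affine_connection U \<Gamma>" and U: "open U" and x: "x \<in> U"
  shows "schouten \<Gamma> x (v + v') w = schouten \<Gamma> x v w + schouten \<Gamma> x v' w" "schouten \<Gamma> x (c *s v) w = c * schouten \<Gamma> x v w"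
    "schouten \<Gamma> x v (w + w') = schouten \<Gamma> x v w + schouten \<Gamma> x v w'" "schouten \<Gamma> x v (c *s w) = c * schouten \<Gamma> x v w"
  unfolding schouten_def
  by (simp_all add: conn_bilinear[OF G x] Dconn_linear[OF G U x] sum.distrib sum_distrib_left algebra_simps diff_divide_distrib add_divide_distrib)

lemma schouten_chol:
  assumes G: "affine_connection U \<Gamma>" and U: "open U" and n: "CARD('n::finite) \<ge> 2"
  shows "chol U (\<lambda>x. schouten (\<Gamma> :: 'n conn) x v w)"
proof -
  have "of_nat CARD('n) - (1::complex) \<noteq> 0" using n by (metis One_nat_def eq_iff_diff_eq_0 not_less_eq_eq numeral_2_eq_2 of_nat_1 of_nat_eq_iff le_refl)
  then show ?thesis unfolding schouten_def Dconn_def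
    by (intro chol_divide chol_diff chol_sum chol_const holo_map_chol[OF conn_holo[OF G U U holo_map_id _ holo_map_const conn_holo[OF G U U holo_map_id _ holo_map_const holo_map_const]]] 
         holo_map_chol[OF holo_map_Dmap(1)[OF U affine_connectionD(3)[OF G]]]) auto
qed

text \<open>The conditions are identities between holomorphic functions on the connected set \<open>U\<close>.\<close>

lemma integrable_extend:
  assumes U: "open U" "connected U" and G: "affine_connection U \<Gamma>" and n: "CARD('n::finite) \<ge> 2"
    and V: "open V" "V \<noteq> {}" "V \<subseteq> U" "\<And>x. x \<in> V \<Longrightarrow> integrable_at \<Gamma> x" and x: "x \<in> U"
  shows "integrable_at (\<Gamma> :: 'n conn) x"
proof -
  note Pc = schouten_chol[OF G U(1) n]
  have GG: "holo_map U (\<lambda>x. \<Gamma> x z (\<Gamma> x v w))" for z v w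
    by (intro conn_holo[OF G U(1) U(1) holo_map_id _ holo_map_const] affine_connectionD(3)[OF G]) auto
  have DG: "holo_map U (\<lambda>x. Dconn \<Gamma> x z v w)" for z v w
    unfolding Dconn_def by (rule holo_map_Dmap(1)[OF U(1) affine_connectionD(3)[OF G]])
  have PG: "chol U (\<lambda>x. schouten \<Gamma> x z (\<Gamma> x v w))" for z v w
  proof -
    have "chol U (\<lambda>x. \<Sum>j\<in>UNIV. \<Gamma> x v w $ j * schouten \<Gamma> x z (axis j 1))"
      by (intro chol_sum chol_mult Pc holo_map_chol affine_connectionD(3)[OF G])
    then show ?thesis
      by (rule chol_cong[OF _ U(1)]) (rule clinear_chol_basis, simp_all add: schouten_linear[OF G U(1)])
  qed
  show ?thesis unfolding integrable_at_def
  proof (intro allI conjI)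
    fix z v w
    have "(Dconn \<Gamma> x z v w + \<Gamma> x z (\<Gamma> x v w) + schouten \<Gamma> x v w *s z - (Dconn \<Gamma> x v z w + \<Gamma> x v (\<Gamma> x z w) + schouten \<Gamma> x z w *s v)) $ k = 0" for k
    proof (rule chol_identity[OF U _ V(1-3) _ x])
      show "chol U (\<lambda>x. (Dconn \<Gamma> x z v w + \<Gamma> x z (\<Gamma> x v w) + schouten \<Gamma> x v w *s z - (Dconn \<Gamma> x v z w + \<Gamma> x v (\<Gamma> x z w) + schouten \<Gamma> x z w *s v)) $ k)"
        by (intro holo_map_chol holo_map_diff holo_map_add holo_map_scale DG GG Pc holo_map_const)
    qed (use V(4) in \<open>auto simp: integrable_at_def\<close>)
    then have "Dconn \<Gamma> x z v w + \<Gamma> x z (\<Gamma> x v w) + schouten \<Gamma> x v w *s z - (Dconn \<Gamma> x v z w + \<Gamma> x v (\<Gamma> x z w) + schouten \<Gamma> x z w *s v) = 0"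
      by (simp add: vec_eq_iff)
    then show "Dconn \<Gamma> x z v w + \<Gamma> x z (\<Gamma> x v w) + schouten \<Gamma> x v w *s z = Dconn \<Gamma> x v z w + \<Gamma> x v (\<Gamma> x z w) + schouten \<Gamma> x z w *s v"
      by simp
    have "dd (\<lambda>y. schouten \<Gamma> y v w) x z + schouten \<Gamma> x z (\<Gamma> x v w) - (dd (\<lambda>y. schouten \<Gamma> y z w) x v + schouten \<Gamma> x v (\<Gamma> x z w)) = 0"
    proof (rule chol_identity[OF U _ V(1-3) _ x])
      show "chol U (\<lambda>x. dd (\<lambda>y. schouten \<Gamma> y v w) x z + schouten \<Gamma> x z (\<Gamma> x v w) - (dd (\<lambda>y. schouten \<Gamma> y z w) x v + schouten \<Gamma> x v (\<Gamma> x z w)))"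
        by (intro chol_diff chol_add PG dd_chol_and_symmetric(1)[OF U(1)] Pc)
    qed (use V(4) in \<open>auto simp: integrable_at_def\<close>)
    then show "dd (\<lambda>y. schouten \<Gamma> y v w) x z + schouten \<Gamma> x z (\<Gamma> x v w) = dd (\<lambda>y. schouten \<Gamma> y z w) x v + schouten \<Gamma> x v (\<Gamma> x z w)" by simp
    have "schouten \<Gamma> x v w - schouten \<Gamma> x w v = 0"
      by (rule chol_identity[OF U _ V(1-3) _ x]) (intro chol_diff Pc, use V(4) in \<open>auto simp: integrable_at_def\<close>)
    then show "schouten \<Gamma> x v w = schouten \<Gamma> x w v" by simp
  qed
qed

text \<open>Third derivatives of \<open>\<phi>\<close> are symmetric: differentiating the second derivative of \<open>\<phi>\<close>, written as \<open>d\<phi>(\<Gamma>)\<close>,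
once more yields \<open>d\<phi>\<close> applied to the curvature operator.\<close>

lemma flat_curvature:
  assumes V: "open V" and \<phi>: "holo_map V \<phi>" and inj: "\<And>x v. x \<in> V \<Longrightarrow> Dmap \<phi> x v = 0 \<Longrightarrow> v = 0"
    and G: "affine_connection V \<Gamma>" and c: "\<And>x v w. x \<in> V \<Longrightarrow> Dmap \<phi> x (\<Gamma> x v w) = Dmap (\<lambda>y. Dmap \<phi> y w) x v" and x: "x \<in> V"
  shows "Dconn \<Gamma> x z v w + \<Gamma> x z (\<Gamma> x v w) = Dconn \<Gamma> x v z w + \<Gamma> x v (\<Gamma> x z w)" "\<Gamma> x v w = \<Gamma> x w v"
proof -
  have inj': "a = b" if "Dmap \<phi> x a = Dmap \<phi> x b" for a b
    using inj[OF x, of "a - b"] that by (simp add: Dmap_linear[OF \<phi> x])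
  have hw: "holo_map V (\<lambda>y. Dmap \<phi> y w)" for w by (rule holo_map_Dmap(1)[OF V \<phi>])
  have d: "Dmap \<phi> x (Dconn \<Gamma> x z v w + \<Gamma> x z (\<Gamma> x v w)) = Dmap (\<lambda>y. Dmap (\<lambda>y. Dmap \<phi> y w) y v) x z" for z v w
  proof -
    have "Dmap (\<lambda>y. Dmap (\<lambda>y. Dmap \<phi> y w) y v) x z = Dmap (\<lambda>y. Dmap \<phi> y (\<Gamma> y v w)) x z"
      by (subst Dmap_cong[OF V x c]) auto
    also have "\<dots> = Dmap (\<lambda>y. Dmap \<phi> y (\<Gamma> x v w)) x z + Dmap \<phi> x (Dmap (\<lambda>y. \<Gamma> y v w) x z)"
      by (subst holo_family(2)[OF Dmap_clinear[OF \<phi>] hw V V holo_map_id _ affine_connectionD(3)[OF G] x])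
         (auto simp: Dmap_eq[OF has_derivative_ident])
    finally show ?thesis by (simp add: c[OF x, symmetric] Dmap_linear[OF \<phi> x] Dconn_def)
  qed
  show "Dconn \<Gamma> x z v w + \<Gamma> x z (\<Gamma> x v w) = Dconn \<Gamma> x v z w + \<Gamma> x v (\<Gamma> x z w)"
    by (rule inj') (simp only: d holo_map_Dmap(3)[OF V hw x, of w v z])
  show "\<Gamma> x v w = \<Gamma> x w v" by (rule inj') (simp only: c[OF x] holo_map_Dmap(3)[OF V \<phi> x, of w v])
qed

text \<open>\<open>\<Gamma>0\<close> equals \<open>\<Gamma>(v, w) + \<theta>(v) w + \<theta>(w) v\<close> for the 1-form \<open>\<theta>\<close> given by its trace. Inserting this into
the vanishing curvature of \<open>\<Gamma>0\<close> and taking the two traces shows that \<open>\<theta>\<close> is closed and that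
\<open>P = \<theta>(\<Gamma>(v, w)) + \<theta>(v) \<theta>(w) - T(v, w)\<close>, with \<open>T\<close> the derivative of \<open>\<theta>\<close>, is the Schouten tensor of \<open>\<Gamma>\<close>. The Cotton condition is what remains when \<open>P\<close> is
differentiated.\<close>

lemma flat_imp_integrable:
  fixes \<Gamma> \<Gamma>0 :: "'n::finite conn"
  assumes V: "open V" and n: "CARD('n) \<ge> 2"
    and G0: "affine_connection V \<Gamma>0" and curv: "\<And>x z v w. x \<in> V \<Longrightarrow> Dconn \<Gamma>0 x z v w + \<Gamma>0 x z (\<Gamma>0 x v w) = Dconn \<Gamma>0 x v z w + \<Gamma>0 x v (\<Gamma>0 x z w)"
    and sym0: "\<And>x v w. x \<in> V \<Longrightarrow> \<Gamma>0 x v w = \<Gamma>0 x w v"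
    and G: "affine_connection V \<Gamma>" "normal V \<Gamma>" and par: "par V \<Gamma>0 \<Gamma>" and x: "x \<in> V"
  shows "integrable_at \<Gamma> x"
proof -
  define N where "N = of_nat CARD('n) + (1::complex)"
  have N: "N \<noteq> 0" unfolding N_def using of_nat_neq_0[of "CARD('n)", where 'a = complex] by (simp add: add.commute)
  \<comment> \<open>the 1-form \<open>\<theta>\<close> by which the two connections differ\<close>
  define \<theta> where "\<theta> x v = (\<Sum>k\<in>UNIV. \<Gamma>0 x (axis k 1) v $ k) / N" for x v
  have \<theta>h: "chol V (\<lambda>x. \<theta> x v)" for v unfolding \<theta>_def
    by (intro chol_divide chol_sum holo_map_chol affine_connectionD(3)[OF G0] chol_const) (use N in auto)
  have \<theta>l: "\<theta> x (u + v) = \<theta> x u + \<theta> x v" "\<theta> x (c *s v) = c * \<theta> x v" if "x \<in> V" for x u v c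
    by (simp_all add: \<theta>_def conn_bilinear[OF G0 that] sum.distrib sum_distrib_left add_divide_distrib)
  have eq: "\<Gamma>0 y v w = \<Gamma> y v w + \<theta> y v *s w + \<theta> y w *s v" if y: "y \<in> V" for y v w
  proof -
    define \<Delta> where "\<Delta> y v w = \<Gamma>0 y v w - (\<theta> y v *s w + \<theta> y w *s v)" for y v w
    have aff: "affine_connection V \<Delta>" unfolding affine_connection_def
    proof (intro conjI ballI allI)
      show "holo_map V (\<lambda>x. \<Delta> x v w)" for v w unfolding \<Delta>_def
        by (intro holo_map_diff holo_map_add holo_map_scale affine_connectionD(3)[OF G0] holo_map_const \<theta>h)
      fix x v assume x: "x \<in> V"
      show "Vector_Spaces.linear (*s) (*s) (\<Delta> x v)" "Vector_Spaces.linear (*s) (*s) (\<lambda>w. \<Delta> x w v)"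
        unfolding clinear_iff \<Delta>_def by (simp_all add: conn_bilinear[OF G0 x] \<theta>l[OF x] vec_eq_iff algebra_simps)
    qed
    have nor: "normal V \<Delta>" unfolding normal_def
    proof (intro ballI conjI allI)
      fix x v w assume x: "x \<in> V"
      show "\<Delta> x v w = \<Delta> x w v" using sym0[OF x] by (simp add: \<Delta>_def add.commute)
      have te: "(\<Sum>k\<in>UNIV. \<theta> x (axis k 1) * v $ k) = \<theta> x v"
        using clinear_chol_basis[of "\<theta> x" v] \<theta>l[OF x] by (simp add: mult.commute)
      have "(\<Sum>k\<in>UNIV. \<Delta> x (axis k 1) v $ k) = (\<Sum>k\<in>UNIV. \<Gamma>0 x (axis k 1) v $ k - \<theta> x (axis k 1) * v $ k - \<theta> x v)"
        by (intro sum.cong refl) (simp add: \<Delta>_def axis_def)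
      also have "\<dots> = N * \<theta> x v - \<theta> x v - of_nat CARD('n) * \<theta> x v"
        unfolding sum_subtractf te using N by (simp add: \<theta>_def)
      also have "\<dots> = 0" by (simp add: N_def algebra_simps)
      finally show "(\<Sum>k\<in>UNIV. \<Delta> x (axis k 1) v $ k) = 0" .
    qed
    have "par V \<Gamma>0 \<Delta>" unfolding par_def
    proof (intro ballI allI)
      fix x v show "\<exists>l. \<Gamma>0 x v v - \<Delta> x v v = l *s v"
        by (rule exI[of _ "2 * \<theta> x v"]) (simp add: \<Delta>_def vec_eq_iff)
    qed
    then have "par V \<Gamma> \<Delta>" using par_trans par_sym par by blast
    then have "\<Gamma> y v w = \<Delta> y v w"
      by (intro normal_unique[OF G aff nor y y]) (use y in \<open>auto simp: par_def\<close>)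
    then show ?thesis by (simp add: \<Delta>_def algebra_simps)
  qed
  define T where "T y z v = dd (\<lambda>y. \<theta> y v) y z" for y z v
  define P where "P y v w = \<theta> y (\<Gamma> y v w) + \<theta> y v * \<theta> y w - T y v w" for y v w
  have Gs: "\<Gamma> y v w = \<Gamma> y w v" if "y \<in> V" for y v w using G(2) that unfolding normal_def by blast
  have Gt: "(\<Sum>k\<in>UNIV. \<Gamma> y (axis k 1) v $ k) = 0" if "y \<in> V" for y v using G(2) that unfolding normal_def by blast
  have Tl: "T y z (u + v) = T y z u + T y z v" "T y z (c *s v) = c * T y z v" 
    "T y (u + v) z = T y u z + T y v z" "T y (c *s v) z = c * T y v z" if y: "y \<in> V" for y z u v c
  proof -
    show "T y z (u + v) = T y z u + T y z v" unfolding T_def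
      by (subst dd_cong[OF V y, of _ "\<lambda>y. \<theta> y u + \<theta> y v"]) (simp_all add: \<theta>l dd_add[OF \<theta>h \<theta>h y])
    show "T y z (c *s v) = c * T y z v" unfolding T_def
      by (subst dd_cong[OF V y, of _ "\<lambda>y. c * \<theta> y v"]) (simp_all add: \<theta>l dd_mult[OF chol_const \<theta>h y] dd_const)
    show "T y (u + v) z = T y u z + T y v z" "T y (c *s v) z = c * T y v z"
      unfolding T_def by (simp_all add: chol_dd_linear[OF \<theta>h y] chol_dd_scale[OF \<theta>h y])
  qed
  have D0: "Dconn \<Gamma>0 y z v w = Dconn \<Gamma> y z v w + T y z v *s w + T y z w *s v" if y: "y \<in> V" for y z v w
  proof -
    have h: "holo_map V (\<lambda>y. \<Gamma> y v w + \<theta> y v *s w)" "holo_map V (\<lambda>y. \<theta> y w *s v)" "holo_map V (\<lambda>y. \<theta> y v *s w)"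
      by (intro holo_map_add holo_map_scale affine_connectionD(3)[OF G(1)] holo_map_const \<theta>h)+
    have "Dconn \<Gamma>0 y z v w = Dmap (\<lambda>y. \<Gamma> y v w + \<theta> y v *s w + \<theta> y w *s v) y z"
      unfolding Dconn_def by (subst Dmap_cong[OF V y eq]) auto
    also have "\<dots> = Dmap (\<lambda>y. \<Gamma> y v w) y z + Dmap (\<lambda>y. \<theta> y v *s w) y z + Dmap (\<lambda>y. \<theta> y w *s v) y z"
      by (simp add: Dmap_add[OF h(1,2) y] Dmap_add[OF affine_connectionD(3)[OF G(1)] h(3) y])
    finally show ?thesis
      by (simp add: Dconn_def T_def Dmap_scale_fun[OF \<theta>h holo_map_const y] Dmap_const)
  qed
  have Pl: "P y (u + v) w = P y u w + P y v w" "P y (c *s v) w = c * P y v w" if y: "y \<in> V" for y u v w c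
    by (simp_all add: P_def conn_bilinear[OF G(1) y] \<theta>l[OF y] Tl[OF y] algebra_simps)
  have raw: "Dconn \<Gamma> y z v w + \<Gamma> y z (\<Gamma> y v w) + P y v w *s z + T y z v *s w
      = Dconn \<Gamma> y v z w + \<Gamma> y v (\<Gamma> y z w) + P y z w *s v + T y v z *s w" if y: "y \<in> V" for y z v w
  proof -
    have "\<Gamma>0 y z (\<Gamma>0 y v w) = \<Gamma> y z (\<Gamma> y v w) + \<theta> y v *s \<Gamma> y z w + \<theta> y w *s \<Gamma> y z v + \<theta> y z *s (\<Gamma> y v w + \<theta> y v *s w + \<theta> y w *s v)
       + (\<theta> y (\<Gamma> y v w) + 2 * \<theta> y v * \<theta> y w) *s z" for z v w
      by (simp add: eq[OF y] conn_bilinear[OF G(1) y] \<theta>l[OF y] vec_eq_iff algebra_simps)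
    then show ?thesis using curv[OF y, of z v w] Gs[OF y, of z v]
      by (simp add: D0[OF y] P_def vec_eq_iff algebra_simps)
  qed
  have trprod: "(\<Sum>k\<in>UNIV. \<Gamma> y z (\<Gamma> y v (axis k 1)) $ k) = (\<Sum>k\<in>UNIV. \<Gamma> y v (\<Gamma> y z (axis k 1)) $ k)" if y: "y \<in> V" for y z v
  proof -
    have e: "\<Gamma> y z (\<Gamma> y v (axis k 1)) $ k = (\<Sum>l\<in>UNIV. \<Gamma> y v (axis k 1) $ l * \<Gamma> y z (axis l 1) $ k)" for z v k
      by (subst clinear_basis[OF affine_connectionD(1)[OF G(1) y], of z "\<Gamma> y v (axis k 1)"]) (simp add: sum_component)
    show ?thesis unfolding e by (subst sum.swap) (simp add: mult.commute)
  qed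
  have te: "(\<Sum>k\<in>UNIV. h (axis k 1) * a $ k) = h a" if "\<And>u v. h (u + v) = h u + h v" "\<And>c v. h (c *s v) = c * h v" for h :: "complex^'n \<Rightarrow> complex" and a
    using clinear_chol_basis[of h a] that by (simp add: mult.commute)
  have trD: "(\<Sum>k\<in>UNIV. Dconn \<Gamma> y z (axis k 1) v $ k) = 0" "(\<Sum>k\<in>UNIV. Dconn \<Gamma> y z v (axis k 1) $ k) = 0" if y: "y \<in> V" for y z v
  proof -
    have "(\<Sum>k\<in>UNIV. Dconn \<Gamma> y z (axis k 1) v $ k) = dd (\<lambda>y. \<Sum>k\<in>UNIV. \<Gamma> y (axis k 1) v $ k) y z"
      unfolding Dconn_def by (simp add: Dmap_nth[OF affine_connectionD(3)[OF G(1)] y] dd_sum[OF holo_map_chol[OF affine_connectionD(3)[OF G(1)]] y])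
    also have "\<dots> = dd (\<lambda>y. 0) y z" by (subst dd_cong[OF V y, of _ "\<lambda>y. 0"]) (simp_all add: Gt)
    finally show 1: "(\<Sum>k\<in>UNIV. Dconn \<Gamma> y z (axis k 1) v $ k) = 0" by (simp add: dd_const)
    have "Dconn \<Gamma> y z v (axis k 1) = Dconn \<Gamma> y z (axis k 1) v" for k
      unfolding Dconn_def by (subst Dmap_cong[OF V y, of "\<lambda>y. \<Gamma> y v (axis k 1)" "\<lambda>y. \<Gamma> y (axis k 1) v"]) (simp_all add: Gs)
    then show "(\<Sum>k\<in>UNIV. Dconn \<Gamma> y z v (axis k 1) $ k) = 0" using 1 by simp
  qed
  \<comment> \<open>trace of raw over w, in which the connection terms drop out\<close>
  have closed: "T y z v = T y v z" if y: "y \<in> V" for y z v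
  proof -
    have Pv: "P y v (u + w) = P y v u + P y v w" "P y v (c *s w) = c * P y v w" for v u w c
      by (simp_all add: P_def conn_bilinear[OF G(1) y] \<theta>l[OF y] Tl[OF y] algebra_simps)
    have s: "(\<Sum>k\<in>UNIV. (Dconn \<Gamma> y z v (axis k 1) + \<Gamma> y z (\<Gamma> y v (axis k 1)) + P y v (axis k 1) *s z + T y z v *s axis k 1) $ k)
       = P y v z + of_nat CARD('n) * T y z v + (\<Sum>k\<in>UNIV. \<Gamma> y z (\<Gamma> y v (axis k 1)) $ k)" for z v
      using te[of "P y v" z] Pv by (simp add: sum.distrib trD[OF y])
    have "P y v z + of_nat CARD('n) * T y z v = P y z v + of_nat CARD('n) * T y v z"
      using s[of z v] s[of v z] trprod[OF y, of z v] unfolding raw[OF y, of z v] by simp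
    then have "N * (T y z v - T y v z) = 0" by (simp add: P_def N_def Gs[OF y, of v z] algebra_simps)
    then show ?thesis using N by simp
  qed
  have I1: "Dconn \<Gamma> y z v w + \<Gamma> y z (\<Gamma> y v w) + P y v w *s z = Dconn \<Gamma> y v z w + \<Gamma> y v (\<Gamma> y z w) + P y z w *s v" if y: "y \<in> V" for y z v w
    using raw[OF y, of z v w] closed[OF y, of z v] by simp
  \<comment> \<open>trace of I1 over z\<close>
  have PS: "schouten \<Gamma> y v w = P y v w" if y: "y \<in> V" for y v w
  proof -
    have s: "(\<Sum>k\<in>UNIV. (Dconn \<Gamma> y (axis k 1) v w + \<Gamma> y (axis k 1) (\<Gamma> y v w) + P y v w *s axis k 1) $ k)
      = (\<Sum>k\<in>UNIV. Dconn \<Gamma> y (axis k 1) v w $ k) + of_nat CARD('n) * P y v w"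
      by (simp add: sum.distrib Gt[OF y])
    have "(\<Sum>k\<in>UNIV. (Dconn \<Gamma> y v (axis k 1) w + \<Gamma> y v (\<Gamma> y (axis k 1) w) + P y (axis k 1) w *s v) $ k)
      = (\<Sum>k\<in>UNIV. \<Gamma> y v (\<Gamma> y (axis k 1) w) $ k) + P y v w"
      using te[of "\<lambda>u. P y u w" v] Pl[OF y] by (simp add: sum.distrib trD[OF y])
    then have "(\<Sum>k\<in>UNIV. Dconn \<Gamma> y (axis k 1) v w $ k) + of_nat CARD('n) * P y v w = (\<Sum>k\<in>UNIV. \<Gamma> y v (\<Gamma> y (axis k 1) w) $ k) + P y v w"
      using s I1[OF y] by simp
    then have e: "(\<Sum>k\<in>UNIV. \<Gamma> y v (\<Gamma> y (axis k 1) w) $ k) - (\<Sum>k\<in>UNIV. Dconn \<Gamma> y (axis k 1) v w $ k) = P y v w * (of_nat CARD('n) - 1)"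
      by (simp add: algebra_simps)
    have "of_nat CARD('n) - (1::complex) \<noteq> 0" using n by (metis One_nat_def eq_iff_diff_eq_0 not_less_eq_eq numeral_2_eq_2 of_nat_1 of_nat_eq_iff le_refl)
    then show ?thesis by (simp add: schouten_def e)
  qed
  have Psym: "P y v w = P y w v" if y: "y \<in> V" for y v w
    by (simp add: P_def Gs[OF y, of v w] closed[OF y, of v w])
  have dP: "dd (\<lambda>y. schouten \<Gamma> y v w) x z = (T x z (\<Gamma> x v w) + \<theta> x (Dconn \<Gamma> x z v w)) + (\<theta> x v * T x z w + T x z v * \<theta> x w) - dd (\<lambda>y. T y v w) x z" for z v w
  proof -
    have \<theta>G: "chol V (\<lambda>y. \<theta> y (\<Gamma> y v w))" "dd (\<lambda>y. \<theta> y (\<Gamma> y v w)) x z = T x z (\<Gamma> x v w) + \<theta> x (Dconn \<Gamma> x z v w)"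
    proof -
      have e: "\<theta> y a = (\<Sum>k\<in>UNIV. a $ k * \<theta> y (axis k 1))" if "y \<in> V" for y a
        using clinear_chol_basis[of "\<theta> y" a] \<theta>l[OF that] by simp
      have c: "chol V (\<lambda>y. \<Gamma> y v w $ k * \<theta> y (axis k 1))" for k
        by (intro chol_mult \<theta>h holo_map_chol affine_connectionD(3)[OF G(1)])
      show "chol V (\<lambda>y. \<theta> y (\<Gamma> y v w))"
        by (rule chol_cong[OF chol_sum[OF c] V]) (rule e)
      have "dd (\<lambda>y. \<theta> y (\<Gamma> y v w)) x z = dd (\<lambda>y. \<Sum>k\<in>UNIV. \<Gamma> y v w $ k * \<theta> y (axis k 1)) x z"
        by (subst dd_cong[OF V x, OF e]) auto
      also have "\<dots> = (\<Sum>k\<in>UNIV. \<Gamma> x v w $ k * T x z (axis k 1) + Dconn \<Gamma> x z v w $ k * \<theta> x (axis k 1))"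
        unfolding dd_sum[OF c x] dd_mult[OF holo_map_chol[OF affine_connectionD(3)[OF G(1)]] \<theta>h x] T_def Dconn_def Dmap_nth[OF affine_connectionD(3)[OF G(1)] x] ..
      also have "\<dots> = T x z (\<Gamma> x v w) + \<theta> x (Dconn \<Gamma> x z v w)"
        using te[of "T x z" "\<Gamma> x v w"] te[of "\<theta> x" "Dconn \<Gamma> x z v w"] Tl[OF x] \<theta>l[OF x] by (simp add: sum.distrib mult.commute)
      finally show "dd (\<lambda>y. \<theta> y (\<Gamma> y v w)) x z = T x z (\<Gamma> x v w) + \<theta> x (Dconn \<Gamma> x z v w)" .
    qed
    have Tc: "chol V (\<lambda>y. T y v w)" unfolding T_def by (rule dd_chol_and_symmetric(1)[OF V \<theta>h])
    have "dd (\<lambda>y. schouten \<Gamma> y v w) x z = dd (\<lambda>y. (\<theta> y (\<Gamma> y v w) + \<theta> y v * \<theta> y w) - T y v w) x z"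
      by (subst dd_cong[OF V x, of _ "\<lambda>y. P y v w"]) (auto simp: PS P_def)
    then show ?thesis
      by (simp add: dd_diff[OF chol_add[OF \<theta>G(1) chol_mult[OF \<theta>h \<theta>h]] Tc x] dd_add[OF \<theta>G(1) chol_mult[OF \<theta>h \<theta>h] x]
            dd_mult[OF \<theta>h \<theta>h x] \<theta>G(2) T_def[of x])
  qed
  show ?thesis unfolding integrable_at_def
  proof (intro allI conjI)
    fix z v w
    show "Dconn \<Gamma> x z v w + \<Gamma> x z (\<Gamma> x v w) + schouten \<Gamma> x v w *s z = Dconn \<Gamma> x v z w + \<Gamma> x v (\<Gamma> x z w) + schouten \<Gamma> x z w *s v"
      unfolding PS[OF x] by (rule I1[OF x])
    show "schouten \<Gamma> x v w = schouten \<Gamma> x w v" unfolding PS[OF x] by (rule Psym[OF x])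
    have sT: "dd (\<lambda>y. T y v w) x z = dd (\<lambda>y. T y z w) x v"
      using d2_sym[OF V \<theta>h x, of w v z] by (simp add: d2_def T_def)
    have "\<theta> x (Dconn \<Gamma> x z v w + \<Gamma> x z (\<Gamma> x v w) + P x v w *s z) = \<theta> x (Dconn \<Gamma> x v z w + \<Gamma> x v (\<Gamma> x z w) + P x z w *s v)"
      using I1[OF x, of z v w] by simp
    then have "\<theta> x (Dconn \<Gamma> x z v w) + \<theta> x (\<Gamma> x z (\<Gamma> x v w)) + P x v w * \<theta> x z = \<theta> x (Dconn \<Gamma> x v z w) + \<theta> x (\<Gamma> x v (\<Gamma> x z w)) + P x z w * \<theta> x v"
      by (simp add: \<theta>l[OF x])
    then show "dd (\<lambda>y. schouten \<Gamma> y v w) x z + schouten \<Gamma> x z (\<Gamma> x v w) = dd (\<lambda>y. schouten \<Gamma> y z w) x v + schouten \<Gamma> x v (\<Gamma> x z w)"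
      unfolding dP PS[OF x] by (simp add: sT P_def closed[OF x, of z v] algebra_simps)
  qed
qed

subsection \<open>Flat charts\<close>

lemma par_subset: "par U \<Gamma> \<Gamma>' \<Longrightarrow> V \<subseteq> U \<Longrightarrow> par V \<Gamma> \<Gamma>'"
  unfolding par_def by blast

lemma affine_subset: "affine_connection U \<Gamma> \<Longrightarrow> V \<subseteq> U \<Longrightarrow> affine_connection V \<Gamma>"
  unfolding affine_connection_def using holo_map_subset by blast

text \<open>The pull-back of the standard flat connection by \<open>\<phi>\<close>.\<close>

lemma flat_pullback_exists:
  assumes b: "biholo V \<phi>"
  shows "\<exists>\<Gamma>0. affine_connection V \<Gamma>0 \<and> (\<forall>x\<in>V. \<forall>v w. Dmap \<phi> x (\<Gamma>0 x v w) = Dmap (\<lambda>y. Dmap \<phi> y w) x v)"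
proof -
  obtain \<psi> where \<psi>: "open V" "open (\<phi> ` V)" "holo_map V \<phi>" "holo_map (\<phi> ` V) \<psi>" "\<forall>x\<in>V. \<psi> (\<phi> x) = x"
    using b unfolding biholo_def by blast
  note hw = holo_map_Dmap(1)[OF \<psi>(1,3)]
  define \<Gamma>0 where "\<Gamma>0 x v w = Dmap \<psi> (\<phi> x) (Dmap (\<lambda>y. Dmap \<phi> y w) x v)" for x v w
  have "affine_connection V \<Gamma>0" unfolding affine_connection_def
  proof (intro conjI ballI allI)
    fix v w show "holo_map V (\<lambda>x. \<Gamma>0 x v w)" unfolding \<Gamma>0_def
      by (rule holo_family(1)[OF Dmap_clinear[OF \<psi>(4)] holo_map_Dmap(1)[OF \<psi>(2,4)] \<psi>(2,1,3) order_refl holo_map_Dmap(1)[OF \<psi>(1) hw]])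
  next
    fix x v assume x: "x \<in> V"
    then have y: "\<phi> x \<in> \<phi> ` V" by simp
    show "Vector_Spaces.linear (*s) (*s) (\<lambda>w. \<Gamma>0 x w v)" unfolding clinear_iff \<Gamma>0_def
      by (simp add: Dmap_linear[OF hw x] Dmap_scale[OF hw x] Dmap_linear[OF \<psi>(4) y] Dmap_scale[OF \<psi>(4) y])
    show "Vector_Spaces.linear (*s) (*s) (\<Gamma>0 x v)" unfolding clinear_iff \<Gamma>0_def holo_map_Dmap(3)[OF \<psi>(1,3) x, of _ v]
      by (simp add: Dmap_linear[OF hw x] Dmap_scale[OF hw x] Dmap_linear[OF \<psi>(4) y] Dmap_scale[OF \<psi>(4) y])
  qed
  moreover have "Dmap \<phi> x (\<Gamma>0 x v w) = Dmap (\<lambda>y. Dmap \<phi> y w) x v" if "x \<in> V" for x v w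
    unfolding \<Gamma>0_def by (rule biholo_Dmap(2)[OF \<psi> that])
  ultimately show ?thesis by blast
qed

lemma proj_restrict_eq:
  assumes U: "open U" and G: "affine_connection U \<Gamma>" and V: "open V" "V \<subseteq> U"
  shows "proj_restrict V (proj_class U \<Gamma>) = {\<Gamma>'. affine_connection V \<Gamma>' \<and> par V \<Gamma> \<Gamma>'}"
proof (intro set_eqI iffI)
  fix \<Gamma>' assume "\<Gamma>' \<in> proj_restrict V (proj_class U \<Gamma>)"
  then obtain \<Gamma>1 where a: "affine_connection U \<Gamma>1" "proj_equiv U \<Gamma> \<Gamma>1" "affine_connection V \<Gamma>'" "proj_equiv V \<Gamma>1 \<Gamma>'"
    unfolding proj_restrict_def proj_class_def by blast
  have "par V \<Gamma> \<Gamma>1" using proj_equiv_iff_par[OF U G a(1)] a(2) par_subset V(2) by blast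
  moreover have "par V \<Gamma>1 \<Gamma>'" using proj_equiv_iff_par[OF V(1) affine_subset[OF a(1) V(2)] a(3)] a(4) by blast
  ultimately show "\<Gamma>' \<in> {\<Gamma>'. affine_connection V \<Gamma>' \<and> par V \<Gamma> \<Gamma>'}" using a(3) par_trans by blast
next
  fix \<Gamma>' assume a: "\<Gamma>' \<in> {\<Gamma>'. affine_connection V \<Gamma>' \<and> par V \<Gamma> \<Gamma>'}"
  have "\<Gamma> \<in> proj_class U \<Gamma>" using G by (simp add: proj_class_def proj_equiv_def)
  moreover have "\<Gamma>' \<in> proj_class V \<Gamma>" using a proj_equiv_iff_par[OF V(1) affine_subset[OF G V(2)]] by (auto simp: proj_class_def)
  ultimately show "\<Gamma>' \<in> proj_restrict V (proj_class U \<Gamma>)" unfolding proj_restrict_def by blast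
qed

lemma affine_zero: "affine_connection V (\<lambda>x v w. 0)"
  by (simp add: affine_connection_def clinear_iff holo_map_const)

text \<open>Every connection that is projectively equivalent to \<open>\<Gamma>0\<close> is the pull-back of one that is equivalent to the
standard connection: push the difference with \<open>\<Gamma>0\<close> forward.\<close>

lemma proj_pullback_eq:
  fixes \<Gamma>0 :: "'n::finite conn"
  assumes b: "biholo V \<phi>" and G0: "affine_connection V \<Gamma>0" and c: "\<And>x v w. x \<in> V \<Longrightarrow> Dmap \<phi> x (\<Gamma>0 x v w) = Dmap (\<lambda>y. Dmap \<phi> y w) x v"
  shows "proj_pullback V \<phi> (proj_class (\<phi> ` V) (\<lambda>x v w. 0)) = {\<Gamma>'. affine_connection V \<Gamma>' \<and> par V \<Gamma>0 \<Gamma>'}"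
proof -
  obtain \<psi> where \<psi>: "open V" "open (\<phi> ` V)" "holo_map V \<phi>" "holo_map (\<phi> ` V) \<psi>" "\<forall>x\<in>V. \<psi> (\<phi> x) = x"
    using b unfolding biholo_def by blast
  note inv = biholo_Dmap[OF \<psi>]
  show ?thesis
  proof (intro set_eqI iffI)
    fix \<Gamma>' assume "\<Gamma>' \<in> proj_pullback V \<phi> (proj_class (\<phi> ` V) (\<lambda>x v w. 0))"
    then obtain \<Gamma>'' where a: "affine_connection V \<Gamma>'" "affine_connection (\<phi> ` V) \<Gamma>''" "proj_equiv (\<phi> ` V) (\<lambda>x v w. 0) \<Gamma>''" "carries_conn V \<phi> \<Gamma>' \<Gamma>''"
      unfolding proj_pullback_def proj_class_def by blast
    have p: "par (\<phi> ` V) (\<lambda>x v w. 0) \<Gamma>''" using proj_equiv_iff_par[OF \<psi>(2) affine_zero a(2)] a(3) by blast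
    have "\<exists>l. \<Gamma>0 x v v - \<Gamma>' x v v = l *s v" if x: "x \<in> V" for x v
    proof -
      obtain l where l: "0 - \<Gamma>'' (\<phi> x) (Dmap \<phi> x v) (Dmap \<phi> x v) = l *s Dmap \<phi> x v" using p x unfolding par_def by blast
      have "Dmap \<phi> x (\<Gamma>' x v v) = Dmap (\<lambda>y. Dmap \<phi> y v) x v + \<Gamma>'' (\<phi> x) (Dmap \<phi> x v) (Dmap \<phi> x v)"
        using a(4) x unfolding carries_conn_def by blast
      then have "Dmap \<phi> x (\<Gamma>0 x v v - \<Gamma>' x v v) = l *s Dmap \<phi> x v"
        using l c[OF x, of v v] Dmap_linear(2)[OF \<psi>(3) x] by simp
      then have "Dmap \<psi> (\<phi> x) (Dmap \<phi> x (\<Gamma>0 x v v - \<Gamma>' x v v)) = Dmap \<psi> (\<phi> x) (Dmap \<phi> x (l *s v))"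
        by (simp add: Dmap_scale[OF \<psi>(3) x])
      then show ?thesis unfolding inv(1)[OF x] by blast
    qed
    then show "\<Gamma>' \<in> {\<Gamma>'. affine_connection V \<Gamma>' \<and> par V \<Gamma>0 \<Gamma>'}" using a(1) by (simp add: par_def)
  next
    fix \<Gamma>' assume "\<Gamma>' \<in> {\<Gamma>'. affine_connection V \<Gamma>' \<and> par V \<Gamma>0 \<Gamma>'}"
    then have a: "affine_connection V \<Gamma>'" "par V \<Gamma>0 \<Gamma>'" by auto
    define S where "S x v w = \<Gamma>' x v w - \<Gamma>0 x v w" for x v w
    have Sa: "affine_connection V S" unfolding affine_connection_def
    proof (intro conjI ballI allI)
      show "holo_map V (\<lambda>x. S x v w)" for v w unfolding S_def by (intro holo_map_diff affine_connectionD(3) a(1) G0)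
      fix x v assume x: "x \<in> V"
      show "Vector_Spaces.linear (*s) (*s) (S x v)" "Vector_Spaces.linear (*s) (*s) (\<lambda>w. S x w v)"
        unfolding clinear_iff S_def by (simp_all add: conn_bilinear[OF G0 x] conn_bilinear[OF a(1) x] vec_eq_iff algebra_simps)
    qed
    define \<Gamma>'' where "\<Gamma>'' y v w = Dmap \<phi> (\<psi> y) (S (\<psi> y) (Dmap \<psi> y v) (Dmap \<psi> y w))" for y v w
    have \<psi>V: "\<psi> ` \<phi> ` V \<subseteq> V" "\<And>y. y \<in> \<phi> ` V \<Longrightarrow> \<psi> y \<in> V" "\<And>y. y \<in> \<phi> ` V \<Longrightarrow> \<phi> (\<psi> y) = y" using \<psi>(5) by auto
    have aff: "affine_connection (\<phi> ` V) \<Gamma>''" unfolding affine_connection_def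
    proof (intro conjI ballI allI)
      fix v w show "holo_map (\<phi> ` V) (\<lambda>x. \<Gamma>'' x v w)" unfolding \<Gamma>''_def
        by (rule holo_family(1)[OF Dmap_clinear[OF \<psi>(3)] holo_map_Dmap(1)[OF \<psi>(1,3)] \<psi>(1,2,4) \<psi>V(1)
              conn_holo[OF Sa \<psi>(1,2,4) \<psi>V(1) holo_map_Dmap(1)[OF \<psi>(2,4)] holo_map_Dmap(1)[OF \<psi>(2,4)]]])
    next
      fix y v assume y: "y \<in> \<phi> ` V"
      show "Vector_Spaces.linear (*s) (*s) (\<Gamma>'' y v)" "Vector_Spaces.linear (*s) (*s) (\<lambda>w. \<Gamma>'' y w v)"
        unfolding clinear_iff \<Gamma>''_def
        by (simp_all add: Dmap_linear[OF \<psi>(4) y] Dmap_scale[OF \<psi>(4) y] conn_bilinear[OF Sa \<psi>V(2)[OF y]]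
            Dmap_linear[OF \<psi>(3) \<psi>V(2)[OF y]] Dmap_scale[OF \<psi>(3) \<psi>V(2)[OF y]])
    qed
    have "par (\<phi> ` V) (\<lambda>x v w. 0) \<Gamma>''" unfolding par_def
    proof (intro ballI allI)
      fix y v assume y: "y \<in> \<phi> ` V"
      obtain l where "\<Gamma>0 (\<psi> y) (Dmap \<psi> y v) (Dmap \<psi> y v) - \<Gamma>' (\<psi> y) (Dmap \<psi> y v) (Dmap \<psi> y v) = l *s Dmap \<psi> y v"
        using a(2) \<psi>V(2)[OF y] unfolding par_def by blast
      then have "S (\<psi> y) (Dmap \<psi> y v) (Dmap \<psi> y v) = (- l) *s Dmap \<psi> y v" unfolding S_def by (metis minus_diff_eq vector_smult_lneg)
      then have "\<Gamma>'' y v v = (- l) *s v"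
        using inv(2)[OF \<psi>V(2)[OF y], of v] \<psi>V(3)[OF y] by (simp only: \<Gamma>''_def Dmap_scale[OF \<psi>(3) \<psi>V(2)[OF y]])
      then have "0 - \<Gamma>'' y v v = l *s v" by simp
      then show "\<exists>l. 0 - \<Gamma>'' y v v = l *s v" by blast
    qed
    then have "proj_equiv (\<phi> ` V) (\<lambda>x v w. 0) \<Gamma>''" using proj_equiv_iff_par[OF \<psi>(2) affine_zero aff] by blast
    moreover have "carries_conn V \<phi> \<Gamma>' \<Gamma>''" unfolding carries_conn_def
    proof (intro ballI allI)
      fix x v w assume x: "x \<in> V"
      have "\<Gamma>'' (\<phi> x) (Dmap \<phi> x v) (Dmap \<phi> x w) = Dmap \<phi> x (S x v w)"
        using \<psi>(5) x by (simp add: \<Gamma>''_def inv(1)[OF x])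
      then show "Dmap \<phi> x (\<Gamma>' x v w) = Dmap (\<lambda>y. Dmap \<phi> y w) x v + \<Gamma>'' (\<phi> x) (Dmap \<phi> x v) (Dmap \<phi> x w)"
        by (simp add: S_def Dmap_linear[OF \<psi>(3) x] c[OF x])
    qed
    ultimately show "\<Gamma>' \<in> proj_pullback V \<phi> (proj_class (\<phi> ` V) (\<lambda>x v w. 0))"
      unfolding proj_pullback_def proj_class_def using aff a(1) by blast
  qed
qed

lemma dd_zero_constant:
  assumes S: "open S" "convex S" and f: "chol S f" and z: "\<And>x v. x \<in> S \<Longrightarrow> dd f x v = 0" and x: "x \<in> S" "y \<in> S"
  shows "f x = f y"
proof -
  have "\<exists>c. \<forall>x\<in>S. f x = c"
  proof (rule has_derivative_zero_constant[OF S(2)])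
    fix x assume x: "x \<in> S"
    have "dd f x = (\<lambda>v. 0)" using z[OF x] by (rule ext)
    then show "(f has_derivative (\<lambda>h. 0)) (at x within S)"
      using chol_has_derivative[OF f x] has_derivative_at_withinI by metis
  qed
  then show ?thesis using x by metis
qed

subsection \<open>Projective flatness from integrability\<close>

text \<open>The second order system is a first order total differential equation for the triple of point, value and
gradient of \<open>u\<close>, here a vector in \<open>\<complex>\<^sup>n \<times> \<complex> \<times> \<complex>\<^sup>n\<close>. Its commutation condition is \<open>integrable_at\<close>,
and Frobenius provides a solution with arbitrary value and gradient at \<open>m\<close>. Keeping the point as a
component makes the coefficients functions of the unknown alone.\<close>

lemma flat_solution:
  fixes \<Gamma> :: "'n::finite conn"
  assumes U: "open U" and n: "CARD('n) \<ge> 2" and G: "affine_connection U \<Gamma>"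
    and Gs: "\<And>x v w. x \<in> U \<Longrightarrow> \<Gamma> x v w = \<Gamma> x w v" and int: "\<And>x. x \<in> U \<Longrightarrow> integrable_at \<Gamma> x" and m: "m \<in> U"
  shows "\<exists>r>0. \<exists>u. ball m r \<subseteq> U \<and> chol (ball m r) u \<and> u m = c \<and> (\<forall>v. dd u m v = pair p0 v) \<and>
    (\<forall>y\<in>ball m r. \<forall>v w. d2 u y w v = dd u y (\<Gamma> y v w) + schouten \<Gamma> y v w * u y)"
proof -
  define S where "S = schouten \<Gamma>"
  define xc :: "complex^('n + 'n option) \<Rightarrow> complex^'n" where "xc z = (\<chi> i. z $ Inl i)" for z
  define pc :: "complex^('n + 'n option) \<Rightarrow> complex^'n" where "pc z = (\<chi> i. z $ Inr (Some i))" for z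
  define uc :: "complex^('n + 'n option) \<Rightarrow> complex" where "uc z = z $ Inr None" for z
  define mk :: "complex^'n \<Rightarrow> complex \<Rightarrow> complex^'n \<Rightarrow> complex^('n + 'n option)" where
    "mk x u p = (\<chi> k. case k of Inl i \<Rightarrow> x $ i | Inr None \<Rightarrow> u | Inr (Some i) \<Rightarrow> p $ i)" for x u p
  have [simp]: "xc (mk x u p) = x" "pc (mk x u p) = p" "uc (mk x u p) = u" for x u p
    by (simp_all add: xc_def pc_def uc_def mk_def)
  have ext: "z = z'" if "xc z = xc z'" "uc z = uc z'" "pc z = pc z'" for z z'
  proof -
    have "z $ k = z' $ k" for k
      using that by (cases k rule: sum.exhaust; (cases "projr k")?) (auto simp: xc_def uc_def pc_def vec_eq_iff)
    then show ?thesis by (simp add: vec_eq_iff)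
  qed
  have xl: "Vector_Spaces.linear (*s) (*s) xc" and pl: "Vector_Spaces.linear (*s) (*s) pc"
    by (simp_all add: clinear_iff xc_def pc_def vec_eq_iff)
  note xh = clinear_holo[OF xl] and ph = clinear_holo[OF pl]
  have uh: "chol T uc" "dd uc z W = uc W" for T z W unfolding uc_def by (rule chol_nth, rule dd_nth)
  define Q where "Q = {z. xc z \<in> U}"
  have Q: "open Q" using open_vimage[OF U holo_map_continuous_on[OF xh(1)]] by (simp add: Q_def vimage_def)
  have xQ: "xc ` Q \<subseteq> U" "z \<in> Q \<Longrightarrow> xc z \<in> U" for z by (auto simp: Q_def)
  define q where "q z v i = pair (pc z) (\<Gamma> (xc z) v (axis i 1)) + S (xc z) v (axis i 1) * uc z" for z v i
  define X where "X z v = mk v (pair (pc z) v) (\<chi> i. q z v i)" for z v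
  note SL = schouten_linear[OF G U, folded S_def]
  have Sc: "chol U (\<lambda>x. S x v w)" for v w unfolding S_def by (rule schouten_chol[OF G U n])
  have Xl: "Vector_Spaces.linear (*s) (*s) (X z)" if z: "z \<in> Q" for z
  proof -
    have mka: "mk (v + v') (a + a') (p + p') = mk v a p + mk v' a' p'" for v v' a a' p p'
      by (rule ext) (simp_all add: mk_def xc_def uc_def pc_def vec_eq_iff)
    have mks: "mk (c *s v) (c * a) (c *s p) = c *s mk v a p" for c v a p
      by (rule ext) (simp_all add: mk_def xc_def uc_def pc_def vec_eq_iff)
    have q: "(\<chi> i. q z (v + w) i) = (\<chi> i. q z v i) + (\<chi> i. q z w i)" "(\<chi> i. q z (c *s v) i) = c *s (\<chi> i. q z v i)" for v w c
      by (simp_all add: vec_eq_iff q_def pair_linear conn_bilinear[OF G xQ(2)[OF z]] SL[OF xQ(2)[OF z]] algebra_simps)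
    show ?thesis unfolding clinear_iff X_def q pair_linear mka mks by blast
  qed
  have Gx: "holo_map Q (\<lambda>z. \<Gamma> (xc z) v w)" "z \<in> Q \<Longrightarrow> Dmap (\<lambda>z. \<Gamma> (xc z) v w) z W = Dconn \<Gamma> (xc z) (xc W) v w" for v w z W
    using holo_map_compose[OF affine_connectionD(3)[OF G] xh(1) xQ(1)] by (auto simp: Dconn_def xh(2))
  have Sx: "chol Q (\<lambda>z. S (xc z) v w)" "z \<in> Q \<Longrightarrow> dd (\<lambda>z. S (xc z) v w) z W = dd (\<lambda>x. S x v w) (xc z) (xc W)" for v w z W
    using chol_compose[OF Sc xh(1) xQ(1)] by (auto simp: xh(2))
  have pvc: "chol Q (\<lambda>z. pair (pc z) v)" "z \<in> Q \<Longrightarrow> dd (\<lambda>z. pair (pc z) v) z W = pair (pc W) v" for v z W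
    using chol_pair[OF ph(1) holo_map_const] dd_pair[OF ph(1) holo_map_const, of z Q v W] by (auto simp: ph(2) Dmap_const pair_linear)
  have pG: "chol Q (\<lambda>z. pair (pc z) (\<Gamma> (xc z) v w))" for v w by (rule chol_pair[OF ph(1) Gx(1)])
  have SU: "chol Q (\<lambda>z. S (xc z) v w * uc z)" for v w by (intro chol_mult Sx(1) uh(1))
  have qc: "chol Q (\<lambda>z. q z v i)" for v i unfolding q_def by (intro chol_add pG SU)
  have qD: "dd (\<lambda>z. q z v i) z W = pair (pc z) (Dconn \<Gamma> (xc z) (xc W) v (axis i 1)) + pair (pc W) (\<Gamma> (xc z) v (axis i 1))
      + (S (xc z) v (axis i 1) * uc W + dd (\<lambda>x. S x v (axis i 1)) (xc z) (xc W) * uc z)" if z: "z \<in> Q" for z v i W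
    unfolding q_def
    by (simp add: dd_add[OF pG SU z] dd_pair[OF ph(1) Gx(1) z] ph(2) Gx(2)[OF z] dd_mult[OF Sx(1) uh(1) z] uh(2) Sx(2)[OF z])
  have Xh: "holo_map Q (\<lambda>z. X z v)" for v unfolding holo_map_iff_chol
  proof
    fix k :: "'n + 'n option"
    show "chol Q (\<lambda>z. X z v $ k)"
    proof (cases k)
      case (Inr j)
      then show ?thesis by (cases j) (simp_all add: X_def mk_def pvc(1) qc)
    qed (simp add: X_def mk_def chol_const)
  qed
  have pX: "pair (pc (X z w)) a = pair (pc z) (\<Gamma> (xc z) w a) + S (xc z) w a * uc z" if z: "z \<in> Q" for z w a
  proof -
    define A where "A a = pair (pc z) (\<Gamma> (xc z) w a) + S (xc z) w a * uc z" for a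
    have "A a = (\<Sum>i\<in>UNIV. a $ i * A (axis i 1))"
      by (rule clinear_chol_basis) (simp_all add: A_def pair_linear conn_bilinear[OF G xQ(2)[OF z]] SL[OF xQ(2)[OF z]] algebra_simps)
    then show ?thesis unfolding pair_def[of "pc (X z w)"] by (simp add: A_def X_def q_def mult.commute)
  qed
  have comm: "Dmap (\<lambda>z. X z v) z (X z w) = Dmap (\<lambda>z. X z w) z (X z v)" if z: "z \<in> Q" for z v w
  proof -
    have x: "xc z \<in> U" by (rule xQ(2)[OF z])
    have I: "Dconn \<Gamma> (xc z) w v e + \<Gamma> (xc z) w (\<Gamma> (xc z) v e) + S (xc z) v e *s w = Dconn \<Gamma> (xc z) v w e + \<Gamma> (xc z) v (\<Gamma> (xc z) w e) + S (xc z) w e *s v"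
        "dd (\<lambda>y. S y v e) (xc z) w + S (xc z) w (\<Gamma> (xc z) v e) = dd (\<lambda>y. S y w e) (xc z) v + S (xc z) v (\<Gamma> (xc z) w e)"
        "S (xc z) w v = S (xc z) v w" for e
      using int[OF x] unfolding integrable_at_def S_def by blast+
    have "Dmap (\<lambda>z. X z v) z (X z w) $ k = Dmap (\<lambda>z. X z w) z (X z v) $ k" for k
    proof (cases k)
      case (Inl i)
      then show ?thesis unfolding Dmap_nth[OF Xh z] by (simp add: X_def mk_def dd_const)
    next
      case (Inr j)
      show ?thesis
      proof (cases j)
        case None
        have "Dmap (\<lambda>z. X z v) z W $ k = pair (pc W) v" for v W
          unfolding Dmap_nth[OF Xh z] using pvc(2)[OF z] by (simp add: X_def mk_def Inr None)
        then show ?thesis by (simp add: pX[OF z] Gs[OF x, of v w] I(3))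
      next
        case (Some i)
        have D: "Dmap (\<lambda>z. X z v) z (X z w) $ k = pair (pc z) (Dconn \<Gamma> (xc z) w v (axis i 1) + \<Gamma> (xc z) w (\<Gamma> (xc z) v (axis i 1)) + S (xc z) v (axis i 1) *s w)
           + uc z * (dd (\<lambda>y. S y v (axis i 1)) (xc z) w + S (xc z) w (\<Gamma> (xc z) v (axis i 1)))" for v w
        proof -
          have "xc (X z w) = w" "uc (X z w) = pair (pc z) w" by (simp_all add: X_def)
          moreover have "Dmap (\<lambda>z. X z v) z (X z w) $ k = dd (\<lambda>z. q z v i) z (X z w)"
            unfolding Dmap_nth[OF Xh z] by (simp add: X_def mk_def Inr Some)
          ultimately show ?thesis by (simp add: qD[OF z] pX[OF z] pair_linear algebra_simps)
        qed
        show ?thesis unfolding D I(1)[of "axis i 1"] I(2)[of "axis i 1"] ..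
      qed
    qed
    then show ?thesis by (simp add: vec_eq_iff)
  qed
  have idl: "Vector_Spaces.linear (*s) (*s) (\<lambda>x :: complex^'n. x)" by (simp add: clinear_iff)
  have z0: "mk m c p0 \<in> Q" using m by (simp add: Q_def)
  obtain r \<Psi> where r: "r > 0" and \<Psi>: "holo_map (ball (0 :: complex^'n) r) \<Psi>" "\<Psi> ` ball 0 r \<subseteq> Q"
    and \<Psi>0: "\<And>x. x \<in> ball 0 r \<Longrightarrow> x = 0 \<Longrightarrow> \<Psi> x = mk m c p0"
    and D\<Psi>: "\<And>x v. x \<in> ball 0 r \<Longrightarrow> v = v \<Longrightarrow> Dmap \<Psi> x v = X (\<Psi> x) v"
    by (rule frobenius[OF Q Xl Xh idl _ _ _ open_UNIV _ holo_map_const z0 comm]) auto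
  have 0: "(0::complex^'n) \<in> ball 0 r" using r by simp
  have x\<Psi>: "xc (\<Psi> x) = m + x" if x: "x \<in> ball 0 r" for x
  proof -
    have "\<Psi> x $ Inl i - x $ i = \<Psi> 0 $ Inl i - 0 $ i" for i
    proof (rule dd_zero_constant[OF open_ball convex_ball _ _ x 0])
      show "chol (ball 0 r) (\<lambda>x. \<Psi> x $ Inl i - x $ i)" by (intro chol_diff holo_map_chol[OF \<Psi>(1)] chol_nth)
      fix y v assume y: "y \<in> ball (0::complex^'n) r"
      have "Dmap \<Psi> y v $ Inl i = v $ i" using D\<Psi>[OF y, of v] by (simp add: X_def mk_def)
      then show "dd (\<lambda>x. \<Psi> x $ Inl i - x $ i) y v = 0"
        by (simp add: dd_diff[OF holo_map_chol[OF \<Psi>(1)] chol_nth y] dd_nth Dmap_nth[OF \<Psi>(1) y])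
    qed
    then show ?thesis using \<Psi>0[OF 0] by (simp add: xc_def vec_eq_iff mk_def algebra_simps)
  qed
  define B where "B = ball m r"
  have B: "open B" and mB: "m \<in> B" using r by (auto simp: B_def)
  have sh: "y - m \<in> ball 0 r" if "y \<in> B" for y using that by (simp add: B_def dist_norm norm_minus_commute)
  define s where "s y = \<Psi> (y - m)" for y
  have dh: "holo_map B (\<lambda>y. y - m)" "(\<lambda>y. y - m) ` B \<subseteq> ball 0 r" using sh by (auto intro: holo_map_diff holo_map_id holo_map_const simp del: mem_ball)
  have Ds: "Dmap (\<lambda>y. y - m) y v = v" for y v
    by (simp add: Dmap_eq[OF has_derivative_diff[OF has_derivative_ident has_derivative_const]])
  have sh': "holo_map B s" "y \<in> B \<Longrightarrow> Dmap s y v = X (s y) v" for y v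
    unfolding s_def using holo_map_compose[OF \<Psi>(1) dh] D\<Psi>[OF sh] by (auto simp: Ds)
  have sQ: "s y \<in> Q" "xc (s y) = y" if "y \<in> B" for y
    using \<Psi>(2) sh[OF that] x\<Psi>[OF sh[OF that]] by (auto simp: s_def)
  define u where "u y = uc (s y)" for y
  have uB: "chol B u" unfolding u_def uc_def by (rule holo_map_chol[OF sh'(1)])
  have du: "dd u y v = pair (pc (s y)) v" if y: "y \<in> B" for y v
  proof -
    have "dd u y v = uc (Dmap s y v)" unfolding u_def uc_def Dmap_nth[OF sh'(1) y] ..
    then show ?thesis by (simp add: sh'(2)[OF y] X_def)
  qed
  have d2u: "d2 u y w v = dd u y (\<Gamma> y v w) + S y v w * u y" if y: "y \<in> B" for y v w
  proof -
    have "d2 u y w v = dd (\<lambda>y. pair (pc (s y)) w) y v" unfolding d2_def by (subst dd_cong[OF B y du]) auto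
    also have "\<dots> = pair (pc (Dmap s y v)) w"
    proof -
      have h: "holo_map B (\<lambda>y. pc (s y))" "Dmap (\<lambda>y. pc (s y)) y v = pc (Dmap s y v)"
        using holo_map_compose[OF ph(1)[of UNIV] sh'(1)] y by (auto simp: ph(2))
      show ?thesis by (simp add: dd_pair[OF h(1) holo_map_const y] h(2) Dmap_const pair_linear)
    qed
    also have "\<dots> = pair (pc (s y)) (\<Gamma> y v w) + S y v w * u y"
      unfolding sh'(2)[OF y] pX[OF sQ(1)[OF y]] sQ(2)[OF y] u_def ..
    finally show ?thesis by (simp add: du[OF y])
  qed
  have sm: "s m = mk m c p0" using \<Psi>0[OF 0] by (simp add: s_def)
  have "B \<subseteq> U" using sQ xQ(2) by fastforce
  then show ?thesis
    using r uB du[OF mB] d2u by (intro exI[of _ r] conjI exI[of _ u]) (auto simp: B_def[symmetric] u_def sm S_def)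
qed

text \<open>In the flat model the solutions of the system are affine functions up to a common factor. Accordingly
\<open>n + 1\<close> solutions with independent initial data are homogeneous coordinates: their ratios \<open>w\<close> by the
one that does not vanish at \<open>m\<close> form a chart, and the Schouten term cancels in the quotients.\<close>

lemma flat_chart:
  fixes \<Gamma> :: "'n::finite conn"
  assumes U: "open U" and n: "CARD('n) \<ge> 2" and G: "affine_connection U \<Gamma>"
    and Gs: "\<And>x v w. x \<in> U \<Longrightarrow> \<Gamma> x v w = \<Gamma> x w v" and int: "\<And>x. x \<in> U \<Longrightarrow> integrable_at \<Gamma> x" and m: "m \<in> U"
  obtains V \<phi> where "m \<in> V" "V \<subseteq> U" "biholo V \<phi>"
    "\<And>x v. x \<in> V \<Longrightarrow> \<exists>l. Dmap \<phi> x (\<Gamma> x v v) = Dmap (\<lambda>y. Dmap \<phi> y v) x v + l *s Dmap \<phi> x v"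
proof -
  note sol = flat_solution[OF U n G Gs int m]
  have "\<forall>j. \<exists>r>0. \<exists>u. ball m r \<subseteq> U \<and> chol (ball m r) u \<and> u m = (if j = None then 1 else 0) \<and>
    (\<forall>v. dd u m v = pair (case j of None \<Rightarrow> 0 | Some i \<Rightarrow> axis i 1) v) \<and>
    (\<forall>y\<in>ball m r. \<forall>v w. d2 u y w v = dd u y (\<Gamma> y v w) + schouten \<Gamma> y v w * u y)"
    by (intro allI sol) auto
  then obtain \<rho> u where \<rho>: "\<And>j::'n option. \<rho> j > 0" "\<And>j. ball m (\<rho> j) \<subseteq> U" and u: "\<And>j. chol (ball m (\<rho> j)) (u j)"
    "\<And>j. u j m = (if j = None then 1 else 0)" "\<And>j v. dd (u j) m v = pair (case j of None \<Rightarrow> 0 | Some i \<Rightarrow> axis i 1) v"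
    "\<And>j y v w. y \<in> ball m (\<rho> j) \<Longrightarrow> d2 (u j) y w v = dd (u j) y (\<Gamma> y v w) + schouten \<Gamma> y v w * u j y"
    by metis
  define r where "r = Min (range \<rho>)"
  have r: "r > 0" "\<And>j. r \<le> \<rho> j" using \<rho>(1) by (auto simp: r_def)
  have br: "ball m r \<subseteq> ball m (\<rho> j)" for j using r(2)[of j] by auto
  define B where "B = ball m r \<inter> (\<lambda>y. u None y) -` (- {0})"
  have B: "open B" unfolding B_def
    by (rule continuous_open_preimage[OF chol_continuous_on[OF chol_subset[OF u(1) br]]]) auto
  have mB: "m \<in> B" using r u(2)[of None] by (simp add: B_def)
  have Bin: "y \<in> ball m (\<rho> j)" "u None y \<noteq> 0" if "y \<in> B" for y j using that br[of j] unfolding B_def by blast+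
  have uB: "chol B (u j)" for j by (rule chol_subset[OF u(1)]) (use Bin in blast)
  define w where "w k y = u (Some k) y / u None y" for k y
  have wB: "chol B (w k)" for k unfolding w_def[abs_def] by (intro chol_divide uB) (use Bin in blast)
  define \<phi> where "\<phi> y = (\<chi> k. w k y)" for y
  have \<phi>h: "holo_map B \<phi>" by (simp add: holo_map_iff_chol \<phi>_def wB)
  have uw: "u (Some k) y = w k y * u None y" if "y \<in> B" for k y using Bin(2)[OF that] by (simp add: w_def)
  have du: "dd (u (Some k)) y v = w k y * dd (u None) y v + dd (w k) y v * u None y" if y: "y \<in> B" for k y v
    by (subst dd_cong[OF B y uw]) (auto simp: dd_mult[OF wB uB y])
  have d2u: "d2 (u (Some k)) y v v = w k y * d2 (u None) y v v + 2 * (dd (w k) y v * dd (u None) y v) + d2 (w k) y v v * u None y" if y: "y \<in> B" for k y v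
  proof -
    note dc = dd_chol_and_symmetric(1)[OF B wB] dd_chol_and_symmetric(1)[OF B uB]
    have "d2 (u (Some k)) y v v = dd (\<lambda>y. w k y * dd (u None) y v + dd (w k) y v * u None y) y v"
      unfolding d2_def by (subst dd_cong[OF B y du]) auto
    also have "\<dots> = w k y * d2 (u None) y v v + dd (w k) y v * dd (u None) y v + (dd (w k) y v * dd (u None) y v + d2 (w k) y v v * u None y)"
      unfolding dd_add[OF chol_mult[OF wB dc(2)] chol_mult[OF dc(1) uB] y] dd_mult[OF wB dc(2) y] dd_mult[OF dc(1) uB y] d2_def ..
    finally show ?thesis by simp
  qed
  have key: "dd (w k) y (\<Gamma> y v v) = d2 (w k) y v v + (2 * dd (u None) y v / u None y) * dd (w k) y v" if y: "y \<in> B" for k y v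
  proof -
    have "d2 (u (Some k)) y v v = dd (u (Some k)) y (\<Gamma> y v v) + schouten \<Gamma> y v v * u (Some k) y" "d2 (u None) y v v = dd (u None) y (\<Gamma> y v v) + schouten \<Gamma> y v v * u None y"
      using u(4) Bin(1)[OF y] by auto
    then have "d2 (w k) y v v * u None y + 2 * (dd (w k) y v * dd (u None) y v) = dd (w k) y (\<Gamma> y v v) * u None y"
      by (simp add: du[OF y] d2u[OF y] uw[OF y] algebra_simps)
    then show ?thesis using Bin(2)[OF y] by (simp add: field_simps)
  qed
  have Dm: "Dmap \<phi> m v = v" for v
  proof -
    have "dd (w k) m v = v $ k" for k
      using du[OF mB, of k v] u(2)[of "Some k"] u(2)[of None] u(3)[of "Some k" v] u(3)[of None v] by (simp add: pair_axis pair_linear)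
    then show ?thesis by (simp add: vec_eq_iff Dmap_nth[OF \<phi>h mB] \<phi>_def)
  qed
  obtain V where V: "V \<subseteq> B" "m \<in> V" "biholo V \<phi>"
    by (rule holo_inverse_function[OF B \<phi>h mB]) (use Dm in auto)
  have "\<exists>l. Dmap \<phi> x (\<Gamma> x v v) = Dmap (\<lambda>y. Dmap \<phi> y v) x v + l *s Dmap \<phi> x v" if "x \<in> V" for x v
  proof -
    have x: "x \<in> B" using that V by blast
    show ?thesis
      by (rule exI[of _ "2 * dd (u None) x v / u None x"])
         (simp add: vec_eq_iff Dmap_nth[OF \<phi>h x] holo_map_Dmap(2)[OF B \<phi>h x] d2_def[symmetric], simp add: \<phi>_def key[OF x])
  qed
  moreover have "V \<subseteq> U" using V(1) Bin(1) \<rho>(2) by blast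
  ultimately show ?thesis using that[OF V(2) _ V(3)] by blast
qed

lemma integrable_imp_proj_flat:
  fixes \<Gamma> :: "'n::finite conn"
  assumes U: "open U" and n: "CARD('n) \<ge> 2" and G: "affine_connection U \<Gamma>"
    and Gs: "\<And>x v w. x \<in> U \<Longrightarrow> \<Gamma> x v w = \<Gamma> x w v" and int: "\<And>x. x \<in> U \<Longrightarrow> integrable_at \<Gamma> x"
  shows "proj_flat U (proj_class U \<Gamma>)"
  unfolding proj_flat_def
proof
  fix m assume m: "m \<in> U"
  show "\<exists>V \<phi>. m \<in> V \<and> V \<subseteq> U \<and> biholo V \<phi> \<and> proj_restrict V (proj_class U \<Gamma>) = proj_pullback V \<phi> (proj_class (\<phi> ` V) (\<lambda>x v w. 0))"
  proof (rule flat_chart[OF U n G Gs int m])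
    fix V \<phi> assume V: "m \<in> V" "V \<subseteq> U" "biholo V \<phi>"
      and l: "\<And>x v. x \<in> V \<Longrightarrow> \<exists>l. Dmap \<phi> x (\<Gamma> x v v) = Dmap (\<lambda>y. Dmap \<phi> y v) x v + l *s Dmap \<phi> x v"
    obtain \<psi> where \<psi>: "open V" "open (\<phi> ` V)" "holo_map V \<phi>" "holo_map (\<phi> ` V) \<psi>" "\<forall>x\<in>V. \<psi> (\<phi> x) = x"
      using V(3) unfolding biholo_def by blast
    obtain \<Gamma>0 where G0: "affine_connection V \<Gamma>0" "\<forall>x\<in>V. \<forall>v w. Dmap \<phi> x (\<Gamma>0 x v w) = Dmap (\<lambda>y. Dmap \<phi> y w) x v"
      using flat_pullback_exists[OF V(3)] by blast
    have p: "par V \<Gamma> \<Gamma>0" unfolding par_def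
    proof (intro ballI allI)
      fix x v assume x: "x \<in> V"
      obtain c where c: "Dmap \<phi> x (\<Gamma> x v v) = Dmap (\<lambda>y. Dmap \<phi> y v) x v + c *s Dmap \<phi> x v" using l[OF x] by blast
      then have "Dmap \<phi> x (\<Gamma> x v v - \<Gamma>0 x v v) = Dmap \<phi> x (c *s v)"
        using G0(2) x by (simp add: Dmap_linear[OF \<psi>(3) x] Dmap_scale[OF \<psi>(3) x])
      then have "\<Gamma> x v v - \<Gamma>0 x v v = c *s v" using biholo_Dmap(1)[OF \<psi> x] by metis
      then show "\<exists>l. \<Gamma> x v v - \<Gamma>0 x v v = l *s v" by blast
    qed
    have "par V \<Gamma> \<Gamma>' \<longleftrightarrow> par V \<Gamma>0 \<Gamma>'" for \<Gamma>' using p par_sym par_trans by blast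
    moreover have "proj_pullback V \<phi> (proj_class (\<phi> ` V) (\<lambda>x v w. 0)) = {\<Gamma>'. affine_connection V \<Gamma>' \<and> par V \<Gamma>0 \<Gamma>'}"
      by (rule proj_pullback_eq[OF V(3) G0(1)]) (use G0(2) in blast)
    ultimately have "proj_restrict V (proj_class U \<Gamma>) = proj_pullback V \<phi> (proj_class (\<phi> ` V) (\<lambda>x v w. 0))"
      using proj_restrict_eq[OF U G \<psi>(1) V(2)] by simp
    then show ?thesis using V by blast
  qed
qed

lemma proj_flat_chart:
  fixes \<Gamma> :: "'n::finite conn"
  assumes U: "open U" and G: "affine_connection U \<Gamma>" and f: "proj_flat U (proj_class U \<Gamma>)" and m: "m \<in> U"
  obtains V \<phi> \<Gamma>0 where "m \<in> V" "V \<subseteq> U" "biholo V \<phi>" "affine_connection V \<Gamma>0"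
    "\<And>x v w. x \<in> V \<Longrightarrow> Dmap \<phi> x (\<Gamma>0 x v w) = Dmap (\<lambda>y. Dmap \<phi> y w) x v" "par V \<Gamma> \<Gamma>0"
proof -
  obtain V \<phi> where V: "m \<in> V" "V \<subseteq> U" "biholo V \<phi>" "proj_restrict V (proj_class U \<Gamma>) = proj_pullback V \<phi> (proj_class (\<phi> ` V) (\<lambda>x v w. 0))"
    using f m unfolding proj_flat_def by blast
  obtain \<Gamma>0 where G0: "affine_connection V \<Gamma>0" "\<forall>x\<in>V. \<forall>v w. Dmap \<phi> x (\<Gamma>0 x v w) = Dmap (\<lambda>y. Dmap \<phi> y w) x v"
    using flat_pullback_exists[OF V(3)] by blast
  have oV: "open V" using V(3) by (simp add: biholo_def)
  have "par V \<Gamma>0 \<Gamma>0" unfolding par_def by (metis cancel_comm_monoid_add_class.diff_cancel vector_smult_lzero)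
  moreover have "proj_pullback V \<phi> (proj_class (\<phi> ` V) (\<lambda>x v w. 0)) = {\<Gamma>'. affine_connection V \<Gamma>' \<and> par V \<Gamma>0 \<Gamma>'}"
    by (rule proj_pullback_eq[OF V(3) G0(1)]) (use G0(2) in blast)
  ultimately have "\<Gamma>0 \<in> proj_restrict V (proj_class U \<Gamma>)" using V(4) G0(1) by simp
  then have "par V \<Gamma> \<Gamma>0" using proj_restrict_eq[OF U G oV V(2)] by simp
  then show ?thesis using that[OF V(1-3) G0(1)] G0(2) by blast
qed

section \<open>Linear webs and totally geodesic hyperplanes\<close>

subsection \<open>Transport by a biholomorphism\<close>

lemma d2_compose:
  assumes U: "open U" and V: "open V" and F: "chol V F" and \<phi>: "holo_map U \<phi>" "\<phi> ` U \<subseteq> V" and x: "x \<in> U"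
  shows "d2 (\<lambda>x. F (\<phi> x)) x v w = d2 F (\<phi> x) (Dmap \<phi> x v) (Dmap \<phi> x w) + dd F (\<phi> x) (Dmap (\<lambda>y. Dmap \<phi> y v) x w)"
proof -
  have \<phi>V: "\<phi> y \<in> V" if "y \<in> U" for y using that \<phi>(2) by blast
  have gF: "holo_map V (grad F)" by (rule grad_holo[OF V F])
  have g\<phi>: "holo_map U (\<lambda>y. grad F (\<phi> y))" "Dmap (\<lambda>y. grad F (\<phi> y)) x w = Dmap (grad F) (\<phi> x) (Dmap \<phi> x w)"
    using holo_map_compose[OF gF \<phi>] x by auto
  have D\<phi>: "holo_map U (\<lambda>y. Dmap \<phi> y v)" by (rule holo_map_Dmap(1)[OF U \<phi>(1)])
  have pg: "pair (Dmap (grad F) z u) u' = d2 F z u' u" if z: "z \<in> V" for z u u'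
  proof -
    have "d2 F z u' u = dd (\<lambda>y. pair (grad F y) u') z u"
      unfolding d2_def by (subst dd_cong[OF V z, of "\<lambda>y. dd F y u'" "\<lambda>y. pair (grad F y) u'"]) (simp_all add: pair_grad[OF F])
    then show ?thesis by (simp add: dd_pair[OF gF holo_map_const z] Dmap_const pair_linear)
  qed
  have "d2 (\<lambda>x. F (\<phi> x)) x v w = dd (\<lambda>y. pair (grad F (\<phi> y)) (Dmap \<phi> y v)) x w"
    unfolding d2_def
    by (subst dd_cong[OF U x, of "\<lambda>y. dd (\<lambda>x. F (\<phi> x)) y v" "\<lambda>y. pair (grad F (\<phi> y)) (Dmap \<phi> y v)"])
       (simp_all add: pair_grad[OF F \<phi>V] chol_compose(2)[OF F \<phi>])
  also have "\<dots> = pair (grad F (\<phi> x)) (Dmap (\<lambda>y. Dmap \<phi> y v) x w) + pair (Dmap (grad F) (\<phi> x) (Dmap \<phi> x w)) (Dmap \<phi> x v)"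
    unfolding dd_pair[OF g\<phi>(1) D\<phi> x] g\<phi>(2) ..
  finally show ?thesis by (simp add: pg[OF \<phi>V[OF x]] pair_grad[OF F \<phi>V[OF x]])
qed

text \<open>First integrals are transported by composition with the inverse chart. The second part is the
tensorial behaviour of the second fundamental form, for a connection that \<open>\<phi>\<close> carries to the
standard one at \<open>x\<close>.\<close>

lemma push_first_int:
  assumes V: "open V" "open (\<phi> ` V)" "holo_map V \<phi>" "holo_map (\<phi> ` V) \<psi>" "\<forall>x\<in>V. \<psi> (\<phi> x) = x"
    and f: "first_int B F f" and BV: "B \<subseteq> V"
  shows "first_int (\<phi> ` B) (push_hfield V \<phi> F) (\<lambda>y. f (\<psi> y))"
    and "x \<in> B \<Longrightarrow> (\<And>v. Dmap \<phi> x (\<Gamma> x v v) = Dmap (\<lambda>y. Dmap \<phi> y v) x v) \<Longrightarrow>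
      tgcond f \<Gamma> x \<longleftrightarrow> tgcond (\<lambda>y. f (\<psi> y)) (\<lambda>x v w. 0) (\<phi> x)"
proof -
  note B = first_intD(1)[OF f] and fh = first_intD(2)[OF f]
  have "\<phi> ` B = \<phi> ` V \<inter> \<psi> -` B" using V(5) BV by auto
  moreover have "open (\<phi> ` V \<inter> \<psi> -` B)" by (rule continuous_open_preimage[OF holo_map_continuous_on[OF V(4)] V(2) B])
  ultimately have oB: "open (\<phi> ` B)" by simp
  have \<psi>h: "holo_map (\<phi> ` B) \<psi>" by (rule holo_map_subset[OF V(4)]) (use BV in blast)
  have \<psi>B: "\<psi> ` \<phi> ` B \<subseteq> B" using V(5) BV by auto
  have Fh: "chol (\<phi> ` B) (\<lambda>y. f (\<psi> y))" by (rule chol_compose(1)[OF fh \<psi>h \<psi>B])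
  have \<psi>x: "\<psi> (\<phi> x) = x" if "x \<in> B" for x using that V(5) BV by blast
  have dF: "dd (\<lambda>y. f (\<psi> y)) (\<phi> x) w = dd f x (Dmap \<psi> (\<phi> x) w)" if "x \<in> B" for x w
    using chol_compose(2)[OF fh \<psi>h \<psi>B, of "\<phi> x"] that \<psi>x by simp
  have D: "Dmap \<psi> (\<phi> x) (Dmap \<phi> x v) = v" "Dmap \<phi> x (Dmap \<psi> (\<phi> x) w) = w" if "x \<in> B" for x v w
    using biholo_Dmap[OF V] that BV by blast+
  have push: "push_hfield V \<phi> F (\<phi> x) = {w. dd (\<lambda>y. f (\<psi> y)) (\<phi> x) w = 0}" if x: "x \<in> B" for x
  proof -
    have "{x'\<in>V. \<phi> x' = \<phi> x} = {x}" using x BV V(5) by (auto, metis subsetD)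
    then have p: "push_hfield V \<phi> F (\<phi> x) = Dmap \<phi> x ` F x" by (simp add: push_hfield_def)
    show ?thesis
    proof (intro equalityI subsetI)
      fix w assume "w \<in> push_hfield V \<phi> F (\<phi> x)"
      then obtain v where "v \<in> F x" "w = Dmap \<phi> x v" unfolding p by blast
      then show "w \<in> {w. dd (\<lambda>y. f (\<psi> y)) (\<phi> x) w = 0}" using first_intD(3)[OF f x] by (simp add: dF[OF x] D(1)[OF x])
    next
      fix w assume "w \<in> {w. dd (\<lambda>y. f (\<psi> y)) (\<phi> x) w = 0}"
      then have "Dmap \<psi> (\<phi> x) w \<in> F x" using first_intD(3)[OF f x] by (simp add: dF[OF x])
      then have "Dmap \<phi> x (Dmap \<psi> (\<phi> x) w) \<in> Dmap \<phi> x ` F x" by (rule imageI)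
      then show "w \<in> push_hfield V \<phi> F (\<phi> x)" unfolding p D(2)[OF x] .
    qed
  qed
  show "first_int (\<phi> ` B) (push_hfield V \<phi> F) (\<lambda>y. f (\<psi> y))"
    unfolding first_int_def
  proof (intro conjI ballI oB Fh)
    fix y assume "y \<in> \<phi> ` B"
    then obtain x where x: "x \<in> B" "y = \<phi> x" by blast
    obtain v where "dd f x v \<noteq> 0" using first_intD(4)[OF f x(1)] by blast
    then have "dd (\<lambda>y. f (\<psi> y)) y (Dmap \<phi> x v) \<noteq> 0" by (simp add: x dF D)
    then show "\<exists>v. dd (\<lambda>y. f (\<psi> y)) y v \<noteq> 0" by blast
    show "push_hfield V \<phi> F y = {v. dd (\<lambda>y. f (\<psi> y)) y v = 0}" using push x by simp
  qed
  show "tgcond f \<Gamma> x \<longleftrightarrow> tgcond (\<lambda>y. f (\<psi> y)) (\<lambda>x v w. 0) (\<phi> x)"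
    if x: "x \<in> B" and c: "\<And>v. Dmap \<phi> x (\<Gamma> x v v) = Dmap (\<lambda>y. Dmap \<phi> y v) x v"
  proof -
    have \<phi>h: "holo_map B \<phi>" by (rule holo_map_subset[OF V(3) BV])
    have yx: "\<phi> x \<in> \<phi> ` B" using x by blast
    have dd1: "dd f x v = dd (\<lambda>y. f (\<psi> y)) (\<phi> x) (Dmap \<phi> x v)" for v by (simp add: dF[OF x] D(1)[OF x])
    have ddF: "dd (\<lambda>x. f (\<psi> (\<phi> x))) y = dd f y" if "y \<in> B" for y using dd_cong[OF B that] \<psi>x by metis
    have "d2 f x v v = d2 (\<lambda>x. f (\<psi> (\<phi> x))) x v v" for v
      unfolding d2_def by (subst dd_cong[OF B x, of "\<lambda>y. dd (\<lambda>x. f (\<psi> (\<phi> x))) y v" "\<lambda>y. dd f y v"]) (simp_all add: ddF)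
    then have d2: "d2 f x v v = d2 (\<lambda>y. f (\<psi> y)) (\<phi> x) (Dmap \<phi> x v) (Dmap \<phi> x v) + dd f x (\<Gamma> x v v)" for v
      using d2_compose[OF B oB Fh \<phi>h order_refl x, of v v] by (simp add: dd1 c)
    have "dd (\<lambda>y. f (\<psi> y)) (\<phi> x) 0 = 0" by (rule chol_dd_linear(3)[OF Fh yx])
    then have "tgcond (\<lambda>y. f (\<psi> y)) (\<lambda>x v w. 0) (\<phi> x) \<longleftrightarrow>
      (\<forall>v. dd (\<lambda>y. f (\<psi> y)) (\<phi> x) (Dmap \<phi> x v) = 0 \<longrightarrow> d2 (\<lambda>y. f (\<psi> y)) (\<phi> x) (Dmap \<phi> x v) (Dmap \<phi> x v) = 0)"
      unfolding tgcond_def using D(2)[OF x] by metis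
    also have "\<dots> \<longleftrightarrow> tgcond f \<Gamma> x" by (simp add: tgcond_def d2 dd1[symmetric])
    finally show ?thesis by simp
  qed
qed

subsection \<open>Linear leaves are geodesic for the flat connection, and conversely\<close>

text \<open>The tangent spaces of the foliation along a leaf contained in a hyperplane are all parallel to that hyperplane, so the
derivative of \<open>f\<close> in a direction of the hyperplane is zero on a line inside the leaf.\<close>

lemma linear_leaf_tgcond:
  assumes sc: "\<And>y v r. y \<in> U \<Longrightarrow> v \<in> F y \<Longrightarrow> r *\<^sub>R v \<in> F y" and f: "first_int B F f" and BU: "B \<subseteq> U" and y: "y \<in> B"
    and H: "affine_hyperplane H" "openin (top_of_set H) (leaf U F y)"
  shows "tgcond f (\<lambda>x v w. 0) y"
proof -
  note B = first_intD(1)[OF f] and fh = first_intD(2)[OF f]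
  obtain a c where a: "a \<noteq> 0" "H = {z. pair a z = c}" using H(1) unfolding affine_hyperplane_def by blast
  obtain T where T: "open T" "leaf U F y = H \<inter> T" using H(2) openin_open by blast
  have yl: "y \<in> leaf U F y" using leaf_refl[of y U F] BU y first_int_zero[OF f y] by blast
  have pa: "chol UNIV (pair a)" "dd (pair a) z v = pair a v" for z v
    using chol_pair[OF holo_map_const holo_map_id, of UNIV a] dd_pair[OF holo_map_const holo_map_id, of z UNIV a v]
    by (simp_all add: Dmap_const pair_linear Dmap_eq[OF has_derivative_ident])
  have 1: "pair a v = 0" if q: "q \<in> leaf U F y" "q \<in> B" and v: "v \<in> F q" for q v
  proof -
    obtain N where N: "q \<in> N" "N \<subseteq> B" "\<forall>y\<in>N. \<forall>v\<in>F y. \<exists>\<gamma> \<delta>. \<delta> > 0 \<and> (\<forall>t\<in>{-\<delta><..<\<delta>}. \<gamma> t \<in> leaf N F y) \<and> \<gamma> 0 = y \<and> (\<gamma> has_vector_derivative v) (at (0::real))"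
      using plaque_connected[OF f q(2)] by (elim exE conjE)
    from N(3)[rule_format, OF N(1) v]
    obtain \<gamma> \<delta> where \<gamma>: "\<delta> > 0" "\<forall>t\<in>{-\<delta><..<\<delta>}. \<gamma> t \<in> leaf N F q" "\<gamma> 0 = q" "(\<gamma> has_vector_derivative v) (at (0::real))"
      by (elim exE conjE)
    have NU: "N \<subseteq> U" using N(2) BU by blast
    have eq: "pair a (\<gamma> t) = c" if t: "t \<in> {-\<delta><..<\<delta>}" for t
    proof -
      have "\<gamma> t \<in> leaf U F q" using \<gamma>(2) t leaf_mono[OF NU] by blast
      from leaf_trans[where U = U and F = F, OF _ q(1) this] have "\<gamma> t \<in> leaf U F y" using sc by blast
      then show ?thesis using T(2) a(2) by blast
    qed
    have d1: "((\<lambda>t. pair a (\<gamma> t)) has_vector_derivative dd (pair a) (\<gamma> 0) v) (at 0)"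
      by (rule has_vector_derivative_chol[OF \<gamma>(4) pa(1)]) simp
    have d2: "((\<lambda>t. pair a (\<gamma> t)) has_vector_derivative 0) (at 0)"
      by (rule has_vector_derivative_transform_within_open[OF has_vector_derivative_const[of c], of "{-\<delta><..<\<delta>}"]) (use \<gamma>(1) eq in auto)
    show ?thesis using vector_derivative_unique_at[OF d1 d2] by (simp add: pa(2))
  qed
  have 2: "dd f q w = 0" if q: "q \<in> leaf U F y" "q \<in> B" and w: "pair a w = 0" for q w
  proof -
    obtain u where u: "dd f q u \<noteq> 0" using first_intD(4)[OF f q(2)] by blast
    have k: "pair a v = (dd f q v / dd f q u) * pair a u" for v
    proof -
      have "dd f q (v - (dd f q v / dd f q u) *s u) = 0" using u by (simp add: chol_dd_linear[OF fh q(2)] chol_dd_scale[OF fh q(2)])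
      then have "pair a (v - (dd f q v / dd f q u) *s u) = 0" using 1[OF q] first_intD(3)[OF f q(2)] by blast
      then show ?thesis by (simp add: pair_linear)
    qed
    have "pair a u \<noteq> 0" using k pair_eq_0[of a] a(1) by force
    then show ?thesis using k[of w] w u by simp
  qed
  show ?thesis unfolding tgcond_def
  proof (intro allI impI)
    fix w assume w: "dd f y w = 0"
    then have aw: "pair a w = 0" using 1[OF yl y] first_intD(3)[OF f y] by blast
    have ya: "pair a y = c" "y \<in> T" using yl T(2) a(2) by auto
    define S where "S = {\<zeta>. y + \<zeta> *s w \<in> T \<inter> B}"
    have S: "open S" "0 \<in> S" unfolding S_def using open_line[OF open_Int[OF T(1) B], of y w] ya(2) y by auto
    have z: "dd f (y + \<zeta> *s w) w = 0" if "\<zeta> \<in> S" for \<zeta>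
    proof (rule 2[OF _ _ aw])
      show "y + \<zeta> *s w \<in> B" using that by (simp add: S_def)
      show "y + \<zeta> *s w \<in> leaf U F y" using that by (simp add: T(2) a(2) S_def pair_linear aw ya)
    qed
    have "((\<lambda>\<zeta>. dd f (y + \<zeta> *s w) w) has_field_derivative dd (\<lambda>x. dd f x w) (y + 0 *s w) w) (at 0)"
      by (rule chol_line_deriv[OF dd_chol_and_symmetric(1)[OF B fh]]) (simp add: y)
    moreover have "((\<lambda>\<zeta>. dd f (y + \<zeta> *s w) w) has_field_derivative 0) (at 0)"
      by (rule has_field_derivative_transform_within_open[OF _ S, of "\<lambda>_. 0"]) (simp_all add: z)
    ultimately have "dd (\<lambda>x. dd f x w) (y + 0 *s w) w = 0" by (rule DERIV_unique)
    then show "d2 f y w w = dd f y 0" by (simp add: d2_def chol_dd_linear[OF fh y])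
  qed
qed

text \<open>The tangent hyperplane is parallel along a segment that starts in a tangent direction. For a vector \<open>w\<close> put
\<open>h w = dd f (\<gamma>) w\<close> along the segment \<open>\<gamma>\<close>, and decompose \<open>w\<close> into a tangential part and \<open>h w\<close> times a transversal
vector \<open>e\<close>. Since the Hessian of \<open>f\<close> vanishes on tangential vectors, \<open>h w\<close> satisfies a homogeneous linear
differential equation, for \<open>w = v\<close> first and then, with \<open>v\<close> known to remain tangent, for every
tangential \<open>w\<close>.\<close>

lemma parallel_subset:
  assumes f: "first_int B F f" and B: "convex B" and t: "\<And>y. y \<in> B \<Longrightarrow> tgcond f (\<lambda>x v w. 0) y"
    and x: "x \<in> B" "x + v \<in> B" and v: "v \<in> F x"
  shows "F x \<subseteq> F (x + v)"
proof
  fix w assume w: "w \<in> F x"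
  note oB = first_intD(1)[OF f] and fh = first_intD(2)[OF f]
  define \<gamma> where "\<gamma> s = x + s *\<^sub>R v" for s
  have \<gamma>B: "\<gamma> s \<in> B" if "s \<in> {0..1}" for s
    using convexD[OF B x, of "1 - s" s] that by (simp add: \<gamma>_def algebra_simps)
  have c\<gamma>: "continuous_on {0..1} \<gamma>" "\<gamma> ` {0..1} \<subseteq> B" using \<gamma>B by (auto simp: \<gamma>_def intro!: continuous_intros)
  have d\<gamma>: "(\<gamma> has_vector_derivative v) (at s within {0..1})" for s unfolding \<gamma>_def by (auto intro!: derivative_eq_intros)
  define a where "a k s = dd f (\<gamma> s) (axis k 1)" for k s
  have ca: "continuous_on {0..1} (a k)" for k unfolding a_def by (rule dd_continuous_on[OF oB fh c\<gamma> continuous_on_const])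
  define n where "n s = (\<Sum>k\<in>UNIV. a k s * cnj (a k s))" for s
  have n0: "n s \<noteq> 0" if s: "s \<in> {0..1}" for s
  proof
    assume "n s = 0"
    moreover have "n s = complex_of_real (\<Sum>k\<in>UNIV. (norm (a k s))\<^sup>2)"
      unfolding n_def of_real_sum by (rule sum.cong[OF refl]) (rule complex_norm_square[symmetric])
    ultimately have "(\<Sum>k\<in>UNIV. (norm (a k s))\<^sup>2) = 0" using of_real_eq_0_iff by metis
    then have a0: "a k s = 0" for k by (simp add: sum_nonneg_eq_0_iff)
    have "dd f (\<gamma> s) u = 0" for u unfolding dd_expand[OF fh \<gamma>B[OF s], of u] a_def[symmetric] a0 by simp
    then show False using first_intD(4)[OF f \<gamma>B[OF s]] by blast
  qed
  \<comment> \<open>the conjugate gradient, normalized: a transversal vector that depends continuously on s\<close>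
  define e :: "real \<Rightarrow> complex^'a" where "e s = (\<chi> k. cnj (a k s) / n s)" for s
  have ce: "continuous_on {0..1} e" unfolding e_def n_def
    by (intro continuous_on_vec_lambda continuous_on_divide continuous_on_cnj ca continuous_on_sum continuous_on_mult) (use n0 in \<open>auto simp: n_def\<close>)
  have e1: "dd f (\<gamma> s) (e s) = 1" if s: "s \<in> {0..1}" for s
  proof -
    have "dd f (\<gamma> s) (e s) = (\<Sum>k\<in>UNIV. a k s * cnj (a k s)) / n s"
      unfolding dd_expand[OF fh \<gamma>B[OF s], of "e s"] by (simp add: e_def a_def sum_divide_distrib mult.commute)
    then show ?thesis using n0[OF s] by (simp add: n_def)
  qed
  define h where "h u s = dd f (\<gamma> s) u" for u s
  have ch: "continuous_on {0..1} (h u)" for u unfolding h_def by (rule dd_continuous_on[OF oB fh c\<gamma> continuous_on_const])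
  have dh: "(h u has_vector_derivative d2 f (\<gamma> s) u v) (at s within {0..1})" if s: "s \<in> {0..1}" for u s
    unfolding h_def d2_def by (rule has_vector_derivative_chol[OF d\<gamma> dd_chol_and_symmetric(1)[OF oB fh] \<gamma>B[OF s]])
  have dec: "dd f (\<gamma> s) (u - h u s *s e s) = 0" if s: "s \<in> {0..1}" for u s
    by (simp add: chol_dd_linear[OF fh \<gamma>B[OF s]] chol_dd_scale[OF fh \<gamma>B[OF s]] e1[OF s], simp add: h_def)
  have d20: "d2 f (\<gamma> s) u u = 0" if "s \<in> {0..1}" "dd f (\<gamma> s) u = 0" for s u
    using t[OF \<gamma>B[OF that(1)]] that(2) chol_dd_linear(3)[OF fh \<gamma>B[OF that(1)]] by (simp add: tgcond_def)
  have zero: "h u s = 0" if u: "h u 0 = 0" and \<mu>: "continuous_on {0..1} \<mu>" "\<And>s. s \<in> {0..1} \<Longrightarrow> d2 f (\<gamma> s) u v = h u s * \<mu> s" and s: "s \<in> {0..1}" for u \<mu> s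
  proof -
    have "compact (\<mu> ` {0..1})" using \<mu>(1) by (intro compact_continuous_image) auto
    then obtain C where C: "\<forall>y\<in>\<mu> ` {0..1}. norm y \<le> C" using compact_imp_bounded bounded_iff by metis
    show ?thesis
    proof (rule gronwall_zero[where C = C, OF dh _ u s])
      fix r :: real assume r: "r \<in> {0..1}"
      have "norm (\<mu> r) \<le> C" using C r by blast
      from mult_right_mono[OF this norm_ge_zero[of "h u r"]]
      show "norm (d2 f (\<gamma> r) u v) \<le> C * norm (h u r)" unfolding \<mu>(2)[OF r] norm_mult
        by (simp only: mult.commute[of "norm (h u r)"])
    qed
  qed
  have \<gamma>0: "\<gamma> 0 = x" and \<gamma>1: "\<gamma> 1 = x + v" by (simp_all add: \<gamma>_def)
  have h0: "h u 0 = 0" if "u \<in> F x" for u using first_intD(3)[OF f x(1)] that by (simp add: h_def \<gamma>0)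
  have hv: "h v s = 0" if s: "s \<in> {0..1}" for s
  proof (rule zero[OF h0[OF v] _ _ s])
    define \<mu> where "\<mu> s = d2 f (\<gamma> s) (v - h v s *s e s) (e s) + d2 f (\<gamma> s) (e s) (v - h v s *s e s) + h v s * d2 f (\<gamma> s) (e s) (e s)" for s
    have cs: "continuous_on {0..1} (\<lambda>s. h v s *s e s)" unfolding vector_scalar_mult_def
      by (intro continuous_on_vec_lambda continuous_on_mult ch continuous_on_component ce)
    show "continuous_on {0..1} \<mu>" unfolding \<mu>_def
      by (intro continuous_on_add continuous_on_mult ch d2_continuous[OF oB fh c\<gamma>] ce continuous_on_diff continuous_on_const cs)
    fix s :: real assume s: "s \<in> {0..1}"
    note bl = d2_bilinear[OF oB fh \<gamma>B[OF s]]
    define w0 where "w0 = v - h v s *s e s"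
    have w0: "d2 f (\<gamma> s) w0 w0 = 0" unfolding w0_def by (rule d20[OF s dec[OF s]])
    have "d2 f (\<gamma> s) v v = d2 f (\<gamma> s) (w0 + h v s *s e s) (w0 + h v s *s e s)" by (simp add: w0_def)
    also have "\<dots> = h v s * \<mu> s" unfolding \<mu>_def w0_def[symmetric] by (simp add: bl w0 algebra_simps)
    finally show "d2 f (\<gamma> s) v v = h v s * \<mu> s" .
  qed
  have "h w 1 = 0"
  proof (rule zero[OF h0[OF w]])
    show "continuous_on {0..1} (\<lambda>s. d2 f (\<gamma> s) (e s) v)" by (rule d2_continuous[OF oB fh c\<gamma> ce continuous_on_const])
    fix s :: real assume s: "s \<in> {0..1}"
    note bl = d2_bilinear[OF oB fh \<gamma>B[OF s]]
    define w1 where "w1 = w - h w s *s e s"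
    have k: "dd f (\<gamma> s) w1 = 0" "dd f (\<gamma> s) v = 0" using dec[OF s] hv[OF s] by (simp_all add: w1_def h_def)
    then have "dd f (\<gamma> s) (w1 + v) = 0" by (simp add: chol_dd_linear[OF fh \<gamma>B[OF s]])
    from d20[OF s this] d20[OF s k(1)] d20[OF s k(2)] have "d2 f (\<gamma> s) w1 v + d2 f (\<gamma> s) v w1 = 0" by (simp add: bl add.commute)
    then have 0: "d2 f (\<gamma> s) w1 v = 0" using d2_sym[OF oB fh \<gamma>B[OF s], of v w1] by simp
    have "d2 f (\<gamma> s) w v = d2 f (\<gamma> s) (w1 + h w s *s e s) v" by (simp add: w1_def)
    also have "\<dots> = h w s * d2 f (\<gamma> s) (e s) v" unfolding bl 0 by simp
    finally show "d2 f (\<gamma> s) w v = h w s * d2 f (\<gamma> s) (e s) v" .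
  qed simp
  then show "w \<in> F (x + v)" using first_intD(3)[OF f x(2)] by (simp add: h_def \<gamma>1)
qed

lemma parallel_local:
  assumes f: "first_int B F f" and B: "convex B" and t: "\<And>y. y \<in> B \<Longrightarrow> tgcond f (\<lambda>x v w. 0) y"
    and x: "x \<in> B" "x + v \<in> B" and v: "v \<in> F x"
  shows "F (x + v) = F x"
proof
  show 1: "F x \<subseteq> F (x + v)" by (rule parallel_subset[OF assms])
  then have "- v \<in> F (x + v)" using v first_int_scale[OF f x(2), of v "-1"] by (auto simp: vector_sneg_minus1[symmetric])
  then have "F (x + v) \<subseteq> F (x + v + - v)" by (intro parallel_subset[OF f B t]) (use x in auto)
  then show "F (x + v) \<subseteq> F x" by simp
qed

lemma segment_tpath:
  assumes "\<And>t. t \<in> {0..1} \<Longrightarrow> p + t *\<^sub>R k \<in> U" "\<And>t. t \<in> {0..1} \<Longrightarrow> k \<in> F (p + t *\<^sub>R k)"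
  shows "tpath U F (\<lambda>t. p + t *\<^sub>R k)"
  by (rule tpath_smooth[where D = "\<lambda>_. k"]) (use assms in \<open>auto intro!: derivative_eq_intros\<close>)

text \<open>A point \<open>y\<close> near \<open>x\<close> is moved along the transversal vector \<open>e\<close> into the hyperplane through \<open>x\<close>, where \<open>f\<close> has the value
\<open>f x\<close> by the parallelism of the tangent spaces. If \<open>f y = f x\<close>, the chart \<open>\<kappa>\<close>, which only
records \<open>f\<close> along \<open>e\<close>, does not distinguish the two points, so nothing was moved.\<close>

lemma plaque_flat:
  assumes f: "first_int B F f" and B: "convex B" and t: "\<And>y. y \<in> B \<Longrightarrow> tgcond f (\<lambda>x v w. 0) y" and x: "x \<in> B"
  shows "\<exists>N. open N \<and> x \<in> N \<and> N \<subseteq> B \<and> (\<forall>y\<in>N. f y = f x \<longrightarrow> y - x \<in> F x)"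
proof -
  note fh = first_intD(2)[OF f]
  obtain M \<kappa> \<psi> e \<rho> where M: "open M" "x \<in> M" "M \<subseteq> B" "\<And>y. y \<in> M \<Longrightarrow> \<psi> (\<kappa> y) = y"
    "\<And>y. \<kappa> y = y + (f y - dd f x y) *s e" "dd f x e = 1"
    by (rule straight_chart[OF f x]) blast
  define \<zeta> where "\<zeta> y = y - dd f x (y - x) *s e" for y
  have \<zeta>h: "holo_map UNIV \<zeta>"
  proof -
    have "holo_map UNIV (\<lambda>y. y - pair (grad f x) (y - x) *s e)"
      by (intro holo_map_diff holo_map_scale chol_pair holo_map_id holo_map_const)
    then show ?thesis unfolding \<zeta>_def pair_grad[OF fh x] .
  qed
  define N where "N = M \<inter> \<zeta> -` M"
  have "open N" unfolding N_def
    by (rule continuous_open_preimage[OF continuous_on_subset[OF holo_map_continuous_on[OF \<zeta>h]] M(1) M(1)]) simp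
  moreover have "x \<in> N" using M(2) by (simp add: N_def \<zeta>_def chol_dd_linear[OF fh x])
  moreover have "y - x \<in> F x" if y: "y \<in> N" "f y = f x" for y
  proof -
    define z where "z = \<zeta> y"
    define k where "k = z - x"
    have zM: "z \<in> M" "y \<in> M" using y(1) by (auto simp: N_def z_def)
    have "dd f x k = 0" by (simp add: k_def z_def \<zeta>_def chol_dd_linear[OF fh x] chol_dd_scale[OF fh x] M(6))
    then have k: "k \<in> F x" using first_intD(3)[OF f x] by blast
    have seg: "x + s *\<^sub>R k \<in> B" if "s \<in> {0..1}" for s
      using convexD[OF B x subsetD[OF M(3) zM(1)], of "1 - s" s] that by (simp add: k_def algebra_simps)
    have par: "F (x + s *\<^sub>R k) = F x" if "s \<in> {0..1}" for s
      by (rule parallel_local[OF f B t x seg[OF that]]) (use first_int_scale[OF f x k] in \<open>auto simp: scaleR_eq_scale\<close>)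
    have tp: "tpath B F (\<lambda>s. x + s *\<^sub>R k)" by (rule segment_tpath) (use seg par k in auto)
    have "f (x + 1 *\<^sub>R k) = f (x + 0 *\<^sub>R k)"
      by (rule tpath_first_int[OF tp f, of 0 1 1]) (use seg in auto)
    then have fz: "f z = f y" using y(2) by (simp add: k_def)
    have dz: "dd f x z = dd f x y - dd f x (y - x)" unfolding z_def \<zeta>_def by (simp add: chol_dd_linear[OF fh x] chol_dd_scale[OF fh x] M(6))
    have "\<kappa> z = \<kappa> y" unfolding M(5) fz dz unfolding z_def \<zeta>_def by (simp add: vec_eq_iff algebra_simps)
    from arg_cong[OF this, of \<psi>] have "z = y" unfolding M(4)[OF zM(1)] M(4)[OF zM(2)] .
    then show ?thesis using k by (simp add: k_def)
  qed
  moreover have "N \<subseteq> B" using M(3) by (auto simp: N_def)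
  ultimately show ?thesis by blast
qed

text \<open>The tangent hyperplane at \<open>p\<close> stays parallel on the slice of \<open>b\<close> by the affine hyperplane through \<open>p\<close>, and
this slice is the whole leaf: it is connected by segments, and along any tangential path the property of lying in it is
locally constant.\<close>

lemma linear_leaf:
  fixes F :: "complex^'n \<Rightarrow> (complex^'n) set"
  assumes b: "open b" "convex b"
    and loc: "\<And>x. x \<in> b \<Longrightarrow> \<exists>r f. r > 0 \<and> ball x r \<subseteq> b \<and> first_int (ball x r) F f \<and> (\<forall>y\<in>ball x r. tgcond f (\<lambda>x v w. 0) y)"
    and p: "p \<in> b"
  shows "\<exists>H. affine_hyperplane H \<and> openin (top_of_set H) (leaf b F p)"
proof -
  have seg: "x + t *\<^sub>R k \<in> b" if "x \<in> b" "x + k \<in> b" "t \<in> {0..1}" for x k t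
    using convexD[OF b(2) that(1,2), of "1 - t" t] that(3) by (simp add: algebra_simps)
  have lin: "v + w \<in> F x" "v - w \<in> F x" "r *\<^sub>R v \<in> F x" if x: "x \<in> b" "v \<in> F x" "w \<in> F x" for x v w r
  proof -
    obtain \<rho> f where f: "\<rho> > 0" "first_int (ball x \<rho>) F f" using loc[OF x(1)] by blast
    then have xx: "x \<in> ball x \<rho>" by simp
    note D = first_intD(3)[OF f(2) xx] and L = chol_dd_linear[OF first_intD(2)[OF f(2)] xx]
    show "v + w \<in> F x" "v - w \<in> F x" "r *\<^sub>R v \<in> F x" using x(2,3) by (simp_all add: D L)
  qed
  \<comment> \<open>the local parallelism propagates along segments of arbitrary length in b\<close>
  have glob: "F (x + k) = F x" if x: "x \<in> b" "x + k \<in> b" "k \<in> F x" for x k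
  proof -
    define A where "A t \<longleftrightarrow> F (x + t *\<^sub>R k) = F x" for t
    have "A 1 = A 0"
    proof (rule unit_interval_const)
      fix t :: real assume t: "t \<in> {0..1}"
      obtain r f where r: "r > 0" "first_int (ball (x + t *\<^sub>R k) r) F f" "\<forall>y\<in>ball (x + t *\<^sub>R k) r. tgcond f (\<lambda>x v w. 0) y"
        using loc[OF seg[OF x(1,2) t]] by blast
      have "continuous_on {0..1} (\<lambda>t. x + t *\<^sub>R k)" by (intro continuous_intros)
      from path_near[OF this open_ball t, of "x + t *\<^sub>R k" r] r(1)
      obtain \<delta> where \<delta>: "\<delta> > 0" "\<forall>s\<in>{0..1}. \<bar>s - t\<bar> < \<delta> \<longrightarrow> (\<lambda>t. x + t *\<^sub>R k) ` {min s t..max s t} \<subseteq> ball (x + t *\<^sub>R k) r" by auto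
      have "A s = A t" if s: "s \<in> {0..1}" "\<bar>s - t\<bar> < \<delta>" for s
      proof -
        have sb: "x + s *\<^sub>R k \<in> ball (x + t *\<^sub>R k) r" using \<delta>(2)[rule_format, OF s] by (auto simp: image_subset_iff)
        have tb: "x + t *\<^sub>R k \<in> ball (x + t *\<^sub>R k) r" using r(1) by simp
        have *: "F (x + s' *\<^sub>R k) = F (x + t' *\<^sub>R k)"
          if "x + s' *\<^sub>R k \<in> ball (x + t *\<^sub>R k) r" "x + t' *\<^sub>R k \<in> ball (x + t *\<^sub>R k) r" "F (x + t' *\<^sub>R k) = F x" for s' t'
        proof -
          have e: "x + s' *\<^sub>R k = x + t' *\<^sub>R k + (s' - t') *\<^sub>R k" by (simp add: algebra_simps)
          have "F (x + t' *\<^sub>R k + (s' - t') *\<^sub>R k) = F (x + t' *\<^sub>R k)"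
          proof (rule parallel_local[OF r(2) convex_ball])
            show "tgcond f (\<lambda>x v w. 0) y" if "y \<in> ball (x + t *\<^sub>R k) r" for y using r(3) that by blast
            show "x + t' *\<^sub>R k \<in> ball (x + t *\<^sub>R k) r" by (rule that(2))
            show "x + t' *\<^sub>R k + (s' - t') *\<^sub>R k \<in> ball (x + t *\<^sub>R k) r" using that(1) unfolding e .
            show "(s' - t') *\<^sub>R k \<in> F (x + t' *\<^sub>R k)" unfolding that(3) by (rule lin(3)[OF x(1,3,3)])
          qed
          then show ?thesis unfolding e .
        qed
        show ?thesis unfolding A_def using *[OF sb tb] *[OF tb sb] by metis
      qed
      then show "\<exists>\<delta>>0. \<forall>s\<in>{0..1}. \<bar>s - t\<bar> < \<delta> \<longrightarrow> A s = A t" using \<delta>(1) by blast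
    qed
    then show ?thesis by (simp add: A_def)
  qed
  have leaf: "leaf b F p = {q \<in> b. q - p \<in> F p}"
  proof (intro equalityI subsetI)
    fix q assume "q \<in> {q \<in> b. q - p \<in> F p}"
    then have q: "q \<in> b" "q - p \<in> F p" by auto
    have sb: "p + t *\<^sub>R (q - p) \<in> b" if "t \<in> {0..1}" for t using seg[OF p _ that, of "q - p"] q(1) by simp
    have "tpath b F (\<lambda>t. p + t *\<^sub>R (q - p))"
    proof (rule segment_tpath[OF sb])
      fix t :: real assume t: "t \<in> {0..1}"
      show "q - p \<in> F (p + t *\<^sub>R (q - p))" unfolding glob[OF p sb[OF t] lin(3)[OF p q(2,2)]] by (rule q(2))
    qed
    then show "q \<in> leaf b F p" unfolding leaf_iff
      by (intro exI[of _ "\<lambda>t. p + t *\<^sub>R (q - p)"]) (simp add: pathstart_def pathfinish_def)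
  next
    fix q assume "q \<in> leaf b F p"
    then obtain g where g: "tpath b F g" "pathstart g = p" "pathfinish g = q" using leaf_iff by metis
    have gb: "g t \<in> b" if "t \<in> {0..1}" for t using g(1) that unfolding tpath_def path_image_def by blast
    have "(g 1 - p \<in> F p) = (g 0 - p \<in> F p)"
    proof (rule unit_interval_const)
      fix t :: real assume t: "t \<in> {0..1}"
      define x where "x = g t"
      have xb: "x \<in> b" using gb[OF t] by (simp add: x_def)
      obtain r f where r: "r > 0" "ball x r \<subseteq> b" "first_int (ball x r) F f" "\<And>y. y \<in> ball x r \<Longrightarrow> tgcond f (\<lambda>x v w. 0) y"
        using loc[OF xb] by blast
      have xx: "x \<in> ball x r" using r(1) by simp
      have "\<exists>N. open N \<and> x \<in> N \<and> N \<subseteq> ball x r \<and> (\<forall>y\<in>N. f y = f x \<longrightarrow> y - x \<in> F x)"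
        by (rule plaque_flat[OF r(3) convex_ball r(4) xx])
      then obtain N where N: "open N" "x \<in> N" "N \<subseteq> ball x r" "\<forall>y\<in>N. f y = f x \<longrightarrow> y - x \<in> F x" by blast
      obtain \<delta> where \<delta>: "\<delta> > 0" "\<forall>s\<in>{0..1}. \<bar>s - t\<bar> < \<delta> \<longrightarrow> g ` {min s t..max s t} \<subseteq> N"
        using path_near[OF tpath_continuous[OF g(1)] N(1) t] N(2) unfolding x_def by blast
      have "(g s - p \<in> F p) = (g t - p \<in> F p)" if s: "s \<in> {0..1}" "\<bar>s - t\<bar> < \<delta>" for s
      proof -
        have sub: "g ` {min s t..max s t} \<subseteq> N" using \<delta>(2) s by blast
        then have gs: "g s \<in> N" by (auto simp: image_subset_iff)
        have sub': "g ` {min s t..max s t} \<subseteq> ball x r" using sub N(3) by blast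
        have eq1: "f (g u) = f (g (min s t))" if "u \<in> {min s t..max s t}" for u
          by (rule tpath_first_int[OF g(1) r(3) _ _ sub' that]) (use s t in auto)
        have "f (g s) = f x" using eq1[of s] eq1[of t] by (simp add: x_def)
        then have d: "g s - x \<in> F x" using N(4) gs by blast
        have sb: "g s \<in> b" by (rule gb[OF s(1)])
        have Fs: "F (g s) = F x" using glob[OF xb _ d] sb by simp
        show ?thesis
        proof
          assume a: "g s - p \<in> F p"
          then have "F (g s) = F p" using glob[OF p, of "g s - p"] sb by simp
          then have "g s - x \<in> F p" using d Fs by simp
          from lin(2)[OF p a this] show "g t - p \<in> F p" by (simp add: x_def)
        next
          assume a: "g t - p \<in> F p"
          then have "F x = F p" using glob[OF p, of "x - p"] xb by (simp add: x_def)
          then have "g s - x \<in> F p" using d by simp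
          from lin(1)[OF p a this] show "g s - p \<in> F p" by (simp add: x_def)
        qed
      qed
      then show "\<exists>\<delta>>0. \<forall>s\<in>{0..1}. \<bar>s - t\<bar> < \<delta> \<longrightarrow> (g s - p \<in> F p) = (g t - p \<in> F p)" using \<delta>(1) by blast
    qed
    moreover have "g 0 - p \<in> F p"
    proof -
      obtain \<rho> f where f: "\<rho> > 0" "first_int (ball p \<rho>) F f" using loc[OF p] by blast
      then have "0 \<in> F p" using first_int_zero[OF f(2)] by simp
      then show ?thesis using g(2) by (simp add: pathstart_def)
    qed
    ultimately show "q \<in> {q \<in> b. q - p \<in> F p}" using g(3) gb[of 1] by (simp add: pathfinish_def)
  qed
  obtain \<rho> f where f: "\<rho> > 0" "first_int (ball p \<rho>) F f" using loc[OF p] by blast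
  then have pp: "p \<in> ball p \<rho>" by simp
  note fh = first_intD(2)[OF f(2)]
  define H where "H = {z. pair (grad f p) z = pair (grad f p) p}"
  have "grad f p \<noteq> 0" using first_intD(4)[OF f(2) pp] pair_grad[OF fh pp] by (metis pair_linear(9))
  then have "affine_hyperplane H" unfolding affine_hyperplane_def H_def by blast
  moreover have "leaf b F p = H \<inter> b"
    unfolding leaf H_def by (auto simp: first_intD(3)[OF f(2) pp] pair_grad[OF fh pp] chol_dd_linear[OF fh pp])
  ultimately show ?thesis using openin_open_Int[OF b(1), of H] by metis
qed

section \<open>The linearization criterion\<close>

lemma subweb:
  fixes W :: "nat \<Rightarrow> complex^'n \<Rightarrow> (complex^'n) set"
  assumes W: "web U I W" and J: "J \<subseteq> I" "CARD('n) \<le> card J"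
  shows "web U J W"
proof -
  have fI: "finite I" using W by (simp add: web_def)
  then have "card J \<le> card I" using J(1) by (rule card_mono)
  then have mn: "min CARD('n) (card J) = min CARD('n) (card I)" using J(2) by simp
  have mono: "\<forall>L\<subseteq>J. P L \<longrightarrow> Q L" if "\<forall>L\<subseteq>I. P L \<longrightarrow> Q L" for P Q :: "nat set \<Rightarrow> bool"
    using that J(1) by blast
  have "general_position J W x" if "general_position I W x" for x
    using that unfolding general_position_def mn by (rule mono)
  then show ?thesis using W J(1) finite_subset[OF J(1) fI] by (auto simp: web_def)
qed

lemma foliation_subset:
  assumes F: "foliation U F" and V: "open V" "V \<subseteq> U"
  shows "foliation V F"
  unfolding foliation_def
proof
  fix x assume x: "x \<in> V"
  then have "x \<in> U" using V(2) by blast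
  from F[unfolded foliation_def, THEN bspec, OF this]
  obtain T \<omega> where T: "open T" "x \<in> T" "holo_map T \<omega>" "integrable_form T \<omega>" "\<forall>y\<in>T. \<omega> y \<noteq> 0 \<and> F y = {v. pair (\<omega> y) v = 0}"
    by (elim exE conjE)
  have "holo_map (T \<inter> V) \<omega>" by (rule holo_map_subset[OF T(3)]) blast
  moreover have "integrable_form (T \<inter> V) \<omega>" using T(4) unfolding integrable_form_def by blast
  moreover have "open (T \<inter> V)" using T(1) V(1) by (rule open_Int)
  moreover have "\<forall>y\<in>T \<inter> V. \<omega> y \<noteq> 0 \<and> F y = {v. pair (\<omega> y) v = 0}" using T(5) by simp
  ultimately show "\<exists>T \<omega>. open T \<and> x \<in> T \<and> T \<subseteq> V \<and> holo_map T \<omega> \<and> integrable_form T \<omega> \<and> (\<forall>y\<in>T. \<omega> y \<noteq> 0 \<and> F y = {v. pair (\<omega> y) v = 0})"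
    using T(2) x by (intro exI[of _ "T \<inter> V"] exI[of _ \<omega>] conjI) simp_all
qed

lemma alg_compat_subset: "alg_compat U I W \<Gamma> \<Longrightarrow> V \<subseteq> U \<Longrightarrow> J \<subseteq> I \<Longrightarrow> alg_compat V J W \<Gamma>"
  unfolding alg_compat_def by blast

lemma linear_web_alg_compat:
  fixes W :: "nat \<Rightarrow> complex^'n \<Rightarrow> (complex^'n) set"
  assumes W: "\<And>i. i \<in> I \<Longrightarrow> foliation V (W i)" and b: "biholo V \<phi>" and l: "linear_web (\<phi> ` V) I (\<lambda>i. push_hfield V \<phi> (W i))"
    and c: "\<And>x v w. x \<in> V \<Longrightarrow> Dmap \<phi> x (\<Gamma> x v w) = Dmap (\<lambda>y. Dmap \<phi> y w) x v"
  shows "alg_compat V I W \<Gamma>"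
  unfolding alg_compat_def
proof (intro ballI allI impI, elim conjE)
  fix i B f x assume i: "i \<in> I" and f: "first_int B (W i) f" and x: "x \<in> B" "x \<in> V"
  obtain \<psi> where \<psi>: "open V" "open (\<phi> ` V)" "holo_map V \<phi>" "holo_map (\<phi> ` V) \<psi>" "\<forall>x\<in>V. \<psi> (\<phi> x) = x"
    using b unfolding biholo_def by blast
  have xB: "x \<in> B \<inter> V" using x by simp
  have f': "first_int (B \<inter> V) (W i) f" by (rule first_int_subset[OF f]) (use first_intD(1)[OF f] \<psi>(1) in auto)
  note P = push_first_int[OF \<psi> f' Int_lower2]
  have sc: "r *\<^sub>R w \<in> push_hfield V \<phi> (W i) y" if y: "y \<in> \<phi> ` V" "w \<in> push_hfield V \<phi> (W i) y" for y w r
  proof -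
    from y(2) obtain z v where z: "z \<in> V" "\<phi> z = y" "v \<in> W i z" "w = Dmap \<phi> z v" unfolding push_hfield_def by blast
    then have "r *\<^sub>R v \<in> W i z" using foliation_scale[OF W[OF i]] by blast
    moreover have "r *\<^sub>R w = Dmap \<phi> z (r *\<^sub>R v)" unfolding z(4) scaleR_eq_scale Dmap_scale[OF \<psi>(3) z(1)] ..
    ultimately show ?thesis using z(1,2) unfolding push_hfield_def by blast
  qed
  obtain H where H: "affine_hyperplane H" "openin (top_of_set H) (leaf (\<phi> ` V) (push_hfield V \<phi> (W i)) (\<phi> x))"
    using l i x(2) unfolding linear_web_def by blast
  have "tgcond (\<lambda>y. f (\<psi> y)) (\<lambda>x v w. 0) (\<phi> x)"
    by (rule linear_leaf_tgcond[OF sc P(1) _ _ H]) (use xB in auto)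
  then show "tgcond f \<Gamma> x" using P(2)[OF xB, of \<Gamma>] c[OF x(2)] by simp
qed

lemma alg_compat_linear_web:
  fixes W :: "nat \<Rightarrow> complex^'n \<Rightarrow> (complex^'n) set"
  assumes W: "\<And>i. i \<in> I \<Longrightarrow> foliation U (W i)" and V: "V \<subseteq> U" and b: "biholo V \<phi>" and conv: "convex (\<phi> ` V)"
    and c: "\<And>x v w. x \<in> V \<Longrightarrow> Dmap \<phi> x (\<Gamma> x v w) = Dmap (\<lambda>y. Dmap \<phi> y w) x v" and a: "alg_compat V I W \<Gamma>"
  shows "linear_web (\<phi> ` V) I (\<lambda>i. push_hfield V \<phi> (W i))"
  unfolding linear_web_def
proof (intro ballI)
  fix i p assume i: "i \<in> I" and p: "p \<in> \<phi> ` V"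
  obtain \<psi> where \<psi>: "open V" "open (\<phi> ` V)" "holo_map V \<phi>" "holo_map (\<phi> ` V) \<psi>" "\<forall>x\<in>V. \<psi> (\<phi> x) = x"
    using b unfolding biholo_def by blast
  show "\<exists>H. affine_hyperplane H \<and> openin (top_of_set H) (leaf (\<phi> ` V) (push_hfield V \<phi> (W i)) p)"
  proof (rule linear_leaf[OF \<psi>(2) conv _ p])
    fix y assume "y \<in> \<phi> ` V"
    then obtain x where x: "x \<in> V" "y = \<phi> x" by blast
    obtain r f where f: "r > 0" "first_int (ball x r) (W i) f"
      using foliation_first_int[OF W[OF i]] x(1) V by (metis subsetD)
    have f': "first_int (ball x r \<inter> V) (W i) f" by (rule first_int_subset[OF f(2)]) (use \<psi>(1) in auto)
    note P = push_first_int[OF \<psi> f' Int_lower2]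
    have "y \<in> \<phi> ` (ball x r \<inter> V)" using x f(1) by simp
    then obtain \<rho> where \<rho>: "\<rho> > 0" "ball y \<rho> \<subseteq> \<phi> ` (ball x r \<inter> V)" using first_intD(1)[OF P(1)] openE by blast
    have "tgcond (\<lambda>y. f (\<psi> y)) (\<lambda>x v w. 0) z" if z: "z \<in> ball y \<rho>" for z
    proof -
      obtain u where u: "u \<in> ball x r \<inter> V" "z = \<phi> u" using z \<rho>(2) by blast
      have "u \<in> V" using u(1) by simp
      moreover from this have "tgcond f \<Gamma> u" using a i f' u(1) unfolding alg_compat_def by blast
      ultimately show ?thesis using P(2)[OF u(1), of \<Gamma>] c u(2) by simp
    qed
    moreover have "ball y \<rho> \<subseteq> \<phi> ` V" using \<rho>(2) by blast
    moreover have "first_int (ball y \<rho>) (push_hfield V \<phi> (W i)) (\<lambda>y. f (\<psi> y))" by (rule first_int_subset[OF P(1) \<rho>(2) open_ball])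
    ultimately show "\<exists>r f. r > 0 \<and> ball y r \<subseteq> \<phi> ` V \<and> first_int (ball y r) (push_hfield V \<phi> (W i)) f \<and> (\<forall>y\<in>ball y r. tgcond f (\<lambda>x v w. 0) y)"
      using \<rho>(1) by (intro exI[of _ \<rho>] exI[of _ "\<lambda>y. f (\<psi> y)"]) blast
  qed
qed

text \<open>On the domain \<open>V\<close> of the linearizing chart the pulled back flat connection \<open>\<Gamma>0\<close> is compatible with the whole web,
hence represents the connection of every \<open>(n + 2)\<close>-subweb there. Coincidence and
flatness on \<open>V\<close> are identities between holomorphic functions, expressed through the normal
representatives, and therefore hold on all of \<open>U\<close>.\<close>

lemma linearizable_imp:
  fixes U :: "(complex^'n) set" and W :: "nat \<Rightarrow> complex^'n \<Rightarrow> (complex^'n) set"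
  assumes n: "CARD('n) \<ge> 2" and U: "open U" "connected U" and W: "web U K W" and lin: "linearizable U K W"
  shows "\<lbrakk>I \<subseteq> K; card I = CARD('n) + 2; J \<subseteq> K; card J = CARD('n) + 2\<rbrakk> \<Longrightarrow> web_connection U I W = web_connection U J W"
    and "\<lbrakk>I \<subseteq> K; card I = CARD('n) + 2\<rbrakk> \<Longrightarrow> proj_flat U (web_connection U I W)"
proof -
  obtain m V \<phi> where V: "m \<in> V" "V \<subseteq> U" "biholo V \<phi>" "linear_web (\<phi> ` V) K (\<lambda>i. push_hfield V \<phi> (W i))"
    using lin unfolding linearizable_def by blast
  obtain \<psi> where \<psi>: "open V" "open (\<phi> ` V)" "holo_map V \<phi>" "holo_map (\<phi> ` V) \<psi>" "\<forall>x\<in>V. \<psi> (\<phi> x) = x"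
    using V(3) unfolding biholo_def by blast
  obtain \<Gamma>0 where G0: "affine_connection V \<Gamma>0" "\<And>x v w. x \<in> V \<Longrightarrow> Dmap \<phi> x (\<Gamma>0 x v w) = Dmap (\<lambda>y. Dmap \<phi> y w) x v"
    using flat_pullback_exists[OF V(3)] by blast
  have Wf: "foliation V (W i)" if i: "i \<in> K" for i
    by (rule foliation_subset[OF _ \<psi>(1) V(2)]) (use W i in \<open>simp add: web_def\<close>)
  have ac: "alg_compat V K W \<Gamma>0" by (rule linear_web_alg_compat[OF Wf V(3,4) G0(2)])
  have conn: "\<exists>\<Gamma>. affine_connection U \<Gamma> \<and> normal U \<Gamma> \<and> web_connection U I W = proj_class U \<Gamma> \<and> par V \<Gamma>0 \<Gamma>"
    if I: "I \<subseteq> K" "card I = CARD('n) + 2" for I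
  proof -
    have WI: "web U I W" by (rule subweb[OF W I(1)]) (simp add: I(2))
    obtain \<Gamma> where G: "affine_connection U \<Gamma>" "normal U \<Gamma>" "alg_compat U I W \<Gamma>" "web_connection U I W = proj_class U \<Gamma>"
      using web_connection_char[OF U(1) WI I(2)] by blast
    have "par V \<Gamma>0 \<Gamma>"
      by (rule alg_compat_unique[OF U(1) WI I(2) V(2) G0(1) alg_compat_subset[OF ac order_refl I(1)] affine_subset[OF G(1) V(2)] alg_compat_subset[OF G(3) V(2) order_refl]])
    then show ?thesis using G by blast
  qed
  have Vne: "V \<noteq> {}" using V(1) by blast
  show "web_connection U I W = web_connection U J W" if I: "I \<subseteq> K" "card I = CARD('n) + 2" "J \<subseteq> K" "card J = CARD('n) + 2"
  proof -
    obtain \<Gamma> where G: "affine_connection U \<Gamma>" "normal U \<Gamma>" "web_connection U I W = proj_class U \<Gamma>" "par V \<Gamma>0 \<Gamma>"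
      using conn[OF I(1,2)] by blast
    obtain \<Delta> where D: "affine_connection U \<Delta>" "normal U \<Delta>" "web_connection U J W = proj_class U \<Delta>" "par V \<Gamma>0 \<Delta>"
      using conn[OF I(3,4)] by blast
    have p: "par V \<Gamma> \<Delta>" by (rule par_trans[OF par_sym[OF G(4)] D(4)])
    have eqV: "\<Gamma> x v w = \<Delta> x v w" if x: "x \<in> V" for x v w
      by (rule normal_unique[OF G(1,2) D(1,2)]) (use x V(2) p in \<open>auto simp: par_def\<close>)
    have eqU: "\<Gamma> x v w $ k - \<Delta> x v w $ k = 0" if x: "x \<in> U" for x v w k
    proof (rule chol_identity[OF U _ \<psi>(1) Vne V(2) _ x])
      show "chol U (\<lambda>x. \<Gamma> x v w $ k - \<Delta> x v w $ k)"
        by (intro chol_diff holo_map_chol affine_connectionD(3)[OF G(1)] affine_connectionD(3)[OF D(1)])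
      show "\<Gamma> x v w $ k - \<Delta> x v w $ k = 0" if "x \<in> V" for x using eqV[OF that] by simp
    qed
    have "par U \<Gamma> \<Delta>" unfolding par_def
    proof (intro ballI allI)
      fix x v assume "x \<in> U"
      then have "\<Gamma> x v v - \<Delta> x v v = 0 *s v" using eqU by (simp add: vec_eq_iff)
      then show "\<exists>l. \<Gamma> x v v - \<Delta> x v v = l *s v" by blast
    qed
    then show ?thesis unfolding G(3) D(3) by (intro proj_class_eq) (simp add: proj_equiv_iff_par[OF U(1) G(1) D(1)])
  qed
  show "proj_flat U (web_connection U I W)" if I: "I \<subseteq> K" "card I = CARD('n) + 2"
  proof -
    obtain \<Gamma> where G: "affine_connection U \<Gamma>" "normal U \<Gamma>" "web_connection U I W = proj_class U \<Gamma>" "par V \<Gamma>0 \<Gamma>"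
      using conn[OF I] by blast
    have inj: "v = 0" if "x \<in> V" "Dmap \<phi> x v = 0" for x v
      using biholo_Dmap(1)[OF \<psi> that(1), of v] biholo_Dmap(1)[OF \<psi> that(1), of 0] that Dmap_linear(3)[OF \<psi>(3) that(1)] by simp
    have fc: "Dconn \<Gamma>0 x z v w + \<Gamma>0 x z (\<Gamma>0 x v w) = Dconn \<Gamma>0 x v z w + \<Gamma>0 x v (\<Gamma>0 x z w)" "\<Gamma>0 x v w = \<Gamma>0 x w v" if "x \<in> V" for x z v w
      by (rule flat_curvature[OF \<psi>(1,3) inj G0 that]; assumption)+
    have nV: "normal V \<Gamma>" using G(2) V(2) unfolding normal_def by blast
    have "integrable_at \<Gamma> x" if "x \<in> V" for x
      by (rule flat_imp_integrable[OF \<psi>(1) n G0(1) fc affine_subset[OF G(1) V(2)] nV G(4) that])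
    then have "integrable_at \<Gamma> x" if "x \<in> U" for x
      by (intro integrable_extend[OF U G(1) n \<psi>(1) Vne V(2) _ that])
    then have "proj_flat U (proj_class U \<Gamma>)"
      by (intro integrable_imp_proj_flat[OF U(1) n G(1)]) (use G(2) in \<open>auto simp: normal_def\<close>)
    then show ?thesis unfolding G(3) .
  qed
qed

text \<open>Every foliation of the web belongs to some \<open>(n + 2)\<close>-subweb, so the common connection is compatible with
the whole web. A flat chart, restricted to the preimage of a ball so that its image is convex, then
linearizes all foliations at once.\<close>

lemma linearizable_if:
  fixes U :: "(complex^'n) set" and W :: "nat \<Rightarrow> complex^'n \<Rightarrow> (complex^'n) set"
  assumes U: "open U" "U \<noteq> {}" and W: "web U K W" and K: "card K \<ge> CARD('n) + 2"
    and eq: "\<And>I J. \<lbrakk>I \<subseteq> K; card I = CARD('n) + 2; J \<subseteq> K; card J = CARD('n) + 2\<rbrakk> \<Longrightarrow> web_connection U I W = web_connection U J W"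
    and flat: "\<And>I. \<lbrakk>I \<subseteq> K; card I = CARD('n) + 2\<rbrakk> \<Longrightarrow> proj_flat U (web_connection U I W)"
  shows "linearizable U K W"
proof -
  have fK: "finite K" using W by (simp add: web_def)
  have Wf: "foliation U (W i)" if "i \<in> K" for i using W that by (simp add: web_def)
  have sub: "web U J W" if "J \<subseteq> K" "card J = CARD('n) + 2" for J by (rule subweb[OF W that(1)]) (simp add: that(2))
  obtain m where m: "m \<in> U" using U(2) by blast
  obtain I0 where I0: "I0 \<subseteq> K" "card I0 = CARD('n) + 2" using obtain_subset_with_card_n[OF K] by metis
  obtain \<Gamma> where G: "affine_connection U \<Gamma>" "web_connection U I0 W = proj_class U \<Gamma>"
    using web_connection_char[OF U(1) sub[OF I0] I0(2)] by blast
  have acJ: "alg_compat U J W \<Gamma>" if J: "J \<subseteq> K" "card J = CARD('n) + 2" for J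
  proof -
    obtain \<Delta> where D: "affine_connection U \<Delta>" "alg_compat U J W \<Delta>" "web_connection U J W = proj_class U \<Delta>"
      using web_connection_char[OF U(1) sub[OF J] J(2)] by blast
    have "\<Gamma> \<in> proj_class U \<Gamma>" using G(1) by (simp add: proj_class_def proj_equiv_def)
    then have "\<Gamma> \<in> proj_class U \<Delta>" using eq[OF I0 J] G(2) D(3) by simp
    then have "par U \<Delta> \<Gamma>" using proj_equiv_iff_par[OF U(1) D(1) G(1)] by (simp add: proj_class_def)
    then show ?thesis using D(2) by (rule alg_compat_par)
  qed
  have "alg_compat U {i} W \<Gamma>" if i: "i \<in> K" for i
  proof -
    have "CARD('n) + 1 \<le> card (K - {i})" using K i fK by simp
    then obtain L where L: "L \<subseteq> K - {i}" "card L = CARD('n) + 1" using obtain_subset_with_card_n by metis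
    have "finite L" using L(1) fK finite_subset by blast
    then have "card (insert i L) = CARD('n) + 2" using L by (subst card_insert_disjoint) auto
    moreover have "insert i L \<subseteq> K" using L(1) i by blast
    ultimately have "alg_compat U (insert i L) W \<Gamma>" using acJ by blast
    then show ?thesis by (rule alg_compat_subset) auto
  qed
  then have ac: "alg_compat U K W \<Gamma>" unfolding alg_compat_def by blast
  have "proj_flat U (proj_class U \<Gamma>)" using flat[OF I0] G(2) by simp
  then obtain V \<phi> \<Gamma>0 where V: "m \<in> V" "V \<subseteq> U" "biholo V \<phi>" and G0: "affine_connection V \<Gamma>0"
    "\<And>x v w. x \<in> V \<Longrightarrow> Dmap \<phi> x (\<Gamma>0 x v w) = Dmap (\<lambda>y. Dmap \<phi> y w) x v" "par V \<Gamma> \<Gamma>0"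
    by (rule proj_flat_chart[OF U(1) G(1) _ m]) (rule that)
  have ac0: "alg_compat V K W \<Gamma>0" by (rule alg_compat_par[OF G0(3) alg_compat_subset[OF ac V(2) order_refl]])
  have bV: "open V" "open (\<phi> ` V)" "holo_map V \<phi>" using V(3) by (auto simp: biholo_def)
  obtain \<rho> where \<rho>: "\<rho> > 0" "ball (\<phi> m) \<rho> \<subseteq> \<phi> ` V" using bV(2) V(1) openE by blast
  define V' where "V' = V \<inter> \<phi> -` ball (\<phi> m) \<rho>"
  have V': "V' \<subseteq> V" "open V'" "m \<in> V'" "\<phi> ` V' = ball (\<phi> m) \<rho>"
  proof -
    show "open V'" unfolding V'_def by (rule continuous_open_preimage[OF holo_map_continuous_on[OF bV(3)] bV(1) open_ball])
    show "\<phi> ` V' = ball (\<phi> m) \<rho>" using \<rho>(2) unfolding V'_def by blast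
  qed (use V(1) \<rho>(1) in \<open>auto simp: V'_def\<close>)
  have b': "biholo V' \<phi>" by (rule biholo_subset[OF V(3) V'(1,2)])
  have VU: "V' \<subseteq> U" using V'(1) V(2) by blast
  have "linear_web (\<phi> ` V') K (\<lambda>i. push_hfield V' \<phi> (W i))"
    by (rule alg_compat_linear_web[OF Wf VU b' _ _ alg_compat_subset[OF ac0 V'(1) order_refl]])
       (use V'(1) G0(2) in \<open>auto simp: V'(4)\<close>)
  then show ?thesis unfolding linearizable_def using m V'(3) VU b' by blast
qed

theorem mainTheorem2:
  fixes U :: "(complex^'n) set" and W :: "nat \<Rightarrow> complex^'n \<Rightarrow> (complex^'n) set" and d :: nat
  assumes "CARD('n) \<ge> 2" and "d \<ge> CARD('n) + 2"
    and "cn_domain U"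
    and "web U {..<d} W"
  shows "linearizable U {..<d} W \<longleftrightarrow>
    (\<forall>I J. I \<subseteq> {..<d} \<and> card I = CARD('n) + 2 \<and> J \<subseteq> {..<d} \<and> card J = CARD('n) + 2 \<longrightarrow>
       web_connection U I W = web_connection U J W) \<and>
    (\<forall>I. I \<subseteq> {..<d} \<and> card I = CARD('n) + 2 \<longrightarrow> proj_flat U (web_connection U I W))"
    (is "?L \<longleftrightarrow> ?E \<and> ?F")
proof
  have U: "open U" "connected U" "U \<noteq> {}" using assms(3) by (auto simp: cn_domain_def)
  show "?E \<and> ?F" if ?L
  proof
    show ?E using linearizable_imp(1)[OF assms(1) U(1,2) assms(4) that] by blast
    show ?F using linearizable_imp(2)[OF assms(1) U(1,2) assms(4) that] by blast
  qed
  show ?L if EF: "?E \<and> ?F"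
  proof (rule linearizable_if[OF U(1,3) assms(4)])
    show "CARD('n) + 2 \<le> card {..<d}" using assms(2) by simp
    show "web_connection U I W = web_connection U J W"
      if "I \<subseteq> {..<d}" "card I = CARD('n) + 2" "J \<subseteq> {..<d}" "card J = CARD('n) + 2" for I J
      using that EF by blast
    show "proj_flat U (web_connection U I W)" if "I \<subseteq> {..<d}" "card I = CARD('n) + 2" for I
      using that EF by blast
  qed
qed

end
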